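(* Let $p>1$ and $V\in L^\infty(\mathbb{R}^N)$. Then the set $\mathcal{E}(\mathbb{R}^N)$ of eigenvalues of $\mathcal{K}_V$ in $\mathbb{R}^N$ equals $(-\infty,\lambda(\mathcal{K}_V,\mathbb{R}^N)]$.
   Context: $\Delta_p u=\mathrm{div}(|\nabla u|^{p-2}\nabla u)$, $\mathcal{K}_V[u]=-\Delta_pu+Vu^{p-1}$ ($u\ge0$). A number $\lambda\in\mathbb{R}$ is an eigenvalue of $\mathcal{K}_V$ in $\mathbb{R}^N$ if there exists a positive $u\in W^{1,p}_{loc}(\mathbb{R}^N)$ with $\int|\nabla u|^{p-2}\nabla u\cdot\nabla\phi+\int Vu^{p-1}\phi=\lambda\int u^{p-1}\phi$ for all $\phi\in C_c^\infty(\mathbb{R}^N)$. $\lambda(\mathcal{K}_V,\mathbb{R}^N)=\sup\{\lambda:\exists\psi\in W^{1,p}_{loc}(\mathbb{R}^N),\ \psi>0,\ \int|\nabla\psi|^{p-2}\nabla\psi\cdot\nabla\phi+\int V\psi^{p-1}\phi\ge\lambda\int\psi^{p-1}\phi\ \forall\ \text{nonnegative }\phi\in C_c^\infty(\mathbb{R}^N)\}$. *)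

theory Defs
  imports "HOL-Analysis.Analysis"
begin

coinductive smooth_fun :: "('a::euclidean_space \<Rightarrow> real) \<Rightarrow> bool" where
  "(\<And>x. f differentiable (at x)) \<Longrightarrow>
   (\<And>v. smooth_fun (\<lambda>x. frechet_derivative f (at x) v)) \<Longrightarrow> smooth_fun f"

definition test_fun :: "('a::euclidean_space \<Rightarrow> real) \<Rightarrow> bool" where
  "test_fun \<phi> \<longleftrightarrow> smooth_fun \<phi> \<and> compact (closure {x. \<phi> x \<noteq> 0})"

definition Lp_loc :: "real \<Rightarrow> ('a::euclidean_space \<Rightarrow> 'b::euclidean_space) \<Rightarrow> bool" where
  "Lp_loc p u \<longleftrightarrow> u \<in> borel_measurable lebesgue \<and>
     (\<forall>K. compact K \<longrightarrow> integrable lebesgue (\<lambda>x. indicator K x * norm (u x) powr p))"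

definition weak_gradient :: "('a::euclidean_space \<Rightarrow> real) \<Rightarrow> ('a \<Rightarrow> 'a) \<Rightarrow> bool" where
  "weak_gradient u g \<longleftrightarrow>
     (\<forall>\<phi>. test_fun \<phi> \<longrightarrow> (\<forall>v.
        (\<integral>x. u x * frechet_derivative \<phi> (at x) v \<partial>lebesgue)
        = - (\<integral>x. (g x \<bullet> v) * \<phi> x \<partial>lebesgue)))"

definition W1p_loc :: "real \<Rightarrow> ('a::euclidean_space \<Rightarrow> real) \<Rightarrow> ('a \<Rightarrow> 'a) \<Rightarrow> bool" where
  "W1p_loc p u g \<longleftrightarrow> Lp_loc p u \<and> Lp_loc p g \<and> weak_gradient u g"

definition Linfty :: "('a::euclidean_space \<Rightarrow> real) \<Rightarrow> bool" where
  "Linfty V \<longleftrightarrow> V \<in> borel_measurable lebesgue \<and> (\<exists>C. AE x in lebesgue. \<bar>V x\<bar> \<le> C)"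

definition weak_form ::
  "real \<Rightarrow> ('a::euclidean_space \<Rightarrow> real) \<Rightarrow> real \<Rightarrow> ('a \<Rightarrow> real) \<Rightarrow> ('a \<Rightarrow> 'a) \<Rightarrow> ('a \<Rightarrow> real) \<Rightarrow> real" where
  "weak_form p V lam u g \<phi> =
     (\<integral>x. norm (g x) powr (p - 2) * frechet_derivative \<phi> (at x) (g x) \<partial>lebesgue)
     + (\<integral>x. V x * u x powr (p - 1) * \<phi> x \<partial>lebesgue)
     - lam * (\<integral>x. u x powr (p - 1) * \<phi> x \<partial>lebesgue)"

definition is_eigenvalue :: "real \<Rightarrow> ('a::euclidean_space \<Rightarrow> real) \<Rightarrow> real \<Rightarrow> bool" where
  "is_eigenvalue p V lam \<longleftrightarrow>
     (\<exists>u g. W1p_loc p u g \<and> (\<forall>x. u x > 0) \<and>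
        (\<forall>\<phi>. test_fun \<phi> \<longrightarrow> weak_form p V lam u g \<phi> = 0))"

definition gen_principal_eigenvalue :: "real \<Rightarrow> ('a::euclidean_space \<Rightarrow> real) \<Rightarrow> ereal" where
  "gen_principal_eigenvalue p V =
     (SUP lam \<in> {lam. \<exists>\<psi> g. W1p_loc p \<psi> g \<and> (\<forall>x. \<psi> x > 0) \<and>
        (\<forall>\<phi>. test_fun \<phi> \<and> (\<forall>x. \<phi> x \<ge> 0) \<longrightarrow> weak_form p V lam \<psi> g \<phi> \<ge> 0)}. ereal lam)"

end

theory Submission
  imports Defs "HOL-Complex_Analysis.Great_Picard"
begin

text \<open>
  An eigenfunction is a supersolution, so every eigenvalue is at most the generalised principal
  eigenvalue. Conversely, if \<open>lam\<close> does not exceed it, then for every \<open>n\<close> there is a positive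
  supersolution at a level above \<open>lam - 1/(n+1)\<close>, and Picone's inequality (testing with
  \<open>f^p (v + d)^(1-p)\<close>, where \<open>v\<close> is the supersolution, \<open>f\<close> a test function and \<open>d > 0\<close>) makes the energy at level \<open>lam - 1/(n+1)\<close>
  coercive on every ball. Direct minimisation gives positive solutions on balls of radius \<open>n\<close>.
  Normalising them, logarithmic and Caccioppoli estimates bound them locally in \<open>W^{1,p}\<close> uniformly in \<open>n\<close>,
  so Rellich's theorem and a Minty-type estimate for the gradients give a locally strongly convergent subsequence,
  whose limit is the eigenfunction; a bound on the negative part of its logarithm makes it positive.
\<close>

text \<open>Compactness and embedding facts are all drawn from one kind of estimate: the local
  \<open>L^p\<close> size of \<open>u(x + z) - u(x)\<close> is controlled by \<open>norm z\<close>
  and the gradient. A Sobolev function is carried as an almost everywhere limit of C1 functions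
  below one integrable majorant, so identities pass to limits by dominated convergence. The obstacle
  is that the energy is minimised over nonnegative functions, where only one-sided variations are
  allowed. The logarithmic estimate shows that the minimiser vanishes almost everywhere or almost
  nowhere on a ball, and it makes the error of the two-sided variation
  \<open>sg * u / (u + dl)\<close> disappear as \<open>dl\<close> tends to 0. A source placed away
  from the ball of interest excludes the zero minimiser and leaves the equation on that ball
  homogeneous. Upper bounds, for which Harnack's inequality is the usual source, come from uniform
  integrability of the powers of \<open>ln (u + exp 1)\<close>: it makes superlevel sets small
  against balls of radius \<open>d\<close>, and an iteration over shrinking shells closes.\<close>

abbreviation integ :: "('a::euclidean_space => real) => bool" where "integ f == integrable lborel f"
abbreviation bmeas :: "('a::euclidean_space => 'b::topological_space) set" where "bmeas == borel_measurable borel"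
abbreviation ib :: "real => 'a::euclidean_space => 'b::zero_neq_one" where "ib R == indicator (cball 0 R)"
abbreviation (input) seq_lim :: "(nat => 'a::topological_space) => 'a => bool" (infixr "---->" 60) where "f ----> l == f \<longlonglongrightarrow> l"
abbreviation (input) AE_lborel :: "('a::euclidean_space => bool) => bool" (binder "AEL " 10) where "AEL x. P x == AE x in lborel. P x"
lemmas integrable_le = Bochner_Integration.integrable_bound

section \<open>Young's inequality and elementary estimates for real powers\<close>

text \<open>The constants are sharp, with equality at \<open>a = b\<close>. This is what turns the
  inequality into the tangent-line inequality for \<open>t powr p\<close>, and later into Picone's
  inequality.\<close>

lemma Young_powr:
 fixes a b p :: real
 assumes "p > 1" "a >= 0" "b >= 0"
 shows "p * a powr (p - 1) * b <= (p - 1) * a powr p + b powr p"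
proof -
 define q where "q = p / (p - 1)"
 have q: "q > 1" "1/p + 1/q = 1" using assms by (auto simp: q_def field_simps)
 have "a powr (p - 1) * b <= (a powr (p-1)) powr q / q + b powr p / p"
  using Youngs_inequality[of q p "a powr (p-1)" b] assms q by (simp add: algebra_simps)
 also have "(a powr (p-1)) powr q = a powr p"
  using assms by (simp add: powr_powr q_def)
 finally have "p * (a powr (p - 1) * b) <= p * (a powr p / q + b powr p / p)"
  using assms by (intro mult_left_mono) auto
 also have "... = (p - 1) * a powr p + b powr p"
  using assms by (simp add: q_def field_simps)
 finally show ?thesis by (simp add: mult.assoc)
qed

lemma Young_powr_crude:
 fixes a b p :: real
 assumes "p > 1" "a >= 0" "b >= 0"
 shows "a powr (p - 1) * b <= a powr p + b powr p"
proof -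
 have "p * (a powr (p - 1) * b) <= (p - 1) * a powr p + b powr p"
  using Young_powr[OF assms] by (simp add: mult.assoc)
 also have "... <= p * a powr p + p * b powr p"
  using assms by (intro add_mono mult_right_mono) (auto simp: mult_le_cancel_right1)
 finally have "p * (a powr (p - 1) * b) <= p * (a powr p + b powr p)"
  by (simp add: algebra_simps)
 then show ?thesis using assms by simp
qed

text \<open>Scaling \<open>a\<close> by \<open>t = e powr (1/p)\<close> in the crude inequality puts
  a prescribed small weight on \<open>a powr p\<close>; the compensating power of \<open>t\<close>
  falls on \<open>b\<close>.\<close>

lemma Young_powr_eps:
 fixes p e :: real
 assumes "p > 1" "e > 0"
 obtains C where "C >= 0" "!!a b. a >= 0 ==> b >= 0 ==> a powr (p - 1) * b <= e * a powr p + C * b powr p"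
proof -
 define t where "t = e powr (1/p)"
 have t: "t > 0" "t powr p = e" using assms by (auto simp: t_def powr_powr)
 define C where "C = t powr ((1-p)*p)"
 have "a powr (p - 1) * b <= e * a powr p + C * b powr p" if ab: "a >= 0" "b >= 0" for a b
 proof -
  have "a powr (p-1) * b = (t*a) powr (p-1) * (b * t powr (1-p))"
   using t ab assms by (simp add: powr_mult powr_diff powr_minus field_simps)
  also have "... <= (t*a) powr p + (b * t powr (1-p)) powr p"
   using ab t assms by (intro Young_powr_crude) auto
  also have "... = e * a powr p + C * b powr p"
   using t ab by (simp add: powr_mult powr_powr C_def mult.commute)
  finally show ?thesis .
 qed
 then show ?thesis using that[of C] by (auto simp: C_def)
qed

lemma powr_sum_le:
 fixes a b p :: real
 assumes "p > 0" "a >= 0" "b >= 0"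
 shows "(a + b) powr p <= 2 powr p * (a powr p + b powr p)"
proof -
 have "(a + b) powr p <= (2 * max a b) powr p" using assms by (intro powr_mono2) auto
 also have "... = 2 powr p * (max a b) powr p" using assms by (simp add: powr_mult)
 also have "... <= 2 powr p * (a powr p + b powr p)" by (intro mult_left_mono) (auto simp: max_def)
 finally show ?thesis .
qed

lemma norm_add_powr_le:
 fixes a b :: "'a::real_normed_vector"
 assumes "p > 0"
 shows "norm (a + b) powr p <= 2 powr p * (norm a powr p + norm b powr p)"
proof -
 have "norm (a + b) powr p <= (norm a + norm b) powr p"
  using assms by (intro powr_mono2 norm_triangle_ineq) auto
 also have "... <= 2 powr p * (norm a powr p + norm b powr p)"
  using assms by (intro powr_sum_le) auto
 finally show ?thesis .
qed

lemma norm_diff_powr_le: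
 fixes a b :: "'a::real_normed_vector"
 assumes "p > 0"
 shows "norm (a - b) powr p <= 2 powr p * (norm a powr p + norm b powr p)"
 using norm_add_powr_le[of p a "-b"] assms by simp

lemma powr_minus_one_mult: "(a::real) >= 0 ==> a powr (p - 1) * a = a powr p"
 by (cases "a = 0") (auto simp: powr_diff)

lemma powr_tangent:
 fixes a b p :: real
 assumes "p > 1" "a >= 0" "b >= 0"
 shows "a powr p + p * a powr (p - 1) * (b - a) <= b powr p"
 using Young_powr[OF assms] powr_minus_one_mult[of a p] assms by (simp add: algebra_simps)

lemma powr_diff_bound:
 fixes a b p :: real
 assumes "p > 1" "a >= 0" "b >= 0"
 shows "abs (a powr p - b powr p) <= p * (max a b) powr (p - 1) * abs (a - b)"
proof -
 have *: "x powr p - y powr p <= p * x powr (p-1) * (x - y)" if "x >= 0" "y >= 0" for x y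
  using powr_tangent[of p x y] assms that by (simp add: algebra_simps)
 show ?thesis
 proof (cases "a >= b")
  case True
  then have "b powr p <= a powr p" using assms by (intro powr_mono2) auto
  then show ?thesis using *[of a b] True assms by simp
 next
  case False
  then have "a powr p <= b powr p" using assms by (intro powr_mono2) auto
  then show ?thesis using *[of b a] False assms by (simp add: max_def)
 qed
qed

text \<open>Serves potentials that may change sign: functions close in \<open>L^p\<close> must have
  nearly equal potential energies, with only a small multiple of their total mass as error.\<close>

lemma powr_diff_eps:
 fixes p e :: real
 assumes "p > 1" "e > 0"
 obtains C where "C >= 0"
  "!!a b. a >= 0 ==> b >= 0 ==> (abs (a powr p - b powr p)) <= e * (a powr p + b powr p) + C * abs (a - b) powr p"
proof -
 have ep: "e / p > 0" using assms by auto
 obtain C where C: "C >= 0" "!!a b. a >= 0 ==> b >= 0 ==> a powr (p - 1) * b <= (e/p) * a powr p + C * b powr p"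
  using Young_powr_eps[OF assms(1) ep] by blast
 have "abs (a powr p - b powr p) <= e * (a powr p + b powr p) + (p*C) * abs (a - b) powr p" if ab: "a >= 0" "b >= 0" for a b
 proof -
  have "abs (a powr p - b powr p) <= p * ((max a b) powr (p - 1) * abs (a - b))"
   using powr_diff_bound[OF assms(1) ab] by (simp add: mult.assoc)
  also have "... <= p * ((e/p) * max a b powr p + C * abs (a-b) powr p)"
   using C(2)[of "max a b" "abs (a-b)"] ab assms by (intro mult_left_mono) auto
  also have "... = e * max a b powr p + (p*C) * abs (a-b) powr p" using assms by (simp add: algebra_simps)
  also have "... <= e * (a powr p + b powr p) + (p*C) * abs (a-b) powr p"
   using assms by (intro add_right_mono mult_left_mono) (auto simp: max_def)
  finally show ?thesis .
 qed
 moreover have "p * C >= 0" using assms C by auto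
 ultimately show ?thesis using that[of "p*C"] by blast
qed

section \<open>The flux of the p-Laplacian and the convexity of \<open>norm v powr p\<close>\<close>

text \<open>Since \<open>0 powr r = 0\<close>, the value at the origin is 0 also for
  \<open>p < 2\<close>, where the scalar factor is unbounded nearby.\<close>

definition pflux :: "real => 'a::real_normed_vector => 'a" where
 "pflux p v = norm v powr (p - 2) *\<^sub>R v"

lemma norm_pflux: "norm (pflux p v) = norm v powr (p - 1)"
proof (cases "v = 0")
 case False
 then have "norm v powr (p - 2) * norm v powr 1 = norm v powr (p - 1)"
  by (subst powr_add[symmetric]) simp
 then show ?thesis using False by (simp add: pflux_def)
qed (simp add: pflux_def)

lemma pflux_inner_self:
 fixes v :: "'a::real_inner"
 shows "pflux p v \<bullet> v = norm v powr p"
proof (cases "v = 0")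
 case False
 then have "norm v powr (p - 2) * norm v powr 2 = norm v powr p"
  by (subst powr_add[symmetric]) simp
 then show ?thesis using False by (simp add: pflux_def power2_norm_eq_inner powr_numeral)
qed (simp add: pflux_def)

lemma pflux_inner_le:
 fixes v w :: "'a::real_inner"
 shows "abs (pflux p v \<bullet> w) <= norm v powr (p - 1) * norm w"
 using Cauchy_Schwarz_ineq2[of "pflux p v" w] by (simp add: norm_pflux)

lemma pflux_scaleR: "c > 0 ==> pflux p (c *\<^sub>R v) = c powr (p - 1) *\<^sub>R pflux p v"
proof -
 assume c: "c > 0"
 have "c powr (p - 2) * c = c powr (p - 1)"
  using powr_add[of c "p-2" 1] c by simp
 then show ?thesis using c by (simp add: pflux_def powr_mult mult.commute mult.left_commute)
qed

text \<open>Only the origin needs an argument, because \<open>norm v powr (p - 2)\<close> may blow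
  up there; the norm of the flux is \<open>norm v powr (p - 1)\<close>, which tends to 0 for
  \<open>p > 1\<close>.\<close>

lemma continuous_on_pflux:
 assumes "p > 1"
 shows "continuous_on UNIV (pflux p :: 'a::real_normed_vector => 'a)"
proof -
 have "isCont (pflux p) v" for v :: 'a
 proof (cases "v = 0")
  case False
  then show ?thesis unfolding pflux_def by (intro continuous_intros) auto
 next
  case True
  have "((%w::'a. norm w powr (p - 1)) \<longlongrightarrow> norm (0::'a) powr (p-1)) (at 0)"
   using assms by (intro tendsto_powr' tendsto_intros) auto
  then have "((%w::'a. norm (pflux p w)) \<longlongrightarrow> 0) (at 0)"
   unfolding norm_pflux using assms by simp
  then have "(pflux p \<longlongrightarrow> (0::'a)) (at 0)" by (simp only: tendsto_norm_zero_iff)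
  moreover have "pflux p 0 = (0::'a)" by (simp add: pflux_def)
  ultimately show ?thesis using True by (simp add: isCont_def)
 qed
 then show ?thesis by (simp add: continuous_at_imp_continuous_on)
qed

lemma pflux_measurable [measurable]:
 "pflux p : borel_measurable (borel :: 'a::euclidean_space measure)"
 unfolding pflux_def by measurable

text \<open>Cauchy-Schwarz followed by the sharp Young inequality. In other words,
  \<open>p * pflux p a\<close> is a subgradient of \<open>norm v powr p\<close> at
  \<open>a\<close>.\<close>

lemma norm_powr_tangent:
 fixes a b :: "'a::real_inner"
 assumes "p > 1"
 shows "norm a powr p + p * (pflux p a \<bullet> (b - a)) <= norm b powr p"
proof -
 have "p * (pflux p a \<bullet> b) <= p * (norm a powr (p - 1) * norm b)"
  using pflux_inner_le[of p a b] assms by (intro mult_left_mono) auto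
 also have "... <= (p - 1) * norm a powr p + norm b powr p"
  using Young_powr[of p "norm a" "norm b"] assms by (simp add: mult.assoc)
 finally show ?thesis by (simp add: inner_diff_right pflux_inner_self algebra_simps)
qed

lemma continuous_on_norm_powr:
 assumes "continuous_on S f" "p > 0"
 shows "continuous_on S (%x. norm (f x) powr p)"
 using assms by (intro continuous_on_powr' continuous_intros) auto

text \<open>The defect in midpoint convexity of \<open>norm v powr p\<close>. It measures the
  distance of two gradients, both for minimising sequences, where the midpoint is a competitor, and
  for two solutions, where the monotonicity of the flux bounds it.\<close>

definition convgap :: "real => 'a::real_inner => 'a => real" where
 "convgap p a b = (norm a powr p + norm b powr p) / 2 - norm ((1/2) *\<^sub>R (a + b)) powr p"

text \<open>Add the tangent inequalities at \<open>a\<close> and at \<open>b\<close>, both evaluated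
  at the midpoint.\<close>

lemma pflux_monotone_convgap:
 fixes a b :: "'a::real_inner"
 assumes "p > 1"
 shows "4 * convgap p a b <= p * ((pflux p a - pflux p b) \<bullet> (a - b))"
proof -
 let ?m = "(1/2) *\<^sub>R (a + b)"
 have m: "?m - a = - ((1/2) *\<^sub>R (a - b))" "?m - b = (1/2) *\<^sub>R (a - b)"
  by (simp_all add: algebra_simps scaleR_2[symmetric] flip: scaleR_add_left)
 have 1: "norm a powr p - p/2 * (pflux p a \<bullet> (a - b)) <= norm ?m powr p"
  using norm_powr_tangent[OF assms, of a ?m] unfolding m by simp
 have 2: "norm b powr p + p/2 * (pflux p b \<bullet> (a - b)) <= norm ?m powr p"
  using norm_powr_tangent[OF assms, of b ?m] unfolding m by simp
 have "p * ((pflux p a - pflux p b) \<bullet> (a - b)) = p * (pflux p a \<bullet> (a-b)) - p * (pflux p b \<bullet> (a-b))"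
  by (simp add: inner_diff_left right_diff_distrib)
 with 1 2 show ?thesis unfolding convgap_def by (simp add: field_simps)
qed

lemma convgap_nonneg:
 fixes a b :: "'a::real_inner"
 assumes "p > 1"
 shows "convgap p a b >= 0"
proof -
 let ?m = "(1/2) *\<^sub>R (a + b)"
 have "a - ?m = (1/2) *\<^sub>R (a - b)" "b - ?m = - ((1/2) *\<^sub>R (a - b))"
  by (simp_all add: algebra_simps scaleR_2[symmetric] flip: scaleR_add_left)
 then show ?thesis
  using norm_powr_tangent[OF assms, of ?m a] norm_powr_tangent[OF assms, of ?m b]
  unfolding convgap_def by simp
qed

lemma powr_midpoint_strict:
 fixes x y p :: real
 assumes "p > 1" "x >= 0" "y >= 0" "x ~= y"
 shows "((x + y)/2) powr p < (x powr p + y powr p) / 2"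
proof -
 have *: "((x + y)/2) powr p < (x powr p + y powr p) / 2" if xy: "0 <= x" "x < y" for x y
 proof (cases "x = 0")
  \<comment> \<open>The mean value theorem on the two halves wants a positive base; for
    \<open>x = 0\<close> the claim reduces to \<open>(1/2) powr p < 1/2\<close>.\<close>
  case True
  have "(1/2::real) powr p < (1/2) powr 1" using assms by (intro powr_less_mono') auto
  then have "y powr p * (1/2) powr p < y powr p * (1/2)" using that True by simp
  then show ?thesis using True that by (simp add: powr_divide powr_one_eq_one)
 next
  case False
  let ?m = "(x+y)/2"
  obtain z1 where z1: "x < z1" "z1 < ?m" "?m powr p - x powr p = (?m - x) * (p * z1 powr (p-1))"
  proof -
   have "EX z>x. z < ?m & ?m powr p - x powr p = (?m - x) * (p * z powr (p-1))"
   using xy False by (intro MVT2 has_real_derivative_powr) auto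
   then show ?thesis using that by blast
  qed
  obtain z2 where z2: "?m < z2" "z2 < y" "y powr p - ?m powr p = (y - ?m) * (p * z2 powr (p-1))"
  proof -
   have "EX z>?m. z < y & y powr p - ?m powr p = (y - ?m) * (p * z powr (p-1))"
   using xy False by (intro MVT2 has_real_derivative_powr) auto
   then show ?thesis using that by blast
  qed
  have "z1 powr (p-1) < z2 powr (p-1)" using z1 z2 that False assms by (intro powr_less_mono2) auto
  then have "(y - ?m) * (p * z1 powr (p-1)) < (y - ?m) * (p * z2 powr (p-1))"
   using that assms by (intro mult_strict_left_mono) auto
  moreover have "y - ?m = ?m - x" by (simp add: field_simps)
  ultimately have "?m powr p - x powr p < y powr p - ?m powr p" unfolding z1(3) z2(3) by metis
  then show ?thesis by (simp add: field_simps)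
 qed
 show ?thesis
 proof (cases "x < y")
  case True then show ?thesis using * assms by blast
 next
  case False
  then show ?thesis using *[of y x] assms by (simp add: add.commute)
 qed
qed

text \<open>If the norms differ, strict convexity of the scalar power gives the gap; if they agree,
  distinct vectors make the triangle inequality strict.\<close>

lemma convgap_pos:
 fixes a b :: "'a::real_inner"
 assumes "p > 1" "a ~= b"
 shows "convgap p a b > 0"
proof (cases "norm a = norm b")
 case False
 have "norm ((1/2) *\<^sub>R (a + b)) <= (norm a + norm b)/2" using norm_triangle_ineq[of a b] by simp
 then have "norm ((1/2) *\<^sub>R (a + b)) powr p <= ((norm a + norm b)/2) powr p"
  using assms by (intro powr_mono2) auto
 also have "... < (norm a powr p + norm b powr p) / 2"
  using powr_midpoint_strict[OF assms(1), of "norm a" "norm b"] False by simp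
 finally show ?thesis by (simp add: convgap_def)
next
 case True
 have "norm (a + b) ~= norm a + norm b"
 proof
  assume "norm (a + b) = norm a + norm b"
  then have "norm a *\<^sub>R b = norm b *\<^sub>R a" using norm_triangle_eq[of a b] by simp
  then have "a = b" using True by (metis norm_eq_zero scaleR_cancel_left)
  then show False using assms by simp
 qed
 then have "norm (a + b) < norm a + norm b" using norm_triangle_ineq[of a b] by linarith
 then have "norm ((1/2) *\<^sub>R (a + b)) < norm a" using True by simp
 then have "norm ((1/2) *\<^sub>R (a + b)) powr p < norm a powr p" using assms by (intro powr_less_mono2) auto
 then show ?thesis using True by (simp add: convgap_def)
qed

text \<open>Compactness of the unit sphere and homogeneity replace the case distinction
 \<open>p < 2\<close>, \<open>p >= 2\<close> of the explicit Clarkson-type inequalities.\<close>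

lemma norm_diff_convgap:
 fixes p e :: real
 assumes "p > 1" "e > 0"
 obtains C where "C >= 0" "!!a b::'a::euclidean_space.
  norm (a - b) powr p <= e * (norm a powr p + norm b powr p) + C * convgap p a b"
proof -
 define N where "N = (%z::'a\<times>'a. norm (fst z) powr p + norm (snd z) powr p)"
 \<comment> \<open>\<open>K\<close> contains every unit pair for which the \<open>e\<close> term
   alone does not suffice. On it the two vectors differ, so the gap is positive, and the maximum of
   the quotient over this compact set becomes \<open>C\<close>.\<close>
 define K where "K = {z. norm z = 1 & norm (fst z - snd z) powr p >= e * N z}"
 have cN: "continuous_on UNIV N" unfolding N_def using assms by (intro continuous_on_add continuous_on_diff continuous_on_divide continuous_on_norm_powr continuous_on_const continuous_on_fst continuous_on_snd continuous_on_scaleR continuous_on_id) auto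
 have cd: "continuous_on UNIV (%z::'a\<times>'a. norm (fst z - snd z) powr p)" using assms by (intro continuous_on_add continuous_on_diff continuous_on_divide continuous_on_norm_powr continuous_on_const continuous_on_fst continuous_on_snd continuous_on_scaleR continuous_on_id) auto
 have cg: "continuous_on UNIV (%z::'a\<times>'a. convgap p (fst z) (snd z))"
  unfolding convgap_def using assms by (intro continuous_on_add continuous_on_diff continuous_on_divide continuous_on_norm_powr continuous_on_const continuous_on_fst continuous_on_snd continuous_on_scaleR continuous_on_id) auto
 have "closed {z::'a\<times>'a. norm z = 1}" "closed {z. norm (fst z - snd z) powr p >= e * N z}"
  using cN cd by (auto intro!: closed_Collect_eq closed_Collect_le continuous_intros)
 moreover have "K = {z. norm z = 1} \<inter> {z. norm (fst z - snd z) powr p >= e * N z}" by (auto simp: K_def)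
 ultimately have "closed K" by (simp add: closed_Int)
 moreover have "bounded K" unfolding bounded_iff K_def by auto
 ultimately have K: "compact K" by (simp add: compact_eq_bounded_closed)
 have Npos: "N z > 0" if "z ~= 0" for z
  using that by (cases z) (auto simp: N_def zero_prod_def add_nonneg_pos add_pos_nonneg)
 have pos: "convgap p (fst z) (snd z) > 0" if "z : K" for z
 proof -
  have "z ~= 0" using that by (auto simp: K_def)
  then have "N z > 0" by (rule Npos)
  then have "e * N z > 0" using assms by simp
  then have "fst z ~= snd z" using that by (auto simp: K_def)
  then show ?thesis using convgap_pos assms by blast
 qed
 obtain C where C: "C >= 0" "!!z. z : K ==> norm (fst z - snd z) powr p <= C * convgap p (fst z) (snd z)"
 proof (cases "K = {}")
  case True then show ?thesis using that[of 0] by auto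
 next
  case False
  have "continuous_on K (%z. norm (fst z - snd z) powr p / convgap p (fst z) (snd z))"
   using pos by (intro continuous_on_divide continuous_on_subset[OF cd] continuous_on_subset[OF cg]) force+
  then obtain z0 where z0: "z0 : K" "!!z. z : K ==> norm (fst z - snd z) powr p / convgap p (fst z) (snd z)
   <= norm (fst z0 - snd z0) powr p / convgap p (fst z0) (snd z0)"
   using continuous_attains_sup[OF K False] by blast
  define C where "C = norm (fst z0 - snd z0) powr p / convgap p (fst z0) (snd z0)"
  have "C >= 0" using pos[OF z0(1)] by (simp add: C_def)
  moreover have "norm (fst z - snd z) powr p <= C * convgap p (fst z) (snd z)" if "z : K" for z
   using z0(2)[OF that] pos[OF that] by (simp add: C_def field_simps)
  ultimately show ?thesis using that by blast
 qed
 have "norm (a - b) powr p <= e * (norm a powr p + norm b powr p) + C * convgap p a b" for a b :: 'a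
 proof (cases "(a, b) = 0")
  case True
  then have "a = 0" "b = 0" by (auto simp: zero_prod_def)
  then show ?thesis by (simp add: convgap_def)
 next
  case False
  define t where "t = norm (a, b)"
  have t: "t > 0" using False by (simp add: t_def)
  define z where "z = ((1/t) *\<^sub>R a, (1/t) *\<^sub>R b)"
  have "z = (1/t) *\<^sub>R (a, b)" by (simp add: z_def)
  then have "norm z = abs (1/t) * norm (a, b)" by (simp only: norm_scaleR)
  then have nz: "norm z = 1" using t by (simp add: t_def[symmetric])
  have az: "a = t *\<^sub>R fst z" "b = t *\<^sub>R snd z" using t by (auto simp: z_def)
  have *: "norm (fst z - snd z) powr p <= e * N z + C * convgap p (fst z) (snd z)"
  proof (cases "z : K")
   case True
   moreover have "N z >= 0" by (simp add: N_def)
   ultimately show ?thesis using C(2)[OF True] assms by (simp add: add_increasing)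
  next
   case False
   then have "norm (fst z - snd z) powr p <= e * N z" using nz by (auto simp: K_def)
   then show ?thesis using C(1) convgap_nonneg[OF assms(1), of "fst z" "snd z"] by (simp add: add_increasing2)
  qed
  have "norm (a - b) powr p = t powr p * norm (fst z - snd z) powr p"
   unfolding az using t by (simp add: powr_mult flip: scaleR_diff_right)
  also have "... <= t powr p * (e * N z + C * convgap p (fst z) (snd z))"
   using * by (intro mult_left_mono) auto
  also have "... = e * (t powr p * N z) + C * (t powr p * convgap p (fst z) (snd z))" by (simp add: algebra_simps)
  also have "t powr p * N z = norm a powr p + norm b powr p"
   unfolding az N_def using t by (simp add: powr_mult algebra_simps)
  also have "t powr p * convgap p (fst z) (snd z) = convgap p a b"
  proof -
   have "(1/2) *\<^sub>R (t *\<^sub>R fst z + t *\<^sub>R snd z) = t *\<^sub>R ((1/2) *\<^sub>R (fst z + snd z))"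
   by (simp add: scaleR_add_right mult.commute)
   then have "norm ((1/2) *\<^sub>R (t *\<^sub>R fst z + t *\<^sub>R snd z)) = t * norm ((1/2) *\<^sub>R (fst z + snd z))"
   using t by (simp only: norm_scaleR abs_of_pos)
   then have "norm ((1/2) *\<^sub>R (t *\<^sub>R fst z + t *\<^sub>R snd z)) powr p
   = t powr p * norm ((1/2) *\<^sub>R (fst z + snd z)) powr p"
   by (simp only: powr_mult)
   moreover have "norm (t *\<^sub>R v) powr p = t powr p * norm v powr p" for v :: 'a
   using t by (simp add: powr_mult)
   ultimately show ?thesis unfolding az convgap_def by (simp only:) (simp add: algebra_simps)
  qed
  finally show ?thesis .
 qed
 then show ?thesis using that C(1) by blast
qed

section \<open>Translation invariance of Lebesgue measure and Cauchy sequences in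
  \<open>L^p\<close>\<close>

lemma cball_in_borel [measurable]: "cball c r : sets (borel :: 'a::euclidean_space measure)"
 by simp

lemma nn_integral_lborel_shift:
 fixes f :: "'a::euclidean_space => ennreal"
 assumes [measurable]: "f : bmeas"
 shows "(\<integral>\<^sup>+x. f (x + z) \<partial>lborel) = (\<integral>\<^sup>+x. f x \<partial>lborel)"
proof -
 have "(\<integral>\<^sup>+x. f x \<partial>lborel) = (\<integral>\<^sup>+x. f x \<partial>distr lborel borel ((+) z))"
  by (simp add: lborel_distr_plus)
 also have "... = (\<integral>\<^sup>+x. f (z + x) \<partial>lborel)" by (subst nn_integral_distr) auto
 finally show ?thesis by (simp add: add.commute)
qed

lemma AE_lborel_shift:
 fixes P :: "'a::euclidean_space => bool"
 assumes "AEL x. P x"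
 shows "AEL x. P (x + z)"
proof -
 have "AE x in distr lborel borel ((+) z). P x" unfolding lborel_distr_plus using assms .
 then have "AEL x. P (z + x)" by (rule AE_distrD[rotated]) simp
 then show ?thesis by (simp add: add.commute)
qed

text \<open>The Riesz-Fischer argument, with an integrable majorant and localised to the sets
  \<open>S k\<close>. Along a fast subsequence a weighted sum \<open>E\<close> of the p-th powers of
  the increments is integrable, so the increments are bounded by a geometric series times
  \<open>E powr (1/p)\<close>. On \<open>S k\<close> the increments are controlled from index
  \<open>k\<close> on, which is why the majorant starts there.\<close>

lemma Lp_Cauchy_subseq:
 fixes f :: "nat => 'a::euclidean_space => 'b::euclidean_space"
 assumes p: "p > 0"
  and f [measurable]: "!!n. f n : bmeas"
  and int: "!!n. integ (%x. norm (f n x) powr p)"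
  and S [measurable]: "!!k. S k : sets borel" and "incseq S"
  and Cau: "!!k e. e > 0 ==> EX N. ALL m>=N. ALL n>=N. (LBINT x. indicator (S k) x * norm (f m x - f n x) powr p) <= e"
 obtains r h where "strict_mono (r :: nat => nat)" "h : bmeas"
  "!!k. EX D. integrable lborel D & (ALL n>=k. AEL x. x : S k --> norm (f (r n) x) powr p <= D x)"
  "AEL x. x : (\<Union>k. S k) --> (%n. f (r n) x) ----> h x"
proof -
 \<comment> \<open>The factor \<open>2 powr (- (k * p))\<close> pays for the weight in
   \<open>a\<close> below, which turns summability into geometric decay of \<open>d k\<close>;
   \<open>(1/2)^k\<close> makes the weighted sum converge.\<close>
 define e where "e k = (1/2)^k * 2 powr (- (real k * p))" for k :: nat
 have "e k > 0" for k by (simp add: e_def)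
 from Cau[OF this] have "EX N. ALL k. ALL m>=N k. ALL n>=N k. (LBINT x. indicator (S k) x * norm (f m x - f n x) powr p) <= e k"
  by (intro choice allI)
 then obtain N where N: "!!k m n. m >= N k ==> n >= N k ==> (LBINT x. indicator (S k) x * norm (f m x - f n x) powr p) <= e k"
  by blast
 define r where "r k = k + (\<Sum>i\<le>k. N i)" for k
 have r: "strict_mono r" by (intro strict_monoI_Suc) (simp add: r_def)
 have rN: "r k >= N k" for k
  using member_le_sum[of k "{..k}" N] by (simp add: r_def)
 define d where "d k x = norm (f (r (Suc k)) x - f (r k) x)" for k x
 have [measurable]: "d k : bmeas" for k unfolding d_def by measurable
 have dint: "integ (%x. indicator (S j) x * d k x powr p)" for j k
 proof (rule integrable_le)
  show "integ (%x. 2 powr p * (norm (f (r (Suc k)) x) powr p + norm (f (r k) x) powr p))"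
   using int by auto
  show "AEL x. norm (indicator (S j) x * d k x powr p)
   <= norm (2 powr p * (norm (f (r (Suc k)) x) powr p + norm (f (r k) x) powr p))"
   using norm_diff_powr_le[OF p] by (auto simp: d_def indicator_def abs_mult)
 qed measurable
 have dle: "(LBINT x. indicator (S j) x * d k x powr p) <= e k" if "j <= k" for j k
 proof -
  have "(LBINT x. indicator (S j) x * d k x powr p) <= (LBINT x. indicator (S k) x * d k x powr p)"
   using incseqD[OF \<open>incseq S\<close> that] by (intro integral_mono dint) (auto simp: indicator_def)
  also have "... <= e k" using N[of k "r (Suc k)" "r k"] rN[of k] strict_mono_leD[OF r, of k "Suc k"]
   unfolding d_def by simp
  finally show ?thesis .
 qed
 define a where "a j k x = (if j <= k then indicator (S j) x * (2 powr (real k * p) * d k x powr p) else 0)" for j k x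
 have [measurable]: "a j k : bmeas" for j k unfolding a_def by measurable
 define E where "E j x = (\<Sum>k. ennreal (a j k x))" for j x
 have [measurable]: "E j : bmeas" for j unfolding E_def by measurable
 have anonneg: "a j k x >= 0" for j k x by (simp add: a_def)
 have aint: "(\<integral>\<^sup>+x. ennreal (a j k x) \<partial>lborel) <= ennreal ((1/2)^k)" for j k
 proof (cases "j <= k")
  case True
  have eq: "a j k x = 2 powr (real k * p) * (indicator (S j) x * d k x powr p)" for x using True by (simp add: a_def)
  have "(\<integral>\<^sup>+x. ennreal (a j k x) \<partial>lborel) = ennreal (LBINT x. a j k x)"
   unfolding eq by (intro nn_integral_eq_integral integrable_mult_right dint) auto
  also have "... <= ennreal (2 powr (real k * p) * e k)"
   unfolding eq using dle[OF True] by (intro ennreal_leI) (simp add: mult_left_mono)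
  also have "2 powr (real k * p) * e k = (1/2)^k" by (simp add: e_def powr_minus field_simps)
  finally show ?thesis .
 qed (simp add: a_def)
 have Efin: "(\<integral>\<^sup>+x. E j x \<partial>lborel) < \<infinity>" for j
 proof -
  have "(\<integral>\<^sup>+x. E j x \<partial>lborel) = (\<Sum>k. \<integral>\<^sup>+x. ennreal (a j k x) \<partial>lborel)"
   unfolding E_def by (intro nn_integral_suminf) measurable
  also have "... <= (\<Sum>k. ennreal ((1/2)^k))" by (intro suminf_le aint summableI)
  also have "... = ennreal (\<Sum>k. (1/2)^k)" by (intro suminf_ennreal2) auto
  finally show ?thesis using le_less_trans by fastforce
 qed
 have EAE: "AEL x. E j x ~= \<infinity>" for j by (rule nn_integral_PInf_AE) (use Efin[of j] in auto)
 have Eint: "integ (%x. enn2real (E j x))" for j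
 proof (rule integrableI_nonneg)
  have "(\<integral>\<^sup>+x. ennreal (enn2real (E j x)) \<partial>lborel) = (\<integral>\<^sup>+x. E j x \<partial>lborel)"
   using EAE[of j] by (intro nn_integral_cong_AE) (auto simp: less_top)
  then show "(\<integral>\<^sup>+x. ennreal (enn2real (E j x)) \<partial>lborel) < \<infinity>" using Efin[of j] by simp
 qed auto
 have dk: "d k x <= (1/2)^k * enn2real (E j x) powr (1/p)" if "E j x ~= \<infinity>" "x : S j" "j <= k" for j k x
 proof -
  have "ennreal (a j k x) <= E j x" unfolding E_def using sum_le_suminf[of "%k. ennreal (a j k x)" "{k}"] by simp
  then have "a j k x <= enn2real (E j x)" using that(1) by (metis anonneg enn2real_ennreal enn2real_mono infinity_ennreal_def less_top)
  then have "2 powr (real k * p) * d k x powr p <= enn2real (E j x)" using that by (simp add: a_def)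
  moreover have "2 powr (real k * p) * d k x powr p = (2^k * d k x) powr p"
   by (simp add: powr_mult d_def powr_powr[symmetric] powr_realpow)
  ultimately have "((2^k * d k x) powr p) powr (1/p) <= enn2real (E j x) powr (1/p)"
   using p by (intro powr_mono2) auto
  then have "2^k * d k x <= enn2real (E j x) powr (1/p)" using p by (simp add: powr_powr d_def)
  then show ?thesis by (simp add: field_simps power_divide)
 qed
 define h where "h x = lim (%n. f (r n) x)" for x
 have h: "h : bmeas" unfolding h_def by (intro borel_measurable_lim_metric) simp
 have conv: "AEL x. x : (\<Union>k. S k) --> (%n. f (r n) x) ----> h x"
 proof -
  have "AEL x. ALL j. E j x ~= \<infinity>" using EAE by (simp add: AE_all_countable)
  then show ?thesis
  proof (rule AE_mp, intro AE_I2 impI)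
   fix x assume E: "ALL j. E j x ~= \<infinity>" and "x : (\<Union>k. S k)"
   then obtain j where j: "x : S j" by auto
   have "summable (%k. f (r (Suc k)) x - f (r k) x)"
   proof (rule summable_comparison_test)
   show "EX N. ALL n>=N. norm (f (r (Suc n)) x - f (r n) x) <= (1/2)^n * enn2real (E j x) powr (1/p)"
   using dk[of j x] E j unfolding d_def by (intro exI[of _ j]) auto
   show "summable (%n. (1/2)^n * enn2real (E j x) powr (1/p))" by (intro summable_mult2) auto
   qed
   then have "convergent (%n. \<Sum>k<n. f (r (Suc k)) x - f (r k) x)" by (simp add: summable_iff_convergent)
   then have "convergent (%n. f (r n) x - f (r 0) x)" by (simp add: sum_lessThan_telescope[of "%k. f (r k) x"])
   then have "convergent (%n. f (r n) x)" using convergent_add[OF _ convergent_const[of "f (r 0) x"]] by fastforce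
   then show "(%n. f (r n) x) ----> h x" unfolding h_def by (simp add: convergent_LIMSEQ_iff)
  qed
 qed
 have dom: "EX D. integrable lborel D & (ALL n>=j. AEL x. x : S j --> norm (f (r n) x) powr p <= D x)" for j
 proof (intro exI conjI allI impI)
  let ?D = "%x. 2 powr p * (norm (f (r j) x) powr p + 2 powr p * enn2real (E j x))"
  show "integ ?D" using int Eint by auto
  fix n assume n: "j <= n"
  show "AEL x. x : S j --> norm (f (r n) x) powr p <= ?D x"
   using EAE[of j]
  proof (rule AE_mp, intro AE_I2 impI)
   fix x assume E: "E j x ~= \<infinity>" and x: "x : S j"
   let ?e = "enn2real (E j x) powr (1/p)"
   have "norm (f (r n) x - f (r j) x) <= (\<Sum>k=j..<n. d k x)"
   using n
   proof (induction rule: dec_induct)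
   case (step n)
   have "norm (f (r (Suc n)) x - f (r j) x) <= d n x + norm (f (r n) x - f (r j) x)"
   using norm_triangle_ineq[of "f (r (Suc n)) x - f (r n) x" "f (r n) x - f (r j) x"] by (simp add: d_def)
   then show ?case using step by simp
   qed simp
   also have "... <= (\<Sum>k=j..<n. (1/2)^k * ?e)" using dk[OF E x] by (intro sum_mono) auto
   also have "... <= (\<Sum>k<n. (1/2)^k * ?e)" by (intro sum_mono2) auto
   also have "... = (\<Sum>k<n. (1/2)^k) * ?e" by (simp add: sum_distrib_right)
   also have "... <= 2 * ?e" by (intro mult_right_mono) (auto simp: sum_gp_strict)
   finally have 1: "norm (f (r n) x - f (r j) x) <= 2 * ?e" .
   have "norm (f (r n) x) powr p <= 2 powr p * (norm (f (r j) x) powr p + norm (f (r n) x - f (r j) x) powr p)"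
   using norm_add_powr_le[OF p, of "f (r j) x" "f (r n) x - f (r j) x"] by simp
   also have "... <= 2 powr p * (norm (f (r j) x) powr p + (2 * ?e) powr p)"
   using 1 p by (intro mult_left_mono add_left_mono powr_mono2) auto
   also have "(2 * ?e) powr p = 2 powr p * enn2real (E j x)" using p by (simp add: powr_mult powr_powr)
   finally show "norm (f (r n) x) powr p <= ?D x" .
  qed
 qed
 show ?thesis using that[OF r h dom conv] .
qed

section \<open>Continuously differentiable functions, the translation estimate and cutoffs\<close>

text \<open>The gradient is an explicit second argument, so that products and compositions carry
  their gradients as formulas.\<close>

definition C1 :: "('a::euclidean_space => real) => ('a => 'a) => bool" where
 "C1 ph G \<longleftrightarrow> (ALL x. (ph has_derivative (%h. G x \<bullet> h)) (at x)) & continuous_on UNIV G"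

definition supp_in :: "('a::real_normed_vector => real) => real => bool" where
 "supp_in ph R \<longleftrightarrow> (ALL x. norm x > R --> ph x = 0)"

lemma C1_D: "C1 ph G ==> (ph has_derivative (%h. G x \<bullet> h)) (at x)" by (simp add: C1_def)

lemma C1_cont: assumes "C1 ph G" shows "continuous_on UNIV ph"
 using has_derivative_continuous[OF C1_D[OF assms]] by (simp add: continuous_at_imp_continuous_on)

lemma C1_cont_grad: assumes "C1 ph G" shows "continuous_on UNIV G"
 using assms by (auto simp: C1_def)

lemma C1_meas: assumes "C1 ph G" shows "ph : bmeas" "G : bmeas"
 using C1_cont[OF assms] C1_cont_grad[OF assms] by (auto intro: borel_measurable_continuous_onI)

lemma C1_const: "C1 (%x. c) (%x. 0)" by (simp add: C1_def)

lemma C1_add: assumes "C1 f F" "C1 g G" shows "C1 (%x. f x + g x) (%x. F x + G x)"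
 unfolding C1_def
proof (intro conjI allI)
 fix x show "((%x. f x + g x) has_derivative (%h. (F x + G x) \<bullet> h)) (at x)"
  using has_derivative_add[OF C1_D[OF assms(1), of x] C1_D[OF assms(2), of x]]
  by (simp add: inner_add_left)
qed (use assms in \<open>auto simp: C1_def intro!: continuous_intros\<close>)

lemma C1_mult: assumes "C1 f F" "C1 g G" shows "C1 (%x. f x * g x) (%x. g x *\<^sub>R F x + f x *\<^sub>R G x)"
 unfolding C1_def
proof (intro conjI allI)
 fix x show "((%x. f x * g x) has_derivative (%h. (g x *\<^sub>R F x + f x *\<^sub>R G x) \<bullet> h)) (at x)"
  using has_derivative_mult[OF C1_D[OF assms(1), of x] C1_D[OF assms(2), of x]]
  by (rule has_derivative_eq_rhs) (auto simp: inner_add_left algebra_simps)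
 show "continuous_on UNIV (%x. g x *\<^sub>R F x + f x *\<^sub>R G x)"
  using C1_cont[OF assms(1)] C1_cont[OF assms(2)] C1_cont_grad[OF assms(1)] C1_cont_grad[OF assms(2)]
  by (intro continuous_intros)
qed

lemma C1_cmult: assumes "C1 f F" shows "C1 (%x. c * f x) (%x. c *\<^sub>R F x)"
 using C1_mult[OF C1_const[of c] assms] by simp

lemma C1_compose:
 assumes "C1 f G" "!!x. (F has_real_derivative F' (f x)) (at (f x))" "continuous_on (range f) F'"
 shows "C1 (%x. F (f x)) (%x. F' (f x) *\<^sub>R G x)"
 unfolding C1_def
proof (intro conjI allI)
 fix x show "((%x. F (f x)) has_derivative (%h. (F' (f x) *\<^sub>R G x) \<bullet> h)) (at x)"
  using has_derivative_compose[OF C1_D[OF assms(1), of x] assms(2)[of x, unfolded has_field_derivative_def]]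
  by (rule has_derivative_eq_rhs) auto
 show "continuous_on UNIV (%x. F' (f x) *\<^sub>R G x)"
  using C1_cont[OF assms(1)] C1_cont_grad[OF assms(1)] assms(3)
  by (intro continuous_intros continuous_on_compose2[of "range f" F' UNIV f]) auto
qed

lemma supp_in_grad:
 assumes "C1 f G" "supp_in f R" "norm x > R"
 shows "G x = 0"
proof -
 have "(f has_derivative (%h. 0)) (at x)"
 proof (rule has_derivative_transform_within_open)
  show "((%x. 0) has_derivative (%h. 0)) (at x)" by simp
  show "open {x::'a. norm x > R}" by (intro open_Collect_less continuous_intros)
 qed (use assms in \<open>auto simp: supp_in_def\<close>)
 then have "(%h. G x \<bullet> h) = (%h. 0)" using has_derivative_unique C1_D[OF assms(1)] by blast
 then have "G x \<bullet> G x = 0" by metis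
 then show ?thesis by simp
qed

lemma continuous_bounded_cball:
 fixes f :: "'a::euclidean_space => 'b::real_normed_vector"
 assumes "continuous_on UNIV f"
 obtains B where "B >= 0" "!!x. norm x <= R ==> norm (f x) <= B"
proof -
 have "compact (f ` cball 0 R)" using assms by (intro compact_continuous_image continuous_on_subset[OF assms]) auto
 then have "bounded (f ` cball 0 R)" by (rule compact_imp_bounded)
 then obtain B where "!!y. y : f ` cball 0 R ==> norm y <= B" unfolding bounded_iff by blast
 then have "norm (f x) <= max 0 B" if "norm x <= R" for x
  using that by (metis dist_0_norm imageI le_max_iff_disj mem_cball)
 then show ?thesis using that[of "max 0 B"] by simp
qed

lemma C1_supp_bounded:
 assumes "C1 f G" "supp_in f R"
 obtains B where "B > 0" "!!x. abs (f x) <= B" "!!x. norm (G x) <= B"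
proof -
 obtain B1 where B1: "B1 >= 0" "!!x. norm x <= R ==> norm (f x) <= B1"
  by (rule continuous_bounded_cball[OF C1_cont[OF assms(1)], of R]) (rule that)
 obtain B2 where B2: "B2 >= 0" "!!x. norm x <= R ==> norm (G x) <= B2"
  by (rule continuous_bounded_cball[OF C1_cont_grad[OF assms(1)], of R]) (rule that)
 have "abs (f x) <= B1 + B2 + 1" for x using B1 B2(1) assms(2) by (cases "norm x <= R") (force simp: supp_in_def)+
 moreover have "norm (G x) <= B1 + B2 + 1" for x
  using B2 B1(1) supp_in_grad[OF assms, of x] by (cases "norm x <= R") force+
 ultimately show ?thesis using that[of "B1 + B2 + 1"] B1(1) B2(1) by simp
qed

text \<open>Write the difference as the integral of \<open>G (x + t z) \<bullet> z\<close> over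
  \<open>t\<close> in the unit interval, apply Jensen's inequality there, exchange the integrals and
  shift \<open>x\<close>; all segments that occur lie in the ball of radius
  \<open>R + norm z\<close>.\<close>

lemma C1_translation:
 fixes f :: "'a::euclidean_space => real"
 assumes p: "p > 1" and f: "C1 f G"
 shows "(\<integral>\<^sup>+x. ib R x * ennreal (abs (f (x + z) - f x) powr p) \<partial>lborel)
  <= ennreal (norm z powr p) * (\<integral>\<^sup>+x. ib (R + norm z) x * ennreal (norm (G x) powr p) \<partial>lborel)"
proof -
 have [measurable]: "f : bmeas" "G : bmeas" using C1_meas[OF f] by auto
 define k where "k t x = norm (G (x + t *\<^sub>R z)) powr p" for t x
 have [measurable]: "(%q. k (snd q) (fst q)) : borel_measurable (borel \<Otimes>\<^sub>M borel)" "(%t. k t x) : bmeas" for x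
  unfolding k_def by measurable
 have mk [measurable]: "(%q. ib R (fst q) * (indicator {0..1} (snd q) * ennreal (k (snd q) (fst q))))
  : borel_measurable (lborel \<Otimes>\<^sub>M lborel)" by measurable
 have pt: "ennreal (abs (f (x + z) - f x) powr p) <= ennreal (norm z powr p) * (\<integral>\<^sup>+t. indicator {0..1} t * ennreal (k t x) \<partial>lborel)" for x
 proof -
  define h where "h t = G (x + t *\<^sub>R z) \<bullet> z" for t
  define w where "w t = f (x + t *\<^sub>R z)" for t
  have ch: "continuous_on {0..1} h" unfolding h_def
   by (intro continuous_intros continuous_on_compose2[OF C1_cont_grad[OF f]]) auto
  have w: "(w has_vector_derivative h t) (at t within {0..1})" for t
  proof -
   have "((%t. x + t *\<^sub>R z) has_derivative (%s. s *\<^sub>R z)) (at t within {0..1})"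
   by (auto intro!: derivative_eq_intros)
   from has_derivative_compose[OF this C1_D[OF f]] show ?thesis
   unfolding has_vector_derivative_def w_def h_def by (rule has_derivative_eq_rhs) (auto simp: algebra_simps)
  qed
  have FTC: "(LBINT t. indicator {0..1} t *\<^sub>R h t) = w 1 - w 0"
   by (rule integral_FTC_atLeastAtMost[OF _ w ch]) auto
  define m where "m = abs (f (x + z) - f x)"
  have i1: "set_integrable lborel {0..1} (%t. abs (h t))" "set_integrable lborel {0..1} h"
   using ch by (auto intro!: borel_integrable_atLeastAtMost' continuous_intros)
  have i2: "set_integrable lborel {0..1} (%t. abs (h t) powr p)"
   using continuous_on_norm_powr[OF ch, of p] p by (intro borel_integrable_atLeastAtMost') auto
  have i3: "set_integrable lborel {0..1} (%t. k t x)"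
   unfolding k_def using p
   by (intro borel_integrable_atLeastAtMost' continuous_on_norm_powr continuous_on_compose2[OF C1_cont_grad[OF f]] continuous_intros) auto
  have "m = abs (LBINT t. indicator {0..1} t *\<^sub>R h t)" unfolding FTC by (simp add: m_def w_def)
  also have "... <= (LINT t:{0..1}|lborel. abs (h t))"
   unfolding set_lebesgue_integral_def using integral_norm_bound[of lborel "%t. indicator {0..1} t *\<^sub>R h t"]
   by (simp add: abs_mult)
  finally have m: "m <= (LINT t:{0..1}|lborel. abs (h t))" .
  have m0: "m >= 0" by (simp add: m_def)
  \<comment> \<open>Jensen's inequality for the p-th power: the tangent inequality at
    \<open>m\<close> is integrated over the unit interval, and the linear term has the right sign
    because \<open>m\<close> is at most the mean of \<open>abs (h t)\<close>.\<close>
  have "m powr p = m powr p + p * m powr (p-1) * (m - m)" by simp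
  also have "... <= m powr p + p * m powr (p-1) * ((LINT t:{0..1}|lborel. abs (h t)) - m)"
   using m p by (intro add_left_mono mult_left_mono) auto
  also have "... = (LINT t:{0..1}|lborel. m powr p + p * m powr (p-1) * (abs (h t) - m))"
  proof -
   have c: "set_integrable lborel {0..1::real} (%t. c)" for c :: real by (simp add: set_integrable_def)
   have "(LINT t:{0..1::real}|lborel. c) = c" for c :: real by (simp add: set_lebesgue_integral_def measure_def)
   then show ?thesis using i1 c by (simp add: set_integral_add set_integral_diff)
  qed
  also have "... <= (LINT t:{0..1}|lborel. abs (h t) powr p)"
  proof (rule set_integral_mono)
   have c: "set_integrable lborel {0..1::real} (%t. c)" for c :: real by (simp add: set_integrable_def)
   show "set_integrable lborel {0..1} (%t. m powr p + p * m powr (p-1) * (abs (h t) - m))"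
   using i1 c by (intro set_integral_add set_integrable_mult_right set_integral_diff) auto
  qed (use i2 powr_tangent[OF p m0] in auto)
  also have "... <= (LINT t:{0..1}|lborel. norm z powr p * k t x)"
  proof (rule set_integral_mono)
   fix t :: real
   have "abs (h t) <= norm z * norm (G (x + t *\<^sub>R z))" unfolding h_def using Cauchy_Schwarz_ineq2[of "G (x + t *\<^sub>R z)" z] by (simp add: mult.commute)
   then have "abs (h t) powr p <= (norm z * norm (G (x + t *\<^sub>R z))) powr p" using p by (intro powr_mono2) auto
   then show "abs (h t) powr p <= norm z powr p * k t x" by (simp add: powr_mult k_def)
  qed (use i2 i3 in auto)
  also have "... = norm z powr p * (LINT t:{0..1}|lborel. k t x)" by simp
  finally have "m powr p <= norm z powr p * (LINT t:{0..1}|lborel. k t x)" .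
  then have "ennreal (m powr p) <= ennreal (norm z powr p) * ennreal (LINT t:{0..1}|lborel. k t x)"
   by (subst ennreal_mult[symmetric]) (auto simp: k_def set_lebesgue_integral_def intro!: ennreal_leI)
  also have "ennreal (LINT t:{0..1}|lborel. k t x) = (\<integral>\<^sup>+t. ennreal (indicator {0..1} t *\<^sub>R k t x) \<partial>lborel)"
   unfolding set_lebesgue_integral_def using i3
   by (intro nn_integral_eq_integral[symmetric]) (auto simp: set_integrable_def k_def)
  also have "... = (\<integral>\<^sup>+t. indicator {0..1} t * ennreal (k t x) \<partial>lborel)"
   by (intro nn_integral_cong) (auto simp: indicator_def)
  finally show ?thesis by (simp add: m_def)
 qed
 have "(\<integral>\<^sup>+x. ib R x * ennreal (abs (f (x + z) - f x) powr p) \<partial>lborel)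
  <= (\<integral>\<^sup>+x. ib R x * (ennreal (norm z powr p) * (\<integral>\<^sup>+t. indicator {0..1} t * ennreal (k t x) \<partial>lborel)) \<partial>lborel)"
  by (intro nn_integral_mono mult_left_mono pt) auto
 also have "... = ennreal (norm z powr p) * (\<integral>\<^sup>+x. (\<integral>\<^sup>+t. ib R x * (indicator {0..1} t * ennreal (k t x)) \<partial>lborel) \<partial>lborel)"
 proof -
  have "ib R x * (ennreal (norm z powr p) * (\<integral>\<^sup>+t. indicator {0..1} t * ennreal (k t x) \<partial>lborel))
   = ennreal (norm z powr p) * (\<integral>\<^sup>+t. ib R x * (indicator {0..1} t * ennreal (k t x)) \<partial>lborel)" for x
   by (subst nn_integral_cmult) (measurable, simp add: mult.left_commute)
  then show ?thesis by (simp only:) (intro nn_integral_cmult lborel.borel_measurable_nn_integral, use mk in \<open>simp add: split_beta'\<close>)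
 qed
 also have "(\<integral>\<^sup>+x. (\<integral>\<^sup>+t. ib R x * (indicator {0..1} t * ennreal (k t x)) \<partial>lborel) \<partial>lborel)
  = (\<integral>\<^sup>+t. (\<integral>\<^sup>+x. ib R x * (indicator {0..1} t * ennreal (k t x)) \<partial>lborel) \<partial>lborel)"
  by (rule lborel_pair.Fubini'[symmetric]) (use mk in \<open>simp add: split_beta'\<close>)
 also have "... <= (\<integral>\<^sup>+t. indicator {0..1::real} t * (\<integral>\<^sup>+x. ib (R + norm z) x * ennreal (norm (G x) powr p) \<partial>lborel) \<partial>lborel)"
 proof (rule nn_integral_mono)
  fix t :: real
  have "(\<integral>\<^sup>+x. ib R x * (indicator {0..1} t * ennreal (k t x)) \<partial>lborel)
   <= (\<integral>\<^sup>+x. indicator {0..1} t * (ib (R + norm z) (x + t *\<^sub>R z) * ennreal (norm (G (x + t *\<^sub>R z)) powr p)) \<partial>lborel)"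
  proof (rule nn_integral_mono)
   fix x :: 'a
   have "norm (x + t *\<^sub>R z) <= R + norm z" if "norm x <= R" "0 <= t" "t <= 1"
   proof -
   have "norm (x + t *\<^sub>R z) <= norm x + t * norm z" using norm_triangle_ineq[of x "t *\<^sub>R z"] that by simp
   also have "... <= R + norm z" using that by (intro add_mono) (auto intro: mult_left_le_one_le)
   finally show ?thesis .
   qed
   then show "ib R x * (indicator {0..1} t * ennreal (k t x))
   <= indicator {0..1} t * (ib (R + norm z) (x + t *\<^sub>R z) * ennreal (norm (G (x + t *\<^sub>R z)) powr p))"
   by (auto simp: indicator_def k_def)
  qed
  also have "... = indicator {0..1} t * (\<integral>\<^sup>+x. ib (R + norm z) (x + t *\<^sub>R z) * ennreal (norm (G (x + t *\<^sub>R z)) powr p) \<partial>lborel)"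
   by (intro nn_integral_cmult) measurable
  also have "(\<integral>\<^sup>+x. ib (R + norm z) (x + t *\<^sub>R z) * ennreal (norm (G (x + t *\<^sub>R z)) powr p) \<partial>lborel)
   = (\<integral>\<^sup>+x. ib (R + norm z) x * ennreal (norm (G x) powr p) \<partial>lborel)"
   by (rule nn_integral_lborel_shift) measurable
  finally show "(\<integral>\<^sup>+x. ib R x * (indicator {0..1} t * ennreal (k t x)) \<partial>lborel)
   <= indicator {0..1} t * (\<integral>\<^sup>+x. ib (R + norm z) x * ennreal (norm (G x) powr p) \<partial>lborel)" .
 qed
 also have "... = (\<integral>\<^sup>+x. ib (R + norm z) x * ennreal (norm (G x) powr p) \<partial>lborel)"
  by (subst nn_integral_multc) auto
 finally show ?thesis by (simp add: mult_left_mono)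
qed

text \<open>Truncation at 0 makes the p-th power continuously differentiable on the whole line, so
  that powers of nonnegative functions can be differentiated at their zeros too.\<close>

lemma has_real_derivative_pos_powr:
 fixes y p :: real
 assumes "p > 1"
 shows "((%y. (max 0 y) powr p) has_real_derivative p * (max 0 y) powr (p - 1)) (at y)"
proof -
 consider "y > 0" | "y < 0" | "y = 0" by linarith
 then show ?thesis
 proof cases
  case 1
  have "((%y. y powr p) has_real_derivative p * y powr (p - 1)) (at y)" using 1 by (rule has_real_derivative_powr)
  then have "((%y. (max 0 y) powr p) has_real_derivative p * y powr (p - 1)) (at y)"
   by (rule has_field_derivative_transform_within_open[where S = "{0<..}"]) (use 1 in auto)
  then show ?thesis using 1 by simp
 next
  case 2
  have "((%y. 0) has_real_derivative 0) (at y)" by simp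
  then have "((%y. (max 0 y) powr p) has_real_derivative 0) (at y)"
   by (rule has_field_derivative_transform_within_open[where S = "{..<0}"]) (use 2 in auto)
  then show ?thesis using 2 assms by simp
 next
  case 3
  have "((%h. abs h powr (p - 1)) \<longlongrightarrow> (abs (0::real)) powr (p-1)) (at 0)"
   using assms by (intro tendsto_powr' tendsto_intros) auto
  then have l: "((%h. abs h powr (p - 1)) \<longlongrightarrow> (0::real)) (at 0)" using assms by simp
  have "((%h. (max 0 h) powr p / h) \<longlongrightarrow> 0) (at 0)"
  proof (rule Lim_null_comparison[OF _ l])
   show "\<forall>\<^sub>F h in at 0. norm (max 0 h powr p / h) <= abs h powr (p - 1)"
   by (intro always_eventually allI) (auto simp: max_def powr_diff divide_nonneg_neg)
  qed
  then show ?thesis using 3 assms by (simp add: DERIV_def)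
 qed
qed

lemma continuous_on_pos_powr:
 assumes "continuous_on S f" "p > 0"
 shows "continuous_on S (%x. (max 0 (f x :: real)) powr p)"
 using assms by (intro continuous_on_powr' continuous_intros) auto

text \<open>The cutoff \<open>sg\<close> is the p-th power of \<open>ct\<close>, so its gradient
  carries the factor \<open>ct powr (p - 1)\<close>. With this factor Young's inequality absorbs
  cutoff terms into \<open>ct powr p\<close> times the p-th power of the gradient. The bound is
  explicit in the width \<open>d\<close> for the later iteration.\<close>

lemma cutoff_exists:
 fixes p r d :: real
 assumes "p > 1" "r >= 0" "d > 0"
 obtains ct :: "'a::euclidean_space => real" and sg dsg where
  "C1 sg dsg" "!!x. sg x = ct x powr p" "!!x. 0 <= ct x" "!!x. ct x <= 1"
  "!!x. norm x <= r ==> ct x = 1" "!!x. norm x > r + d ==> ct x = 0"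
  "!!x. norm (dsg x) <= (4 * p / d) * ct x powr (p - 1)"
proof -
 \<comment> \<open>Normalises the squared norm so that \<open>t\<close> runs from 0 on the sphere of
   radius \<open>r\<close> to 1 on the sphere of radius \<open>r + d\<close>.\<close>
 define c where "c = 1 / (d * (2 * r + d))"
 have c: "c > 0" using assms by (simp add: c_def)
 have c1: "c * ((r+d)\<^sup>2 - r\<^sup>2) = 1"
 proof -
  have "(r+d)\<^sup>2 - r\<^sup>2 = d * (2 * r + d)" by (simp add: power2_eq_square algebra_simps)
  then show ?thesis using assms by (simp add: c_def)
 qed
 define t where "t x = c * (x \<bullet> x - r\<^sup>2)" for x :: 'a
 have "C1 (%x::'a. x \<bullet> x - r\<^sup>2) (%x. 2 *\<^sub>R x)"
  unfolding C1_def by (auto intro!: derivative_eq_intros continuous_intros ext simp: inner_commute)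
 then have t: "C1 t (%x. c *\<^sub>R (2 *\<^sub>R x))" unfolding t_def by (rule C1_cmult)
 define y where "y x = 1 - (max 0 (t x)) powr 2" for x
 have "C1 (%x. (max 0 (t x)) powr 2) (%x. (2 * (max 0 (t x)) powr (2 - 1)) *\<^sub>R (c *\<^sub>R (2 *\<^sub>R x)))"
  by (rule C1_compose[OF t, where F = "%s. (max 0 s) powr 2" and F' = "%s. 2 * (max 0 s) powr (2-1)"])
   (use has_real_derivative_pos_powr[of 2] in \<open>auto intro!: continuous_intros\<close>)
 from C1_add[OF C1_const[of 1] C1_cmult[OF this, of "-1"]]
 have y: "C1 y (%x. - ((2 * (max 0 (t x))) *\<^sub>R (c *\<^sub>R (2 *\<^sub>R x))))"
  unfolding y_def by simp
 define dy where "dy x = - ((2 * (max 0 (t x))) *\<^sub>R (c *\<^sub>R (2 *\<^sub>R x)))" for x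
 define ct where "ct x = max 0 (y x)" for x
 have sg: "C1 (%x. ct x powr p) (%x. (p * ct x powr (p - 1)) *\<^sub>R dy x)"
  unfolding ct_def dy_def
  by (rule C1_compose[OF y, where F = "%s. (max 0 s) powr p" and F' = "%s. p * (max 0 s) powr (p-1)"])
   (use assms has_real_derivative_pos_powr[OF assms(1)] in \<open>auto intro!: continuous_intros continuous_on_pos_powr\<close>)
 have t0: "t x <= 0" if "norm x <= r" for x
 proof -
  have "x \<bullet> x <= r\<^sup>2" using power_mono[OF that, of 2] by (simp add: power2_norm_eq_inner)
  then show ?thesis using c by (simp add: t_def mult_nonneg_nonpos)
 qed
 have t1: "t x >= 1" if "norm x >= r + d" for x
 proof -
  have "(r+d)\<^sup>2 <= x \<bullet> x" using power_mono[OF that, of 2] assms by (simp add: power2_norm_eq_inner)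
  then have "c * ((r+d)\<^sup>2 - r\<^sup>2) <= t x" using c by (simp add: t_def)
  moreover note c1
  ultimately show ?thesis by simp
 qed
 show ?thesis
 proof (rule that[OF sg])
  fix x :: 'a
  show "ct x <= 1" by (simp add: ct_def y_def)
  show "ct x = 1" if "norm x <= r" using t0[OF that] by (simp add: ct_def y_def max_def)
  have chi0: "ct x = 0" if "norm x >= r + d"
  proof -
   have "1 powr 2 <= max 0 (t x) powr 2" using t1[OF that] by (intro powr_mono2) auto
   then show ?thesis by (simp add: ct_def y_def)
  qed
  then show "ct x = 0" if "norm x > r + d" using that by simp
  show "norm ((p * ct x powr (p - 1)) *\<^sub>R dy x) <= 4 * p / d * ct x powr (p - 1)"
  proof (cases "norm x >= r + d")
   case True then show ?thesis using chi0 by simp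
  next
   case False
   have "x \<bullet> x <= (r+d)\<^sup>2" using False power_mono[of "norm x" "r+d" 2] by (simp add: power2_norm_eq_inner)
   then have "t x <= c * ((r+d)\<^sup>2 - r\<^sup>2)" using c by (simp add: t_def)
   also note c1
   finally have tx: "max 0 (t x) <= 1" by simp
   have "norm (dy x) = (2 * max 0 (t x)) * (c * (2 * norm x))" using c by (simp add: dy_def)
   also have "... <= (2 * 1) * (c * (2 * (r + d)))"
   using tx False c assms by (intro mult_mono) auto
   also have "... <= 4 / d"
   proof -
   have "(r + d) / (2 * r + d) <= 1" using assms by simp
   then have "4 / d * ((r + d) / (2 * r + d)) <= 4 / d * 1" using assms by (intro mult_left_mono) auto
   then show ?thesis by (simp add: c_def)
   qed
   finally have "p * ct x powr (p - 1) * norm (dy x) <= p * ct x powr (p - 1) * (4 / d)"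
   using assms by (intro mult_left_mono) auto
   then show ?thesis using assms by (simp add: mult_ac)
  qed
 qed (auto simp: ct_def)
qed

section \<open>Sobolev functions as dominated limits of C1 functions, with the chain and product
  rules\<close>

text \<open>Values and gradients converge almost everywhere below a common majorant of their p-th
  powers. This is strong \<open>W^{1,p}\<close> convergence in a form to which dominated convergence
  applies directly.\<close>

definition approx :: "real => (nat => 'a::euclidean_space => real) => (nat => 'a => 'a) => ('a => real)
 => ('a => real) => ('a => 'a) => bool" where
 "approx p ph G D u g \<longleftrightarrow> (ALL k. C1 (ph k) (G k) & (ALL x. ph k x >= 0)) & integrable lborel D &
  (ALL k. AEL x. ph k x powr p + norm (G k x) powr p <= D x) &
  u : bmeas & g : bmeas & (ALL x. u x >= 0) &
  (AEL x. (%k. ph k x) ----> u x & (%k. G k x) ----> g x)"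

lemma integrable_ind_cball: "integ (indicat_real (cball c R :: 'a::euclidean_space set))"
 by (intro integrable_real_indicator) (use emeasure_lborel_cball_finite[of c R] in \<open>auto simp: less_top\<close>)

lemma approxD:
 assumes "approx p ph G D u g"
 shows "C1 (ph k) (G k)" "ph k x >= 0" "integrable lborel D"
  "AEL x. ph k x powr p + norm (G k x) powr p <= D x"
  "u : bmeas" "g : bmeas" "u x >= 0"
  "AEL x. (%k. ph k x) ----> u x & (%k. G k x) ----> g x"
  "ph k : bmeas" "G k : bmeas"
 using assms C1_meas[of "ph k" "G k"] unfolding approx_def by auto

lemma tendsto_norm_powr:
 assumes "(f \<longlongrightarrow> l) F" "p > 0"
 shows "((%x. norm (f x) powr p) \<longlongrightarrow> norm l powr p) F"
 using assms by (intro tendsto_powr' tendsto_intros) auto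

lemma tendsto_nonneg_powr:
 fixes f :: "'b => real"
 assumes "(f \<longlongrightarrow> l) F" "p > 0" "!!x. f x >= 0"
 shows "((%x. f x powr p) \<longlongrightarrow> l powr p) F"
 using assms by (intro tendsto_powr' tendsto_intros) auto

lemma approx_le:
 assumes A: "approx p ph G D u g" and p: "p > 0"
 shows "AEL x. u x powr p + norm (g x) powr p <= D x"
proof -
 have "AEL x. ALL k. ph k x powr p + norm (G k x) powr p <= D x"
  using approxD(4)[OF A] by (simp add: AE_all_countable)
 with approxD(8)[OF A] show ?thesis
 proof eventually_elim
  case (elim x)
  have "(%k. ph k x powr p + norm (G k x) powr p) ----> u x powr p + norm (g x) powr p"
   using elim approxD(2)[OF A] p by (intro tendsto_add tendsto_nonneg_powr tendsto_norm_powr) auto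
  then show ?case using elim by (intro LIMSEQ_le_const2) auto
 qed
qed

lemma approx_integrable:
 assumes A: "approx p ph G D u g" and p: "p > 0"
 shows "integ (%x. u x powr p)" "integ (%x. norm (g x) powr p)"
  "integ (%x. ph k x powr p)" "integ (%x. norm (G k x) powr p)"
proof -
 note [measurable] = approxD(5,6,9,10)[OF A]
 have *: "u x powr p + norm (g x) powr p <= D x ==> u x powr p <= abs (D x) & norm (g x) powr p <= abs (D x)" for x
  by (smt (verit) powr_ge_zero)
 have **: "ph k x powr p + norm (G k x) powr p <= D x ==> ph k x powr p <= abs (D x) & norm (G k x) powr p <= abs (D x)" for x
  by (smt (verit) powr_ge_zero)
 show "integ (%x. u x powr p)"
  using approx_le[OF A p] * by (intro integrable_le[OF approxD(3)[OF A]]) auto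
 show "integ (%x. norm (g x) powr p)"
  using approx_le[OF A p] * by (intro integrable_le[OF approxD(3)[OF A]]) auto
 show "integ (%x. ph k x powr p)"
  using approxD(4)[OF A, of k] ** by (intro integrable_le[OF approxD(3)[OF A]]) auto
 show "integ (%x. norm (G k x) powr p)"
  using approxD(4)[OF A, of k] ** by (intro integrable_le[OF approxD(3)[OF A]]) auto
qed

text \<open>The interval of differentiability starts strictly below 0, so that the derivative is
  two-sided at 0 and the chain rule holds where the inner function vanishes; bounds on
  \<open>F'\<close> are only asked on the range of nonnegative functions.\<close>

definition Lipfun :: "(real => real) => (real => real) => bool" where
 "Lipfun F F' \<longleftrightarrow> (EX a>0. (ALL t>-a. (F has_real_derivative F' t) (at t)) & continuous_on {-a<..} F') & (EX B>=0. ALL t>=0. abs (F' t) <= B)"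

lemma LipfunD:
 assumes "Lipfun F F'"
 shows "t >= 0 ==> (F has_real_derivative F' t) (at t)" "continuous_on {0..} F'" "continuous_on {0..} F"
  "EX B>=0. ALL t>=0. abs (F' t) <= B & abs (F t) <= abs (F 0) + B * t"
proof -
 obtain a B where a: "a > 0" "ALL t>-a. (F has_real_derivative F' t) (at t)" "continuous_on {-a<..} F'"
  and B: "B >= 0" "ALL t>=0. abs (F' t) <= B" using assms unfolding Lipfun_def by blast
 show 1: "(F has_real_derivative F' t) (at t)" if "t >= 0" for t using a that by auto
 show "continuous_on {0..} F'" using a by (intro continuous_on_subset[OF a(3)]) auto
 show "continuous_on {0..} F" using 1 DERIV_isCont by (fastforce intro: continuous_at_imp_continuous_on)
 have "abs (F t) <= abs (F 0) + B * t" if "t >= 0" for t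
 proof -
  have "norm (F t - F 0) <= B * norm (t - 0)"
   by (rule field_differentiable_bound[where S="{0..}" and f' = F'])
   (use 1 B that in \<open>auto intro: has_field_derivative_at_within\<close>)
  then show ?thesis using that by simp
 qed
 then show "EX B>=0. ALL t>=0. abs (F' t) <= B & abs (F t) <= abs (F 0) + B * t" using B by blast
qed

lemma Lipfun_const: "Lipfun (%t. c) (%t. 0)"
 unfolding Lipfun_def by (intro conjI exI[of _ 1] exI[of _ "0::real"]) auto

lemma Lipfun_id: "Lipfun (%t. t) (%t. 1)"
 unfolding Lipfun_def by (intro conjI exI[of _ 1]) auto

text \<open>The localised composition \<open>sg * F(v)\<close> and its formal gradient, split into
  the cutoff part and the part along \<open>g\<close>. Most test functions below have this
  shape.\<close>

abbreviation (input) pval :: "('a => real) => (real => real) => ('a => real) => 'a => real" where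
 "pval sg F v \<equiv> %x. sg x * F (v x)"

abbreviation (input) pgrad :: "('a => real) => ('a => 'a) => (real => real) => (real => real) => ('a => real) => ('a => 'a) => 'a => 'a::real_vector" where
 "pgrad sg dsg F F' v g \<equiv> %x. F (v x) *\<^sub>R dsg x + (sg x * F' (v x)) *\<^sub>R g x"

lemma Lipfun_C1:
 assumes "Lipfun F F'" "C1 sg dsg" "C1 ph G" "!!x. ph x >= 0"
 shows "C1 (pval sg F ph) (pgrad sg dsg F F' ph G)"
proof -
 have "C1 (%x. F (ph x)) (%x. F' (ph x) *\<^sub>R G x)"
  using assms LipfunD[OF assms(1)]
  by (intro C1_compose[OF assms(3)] continuous_on_subset[OF LipfunD(2)[OF assms(1)]]) auto
 from C1_mult[OF assms(2) this] show ?thesis by simp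
qed

lemma Lipfun_measurable:
 assumes F: "Lipfun F F'" and [measurable]: "v : bmeas" and "!!x. v x >= 0"
 shows "(%x. F (v x)) : bmeas" "(%x. F' (v x)) : bmeas"
proof -
 have c: "continuous_on UNIV (%t. F (max 0 t))" "continuous_on UNIV (%t. F' (max 0 t))"
  using LipfunD(2,3)[OF F] by (auto intro!: continuous_on_compose2[of "{0..}" _ UNIV "max 0"] continuous_intros)
 have "(%x. F (max 0 (v x))) : bmeas" "(%x. F' (max 0 (v x))) : bmeas"
  using c[THEN borel_measurable_continuous_onI] by measurable
 moreover have "max 0 (v x) = v x" for x using assms(3)[of x] by simp
 ultimately show "(%x. F (v x)) : bmeas" "(%x. F' (v x)) : bmeas" by simp_all
qed

lemma Lipfun_tendsto:
 assumes F: "Lipfun F F'" and "v ----> l" "!!k. v k >= 0" "l >= 0"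
 shows "(%k. F (v k)) ----> F l" "(%k. F' (v k)) ----> F' l"
 using assms(2-) by (auto intro!: continuous_on_tendsto_compose[OF LipfunD(2)[OF F]] continuous_on_tendsto_compose[OF LipfunD(3)[OF F]])

lemma sum3_powr_le:
 fixes a b c p :: real
 assumes "p > 0" "a >= 0" "b >= 0" "c >= 0"
 shows "(a + b + c) powr p <= 4 powr p * (a powr p + b powr p + c powr p)"
proof -
 have "(a + b + c) powr p <= 2 powr p * ((a + b) powr p + c powr p)" using assms by (intro powr_sum_le) auto
 also have "... <= 2 powr p * (2 powr p * (a powr p + b powr p) + 2 powr p * c powr p)"
 proof -
  have "c powr p * 1 <= c powr p * 2 powr p" using assms by (intro mult_left_mono ge_one_powr_ge_zero) auto
  then show ?thesis using powr_sum_le[OF assms(1-3)] by (intro mult_left_mono add_mono) (auto simp: mult_ac)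
 qed
 also have "... = (2 powr p * 2 powr p) * (a powr p + b powr p + c powr p)" by (simp add: algebra_simps)
 also have "2 powr p * 2 powr p = (4::real) powr p" using powr_mult[of 2 2 p] by simp
 finally show ?thesis .
qed

text \<open>The product and chain rules hold for the C1 approximants. As \<open>F\<close> grows at
  most linearly and \<open>F'\<close> is bounded, a multiple of \<open>1 + D\<close> on the ball
  dominates the approximants and their limit at once.\<close>

lemma approx_prod:
 assumes A: "approx p ph G D u g" and p: "p > 1" and F: "Lipfun F F'" and sg: "C1 sg dsg"
 shows "C1 (pval sg F (ph k)) (pgrad sg dsg F F' (ph k) (G k))"
  "pval sg F u : bmeas" "pgrad sg dsg F F' u g : bmeas"
  "AEL x. (%k. pval sg F (ph k) x) ----> pval sg F u x & (%k. pgrad sg dsg F F' (ph k) (G k) x) ----> pgrad sg dsg F F' u g x"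
  "EX E. integrable lborel E & (ALL k. AEL x. norm x <= R --> (abs (pval sg F (ph k) x)) powr p <= E x & norm (pgrad sg dsg F F' (ph k) (G k) x) powr p <= E x)
   & (AEL x. norm x <= R --> (abs (pval sg F u x)) powr p <= E x & norm (pgrad sg dsg F F' u g x) powr p <= E x)"
proof -
 note [measurable] = approxD(5,6,9,10)[OF A] C1_meas[OF sg]
  Lipfun_measurable[OF F approxD(5)[OF A] approxD(7)[OF A]]
 show "C1 (pval sg F (ph k)) (pgrad sg dsg F F' (ph k) (G k))"
  using Lipfun_C1[OF F sg approxD(1)[OF A] approxD(2)[OF A]] .
 show "pval sg F u : bmeas" by measurable
 show "pgrad sg dsg F F' u g : bmeas" by measurable
 show "AEL x. (%k. pval sg F (ph k) x) ----> pval sg F u x & (%k. pgrad sg dsg F F' (ph k) (G k) x) ----> pgrad sg dsg F F' u g x"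
  using approxD(8)[OF A]
 proof eventually_elim
  case (elim x)
  then show ?case using Lipfun_tendsto[OF F, of "%k. ph k x" "u x"] approxD(2,7)[OF A]
   by (auto intro!: tendsto_intros)
 qed
 obtain B where B: "B >= 0" "!!t. t >= 0 ==> (abs (F' t)) <= B" "!!t. t >= 0 ==> (abs (F t)) <= abs (F 0) + B * t"
  using LipfunD(4)[OF F] by blast
 obtain S1 where S1: "S1 >= 0" "!!x. norm x <= R ==> norm (sg x) <= S1"
  by (rule continuous_bounded_cball[OF C1_cont[OF sg], of R]) (rule that)
 obtain S2 where S2: "S2 >= 0" "!!x. norm x <= R ==> norm (dsg x) <= S2"
  by (rule continuous_bounded_cball[OF C1_cont_grad[OF sg], of R]) (rule that)
 define K where "K = (S1 + S2) * (abs (F 0) + B)"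
 have K: "K >= 0" using S1 S2 B by (simp add: K_def)
 define E where "E x = ib R x * ((K powr p * 4 powr p) * (1 + D x))" for x
 have Eint: "integrable lborel E"
 proof -
  have eq: "E = (%x. (K powr p * 4 powr p) * (ib R x + ib R x * D x))"
   by (auto simp: E_def fun_eq_iff algebra_simps)
  have "integ (%x. ib R x * D x)"
   using integrable_real_mult_indicator[OF _ approxD(3)[OF A], of "cball 0 R"] by (simp add: mult.commute)
  then show ?thesis unfolding eq
   by (intro integrable_mult_right Bochner_Integration.integrable_add integrable_ind_cball)
 qed
 have bnd: "abs (pval sg F v x) powr p <= E x & norm (pgrad sg dsg F F' v gv x) powr p <= E x"
  if "v x >= 0" "v x powr p + norm (gv x) powr p <= D x" "norm x <= R" for v gv x
 proof -
  let ?s = "1 + v x + norm (gv x)"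
  have Fb: "abs (F (v x)) <= (abs (F 0) + B) * (1 + v x)"
   using B(3)[OF that(1)] that(1) B(1) by (simp add: algebra_simps) (smt (verit) mult_nonneg_nonneg abs_ge_zero)
  have s: "abs (sg x) <= S1" "norm (dsg x) <= S2" using S1(2)[OF that(3)] S2(2)[OF that(3)] by auto
  have 1: "abs (pval sg F v x) <= K * ?s"
  proof -
   have "abs (pval sg F v x) <= S1 * ((abs (F 0) + B) * (1 + v x))" unfolding abs_mult using s Fb S1 by (intro mult_mono) auto
   also have "... <= (S1 + S2) * ((abs (F 0) + B) * ?s)" using S1 S2 B that by (intro mult_mono) auto
   finally show ?thesis by (simp add: K_def mult.assoc)
  qed
  have 2: "norm (pgrad sg dsg F F' v gv x) <= K * ?s"
  proof -
   have "norm (pgrad sg dsg F F' v gv x) <= abs (F (v x)) * norm (dsg x) + abs (sg x) * abs (F' (v x)) * norm (gv x)"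
   by (rule order_trans[OF norm_triangle_ineq]) (simp add: abs_mult)
   also have "... <= ((abs (F 0) + B) * (1 + v x)) * S2 + S1 * (abs (F 0) + B) * norm (gv x)"
   using Fb s B(1) B(2)[OF that(1)] S1 S2 that by (intro add_mono mult_mono) auto
   also have "... <= (abs (F 0) + B) * (1 + v x) * (S1 + S2) + (S1 + S2) * (abs (F 0) + B) * norm (gv x)"
   using S1(1) S2(1) B(1) that(1) by (intro add_mono mult_left_mono mult_right_mono) auto
   also have "... = K * ?s" by (simp add: K_def algebra_simps)
   finally show ?thesis .
  qed
  have "(K * ?s) powr p = K powr p * ?s powr p" by (simp add: powr_mult)
  also have "... <= K powr p * (4 powr p * (1 powr p + v x powr p + norm (gv x) powr p))"
   using p that by (intro mult_left_mono sum3_powr_le) auto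
  also have "... <= K powr p * (4 powr p * (1 + D x))" using that by (intro mult_left_mono) auto
  also have "... = E x" using that by (simp add: E_def)
  finally have 3: "(K * ?s) powr p <= E x" .
  show ?thesis using 1 2 p powr_mono2[of p _ "K * ?s"] 3 by (meson abs_ge_zero norm_ge_zero order.strict_implies_order order_trans zero_less_one)
 qed
 show "EX E. integrable lborel E & (ALL k. AEL x. norm x <= R --> (abs (pval sg F (ph k) x)) powr p <= E x & norm (pgrad sg dsg F F' (ph k) (G k) x) powr p <= E x)
   & (AEL x. norm x <= R --> (abs (pval sg F u x)) powr p <= E x & norm (pgrad sg dsg F F' u g x) powr p <= E x)"
 proof (intro exI[of _ E] conjI allI Eint)
  show "AEL x. norm x <= R --> (abs (pval sg F (ph k) x)) powr p <= E x & norm (pgrad sg dsg F F' (ph k) (G k) x) powr p <= E x" for k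
   using approxD(4)[OF A, of k] by eventually_elim (use bnd[of "ph k" _ "G k"] approxD(2)[OF A] in blast)
  show "AEL x. norm x <= R --> (abs (pval sg F u x)) powr p <= E x & norm (pgrad sg dsg F F' u g x) powr p <= E x"
   using approx_le[OF A order.strict_trans[OF zero_less_one p]]
   by eventually_elim (use bnd[of u _ g] approxD(7)[OF A] in blast)
 qed
qed

text \<open>Passage to the limit in the translation estimate: Fatou's lemma on the left, dominated
  convergence for the gradients on the right.\<close>

lemma approx_translation:
 assumes A: "approx p ph G D u g" and p: "p > 1" and F: "Lipfun F F'" and sg: "C1 sg dsg"
 shows "(\<integral>\<^sup>+x. ib R x * ennreal (abs (pval sg F u (x + z) - pval sg F u x) powr p) \<partial>lborel)
  <= ennreal (norm z powr p * (LBINT x. ib (R + norm z) x * norm (pgrad sg dsg F F' u g x) powr p))"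
proof -
 let ?w = "%k. pval sg F (ph k)" and ?W = "%k. pgrad sg dsg F F' (ph k) (G k)"
 let ?v = "pval sg F u" and ?V = "pgrad sg dsg F F' u g"
 define R' where "R' = R + norm z"
 note P = approx_prod[OF A p F sg]
 have m [measurable]: "?w k : bmeas" "?W k : bmeas" for k
  using C1_meas[OF P(1)[of k]] by auto
 note [measurable] = P(2,3)
 obtain E where E: "integrable lborel E" "!!k. AEL x. norm x <= R' --> (abs (?w k x)) powr p <= E x & norm (?W k x) powr p <= E x"
  using P(5)[of R'] by blast
 let ?I = "%k. LBINT x. indicator (cball 0 R') x * norm (?W k x) powr p"
 let ?J = "LBINT x. indicator (cball 0 R') x * norm (?V x) powr p"
 have Eb: "AEL x. norm (indicator (cball 0 R') x * norm (?W k x) powr p) <= abs (E x)" for k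
  using E(2)[of k] by eventually_elim (auto simp: indicator_def)
 have Ii: "integ (%x. indicator (cball 0 R') x * norm (?W k x) powr p)" for k
  by (rule integrable_le[OF E(1)]) (use Eb[of k] in auto)
 have conv: "?I ----> ?J"
 proof (rule integral_dominated_convergence[where w = "%x. abs (E x)"])
  show "AEL x. (%k. indicator (cball 0 R') x * norm (?W k x) powr p) ----> indicator (cball 0 R') x * norm (?V x) powr p"
   using P(4) by eventually_elim (use p in \<open>auto intro!: tendsto_mult tendsto_norm_powr\<close>)
 qed (use E Eb in auto)
 have "(\<integral>\<^sup>+x. ib R x * ennreal (abs (?v (x + z) - ?v x) powr p) \<partial>lborel)
  = (\<integral>\<^sup>+x. liminf (%k. ib R x * ennreal (abs (?w k (x + z) - ?w k x) powr p)) \<partial>lborel)"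
 proof (rule nn_integral_cong_AE)
  have "AEL x. (%k. ?w k x) ----> ?v x" using P(4) by eventually_elim auto
  from this AE_lborel_shift[OF this, of z]
  show "AEL x. ib R x * ennreal (abs (?v (x + z) - ?v x) powr p) =
   liminf (%k. ib R x * ennreal (abs (?w k (x + z) - ?w k x) powr p))"
  proof eventually_elim
   case (elim x)
   have "(%k. abs (?w k (x + z) - ?w k x) powr p) ----> (abs (?v (x + z) - ?v x)) powr p"
   using tendsto_norm_powr[OF tendsto_diff[OF elim(2,1)], of p] p by simp
   then have "(%k. ennreal (abs (?w k (x + z) - ?w k x) powr p)) ----> ennreal (abs (?v (x + z) - ?v x) powr p)"
   by (rule tendsto_ennrealI)
   from lim_imp_Liminf[OF _ this] show ?case by (cases "x : cball 0 R") (auto simp: Liminf_const)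
  qed
 qed
 also have "... <= liminf (%k. \<integral>\<^sup>+x. ib R x * ennreal (abs (?w k (x + z) - ?w k x) powr p) \<partial>lborel)"
  by (rule nn_integral_liminf) measurable
 also have "... <= liminf (%k. ennreal (norm z powr p * ?I k))"
 proof (rule Liminf_mono, intro always_eventually allI)
  fix k
  have "(\<integral>\<^sup>+x. ib R x * ennreal (abs (?w k (x + z) - ?w k x) powr p) \<partial>lborel)
   <= ennreal (norm z powr p) * (\<integral>\<^sup>+x. indicator (cball 0 R') x * ennreal (norm (?W k x) powr p) \<partial>lborel)"
   unfolding R'_def by (rule C1_translation[OF p P(1)])
  also have "(\<integral>\<^sup>+x. indicator (cball 0 R') x * ennreal (norm (?W k x) powr p) \<partial>lborel) = (\<integral>\<^sup>+x. ennreal (indicator (cball 0 R') x * norm (?W k x) powr p) \<partial>lborel)"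
   by (intro nn_integral_cong) (auto simp: indicator_def)
  also have "... = ennreal (?I k)" by (rule nn_integral_eq_integral[OF Ii]) auto
  finally show "(\<integral>\<^sup>+x. ib R x * ennreal (abs (?w k (x + z) - ?w k x) powr p) \<partial>lborel) <= ennreal (norm z powr p * ?I k)"
   by (simp add: ennreal_mult'')
 qed
 also have "... = ennreal (norm z powr p * ?J)"
  by (intro lim_imp_Liminf tendsto_ennrealI tendsto_mult tendsto_const conv) simp
 finally show ?thesis by (simp add: R'_def)
qed

section \<open>Poincare and Rellich theorems from translation bounds\<close>

text \<open>A Poincare inequality anchored on a set \<open>A\<close> where \<open>f\<close> is
  bounded: compare \<open>f x\<close> with \<open>f y\<close> and average over \<open>y\<close> in
  \<open>A\<close>. The measure of \<open>A\<close> enters through the factor \<open>1 / al\<close>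
  only.\<close>

lemma poincare_translation:
 fixes f :: "'a::euclidean_space => real"
 assumes p: "p > 0" and f [measurable]: "f : bmeas" and K: "K >= 0" and R: "R >= 0"
  and tr: "!!z. norm z <= 2 * R ==> (\<integral>\<^sup>+x. ib R x * ennreal (abs (f (x + z) - f x) powr p) \<partial>lborel) <= ennreal K"
  and A [measurable]: "A : sets borel" and AR: "A \<subseteq> cball 0 R" and al: "0 < al" "al <= measure lborel A"
  and b: "!!x. x : A ==> (abs (f x)) <= b" "b >= 0"
 defines "C \<equiv> 2 powr p * (measure lborel (cball 0 (2 * R) :: 'a set) * K / al + b powr p * measure lborel (cball 0 R :: 'a set))"
 shows "integ (%x. ib R x * abs (f x) powr p)"
  "(LBINT x. ib R x * abs (f x) powr p) <= C"
proof -
 let ?B = "cball 0 R :: 'a set"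
 let ?X = "\<integral>\<^sup>+x. ennreal (indicator ?B x * abs (f x) powr p) \<partial>lborel"
 let ?a = "measure lborel A"
 have fin: "emeasure lborel A < \<infinity>" "emeasure lborel ?B < \<infinity>"
  using emeasure_mono[OF AR, of lborel] emeasure_lborel_cball_finite[of "0::'a" R] by (auto simp: less_top intro: le_less_trans)
 have emA: "emeasure lborel A = ennreal ?a" and emB: "emeasure lborel ?B = ennreal (measure lborel ?B)"
  and em2: "emeasure lborel (cball 0 (2*R) :: 'a set) = ennreal (measure lborel (cball 0 (2*R) :: 'a set))"
  using fin emeasure_lborel_cball_finite[of "0::'a" "2*R"] by (auto intro!: emeasure_eq_ennreal_measure)
 have C0: "C >= 0" using K al by (auto simp: C_def)
 let ?d = "%x y. indicator ?B x * (indicator A y * ennreal (abs (f x - f y) powr p))"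
 have dm [measurable]: "(%q. ?d (fst q) (snd q)) : borel_measurable (lborel \<Otimes>\<^sub>M lborel)" by measurable
 \<comment> \<open>With the substitution \<open>y = x + z\<close> the double integral becomes an
   integral of translation moduli; two points of the ball differ by at most \<open>2 * R\<close>,
   which bounds the shifts that count.\<close>
 have dd: "(\<integral>\<^sup>+x. (\<integral>\<^sup>+y. ?d x y \<partial>lborel) \<partial>lborel) <= ennreal (measure lborel (cball 0 (2 * R) :: 'a set) * K)"
 proof -
  have dz [measurable]: "(%q. ?d (fst q) (fst q + snd q)) : borel_measurable (lborel \<Otimes>\<^sub>M lborel)" by measurable
  have "(\<integral>\<^sup>+x. (\<integral>\<^sup>+y. ?d x y \<partial>lborel) \<partial>lborel) = (\<integral>\<^sup>+x. (\<integral>\<^sup>+z. ?d x (z + x) \<partial>lborel) \<partial>lborel)"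
   by (intro nn_integral_cong nn_integral_lborel_shift[symmetric]) measurable
  also have "... = (\<integral>\<^sup>+z. (\<integral>\<^sup>+x. ?d x (z + x) \<partial>lborel) \<partial>lborel)"
   by (rule lborel_pair.Fubini'[symmetric]) (use dz in \<open>simp add: split_beta' add.commute\<close>)
  also have "... <= (\<integral>\<^sup>+z. ib (2*R) (z::'a) * ennreal K \<partial>lborel)"
  proof (rule nn_integral_mono)
   fix z :: 'a
   show "(\<integral>\<^sup>+x. ?d x (z + x) \<partial>lborel) <= ib (2*R) z * ennreal K"
   proof (cases "norm z <= 2 * R")
   case True
   have "(\<integral>\<^sup>+x. ?d x (z + x) \<partial>lborel) <= (\<integral>\<^sup>+x. indicator ?B x * ennreal (abs (f (x + z) - f x) powr p) \<partial>lborel)"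
   by (intro nn_integral_mono) (auto simp: indicator_def abs_minus_commute add.commute)
   with tr[OF True] True show ?thesis by simp
   next
   case False
   have "?d x (z + x) = 0" for x
   proof (rule ccontr)
   assume "?d x (z + x) ~= 0"
   then have "x : ?B" "z + x : A" by (auto simp: indicator_def split: if_splits)
   then have "norm x <= R" "norm (z + x) <= R" using AR by auto
   then have "norm z <= 2 * R" using norm_triangle_ineq4[of "z + x" x] by simp
   then show False using False by simp
   qed
   then have "(\<integral>\<^sup>+x. ?d x (z + x) \<partial>lborel) = (\<integral>\<^sup>+x. 0 \<partial>(lborel :: 'a measure))" by (intro nn_integral_cong)
   then show ?thesis by simp
   qed
  qed
  also have "... = ennreal (measure lborel (cball 0 (2 * R) :: 'a set) * K)"
   using K by (simp add: nn_integral_multc em2 ennreal_mult)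
  finally show ?thesis .
 qed
 have "ennreal ?a * ?X = (\<integral>\<^sup>+x. (\<integral>\<^sup>+y. indicator A y * ennreal (indicator ?B x * abs (f x) powr p) \<partial>lborel) \<partial>lborel)"
  by (simp add: nn_integral_multc emA[symmetric] nn_integral_cmult)
 also have "... <= (\<integral>\<^sup>+x. (\<integral>\<^sup>+y. ennreal (2 powr p) * ?d x y + (ennreal (2 powr p * b powr p) * indicator ?B x) * indicator A y \<partial>lborel) \<partial>lborel)"
 proof (intro nn_integral_mono)
  fix x y :: 'a
  show "indicator A y * ennreal (indicator ?B x * abs (f x) powr p) <= ennreal (2 powr p) * ?d x y + (ennreal (2 powr p * b powr p) * indicator ?B x) * indicator A y"
  proof (cases "y : A & x : ?B")
   case True
   have "abs (f x) powr p <= 2 powr p * (abs (f x - f y) powr p + abs (f y) powr p)"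
   using norm_add_powr_le[OF p, of "f x - f y" "f y"] by simp
   also have "... <= 2 powr p * (abs (f x - f y) powr p + b powr p)"
   using b True p by (intro mult_left_mono add_left_mono powr_mono2) auto
   finally have "ennreal (abs (f x) powr p) <= ennreal (2 powr p * abs (f x - f y) powr p + 2 powr p * b powr p)"
   by (intro ennreal_leI) (simp add: algebra_simps)
   then show ?thesis using True by (simp add: ennreal_plus ennreal_mult)
  qed (auto simp: indicator_def)
 qed
 also have "... = (\<integral>\<^sup>+x. ennreal (2 powr p) * (\<integral>\<^sup>+y. ?d x y \<partial>lborel) + ennreal (2 powr p * b powr p) * indicator ?B x * ennreal ?a \<partial>lborel)"
  by (intro nn_integral_cong) (simp add: nn_integral_add nn_integral_cmult emA)
 also have "... = ennreal (2 powr p) * (\<integral>\<^sup>+x. (\<integral>\<^sup>+y. ?d x y \<partial>lborel) \<partial>lborel) + ennreal (2 powr p * b powr p) * ennreal (measure lborel ?B) * ennreal ?a"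
 proof -
  have m1: "(%x. \<integral>\<^sup>+y. ?d x y \<partial>lborel) : borel_measurable lborel"
   using lborel.borel_measurable_nn_integral[of "%x y. ?d x y" lborel] dm by (simp add: split_beta')
  show ?thesis
   by (subst nn_integral_add) (use m1 in \<open>auto simp: nn_integral_cmult nn_integral_multc emB\<close>)
 qed
 also have "... <= ennreal (2 powr p) * ennreal (measure lborel (cball 0 (2 * R) :: 'a set) * K)
  + ennreal (2 powr p * b powr p) * ennreal (measure lborel ?B) * ennreal ?a"
  using dd by (intro add_right_mono mult_left_mono) auto
 finally have *: "ennreal ?a * ?X <= ennreal (2 powr p) * ennreal (measure lborel (cball 0 (2 * R) :: 'a set) * K)
  + ennreal (2 powr p * b powr p) * ennreal (measure lborel ?B) * ennreal ?a"
  .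
 have "ennreal ?a * ?X <= ennreal (2 powr p * (measure lborel (cball 0 (2 * R) :: 'a set) * K) + 2 powr p * b powr p * measure lborel ?B * ?a)"
  using * K by (simp add: ennreal_mult ennreal_plus)
 also have "... <= ennreal (?a * C)"
 proof (rule ennreal_leI)
  have "2 powr p * (measure lborel (cball 0 (2 * R) :: 'a set) * K) <= ?a * (2 powr p * (measure lborel (cball 0 (2 * R) :: 'a set) * K / al))"
  proof -
   have "al * (2 powr p * (measure lborel (cball 0 (2 * R) :: 'a set) * K / al)) <= ?a * (2 powr p * (measure lborel (cball 0 (2 * R) :: 'a set) * K / al))"
   using al K by (intro mult_right_mono) auto
   then show ?thesis using al by simp
  qed
  then show "2 powr p * (measure lborel (cball 0 (2 * R) :: 'a set) * K) + 2 powr p * b powr p * measure lborel ?B * ?a <= ?a * C"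
   by (simp add: C_def algebra_simps)
 qed
 also have "ennreal (?a * C) = ennreal ?a * ennreal C" using C0 by (simp add: ennreal_mult)
 finally have "ennreal ?a * ?X <= ennreal ?a * ennreal C" .
 then have X: "?X <= ennreal C" using al by (subst (asm) ennreal_mult_le_mult_iff) auto
 then show int: "integ (%x. indicator ?B x * abs (f x) powr p)"
  by (intro integrableI_nonneg) (auto simp: le_less_trans)
 have "ennreal (LBINT x. indicator ?B x * abs (f x) powr p) <= ennreal C"
  using X nn_integral_eq_integral[OF int] by simp
 then show "(LBINT x. indicator ?B x * abs (f x) powr p) <= C" using C0 by simp
qed

lemma integral_lborel_shift:
 fixes f :: "'a::euclidean_space => real"
 assumes "f : bmeas"
 shows "(LBINT x. f (x + z)) = (LBINT x. f x)"
proof -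
 have "(LBINT x. f x) = (\<integral>x. f x \<partial>distr lborel borel ((+) z))" unfolding lborel_distr_plus ..
 also have "... = (LBINT x. f (z + x))" using assms by (subst integral_distr) auto
 finally show ?thesis by (simp add: add.commute)
qed

text \<open>The tangent inequality at \<open>m\<close> integrated against the density
  \<open>kp\<close>. Stated with values in \<open>ennreal\<close>, it is trivial when the right-hand
  side is infinite.\<close>

lemma jensen_kernel:
 fixes py kp :: "'a::euclidean_space => real"
 assumes p: "p > 1" and [measurable]: "py : bmeas" "kp : bmeas"
  and kp: "!!y. kp y >= 0" "integrable lborel kp" "(LBINT y. kp y) = 1"
  and py: "integ (%y. py y * kp y)"
 shows "ennreal (abs (LBINT y. py y * kp y) powr p) <= (\<integral>\<^sup>+y. ennreal (abs (py y) powr p * kp y) \<partial>lborel)"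
proof (cases "(\<integral>\<^sup>+y. ennreal (abs (py y) powr p * kp y) \<partial>lborel) < \<infinity>")
 case True
 have int: "integ (%y. abs (py y) powr p * kp y)"
  using True kp by (intro integrableI_nonneg) auto
 define m where "m = abs (LBINT y. py y * kp y)"
 have m0: "m >= 0" by (simp add: m_def)
 have ia: "integ (%y. abs (py y) * kp y)"
  using integrable_abs[OF py] kp by (simp add: abs_mult)
 have m: "m <= (LBINT y. abs (py y) * kp y)"
  using integral_abs_bound[of lborel "%y. py y * kp y"] kp by (simp add: m_def abs_mult)
 have "m powr p <= m powr p * (LBINT y. kp y) + p * m powr (p-1) * ((LBINT y. abs (py y) * kp y) - m * (LBINT y. kp y))"
  using m p kp by simp
 also have "... = (LBINT y. (m powr p + p * m powr (p-1) * (abs (py y) - m)) * kp y)"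
 proof -
  have "(%y. (m powr p + p * m powr (p-1) * (abs (py y) - m)) * kp y)
   = (%y. m powr p * kp y + p * m powr (p-1) * (abs (py y) * kp y - m * kp y))" by (auto simp: fun_eq_iff algebra_simps)
  then show ?thesis using kp(2) ia by simp
 qed
 also have "... <= (LBINT y. abs (py y) powr p * kp y)"
 proof (rule integral_mono[OF _ int])
  have "(%y. (m powr p + p * m powr (p-1) * (abs (py y) - m)) * kp y)
   = (%y. m powr p * kp y + p * m powr (p-1) * (abs (py y) * kp y - m * kp y))" by (auto simp: fun_eq_iff algebra_simps)
  then show "integ (%y. (m powr p + p * m powr (p-1) * (abs (py y) - m)) * kp y)" using kp(2) ia by simp
  show "(m powr p + p * m powr (p-1) * (abs (py y) - m)) * kp y <= abs (py y) powr p * kp y" for y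
   using powr_tangent[OF p m0, of "abs (py y)"] kp(1)[of y] by (intro mult_right_mono) auto
 qed
 finally have "ennreal (m powr p) <= ennreal (LBINT y. abs (py y) powr p * kp y)" by (rule ennreal_leI)
 also have "... = (\<integral>\<^sup>+y. ennreal (abs (py y) powr p * kp y) \<partial>lborel)"
  using kp by (intro nn_integral_eq_integral[symmetric] int) auto
 finally show ?thesis by (simp add: m_def)
qed (simp add: less_top[symmetric])

lemma integrable_lborel_shift:
 fixes f :: "'a::euclidean_space => real"
 assumes "integ f"
 shows "integ (%x. f (x + z))"
proof -
 have "integrable (distr lborel borel ((+) z)) f" unfolding lborel_distr_plus using assms .
 then have "integ (%x. f (z + x))" using assms by (subst (asm) integrable_distr_eq) auto
 then show ?thesis by (simp add: add.commute)
qed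

text \<open>The Frechet-Kolmogorov argument. Averages \<open>T j\<close> at scale \<open>h j\<close>
  are locally bounded and Lipschitz uniformly in \<open>n\<close>, so one diagonal subsequence makes
  all of them converge pointwise; the error of averaging is at most \<open>C * h j powr p\<close>
  uniformly in \<open>n\<close>.\<close>

lemma Rellich:
 fixes f :: "nat => 'a::euclidean_space => real"
 assumes p: "p > 1" and f [measurable]: "!!n. f n : bmeas"
  and int: "!!n. integ (%x. abs (f n x) powr p)"
  and bd: "!!R. EX C>=0. ALL n. (LBINT x. ib R x * abs (f n x) powr p) <= C &
   (ALL z. norm z <= 1 --> (\<integral>\<^sup>+x. ib R x * ennreal (abs (f n (x + z) - f n x) powr p) \<partial>lborel) <= ennreal (C * norm z powr p))"
 obtains r where "strict_mono (r :: nat => nat)"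
  "!!R e. e > 0 ==> EX N. ALL m>=N. ALL n>=N. (LBINT x. ib R x * abs (f (r m) x - f (r n) x) powr p) <= e"
proof -
 have loc_le: "abs (f n x) <= 1 + abs (f n x) powr p" for n x
 proof (cases "abs (f n x) <= 1")
  case False
  then have "abs (f n x) powr 1 <= abs (f n x) powr p" using p by (intro powr_mono) auto
  then show ?thesis using False by simp
 qed (simp add: add_increasing2)
 have iB: "integ (%x. ib R x * abs (f n x) powr p)" for R n
  using integrable_real_mult_indicator[OF _ int, of "cball 0 R" n] by (simp add: mult.commute)
 have iC: "integ (%x. ib R x + ib R x * abs (f n x) powr p)" for R n
  by (intro Bochner_Integration.integrable_add iB integrable_ind_cball)
 have i1: "integ (%x. ib R x * abs (f n x))" for R n
  by (rule integrable_le[OF iC[of R n]])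
   (use loc_le[of n] in \<open>auto simp: indicator_def\<close>)
 have "EX C>=0. ALL n. (LBINT x. ib R x * abs (f n x)) <= C" for R
 proof -
  obtain C where C: "C >= 0" "!!n. (LBINT x. ib R x * abs (f n x) powr p) <= C" using bd[of R] by blast
  have "(LBINT x. ib R x * abs (f n x)) <= measure lborel (cball 0 R :: 'a set) + C" for n
  proof -
   have "(LBINT x. ib R x * abs (f n x)) <= (LBINT x. ib R x + ib R x * abs (f n x) powr p)"
   by (rule integral_mono[OF i1 iC]) (use loc_le[of n] in \<open>auto simp: indicator_def\<close>)
   also have "... = (LBINT x. indicat_real (cball 0 R :: 'a set) x) + (LBINT x. ib R x * abs (f n x) powr p)"
   by (rule Bochner_Integration.integral_add[OF integrable_ind_cball iB])
   finally show ?thesis using C(2)[of n] by simp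
  qed
  then show ?thesis using C(1) by (intro exI[of _ "measure lborel (cball 0 R :: 'a set) + C"]) auto
 qed
 then obtain C1 where C1: "!!R. C1 R >= 0" "!!R n. (LBINT x. ib R x * abs (f n x)) <= C1 R" by metis
 define h where "h j = 1 / (real j + 1)" for j :: nat
 have h: "h j > 0" "h j <= 1" for j by (auto simp: h_def)
 \<comment> \<open>A tent function: the Lipschitz bound of the kernel is what passes to the
   averages.\<close>
 define kp0 where "kp0 j y = max 0 (h j - norm y)" for j and y :: 'a
 have kp0m [measurable]: "kp0 j : bmeas" for j unfolding kp0_def by measurable
 have kp0b: "0 <= kp0 j y" "kp0 j y <= indicator (cball 0 1) y" for j y using h[of j] norm_ge_zero[of y] by (auto simp: kp0_def indicator_def max_def simp del: norm_ge_zero)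
 have kp0i: "integ (kp0 j)" for j
  by (rule integrable_le[OF integrable_ind_cball[of 0 1]]) (use kp0b[of j] in auto)
 define c where "c j = (LBINT y. kp0 j y)" for j
 have c: "c j > 0" for j
 proof -
  have "0 < h j / 2 * measure lborel (cball 0 (h j / 2) :: 'a set)" using h[of j] content_cball_pos[of "h j / 2" "0::'a"] by simp
  also have "... = (LBINT y. h j / 2 * indicator (cball 0 (h j/2) :: 'a set) y)" by simp
  also have "... <= c j" unfolding c_def
   by (rule integral_mono[OF integrable_mult_right[OF integrable_ind_cball] kp0i]) (auto simp: kp0_def indicator_def max_def)
  finally show ?thesis .
 qed
 define kp where "kp j y = kp0 j y / c j" for j y
 have kpm [measurable]: "kp j : bmeas" for j unfolding kp_def by measurable
 have kp: "kp j y >= 0" "integ (kp j)" "(LBINT y. kp j y) = 1" for j y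
  using kp0b[of j y] c[of j] kp0i[of j] by (auto simp: kp_def[abs_def] c_def[symmetric])
 have kple: "kp j y <= indicator (cball 0 1) y / c j" for j y using kp0b[of j y] c[of j] by (auto simp: kp_def intro: divide_right_mono)
 have kplip: "abs (kp j y - kp j y') <= norm (y - y') / c j" for j y y'
 proof -
  have "abs (kp0 j y - kp0 j y') <= norm (y - y')" using norm_triangle_ineq3[of y y'] by (auto simp: kp0_def)
  then show ?thesis using c[of j] by (simp add: kp_def divide_right_mono flip: diff_divide_distrib)
 qed
 have kpsupp: "kp j y = 0" if "norm y > 1" for j y using that h[of j] by (simp add: kp_def kp0_def)
 have kpsupp': "kp j y = 0" if "norm y > h j" for j y using that by (simp add: kp_def kp0_def)
 define T where "T j n x = (LBINT y. f n y * kp j (y - x))" for j n x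
 have Tm [measurable]: "T j n : bmeas" for j n
  unfolding T_def by measurable
 have Tint: "integ (%y. f n y * kp j (y - x))" for j n x
 proof (rule integrable_le)
  show "integ (%y. (1 / c j) * (ib (norm x + 1) y * abs (f n y)))" by (intro integrable_mult_right i1)
  have "norm (f n y * kp j (y - x)) <= norm ((1 / c j) * (ib (norm x + 1) y * abs (f n y)))" for y
  proof (cases "norm (y - x) <= 1")
   case True
   then have "norm y <= norm x + 1" using norm_triangle_ineq2[of y x] by simp
   moreover have "kp j (y - x) <= 1 / c j" using kple[of j "y - x"] True by simp
   ultimately show ?thesis using kp(1)[of j "y-x"] c[of j] mult_left_mono[of "kp j (y - x)" "1 / c j" "abs (f n y)"] by (simp add: abs_mult)
  qed (simp add: kpsupp)
  then show "AEL y. norm (f n y * kp j (y - x)) <= norm ((1 / c j) * (ib (norm x + 1) y * abs (f n y)))" by simp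
 qed measurable
 have Tbd: "abs (T j n x) <= C1 (R + 1) / c j" if "norm x <= R" for j n x R
 proof -
  have "abs (T j n x) <= (LBINT y. abs (f n y * kp j (y - x)))" unfolding T_def by (rule integral_abs_bound)
  also have "... <= (LBINT y. (1 / c j) * (ib (R + 1) y * abs (f n y)))"
  proof (rule integral_mono)
   show "integ (%y. (1 / c j) * (ib (R + 1) y * abs (f n y)))" by (intro integrable_mult_right i1)
   fix y show "abs (f n y * kp j (y - x)) <= (1 / c j) * (ib (R + 1) y * abs (f n y))"
   proof (cases "norm (y - x) <= 1")
   case True
   then have "norm y <= R + 1" using norm_triangle_ineq2[of y x] that by simp
   moreover have "kp j (y - x) <= 1 / c j" using kple[of j "y - x"] True by simp
   ultimately show ?thesis using kp(1)[of j "y-x"] c[of j] mult_left_mono[of "kp j (y - x)" "1 / c j" "abs (f n y)"] by (simp add: abs_mult)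
   qed (use c[of j] in \<open>simp add: kpsupp\<close>)
  qed (use Tint in auto)
  also have "... <= (1 / c j) * C1 (R + 1)" using C1(2)[where R="R+1" and n=n] c[of j] by (simp add: divide_right_mono)
  finally show ?thesis by simp
 qed
 have Tlip: "abs (T j n x - T j n x') <= norm (x - x') / c j * C1 (R + 1)" if "norm x <= R" "norm x' <= R" for j n x x' R
 proof -
  have "T j n x - T j n x' = (LBINT y. f n y * kp j (y - x) - f n y * kp j (y - x'))"
   unfolding T_def by (intro Bochner_Integration.integral_diff[symmetric] Tint)
  also have "\<bar>...\<bar> <= (LBINT y. \<bar>f n y * kp j (y - x) - f n y * kp j (y - x')\<bar>)" by (rule integral_abs_bound)
  also have "... <= (LBINT y. (norm (x - x') / c j) * (ib (R + 1) y * abs (f n y)))"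
  proof (rule integral_mono)
   show "integ (%y. (norm (x - x') / c j) * (ib (R + 1) y * abs (f n y)))" by (intro integrable_mult_right i1)
   show "integ (%y. abs (f n y * kp j (y - x) - f n y * kp j (y - x')))"
   by (intro integrable_abs Bochner_Integration.integrable_diff Tint)
   fix y show "abs (f n y * kp j (y - x) - f n y * kp j (y - x')) <= (norm (x - x') / c j) * (ib (R + 1) y * abs (f n y))"
   proof (cases "norm y <= R + 1")
   case True
   have "abs (f n y * kp j (y - x) - f n y * kp j (y - x')) = abs (f n y) * abs (kp j (y - x) - kp j (y - x'))"
   by (simp add: abs_mult flip: right_diff_distrib)
   also have "... <= abs (f n y) * (norm (x - x') / c j)"
   using kplip[of j "y - x" "y - x'"] by (intro mult_left_mono) (auto simp: norm_minus_commute)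
   finally show ?thesis using True by (simp add: mult.commute)
   next
   case False
   have "norm (y - x) > 1" "norm (y - x') > 1" using False that norm_triangle_ineq2[of y x] norm_triangle_ineq2[of y x'] by linarith+
   then show ?thesis using False c[of j] by (simp add: kpsupp)
   qed
  qed
  also have "... <= (norm (x - x') / c j) * C1 (R + 1)"
   using C1(2)[where R="R+1" and n=n] c[of j] by (simp add: mult_left_mono divide_right_mono)
  finally show ?thesis .
 qed
 obtain Q :: "'a set" where Q: "countable Q" "!!X. open X ==> X ~= {} ==> \<exists>d\<in>Q. d : X"
  using countable_dense_setE by blast
 \<comment> \<open>Dividing by this bound puts the values at all pairs \<open>(q, j)\<close> into
   the unit interval around 0, so that a single extraction over a countable index set serves every
   scale \<open>j\<close>.\<close>
 define Bd where "Bd q j = C1 (norm q + 1) / c j + 1" for q :: 'a and j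
 have Bd: "Bd q j > 0" for q j using C1(1) c[of j] by (simp add: Bd_def add_nonneg_pos)
 obtain k where k: "strict_mono k" "!!q j. q : Q ==> EX l. (%n. T j (k n) q / Bd q j) ----> l"
 proof -
  have cnt: "countable (Q \<times> (UNIV :: nat set))" using Q by simp
  have "norm ((%n z. T (snd z) n (fst z) / Bd (fst z) (snd z)) n z) <= 1" for n z
   using Tbd[of "fst z" "norm (fst z)" "snd z" n] Bd[of "fst z" "snd z"] by (simp add: Bd_def abs_of_pos)
  then obtain k where "strict_mono k" "!!z. z : Q \<times> UNIV ==> EX l. (%n. T (snd z) (k n) (fst z) / Bd (fst z) (snd z)) ----> l"
   using function_convergent_subsequence[OF cnt, of "%n z. T (snd z) n (fst z) / Bd (fst z) (snd z)" 1] by blast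
  then show ?thesis using that[of k] by fastforce
 qed
 have Tconv: "convergent (%n. T j (k n) x)" for j x
 proof -
  have "Cauchy (%n. T j (k n) x)"
  proof (rule metric_CauchyI)
   fix e :: real assume e: "e > 0"
   define L where "L = C1 (norm x + 1 + 1) / c j"
   have L: "L >= 0" using C1(1) c[of j] by (simp add: L_def)
   define dl where "dl = min 1 (e / (3 * (L + 1)))"
   have dl: "dl > 0" "dl <= 1" "dl * L <= e / 3"
   proof -
   have "dl * L <= e / (3 * (L + 1)) * (L + 1)" using L e by (intro mult_mono) (auto simp: dl_def)
   also have "... = e / 3"
   proof -
   have "e / (3 * m) * m = e / 3" if "m > 0" for m :: real using that by simp
   then show ?thesis using L by (metis add_nonneg_pos zero_less_one)
   qed
   finally show "dl * L <= e / 3" by simp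
   qed (use e L in \<open>auto simp: dl_def\<close>)
   obtain q where q: "q : Q" "dist x q < dl" using Q(2)[of "ball x dl"] dl by auto
   have nq: "norm q <= norm x + 1" using q(2) dl(2) norm_triangle_ineq2[of q x] by (simp add: dist_norm norm_minus_commute)
   have Txq: "abs (T j n x - T j n q) <= e / 3" for n
   proof -
   have "abs (T j n x - T j n q) <= norm (x - q) * L" using Tlip[of x "norm x + 1" q j n] nq by (simp add: L_def)
   also have "... <= dl * L" using q L by (intro mult_right_mono) (auto simp: dist_norm)
   finally show ?thesis using dl by simp
   qed
   obtain l where "(%n. T j (k n) q / Bd q j) ----> l" using k(2)[OF q(1)] by blast
   from tendsto_mult_right[OF this, of "Bd q j"] have "(%n. T j (k n) q) ----> l * Bd q j" using Bd[of q j] by simp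
   then have "Cauchy (%n. T j (k n) q)" by (rule LIMSEQ_imp_Cauchy)
   then obtain M where M: "!!m n. m >= M ==> n >= M ==> dist (T j (k m) q) (T j (k n) q) < e / 3"
   using metric_CauchyD[of "%n. T j (k n) q" "e/3"] e by auto
   show "EX M. ALL m>=M. ALL n>=M. dist (T j (k m) x) (T j (k n) x) < e"
   proof (intro exI[of _ M] allI impI)
   fix m n assume "M <= m" "M <= n"
   then show "dist (T j (k m) x) (T j (k n) x) < e"
   using M[of m n] Txq[of "k m"] Txq[of "k n"] unfolding dist_real_def by linarith
   qed
  qed
  then show ?thesis by (simp add: Cauchy_convergent_iff)
 qed
 define S where "S j x = lim (%n. T j (k n) x)" for j x
 have S: "(%n. T j (k n) x) ----> S j x" for j x using Tconv by (simp add: S_def convergent_LIMSEQ_iff)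
 have Sm [measurable]: "S j : bmeas" for j unfolding S_def by (intro borel_measurable_lim_metric) simp
 have Sbd: "abs (S j x) <= C1 (R + 1) / c j" if "norm x <= R" for j x R
  using tendsto_rabs[OF S[of j x]] Tbd[OF that] by (intro LIMSEQ_le_const2) auto
 have TSb: "norm (ib R x * abs (T j (k n) x - S j x) powr p) <= ib R x * (2 * (C1 (R+1) / c j)) powr p" for R j n x
  using Tbd[of x R j "k n"] Sbd[of x R j] p by (cases "norm x <= R") (auto intro!: powr_mono2)
 have TSi: "integ (%x. ib R x * abs (T j (k n) x - S j x) powr p)" for R j n
 proof (rule integrable_le)
  show "integ (%x::'a. ib R x * (2 * (C1 (R+1) / c j)) powr p)"
   by (intro integrable_mult_left integrable_ind_cball)
  show "AEL x. norm (ib R x * abs (T j (k n) x - S j x) powr p) <= norm (ib R x * (2 * (C1 (R+1) / c j)) powr p)"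
   using TSb[of R _ j n] by (intro AE_I2) (simp add: abs_mult)
 qed measurable
 have TS: "(%n. LBINT x. ib R x * abs (T j (k n) x - S j x) powr p) ----> 0" for R j
 proof -
  have "(%n. LBINT x. ib R x * abs (T j (k n) x - S j x) powr p) ----> (\<integral>x. (0::real) \<partial>(lborel :: 'a measure))"
  proof (rule integral_dominated_convergence[where w = "%x. ib R x * (2 * (C1 (R+1) / c j)) powr p"])
   have "(%n. ib R x * abs (T j (k n) x - S j x) powr p) ----> 0" for x
   proof -
   have "(%n. T j (k n) x - S j x) ----> 0" using S[of j x] by (simp add: LIM_zero)
   from tendsto_mult[OF tendsto_const tendsto_norm_powr[OF this, of p]] show ?thesis using p by fastforce
   qed
   then show "AEL x. (%n. ib R x * abs (T j (k n) x - S j x) powr p) ----> 0" by simp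
   show "integ (%x::'a. ib R x * (2 * (C1 (R+1) / c j)) powr p)"
   by (intro integrable_mult_left integrable_ind_cball)
  qed (use TSb in auto)
  then show ?thesis by simp
 qed
 \<comment> \<open>Jensen's inequality for the kernel and Fubini reduce the error to translations by
   vectors of norm at most \<open>h j\<close>, where the modulus hypothesis applies because
   \<open>h j <= 1\<close>.\<close>
 have err: "integ (%x. ib R x * abs (T j n x - f n x) powr p) &
   (LBINT x. ib R x * abs (T j n x - f n x) powr p) <= C * h j powr p"
  if C: "C >= 0" "!!z. norm z <= 1 ==> (\<integral>\<^sup>+x. ib R x * ennreal (abs (f n (x + z) - f n x) powr p) \<partial>lborel) <= ennreal (C * norm z powr p)" for C R j n
 proof -
  have J: "ennreal (abs (T j n x - f n x) powr p) <= (\<integral>\<^sup>+z. ennreal (abs (f n (z + x) - f n x) powr p * kp j z) \<partial>lborel)" for x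
  proof -
   have Tx: "T j n x = (LBINT z. f n (z + x) * kp j z)"
   unfolding T_def using integral_lborel_shift[of "%y. f n y * kp j (y - x)" x] by simp
   have i: "integ (%z. f n (z + x) * kp j z)"
   using integrable_lborel_shift[OF Tint[of n j x], of x] by simp
   have i2: "integ (%z. f n x * kp j z)" using kp by simp
   have eq: "T j n x - f n x = (LBINT z. (f n (z + x) - f n x) * kp j z)"
   unfolding Tx using Bochner_Integration.integral_diff[OF i i2] kp(3)[of j] by (simp add: left_diff_distrib)
   have i3: "integ (%z. (f n (z + x) - f n x) * kp j z)"
   using Bochner_Integration.integrable_diff[OF i i2] by (simp add: left_diff_distrib)
   show ?thesis unfolding eq by (rule jensen_kernel[OF p _ _ kp i3]) measurable
  qed
  let ?X = "\<integral>\<^sup>+x. ennreal (ib R x * abs (T j n x - f n x) powr p) \<partial>lborel"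
  let ?q = "%x z. ib R x * ennreal (abs (f n (z + x) - f n x) powr p * kp j z)"
  have qm: "(%w. ?q (fst w) (snd w)) : borel_measurable (lborel \<Otimes>\<^sub>M lborel)" by measurable
  have "?X <= (\<integral>\<^sup>+x. (\<integral>\<^sup>+z. ?q x z \<partial>lborel) \<partial>lborel)"
  proof (rule nn_integral_mono)
   fix x :: 'a
   show "ennreal (ib R x * abs (T j n x - f n x) powr p) <= (\<integral>\<^sup>+z. ?q x z \<partial>lborel)"
   using J[of x] by (cases "norm x <= R") auto
  qed
  also have "... = (\<integral>\<^sup>+z. (\<integral>\<^sup>+x. ?q x z \<partial>lborel) \<partial>lborel)"
   by (rule lborel_pair.Fubini'[symmetric]) (use qm in \<open>simp add: split_beta'\<close>)
  also have "... <= (\<integral>\<^sup>+z. ennreal (C * h j powr p) * ennreal (kp j z) \<partial>lborel)"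
  proof (rule nn_integral_mono)
   fix z :: 'a
   show "(\<integral>\<^sup>+x. ?q x z \<partial>lborel) <= ennreal (C * h j powr p) * ennreal (kp j z)"
   proof (cases "norm z <= h j")
   case True
   have "(\<integral>\<^sup>+x. ?q x z \<partial>lborel) = (\<integral>\<^sup>+x. ib R x * ennreal (abs (f n (x + z) - f n x) powr p) * ennreal (kp j z) \<partial>lborel)"
   by (intro nn_integral_cong) (simp add: ennreal_mult'' kp(1) add.commute mult.assoc)
   also have "... = (\<integral>\<^sup>+x. ib R x * ennreal (abs (f n (x + z) - f n x) powr p) \<partial>lborel) * ennreal (kp j z)"
   by (rule nn_integral_multc) measurable
   also have "... <= ennreal (C * norm z powr p) * ennreal (kp j z)"
   using C(2)[of z] True h[of j] by (intro mult_right_mono) auto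
   also have "... <= ennreal (C * h j powr p) * ennreal (kp j z)"
   using True C p by (intro mult_right_mono ennreal_leI mult_left_mono powr_mono2) auto
   finally show ?thesis .
   qed (simp add: kpsupp')
  qed
  also have "... = ennreal (C * h j powr p) * (\<integral>\<^sup>+z. ennreal (kp j z) \<partial>lborel)" by (rule nn_integral_cmult) measurable
  also have "(\<integral>\<^sup>+z. ennreal (kp j z) \<partial>lborel) = 1" using nn_integral_eq_integral[OF kp(2)[of j]] kp(1,3) by simp
  finally have X: "?X <= ennreal (C * h j powr p)" by simp
  have i: "integ (%x. ib R x * abs (T j n x - f n x) powr p)"
   by (rule integrableI_nonneg) (use X in \<open>auto simp: le_less_trans\<close>)
  have "ennreal (LBINT x. ib R x * abs (T j n x - f n x) powr p) <= ennreal (C * h j powr p)"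
   using X nn_integral_eq_integral[OF i] by simp
  then show ?thesis using i C(1) by simp
 qed
 show ?thesis
 proof (rule that[OF k(1)])
  fix R e :: real assume e: "e > 0"
  obtain C where C: "C >= 0" "!!n z. norm z <= 1 ==> (\<integral>\<^sup>+x. ib R x * ennreal (abs (f n (x + z) - f n x) powr p) \<partial>lborel) <= ennreal (C * norm z powr p)"
   using bd[of R] by blast
  have "(%j. 4 powr p * (2 * (C * h j powr p))) ----> 4 powr p * (2 * (C * 0 powr p))"
  proof -
   have "h ----> 0" unfolding h_def using LIMSEQ_inverse_real_of_nat by (simp add: inverse_eq_divide add.commute)
   then show ?thesis using p h(1) by (intro tendsto_mult tendsto_const tendsto_nonneg_powr) (auto simp: less_imp_le)
  qed
  then have "\<forall>\<^sub>F j in sequentially. 4 powr p * (2 * (C * h j powr p)) < e / 2"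
   by (rule order_tendstoD(2)) (use e p in simp)
  then obtain j where j: "4 powr p * (2 * (C * h j powr p)) < e / 2" by (auto simp: eventually_sequentially)
  let ?t = "%n. LBINT x. ib R x * abs (T j (k n) x - S j x) powr p"
  have "(%n. 4 powr p * ?t n) ----> 4 powr p * 0" by (intro tendsto_mult tendsto_const TS)
  then have "\<forall>\<^sub>F n in sequentially. 4 powr p * ?t n < e / 4" by (rule order_tendstoD(2)) (use e in simp)
  then obtain N where N: "!!n. n >= N ==> 4 powr p * ?t n < e / 4" by (auto simp: eventually_sequentially)
  let ?E = "%n. LBINT x. ib R x * abs (T j (k n) x - f (k n) x) powr p"
  have E: "integ (%x. ib R x * abs (T j (k n) x - f (k n) x) powr p)" "?E n <= C * h j powr p" for n
   using err[OF C(1), of R "k n" j] C(2) by auto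
  show "EX N. ALL m>=N. ALL n>=N. (LBINT x. ib R x * abs (f (k m) x - f (k n) x) powr p) <= e"
  proof (intro exI[of _ N] allI impI)
   fix m n assume mn: "N <= m" "N <= n"
   let ?rhs = "%x. 4 powr p * ((ib R x * abs (T j (k m) x - f (k m) x) powr p + ib R x * abs (T j (k n) x - f (k n) x) powr p)
   + (ib R x * abs (T j (k m) x - S j x) powr p + ib R x * abs (T j (k n) x - S j x) powr p))"
   have ri: "integ ?rhs" using E TSi by (intro integrable_mult_right Bochner_Integration.integrable_add) auto
   have le: "ib R x * abs (f (k m) x - f (k n) x) powr p <= ?rhs x" for x
   proof -
   let ?a = "T j (k m) x - f (k m) x" and ?b = "T j (k n) x - f (k n) x" and ?c = "T j (k m) x - S j x" and ?d = "T j (k n) x - S j x"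
   have "abs (f (k m) x - f (k n) x) = norm ((?b - ?a) + (?c - ?d))" by simp
   then have "abs (f (k m) x - f (k n) x) powr p <= 2 powr p * (norm (?b - ?a) powr p + norm (?c - ?d) powr p)"
   using norm_add_powr_le[of p "?b - ?a" "?c - ?d"] p by simp
   also have "... <= 2 powr p * (2 powr p * (norm ?b powr p + norm ?a powr p) + 2 powr p * (norm ?c powr p + norm ?d powr p))"
   using p by (intro mult_left_mono add_mono norm_diff_powr_le) auto
   also have "... = (2 powr p * 2 powr p) * ((abs ?a powr p + abs ?b powr p) + (abs ?c powr p + abs ?d powr p))" by (simp add: algebra_simps)
   also have "2 powr p * 2 powr p = (4::real) powr p" using powr_mult[of 2 2 p] by simp
   finally show ?thesis by (auto simp: indicator_def)
   qed
   have "(LBINT x. ib R x * abs (f (k m) x - f (k n) x) powr p) <= (LBINT x. ?rhs x)"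
   proof (rule integral_mono[OF _ ri le])
   show "integ (%x. ib R x * abs (f (k m) x - f (k n) x) powr p)"
   by (rule integrable_le[OF ri]) (use le in \<open>auto intro!: order_trans[OF le]\<close>)
   qed
   also have "... = 4 powr p * ((?E m + ?E n) + (?t m + ?t n))"
   using E TSi by simp
   also have "... <= 4 powr p * ((C * h j powr p + C * h j powr p) + (?t m + ?t n))"
   using E(2)[of m] E(2)[of n] by (intro mult_left_mono add_mono) auto
   also have "... = 4 powr p * (2 * (C * h j powr p)) + 4 powr p * ?t m + 4 powr p * ?t n" by (simp add: algebra_simps)
   also have "... <= e" using j N[OF mn(1)] N[OF mn(2)] by simp
   finally show "(LBINT x. ib R x * abs (f (k m) x - f (k n) x) powr p) <= e" .
  qed
 qed
qed

section \<open>Weak formulation, supersolutions and admissible test functions\<close>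

text \<open>The spectral parameter is absorbed into the potential, so that the equation is
  homogeneous with a single bounded coefficient.\<close>

definition weakf :: "real => ('a::euclidean_space => real) => ('a => real) => ('a => 'a) => ('a => real) => ('a => 'a) => real" where
 "weakf p W u g zt dzt = (LBINT x. pflux p (g x) \<bullet> dzt x + W x * u x powr (p - 1) * zt x)"

text \<open>The bound holds at every point; an essentially bounded potential is changed on a null
  set beforehand.\<close>

definition bddpot :: "real => ('a::euclidean_space => real) => bool" where
 "bddpot c W \<longleftrightarrow> W : bmeas & (ALL x. abs (W x) <= c)"

text \<open>Nonnegative functions with global p-integrability; a function that is only locally in
  the Sobolev space enters after multiplication by a cutoff.\<close>

definition Wp :: "real => ('a::euclidean_space => real) => ('a => 'a) => bool" where
 "Wp p u g \<longleftrightarrow> (EX ph G D. approx p ph G D u g)"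

definition super :: "real => ('a::euclidean_space => real) => real => ('a => real) => ('a => 'a) => bool" where
 "super p W R u g \<longleftrightarrow> (ALL zt dzt. C1 zt dzt --> supp_in zt R --> (ALL x. zt x >= 0) --> weakf p W u g zt dzt >= 0)"

definition sol :: "real => ('a::euclidean_space => real) => real => ('a => real) => ('a => 'a) => bool" where
 "sol p W R u g \<longleftrightarrow> (ALL zt dzt. C1 zt dzt --> supp_in zt R --> weakf p W u g zt dzt = 0)"

lemma sol_super: "sol p W R u g ==> super p W R u g" by (simp add: sol_def super_def)

lemma super_mono: "super p W R u g ==> r <= R ==> super p W r u g"
 unfolding super_def supp_in_def by (meson order_le_less_trans)

lemma sol_mono: "sol p W R u g ==> r <= R ==> sol p W r u g"
 unfolding sol_def supp_in_def by (meson order_le_less_trans)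

lemma WpD:
 assumes "Wp p u g" "p > 1"
 shows "u : bmeas" "g : bmeas" "u x >= 0"
  "integ (%x. u x powr p)" "integ (%x. norm (g x) powr p)"
proof -
 obtain ph G D where A: "approx p ph G D u g" using assms by (auto simp: Wp_def)
 show "u : bmeas" "g : bmeas" "u x >= 0" using approxD[OF A] by auto
 show "integ (%x. u x powr p)" "integ (%x. norm (g x) powr p)"
  using approx_integrable[OF A] assms(2) by auto
qed

lemma bddpotD: assumes "bddpot c W" shows "W : bmeas" "abs (W x) <= c" "c >= 0"
 using assms order_trans[OF abs_ge_zero] unfolding bddpot_def by blast+

lemma weakf_integrand_le:
 fixes v w :: "'a::real_inner" and a b k p :: real
 assumes "p > 1" "abs k <= c" "a >= 0"
 shows "abs (pflux p v \<bullet> w + k * a powr (p - 1) * b) <= (norm v powr p + norm w powr p) + c * (a powr p + abs b powr p)"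
proof -
 have "abs (pflux p v \<bullet> w) <= norm v powr p + norm w powr p"
  using pflux_inner_le[of p v w] Young_powr_crude[OF assms(1), of "norm v" "norm w"] by simp
 moreover have "abs (k * a powr (p - 1) * b) <= c * (a powr p + abs b powr p)"
 proof -
  have "abs (k * a powr (p - 1) * b) = abs k * (a powr (p-1) * abs b)" by (simp add: abs_mult mult.assoc)
  also have "... <= c * (a powr p + abs b powr p)"
   using assms Young_powr_crude[OF assms(1,3), of "abs b"] by (intro mult_mono) auto
  finally show ?thesis .
 qed
 ultimately show ?thesis by linarith
qed

lemma weakf_integrable:
 assumes p: "p > 1" and W: "bddpot c W" and U: "Wp p u g"
  and [measurable]: "zt : bmeas" "dzt : bmeas"
  and i: "integ (%x. abs (zt x) powr p)" "integ (%x. norm (dzt x) powr p)"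
 shows "integ (%x. pflux p (g x) \<bullet> dzt x + W x * u x powr (p - 1) * zt x)"
proof (rule integrable_le)
 note [measurable] = WpD(1,2)[OF U p] bddpotD(1)[OF W]
 show "integ (%x. (norm (g x) powr p + norm (dzt x) powr p) + c * (u x powr p + abs (zt x) powr p))"
  using i WpD(4,5)[OF U p] by auto
 show "AEL x. norm (pflux p (g x) \<bullet> dzt x + W x * u x powr (p - 1) * zt x)
  <= norm ((norm (g x) powr p + norm (dzt x) powr p) + c * (u x powr p + abs (zt x) powr p))"
 proof (intro AE_I2)
  fix x
  show "norm (pflux p (g x) \<bullet> dzt x + W x * u x powr (p - 1) * zt x)
  <= norm ((norm (g x) powr p + norm (dzt x) powr p) + c * (u x powr p + abs (zt x) powr p))"
   unfolding real_norm_def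
   by (rule order_trans[OF weakf_integrand_le[OF p bddpotD(2)[OF W] WpD(3)[OF U p]] abs_ge_self])
 qed
 show "(%x. pflux p (g x) \<bullet> dzt x + W x * u x powr (p - 1) * zt x) : borel_measurable lborel" by measurable
qed

lemma weakf_tendsto:
 assumes p: "p > 1" and W: "bddpot c W" and U: "Wp p u g"
  and [measurable]: "!!k. zt k : bmeas" "!!k. dzt k : bmeas"
   "z : bmeas" "dz : bmeas"
  and conv: "AEL x. (%k. zt k x) ----> z x & (%k. dzt k x) ----> dz x"
  and E: "integrable lborel E" "!!k. AEL x. abs (zt k x) powr p <= E x & norm (dzt k x) powr p <= E x"
 shows "(%k. weakf p W u g (zt k) (dzt k)) ----> weakf p W u g z dz"
proof -
 note [measurable] = WpD(1,2)[OF U p] bddpotD(1)[OF W]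
 show ?thesis unfolding weakf_def
proof (rule integral_dominated_convergence)
 show "integ (%x. (norm (g x) powr p + E x) + c * (u x powr p + E x))"
  using E(1) WpD(4,5)[OF U p] by auto
 show "AEL x. norm (pflux p (g x) \<bullet> dzt k x + W x * u x powr (p - 1) * zt k x) <= (norm (g x) powr p + E x) + c * (u x powr p + E x)" for k
  using E(2)[of k]
 proof eventually_elim
  case (elim x)
  have "norm (pflux p (g x) \<bullet> dzt k x + W x * u x powr (p - 1) * zt k x) <= (norm (g x) powr p + norm (dzt k x) powr p) + c * (u x powr p + abs (zt k x) powr p)"
   using weakf_integrand_le[OF p bddpotD(2)[OF W] WpD(3)[OF U p]] by simp
  also have "... <= (norm (g x) powr p + E x) + c * (u x powr p + E x)"
   using elim bddpotD(3)[OF W] by (intro add_mono mult_left_mono) auto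
  finally show ?case .
 qed
 show "AEL x. (%k. pflux p (g x) \<bullet> dzt k x + W x * u x powr (p - 1) * zt k x) ----> pflux p (g x) \<bullet> dz x + W x * u x powr (p - 1) * z x"
  using conv by eventually_elim (auto intro!: tendsto_intros)
qed measurable
qed

lemma weakf_prod_tendsto:
 assumes p: "p > 1" and W: "bddpot c W" and U: "Wp p u g" and A: "approx p ph G D v gv"
  and F: "Lipfun F F'" and sg: "C1 sg dsg" and R: "supp_in sg R"
 shows "(%k. weakf p W u g (pval sg F (ph k)) (pgrad sg dsg F F' (ph k) (G k))) ----> weakf p W u g (pval sg F v) (pgrad sg dsg F F' v gv)"
  "integ (%x. pflux p (g x) \<bullet> pgrad sg dsg F F' v gv x + W x * u x powr (p - 1) * pval sg F v x)"
proof -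
 note P = approx_prod[OF A p F sg]
 obtain E where E: "integrable lborel E" "!!k. AEL x. norm x <= R --> (abs (pval sg F (ph k) x)) powr p <= E x & norm (pgrad sg dsg F F' (ph k) (G k) x) powr p <= E x"
  "AEL x. norm x <= R --> (abs (pval sg F v x)) powr p <= E x & norm (pgrad sg dsg F F' v gv x) powr p <= E x"
  using P(5)[of R] by blast
 have out: "sg x = 0" "dsg x = 0" if "\<not> norm x <= R" for x
  using that R supp_in_grad[OF sg R, of x] by (auto simp: supp_in_def)
 have E2: "AEL x. abs (pval sg F (ph k) x) powr p <= abs (E x) & norm (pgrad sg dsg F F' (ph k) (G k) x) powr p <= abs (E x)" for k
  using E(2)[of k]
 proof eventually_elim
  case (elim x) then show ?case using out[of x] by (cases "norm x <= R") auto
 qed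
 have E3: "AEL x. abs (pval sg F v x) powr p <= abs (E x) & norm (pgrad sg dsg F F' v gv x) powr p <= abs (E x)"
  using E(3)
 proof eventually_elim
  case (elim x) then show ?case using out[of x] by (cases "norm x <= R") auto
 qed
 show "(%k. weakf p W u g (pval sg F (ph k)) (pgrad sg dsg F F' (ph k) (G k))) ----> weakf p W u g (pval sg F v) (pgrad sg dsg F F' v gv)"
  by (rule weakf_tendsto[OF p W U _ _ _ _ P(4) integrable_abs[OF E(1)] E2]) (use P(2,3) C1_meas[OF P(1)] in auto)
 note [measurable] = P(2,3)
 have i: "integ (%x. abs (pval sg F v x) powr p)" "integ (%x. norm (pgrad sg dsg F F' v gv x) powr p)"
  by (rule integrable_le[OF integrable_abs[OF E(1)]]; use E3 in auto)+
 show "integ (%x. pflux p (g x) \<bullet> pgrad sg dsg F F' v gv x + W x * u x powr (p - 1) * pval sg F v x)"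
  by (rule weakf_integrable[OF p W U P(2,3) i])
qed

text \<open>Enlarges the class of test functions. The inequality holds for the C1 approximants
  \<open>sg * F(ph k)\<close>, and the weak form is continuous under dominated convergence of the
  test function and its gradient.\<close>

lemma super_test:
 assumes p: "p > 1" and W: "bddpot c W" and U: "Wp p u g" and S: "super p W R u g" and V: "Wp p v gv"
  and F: "Lipfun F F'" "!!t. t >= 0 ==> F t >= 0" and sg: "C1 sg dsg" "supp_in sg R" "!!x. sg x >= 0"
 shows "weakf p W u g (pval sg F v) (pgrad sg dsg F F' v gv) >= 0"
  "integ (%x. pflux p (g x) \<bullet> pgrad sg dsg F F' v gv x + W x * u x powr (p - 1) * pval sg F v x)"
proof -
 obtain ph G D where A: "approx p ph G D v gv" using V by (auto simp: Wp_def)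
 have "weakf p W u g (pval sg F (ph k)) (pgrad sg dsg F F' (ph k) (G k)) >= 0" for k
  using S approx_prod(1)[OF A p F(1) sg(1), of k] sg F(2) approxD(2)[OF A]
  unfolding super_def by (auto simp: supp_in_def)
 then show "weakf p W u g (pval sg F v) (pgrad sg dsg F F' v gv) >= 0"
  using weakf_prod_tendsto(1)[OF p W U A F(1) sg(1,2)] by (intro LIMSEQ_le_const) auto
 show "integ (%x. pflux p (g x) \<bullet> pgrad sg dsg F F' v gv x + W x * u x powr (p - 1) * pval sg F v x)"
  by (rule weakf_prod_tendsto(2)[OF p W U A F(1) sg(1,2)])
qed

lemma sol_test:
 assumes p: "p > 1" and W: "bddpot c W" and U: "Wp p u g" and S: "sol p W R u g" and V: "Wp p v gv"
  and F: "Lipfun F F'" and sg: "C1 sg dsg" "supp_in sg R"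
 shows "weakf p W u g (pval sg F v) (pgrad sg dsg F F' v gv) = 0"
  "integ (%x. pflux p (g x) \<bullet> pgrad sg dsg F F' v gv x + W x * u x powr (p - 1) * pval sg F v x)"
proof -
 obtain ph G D where A: "approx p ph G D v gv" using V by (auto simp: Wp_def)
 have "weakf p W u g (pval sg F (ph k)) (pgrad sg dsg F F' (ph k) (G k)) = 0" for k
  using S approx_prod(1)[OF A p F(1) sg(1), of k] sg
  unfolding sol_def by (auto simp: supp_in_def)
 then show "weakf p W u g (pval sg F v) (pgrad sg dsg F F' v gv) = 0"
  using weakf_prod_tendsto(1)[OF p W U A F(1) sg(1,2)] by (simp add: LIMSEQ_const_iff)
 show "integ (%x. pflux p (g x) \<bullet> pgrad sg dsg F F' v gv x + W x * u x powr (p - 1) * pval sg F v x)"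
  by (rule weakf_prod_tendsto(2)[OF p W U A F(1) sg(1,2)])
qed

section \<open>Logarithmic estimates for supersolutions\<close>

lemma integrable_ind_mult:
 fixes f :: "'a::euclidean_space => real"
 assumes "integ f"
 shows "integ (%x. ib R x * f x)"
 using integrable_real_mult_indicator[OF _ assms, of "cball 0 R"] by (simp add: mult.commute)

text \<open>Testing the inequality with \<open>sg (u + dl)\<^sup>1\<^sup>-\<^sup>p H(u)\<close>; the choice \<open>H = 1\<close> is the classical logarithmic estimate.\<close>

lemma log_estimate_weighted:
 assumes p: "p > 1" and c: "c >= 0" and r: "r >= 0"
 obtains C where "C >= 0"
 "!!W u g dl H H' K B. bddpot c (W :: 'a::euclidean_space => real) ==> Wp p u g ==> super p W (r + 1) u g ==> dl > 0 ==>
  Lipfun (%t. (t + dl) powr (1 - p) * H t) (%t. (t + dl) powr (- p) * (- (p - 1) * H t + (t + dl) * H' t)) ==>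
  (!!t. t >= 0 ==> H t >= 0) ==> (!!t. t >= 0 ==> (t + dl) powr (- p) * H t <= B) ==> K >= 0 ==>
  (!!t. t >= 0 ==> (t + dl) * H' t <= (p - 1) / 4 * H t + K) ==> (%x. H (u x)) : bmeas ==>
  integ (%x. ib r x * ((norm (g x) / (u x + dl)) powr p * H (u x))) &
  (LBINT x. ib r x * ((norm (g x) / (u x + dl)) powr p * H (u x)))
   <= C * ((LBINT x. ib (r + 1) x * H (u x)) + K * (LBINT x. ib (r + 1) x * (norm (g x) / (u x + dl)) powr p))"
proof -
 \<comment> \<open>Differentiating the power of \<open>u + dl\<close> yields the good term with
   factor \<open>p - 1\<close>. A quarter is spent on the cutoff gradient and a quarter on
   \<open>H'\<close>, which leaves the factor \<open>(p - 1) / 2\<close>.\<close>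
 have e4: "(p - 1) / 4 > 0" using p by simp
 obtain K0 where K0: "K0 >= 0" "!!a b. a >= 0 ==> b >= 0 ==> a powr (p - 1) * b <= (p - 1) / 4 * a powr p + K0 * b powr p"
  using Young_powr_eps[OF p e4] by blast
 define K1 where "K1 = K0 * (4 * p) powr p + c"
 have K1: "K1 >= 0" using K0 c by (simp add: K1_def)
 define C where "C = 2 / (p - 1) * (K1 + 1)"
 have C: "C >= 0" using K1 p by (simp add: C_def)
 have d1: "(0::real) < 1" by simp
 obtain ct :: "'a => real" and sg dsg where sg: "C1 sg dsg" "!!x. sg x = ct x powr p" "!!x. 0 <= ct x" "!!x. ct x <= 1"
  "!!x. norm x <= r ==> ct x = 1" "!!x. norm x > r + 1 ==> ct x = 0"
  "!!x. norm (dsg x) <= (4 * p / 1) * ct x powr (p - 1)"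
  by (rule cutoff_exists[OF p r d1, where 'a='a]) (rule that)
 have sgs: "supp_in sg (r + 1)" using sg(6) by (simp add: supp_in_def sg(2))
 have sg0: "sg x >= 0" "sg x <= ib (r + 1) x" for x
  using sg(3,4,6)[of x] p by (auto simp: sg(2) indicator_def powr_le1)
 show ?thesis
 proof (rule that[OF C], goal_cases)
  case (1 W u g dl H H' K B)
  note W = 1(1) and U = 1(2) and S = 1(3) and dl = 1(4) and F = 1(5) and H0 = 1(6) and HB = 1(7) and K = 1(8) and HK = 1(9)
  note [measurable] = 1(10) WpD(1,2)[OF U p] bddpotD(1)[OF W] C1_meas[OF sg(1)]
  have u0: "u x >= 0" for x using WpD(3)[OF U p] .
  let ?F = "%t. (t + dl) powr (1 - p) * H t" and ?F' = "%t. (t + dl) powr (- p) * (- (p - 1) * H t + (t + dl) * H' t)"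
  \<comment> \<open>\<open>y\<close> is the length of the gradient of
    \<open>ln (u + dl)\<close>.\<close>
  define y where "y x = norm (g x) / (u x + dl)" for x
  have y0: "y x >= 0" for x using u0[of x] dl by (simp add: y_def)
  have [measurable]: "y : bmeas" unfolding y_def by measurable
  have yp: "y x powr p = norm (g x) powr p * (u x + dl) powr (- p)" for x
   using u0[of x] dl by (simp add: y_def powr_divide powr_minus_divide)
  have yp1: "y x powr (p - 1) = norm (g x) powr (p - 1) * (u x + dl) powr (1 - p)" for x
   using powr_minus_divide[of "u x + dl" "p - 1"] u0[of x] dl by (simp add: y_def powr_divide)
  have B0: "B >= 0" using HB[of 0] H0[of 0] by (smt (verit) mult_nonneg_nonneg powr_ge_zero)
  have yHi: "integ (%x. y x powr p * H (u x))"
  proof (rule integrable_le[OF integrable_mult_right[OF WpD(5)[OF U p], of B]])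
   show "AEL x. norm (y x powr p * H (u x)) <= norm (B * norm (g x) powr p)"
   proof (intro AE_I2)
   fix x
   have "y x powr p * H (u x) = norm (g x) powr p * ((u x + dl) powr (- p) * H (u x))" by (simp add: yp)
   also have "... <= norm (g x) powr p * B" using HB[OF u0] by (intro mult_left_mono) auto
   finally show "norm (y x powr p * H (u x)) <= norm (B * norm (g x) powr p)" using H0[OF u0, of x] B0 by (simp add: mult.commute)
   qed
  qed measurable
  have ypi: "integ (%x. y x powr p)"
  proof (rule integrable_le[OF integrable_mult_right[OF WpD(5)[OF U p], of "dl powr (-p)"]])
   have "(u x + dl) powr (- p) <= dl powr (-p)" for x using u0[of x] dl p by (intro powr_mono2') auto
   then show "AEL x. norm (y x powr p) <= norm (dl powr (-p) * norm (g x) powr p)"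
   by (intro AE_I2) (simp add: yp mult.commute[of "dl powr (-p)"] mult_left_mono)
  qed measurable
  have Hle: "H t <= B * (2 powr p * (t powr p + dl powr p))" if "t >= 0" for t
  proof -
   have "H t = (t + dl) powr p * ((t + dl) powr (- p) * H t)" using that dl by (simp add: powr_minus)
   also have "... <= (t + dl) powr p * B" using HB[OF that] by (intro mult_left_mono) auto
   also have "... <= 2 powr p * (t powr p + dl powr p) * B" using that dl p B0 by (intro mult_right_mono powr_sum_le) auto
   finally show ?thesis by (simp add: mult.commute)
  qed
  have Hi: "integ (%x. ib (r+1) x * H (u x))"
  proof (rule integrable_le)
   show "integ (%x. (B * 2 powr p) * (ib (r+1) x * u x powr p) + (B * 2 powr p * dl powr p) * ib (r+1) x)"
   by (intro Bochner_Integration.integrable_add integrable_mult_right integrable_ind_mult integrable_ind_cball WpD(4)[OF U p])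
   show "AEL x. norm (ib (r+1) x * H (u x)) <= norm ((B * 2 powr p) * (ib (r+1) x * u x powr p) + (B * 2 powr p * dl powr p) * ib (r+1) x)"
   proof (intro AE_I2)
   fix x show "norm (ib (r+1) x * H (u x)) <= norm ((B * 2 powr p) * (ib (r+1) x * u x powr p) + (B * 2 powr p * dl powr p) * ib (r+1) x)"
   using Hle[OF u0, of x] H0[OF u0, of x] B0 by (cases "x : cball 0 (r+1)") (auto simp: algebra_simps)
   qed
  qed measurable
  have sgyHi: "integ (%x. sg x * (y x powr p * H (u x)))"
  proof (rule integrable_le[OF yHi])
   show "AEL x. norm (sg x * (y x powr p * H (u x))) <= norm (y x powr p * H (u x))"
   using sg0 by (intro AE_I2) (auto simp: abs_mult indicator_def intro!: mult_left_le_one_le order_trans[OF sg0(2)])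
  qed measurable
  note T = super_test[OF p W U S U F, of sg dsg]
  have T1: "weakf p W u g (pval sg ?F u) (pgrad sg dsg ?F ?F' u g) >= 0"
   and T2: "integ (%x. pflux p (g x) \<bullet> pgrad sg dsg ?F ?F' u g x + W x * u x powr (p - 1) * pval sg ?F u x)"
   using T sg(1) sgs sg0 H0 by auto
  have pt: "pflux p (g x) \<bullet> pgrad sg dsg ?F ?F' u g x + W x * u x powr (p - 1) * pval sg ?F u x
   <= - ((p - 1) / 2) * (sg x * (y x powr p * H (u x))) + K * (ib (r+1) x * y x powr p) + K1 * (ib (r+1) x * H (u x))" for x
  proof -
   let ?h = "H (u x)" and ?i = "indicat_real (cball 0 (r+1)) x"
   have h: "?h >= 0" using H0 u0 by simp
   have ud: "u x + dl > 0" using u0[of x] dl by simp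
   have a: "pflux p (g x) \<bullet> (?F (u x) *\<^sub>R dsg x) <= ((p - 1) / 4 * (sg x * y x powr p) + K0 * (4 * p) powr p * ?i) * ?h"
   proof -
   have "pflux p (g x) \<bullet> (?F (u x) *\<^sub>R dsg x) = ?F (u x) * (pflux p (g x) \<bullet> dsg x)" by simp
   also have "... <= ?F (u x) * (norm (g x) powr (p - 1) * norm (dsg x))"
   using pflux_inner_le[of p "g x" "dsg x"] h by (intro mult_left_mono) auto
   also have "... = (y x powr (p - 1) * norm (dsg x)) * ?h" by (simp add: yp1 mult_ac)
   also have "y x powr (p - 1) * norm (dsg x) <= (p - 1) / 4 * (sg x * y x powr p) + K0 * (4 * p) powr p * ?i"
   proof (cases "norm x <= r + 1")
   case True
   have "y x powr (p - 1) * norm (dsg x) <= y x powr (p - 1) * (4 * p * ct x powr (p - 1))"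
   using sg(7)[of x] by (intro mult_left_mono) auto
   also have "... = (ct x * y x) powr (p - 1) * (4 * p)" by (simp add: powr_mult)
   also have "... <= (p - 1) / 4 * (ct x * y x) powr p + K0 * (4 * p) powr p"
   using K0(2)[of "ct x * y x" "4 * p"] sg(3)[of x] y0[of x] p by simp
   finally show ?thesis using True by (simp add: powr_mult sg(2))
   next
   case False
   then show ?thesis using sg(6)[of x] sg(7)[of x] p by (simp add: sg(2))
   qed
   finally show ?thesis using h by (simp add: mult_right_mono)
   qed
   have b: "pflux p (g x) \<bullet> ((sg x * ?F' (u x)) *\<^sub>R g x) <= sg x * y x powr p * (- (p - 1) * ?h + ((p - 1) / 4 * ?h + K))"
   proof -
   have "pflux p (g x) \<bullet> ((sg x * ?F' (u x)) *\<^sub>R g x) = sg x * ?F' (u x) * norm (g x) powr p" by (simp add: pflux_inner_self)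
   also have "... = sg x * y x powr p * (- (p - 1) * ?h + (u x + dl) * H' (u x))" by (simp add: yp mult_ac)
   also have "... <= sg x * y x powr p * (- (p - 1) * ?h + ((p - 1) / 4 * ?h + K))"
   using HK[OF u0[of x]] sg0(1)[of x] by (intro mult_left_mono add_left_mono) auto
   finally show ?thesis .
   qed
   have d: "W x * u x powr (p - 1) * pval sg ?F u x <= c * ?i * ?h"
   proof -
   \<comment> \<open>By this cancellation the potential term is bounded by \<open>c * H(u)\<close>
     with no factor depending on the size of \<open>u\<close>.\<close>
   have q: "u x powr (p - 1) * (u x + dl) powr (1 - p) <= 1"
   proof -
   have "u x powr (p - 1) <= (u x + dl) powr (p - 1)" using u0[of x] dl p by (intro powr_mono2) auto
   then have "u x powr (p - 1) * (u x + dl) powr (1 - p) <= (u x + dl) powr (p - 1) * (u x + dl) powr (1 - p)" by (intro mult_right_mono) auto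
   also have "... = 1" using ud by (simp flip: powr_add)
   finally show ?thesis .
   qed
   have "W x * u x powr (p - 1) * pval sg ?F u x = W x * ((u x powr (p - 1) * (u x + dl) powr (1 - p)) * sg x) * ?h" by (simp add: mult_ac)
   also have "... <= c * (1 * ?i) * ?h"
   using bddpotD(2)[OF W, of x] q sg0[of x] h c by (intro mult_right_mono mult_mono) auto
   finally show ?thesis by simp
   qed
   have e: "K * (sg x * y x powr p) <= K * (?i * y x powr p)" using sg0(2)[of x] K by (intro mult_left_mono mult_right_mono) auto
   have "pflux p (g x) \<bullet> pgrad sg dsg ?F ?F' u g x + W x * u x powr (p - 1) * pval sg ?F u x
   <= ((p - 1) / 4 * (sg x * y x powr p) + K0 * (4 * p) powr p * ?i) * ?h
   + sg x * y x powr p * (- (p - 1) * ?h + ((p - 1) / 4 * ?h + K)) + c * ?i * ?h"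
   unfolding inner_add_right using a b d by linarith
   also have "... = - ((p - 1) / 2) * (sg x * (y x powr p * ?h)) + K * (sg x * y x powr p) + K1 * (?i * ?h)"
   by (simp add: K1_def field_simps)
   finally show ?thesis using e by linarith
  qed
  have yii: "integ (%x. ib (r+1) x * y x powr p)" by (intro integrable_ind_mult ypi)
  let ?I = "LBINT x. sg x * (y x powr p * H (u x))"
  let ?J = "LBINT x. ib (r+1) x * y x powr p" and ?L = "LBINT x. ib (r+1) x * H (u x)"
  have "0 <= (LBINT x. - ((p - 1) / 2) * (sg x * (y x powr p * H (u x))) + K * (ib (r+1) x * y x powr p) + K1 * (ib (r+1) x * H (u x)))"
   using T1 unfolding weakf_def
   by (rule order_trans[OF _ integral_mono[OF T2]]) (use sgyHi yii Hi pt in auto)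
  also have "... = - ((p - 1) / 2) * ?I + K * ?J + K1 * ?L" using sgyHi yii Hi by simp
  finally have "(p - 1) / 2 * ?I <= K1 * ?L + K * ?J" by simp
  then have I: "?I <= 2 / (p - 1) * (K1 * ?L + K * ?J)" using p by (simp add: field_simps)
  have J0: "?J >= 0" "?L >= 0" using H0 u0 by (auto intro!: integral_nonneg_AE)
  have "K1 * ?L + K * ?J <= (K1 + 1) * ?L + (K1 + 1) * (K * ?J)"
   using J0 K K1 by (intro add_mono) (auto simp: mult_right_mono algebra_simps)
  then have "2 / (p - 1) * (K1 * ?L + K * ?J) <= 2 / (p - 1) * ((K1 + 1) * ?L + (K1 + 1) * (K * ?J))"
   using p by (intro mult_left_mono) auto
  also have "... = C * (?L + K * ?J)" unfolding C_def mult.assoc by (simp only: distrib_left[of "K1 + 1"])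
  finally have I2: "?I <= C * (?L + K * ?J)" using I by linarith
  have ii: "integ (%x. ib r x * (y x powr p * H (u x)))" by (intro integrable_ind_mult yHi)
  have "(LBINT x. ib r x * (y x powr p * H (u x))) <= ?I"
   using sg(5) sg0 H0[OF u0] by (intro integral_mono[OF ii sgyHi] mult_right_mono) (auto simp: indicator_def sg(2))
  then show ?case using I2 ii unfolding y_def by auto
 qed
qed

lemma ln_powr_le:
 fixes s q :: real
 assumes "s >= 0" "q > 0"
 obtains B where "B >= 0" "!!x. x >= 1 ==> ln x powr s <= B * x powr q"
proof -
 define a where "a = q / (s + 1)"
 have a: "a > 0" "a * s <= q" using assms by (auto simp: a_def field_simps)
 have "ln x powr s <= (1 / a) powr s * x powr q" if x: "x >= 1" for x
 proof -
  have "ln x powr s <= (x powr a / a) powr s" using ln_powr_bound[OF x a(1)] assms x by (intro powr_mono2) auto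
  also have "... = (1 / a) powr s * x powr (a * s)" using a by (simp add: powr_divide powr_powr)
  also have "... <= (1 / a) powr s * x powr q" using a x by (intro mult_left_mono powr_mono) auto
  finally show ?thesis .
 qed
 then show ?thesis using that[of "(1/a) powr s"] by simp
qed

lemma LipfunI:
 assumes "a > 0" "!!t. t > - a ==> (F has_real_derivative F' t) (at t)" "continuous_on {-a<..} F'"
  "B >= 0" "!!t. t >= 0 ==> (abs (F' t)) <= B"
 shows "Lipfun F F'"
 using assms unfolding Lipfun_def by blast

lemma Lipfun_ln:
 assumes "dl > 0"
 shows "Lipfun (%t. ln (t + dl)) (%t. 1 / (t + dl))"
proof (rule LipfunI[of dl _ _ "1/dl"])
 fix t assume "- dl < t"
 then show "((%t. ln (t + dl)) has_real_derivative 1 / (t + dl)) (at t)" by (auto intro!: derivative_eq_intros)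
next
 show "continuous_on {- dl<..} (%t. 1 / (t + dl))" by (intro continuous_intros) auto
next
 fix t :: real assume "t >= 0"
 then show "abs (1 / (t + dl)) <= 1 / dl" using assms by (simp add: frac_le)
qed (use assms in auto)

lemma Lipfun_powr_neg:
 fixes p :: real
 assumes "dl > 0" "p > 1"
 shows "Lipfun (%t. (t + dl) powr (1 - p) * 1) (%t. (t + dl) powr (- p) * (- (p - 1) * 1 + (t + dl) * 0))"
proof (rule LipfunI[of dl _ _ "(p - 1) * dl powr (-p)"])
 fix t assume t: "- dl < t"
 have "((%t. (t + dl) powr (1 - p)) has_real_derivative (1 - p) * (t + dl) powr (1 - p - 1) * 1) (at t)"
  using t by (intro DERIV_chain2[where f = "%z. z powr (1 - p)" and g = "%t. t + dl"] has_real_derivative_powr) (auto intro!: derivative_eq_intros)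
 then show "((%t. (t + dl) powr (1 - p) * 1) has_real_derivative (t + dl) powr (- p) * (- (p - 1) * 1 + (t + dl) * 0)) (at t)"
  by (simp add: algebra_simps)
next
 show "continuous_on {- dl<..} (%t. (t + dl) powr (- p) * (- (p - 1) * 1 + (t + dl) * 0))" by (intro continuous_intros) auto
next
 fix t :: real assume "t >= 0"
 then have "(t + dl) powr (-p) <= dl powr (-p)" using assms by (intro powr_mono2') auto
 then show "abs ((t + dl) powr (- p) * (- (p - 1) * 1 + (t + dl) * 0)) <= (p - 1) * dl powr (-p)"
  using assms by (simp add: abs_mult mult.commute mult_left_mono)
qed (use assms in auto)

text \<open>The case \<open>H = 1\<close>, \<open>K = 0\<close>. The constant depends on neither
  \<open>u\<close> nor \<open>dl\<close>; letting \<open>dl\<close> tend to 0 is what later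
  separates zero from positive values.\<close>

lemma log_estimate:
 assumes p: "p > 1" and c: "c >= 0" and r: "r >= 0"
 obtains C where "C >= 0"
 "!!W u g dl. bddpot c (W :: 'a::euclidean_space => real) ==> Wp p u g ==> super p W (r + 1) u g ==> dl > 0 ==>
  integ (%x. ib r x * (norm (g x) / (u x + dl)) powr p) &
  (LBINT x. ib r x * (norm (g x) / (u x + dl)) powr p) <= C"
proof (rule log_estimate_weighted[OF p c r, where 'a='a])
 fix C :: real
 assume C: "C >= 0" and
 est: "!!W u g dl H H' K B. bddpot c (W :: 'a => real) ==> Wp p u g ==> super p W (r + 1) u g ==> dl > 0 ==>
  Lipfun (%t. (t + dl) powr (1 - p) * H t) (%t. (t + dl) powr (- p) * (- (p - 1) * H t + (t + dl) * H' t)) ==>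
  (!!t. t >= 0 ==> H t >= 0) ==> (!!t. t >= 0 ==> (t + dl) powr (- p) * H t <= B) ==> K >= 0 ==>
  (!!t. t >= 0 ==> (t + dl) * H' t <= (p - 1) / 4 * H t + K) ==> (%x. H (u x)) : bmeas ==>
  integ (%x. ib r x * ((norm (g x) / (u x + dl)) powr p * H (u x))) &
  (LBINT x. ib r x * ((norm (g x) / (u x + dl)) powr p * H (u x)))
   <= C * ((LBINT x. ib (r + 1) x * H (u x)) + K * (LBINT x. ib (r + 1) x * (norm (g x) / (u x + dl)) powr p))"
 show ?thesis
 proof (rule that[of "C * measure lborel (cball 0 (r+1) :: 'a set)"], goal_cases)
  case (2 W u g dl)
  have "(t + dl) powr (- p) * 1 <= dl powr (-p)" if "t >= 0" for t
   using that 2 p by (auto intro!: powr_mono2')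
  with est[OF 2(1-4) Lipfun_powr_neg[OF 2(4) p], of "dl powr (-p)" 0] p show ?case by simp
 qed (use C in auto)
qed

text \<open>The Poincare inequality on the ball of radius \<open>R\<close> asks for shifts up to
  \<open>2 * R\<close>, hence the gradient estimate on the ball of radius
  \<open>3 * R\<close>.\<close>

lemma super_log_translation:
 assumes p: "p > 1" and c: "c >= 0" and R: "R >= 0"
 obtains K where "K >= 0"
 "!!W u g dl z. bddpot c (W :: 'a::euclidean_space => real) ==> Wp p u g ==> super p W (3 * R + 1) u g ==> dl > 0 ==>
  norm z <= 2 * R ==>
  (\<integral>\<^sup>+x. ib R x * ennreal (abs (ln (u (x + z) + dl) - ln (u x + dl)) powr p) \<partial>lborel) <= ennreal K"
proof (rule log_estimate[OF p c, of "3*R", where 'a='a])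
 show "0 <= 3 * R" using R by simp
 fix C :: real
 assume C: "C >= 0" and est: "!!W u g dl. bddpot c (W :: 'a => real) ==> Wp p u g ==> super p W (3 * R + 1) u g ==> dl > 0 ==>
  integ (%x. ib (3*R) x * (norm (g x) / (u x + dl)) powr p) &
  (LBINT x. ib (3*R) x * (norm (g x) / (u x + dl)) powr p) <= C"
 show ?thesis
 proof (rule that[of "(2 * R) powr p * C"], goal_cases)
  case (2 W u g dl z)
  obtain ph G D where A: "approx p ph G D u g" using 2 by (auto simp: Wp_def)
  have u0: "u x >= 0" for x using WpD(3)[OF 2(2) p] .
  note [measurable] = WpD(1,2)[OF 2(2) p]
  have g: "norm (pgrad (%x. 1) (%x. 0) (%t. ln (t + dl)) (%t. 1 / (t + dl)) u g x) = norm (g x) / (u x + dl)" for x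
   using u0[of x] 2(4) by simp
  have le: "(LBINT x. ib (R + norm z) x * (norm (g x) / (u x + dl)) powr p) <= C"
  proof -
   note E = est[OF 2(1-4)]
   have "(LBINT x. ib (R + norm z) x * (norm (g x) / (u x + dl)) powr p)
   <= (LBINT x. ib (3*R) x * (norm (g x) / (u x + dl)) powr p)"
   proof (rule integral_mono')
   show "integ (%x. ib (3*R) x * (norm (g x) / (u x + dl)) powr p)" using E by simp
   qed (use 2(5) in \<open>auto simp: indicator_def\<close>)
   then show ?thesis using E by linarith
  qed
  have "(\<integral>\<^sup>+x. ib R x * ennreal (abs (ln (u (x + z) + dl) - ln (u x + dl)) powr p) \<partial>lborel)
   <= ennreal (norm z powr p * (LBINT x. ib (R + norm z) x * (norm (g x) / (u x + dl)) powr p))"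
   using approx_translation[OF A p Lipfun_ln[OF 2(4)] C1_const[of 1], of R z] unfolding g by simp
  also have "... <= ennreal ((2 * R) powr p * C)"
   using le 2(5) p C by (intro ennreal_leI mult_mono powr_mono2 integral_nonneg_AE) auto
  finally show ?case .
 qed (use C in auto)
qed

section \<open>A strong maximum principle and the normalisation of solutions\<close>

text \<open>The function \<open>ln (u + dl) - ln dl\<close> vanishes where \<open>u\<close> does, so
  the Poincare inequality bounds it in \<open>L^p\<close> independently of \<open>dl\<close>. On the
  set where \<open>u >= t\<close> it is at least \<open>ln (t / dl)\<close>, which is unbounded as
  \<open>dl\<close> tends to 0; such a set must be null.\<close>

lemma super_dichotomy:
 fixes W :: "'a::euclidean_space => real"
 assumes p: "p > 1" and W: "bddpot c W" and U: "Wp p u g" and R: "R >= 0" and S: "super p W (3 * R + 1) u g"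
  and pos: "measure lborel {x : cball 0 R. u x = 0} > 0"
 shows "AEL x. x : cball 0 R --> u x = 0"
proof -
 note [measurable] = WpD(1,2)[OF U p]
 have u0: "u x >= 0" for x using WpD(3)[OF U p] .
 obtain K where K: "K >= 0" "!!dl z. dl > 0 ==> norm z <= 2 * R ==>
  (\<integral>\<^sup>+x. ib R x * ennreal (abs (ln (u (x + z) + dl) - ln (u x + dl)) powr p) \<partial>lborel) <= ennreal K"
  by (rule super_log_translation[OF p bddpotD(3)[OF W] R, where 'a='a]) (use W U S that in blast)
 define A where "A = {x : cball 0 R. u x = 0}"
 have A [measurable]: "A : sets borel" unfolding A_def by measurable
 define C where "C = 2 powr p * (measure lborel (cball 0 (2 * R) :: 'a set) * K / measure lborel A + 0 powr p * measure lborel (cball 0 R :: 'a set))"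
 have est: "integ (%x. ib R x * abs (ln (u x + dl) - ln dl) powr p)"
  "(LBINT x. ib R x * abs (ln (u x + dl) - ln dl) powr p) <= C" if dl: "dl > 0" for dl
 proof -
  have tr: "(\<integral>\<^sup>+x. ib R x * ennreal (abs ((ln (u (x + z) + dl) - ln dl) - (ln (u x + dl) - ln dl)) powr p) \<partial>lborel) <= ennreal K"
   if "norm z <= 2 * R" for z using K(2)[OF dl that] by simp
  note P = poincare_translation[of p "%x. ln (u x + dl) - ln dl" K R A "measure lborel A" 0]
  show "integ (%x. ib R x * abs (ln (u x + dl) - ln dl) powr p)"
   by (rule P(1)) (use p K R tr pos in \<open>auto simp: A_def\<close>)
  show "(LBINT x. ib R x * abs (ln (u x + dl) - ln dl) powr p) <= C" unfolding C_def
   by (rule P(2)) (use p K R tr pos in \<open>auto simp: A_def\<close>)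
 qed
 have "AEL x. x : cball 0 R --> u x < 1 / real (Suc m)" for m
 proof -
  define t where "t = 1 / real (Suc m)"
  have t: "t > 0" by (simp add: t_def)
  define B where "B = {x : cball 0 R. u x >= t}"
  have B [measurable]: "B : sets borel" unfolding B_def by measurable
  have Bfin: "emeasure lborel B < \<infinity>"
  proof -
   have "emeasure lborel B <= emeasure lborel (cball 0 R :: 'a set)" by (rule emeasure_mono) (auto simp: B_def)
   also have "... < \<infinity>" using emeasure_lborel_cball_finite[of "0::'a" R] by (simp add: less_top)
   finally show ?thesis .
  qed
  have "measure lborel B = 0"
  proof (rule ccontr)
   assume "measure lborel B ~= 0"
   then have b: "measure lborel B > 0" using measure_nonneg[of lborel B] by linarith
   have ineq: "measure lborel B * y powr p <= C" if y: "y > 0" for y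
   proof -
   \<comment> \<open>Chosen so that \<open>ln t - ln dl = y\<close>.\<close>
   define dl where "dl = t / exp y"
   have dl: "dl > 0" using t by (simp add: dl_def)
   have "measure lborel B * y powr p = (LBINT x. indicator B x * y powr p)" by simp
   also have "... <= (LBINT x. ib R x * abs (ln (u x + dl) - ln dl) powr p)"
   proof (rule integral_mono[OF _ est(1)[OF dl]])
   show "integ (%x. indicator B x * y powr p)" using Bfin by (intro integrable_mult_left integrable_real_indicator) auto
   fix x
   have "y powr p <= abs (ln (u x + dl) - ln dl) powr p" if "u x >= t"
   proof (rule powr_mono2)
   have "y = ln t - ln dl" using t by (simp add: dl_def ln_div)
   also have "ln t <= ln (u x + dl)" using that t dl by (subst ln_le_cancel_iff) auto
   finally show "y <= abs (ln (u x + dl) - ln dl)" by simp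
   qed (use p y in auto)
   then show "indicator B x * y powr p <= ib R x * abs (ln (u x + dl) - ln dl) powr p"
   by (auto simp: B_def indicator_def)
   qed
   also have "... <= C" by (rule est(2)[OF dl])
   finally show ?thesis .
   qed
   have C0: "C > 0" using ineq[of 1] b by simp
   \<comment> \<open>At this \<open>y\<close> the left side of \<open>ineq\<close> equals
     \<open>2 * C\<close>, which contradicts the bound \<open>C\<close>.\<close>
   define y where "y = (2 * C / measure lborel B) powr (1 / p)"
   have "y > 0" "y powr p = 2 * C / measure lborel B" using C0 b p by (auto simp: y_def powr_powr)
   then have "2 * C <= C" using ineq[of y] b by simp
   then show False using C0 by simp
  qed
  then have "emeasure lborel B = 0" using Bfin by (simp add: emeasure_eq_ennreal_measure)
  then have "AEL x. x \<notin> B" by (intro AE_not_in) (auto simp: null_sets_def)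
  then show ?thesis by eventually_elim (auto simp: B_def t_def not_le)
 qed
 then have "AEL x. ALL m. x : cball 0 R --> u x < 1 / real (Suc m)" unfolding AE_all_countable by blast
 then show ?thesis
 proof eventually_elim
  case (elim x)
  show ?case
  proof
   assume x: "x : cball 0 R"
   show "u x = 0"
   proof (rule ccontr)
   assume "u x ~= 0"
   then have "u x > 0" using u0[of x] by simp
   then obtain m where "inverse (real (Suc m)) < u x" using reals_Archimedean by blast
   then show False using elim x by (auto simp: inverse_eq_divide dest!: spec[of _ m])
   qed
  qed
 qed
qed

text \<open>Replaces a normalisation at a point, which has no meaning for functions known up to null
  sets. The sublevel set anchors the upper estimates, the superlevel set the lower ones; the
  thresholds 1 and 2 come from a search over doubling levels.\<close>

definition normalised :: "real => ('a::euclidean_space => real) => bool" where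
 "normalised al u \<longleftrightarrow> al > 0 & al <= measure lborel {x : cball 0 1. u x <= 2} & al <= measure lborel {x : cball 0 1. u x >= 1}"

text \<open>The negative part of the logarithm inherits the translation modulus, since
  \<open>max 0\<close> is a contraction, and it vanishes where \<open>u >= 1\<close>, a set of
  measure at least \<open>al\<close>; the Poincare inequality applies.\<close>

lemma neg_log_bound:
 assumes p: "p > 1" and c: "c >= 0" and R: "R >= 1"
 obtains C where
 "!!W u g dl. bddpot c (W :: 'a::euclidean_space => real) ==> Wp p u g ==> super p W (3 * R + 1) u g ==> normalised al u ==> dl > 0 ==>
  integ (%x. ib R x * abs (max 0 (- ln (u x + dl))) powr p) &
  (LBINT x. ib R x * abs (max 0 (- ln (u x + dl))) powr p) <= C"
proof (rule super_log_translation[OF p c, of R, where 'a='a])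
 show "0 <= R" using R by simp
 fix K :: real
 assume K: "K >= 0" and tr: "!!W u g dl z. bddpot c (W :: 'a => real) ==> Wp p u g ==> super p W (3 * R + 1) u g ==> dl > 0 ==> norm z <= 2 * R ==>
  (\<integral>\<^sup>+x. ib R x * ennreal (abs (ln (u (x + z) + dl) - ln (u x + dl)) powr p) \<partial>lborel) <= ennreal K"
 show ?thesis
 proof (rule that[of "2 powr p * (measure lborel (cball 0 (2 * R) :: 'a set) * K / al + 0 powr p * measure lborel (cball 0 R :: 'a set))"], goal_cases)
  case (1 W u g dl)
  note [measurable] = WpD(1,2)[OF 1(2) p]
  define A where "A = {x : cball 0 1. u x >= 1}"
  have A: "A : sets borel" unfolding A_def by measurable
  have tr2: "(\<integral>\<^sup>+x. ib R x * ennreal (abs (max 0 (- ln (u (x + z) + dl)) - max 0 (- ln (u x + dl))) powr p) \<partial>lborel) <= ennreal K"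
   if "norm z <= 2 * R" for z
  proof (rule order_trans[OF nn_integral_mono tr[OF 1(1-3,5) that]])
   fix x
   have "abs (max 0 (- ln (u (x + z) + dl)) - max 0 (- ln (u x + dl))) <= abs (ln (u (x + z) + dl) - ln (u x + dl))" by (auto simp: max_def)
   then show "ib R x * ennreal (abs (max 0 (- ln (u (x + z) + dl)) - max 0 (- ln (u x + dl))) powr p)
   <= ib R x * ennreal (abs (ln (u (x + z) + dl) - ln (u x + dl)) powr p)"
   using p by (intro mult_left_mono ennreal_leI powr_mono2) auto
  qed
  have b: "abs (max 0 (- ln (u x + dl))) <= 0" if "x : A" for x
   using that 1(5) by (simp add: A_def)
  have N: "al > 0" "al <= measure lborel A" using 1(4) by (auto simp: normalised_def A_def)
  have AR: "A \<subseteq> cball 0 R" using R by (auto simp: A_def)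
  have p0: "p > 0" using p by simp
  have R0: "R >= 0" using R by simp
  have m: "(%x. max 0 (- ln (u x + dl))) : bmeas" by measurable
  from poincare_translation[OF p0 m K R0 tr2 A AR N b order_refl] show ?case by simp
 qed
qed

section \<open>Uniform integrability of the powers of the logarithm\<close>

text \<open>The shift by \<open>exp 1\<close> keeps the logarithm at least 1, so that its powers
  increase with the exponent and are differentiable beyond \<open>t = 0\<close>.\<close>

lemma ln_add_exp_ge_1: "t >= 0 ==> ln (t + exp 1) >= (1::real)"
proof -
 assume "t >= 0"
 then have "ln (exp 1) <= ln (t + exp 1 :: real)" by (subst ln_le_cancel_iff) (auto simp: add_nonneg_pos)
 then show ?thesis by simp
qed

lemma add_exp_gt_1: "t >= 0 ==> t + exp 1 > (1::real)"
 using exp_ge_add_one_self[of 1] by linarith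

lemma ln_powr_deriv:
 fixes t s :: real
 assumes "t > - (exp 1 - 1)"
 shows "((%t. ln (t + exp 1) powr s) has_real_derivative s * ln (t + exp 1) powr (s - 1) / (t + exp 1)) (at t)"
proof -
 have t: "t + exp 1 > 1" using assms by simp
 then have l: "ln (t + exp 1) > 0" by simp
 have "((%t. ln (t + exp 1)) has_real_derivative 1 / (t + exp 1)) (at t)"
  using t by (auto intro!: derivative_eq_intros)
 from DERIV_chain2[OF has_real_derivative_powr[OF l, of s] this] show ?thesis by simp
qed

lemma ln_powr_continuous:
 fixes s :: real
 shows "continuous_on {- (exp 1 - 1)<..} (%t. ln (t + exp 1) powr s)"
 by (intro continuous_at_imp_continuous_on ballI DERIV_isCont[OF ln_powr_deriv]) simp

text \<open>The derivative is \<open>(t + exp 1) powr (- p)\<close> times powers of the logarithm,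
  and these are beaten by \<open>(t + exp 1) powr p\<close>.\<close>

lemma Lipfun_ln_powr_test:
 fixes p s :: real
 assumes p: "p > 1" and s: "s >= 0"
 shows "Lipfun (%t. (t + exp 1) powr (1 - p) * ln (t + exp 1) powr s)
  (%t. (t + exp 1) powr (- p) * (- (p - 1) * ln (t + exp 1) powr s + (t + exp 1) * (s * ln (t + exp 1) powr (s - 1) / (t + exp 1))))"
proof -
 have p0: "p > 0" using p by simp
 obtain B where B: "B >= 0" "!!x. x >= 1 ==> ln x powr s <= B * x powr p" using ln_powr_le[OF s p0] by blast
 show ?thesis
 proof (rule LipfunI[of "exp 1 - 1" _ _ "((p - 1) + s) * B"])
  show "(exp 1 - 1 :: real) > 0" by simp
  fix t :: real assume t: "t > - (exp 1 - 1)"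
  then have t1: "t + exp 1 > 0" by simp
  have d1: "((%t. (t + exp 1) powr (1 - p)) has_real_derivative (1 - p) * (t + exp 1) powr (1 - p - 1) * 1) (at t)"
   using t1 by (intro DERIV_chain2[where f = "%z. z powr (1 - p)" and g = "%t. t + exp 1"] has_real_derivative_powr) (auto intro!: derivative_eq_intros)
  have e: "(t + exp 1) powr (1 - p) = (t + exp 1) powr (- p) * (t + exp 1)"
   using powr_add[of "t + exp 1" "-p" 1] t1 by simp
  show "((%t. (t + exp 1) powr (1 - p) * ln (t + exp 1) powr s) has_real_derivative
   (t + exp 1) powr (- p) * (- (p - 1) * ln (t + exp 1) powr s + (t + exp 1) * (s * ln (t + exp 1) powr (s - 1) / (t + exp 1)))) (at t)"
   by (rule DERIV_cong[OF DERIV_mult[OF d1 ln_powr_deriv[OF t]]]) (use t1 in \<open>simp add: e distrib_left add_divide_distrib[symmetric] mult_ac\<close>)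
 next
  show "continuous_on {- (exp 1 - 1)<..} (%t. (t + exp 1) powr (- p) * (- (p - 1) * ln (t + exp 1) powr s + (t + exp 1) * (s * ln (t + exp 1) powr (s - 1) / (t + exp 1))))"
   using ln_powr_continuous by (intro continuous_intros) auto
 next
  fix t :: real assume t: "t >= 0"
  have t1: "t + exp 1 > 1" using add_exp_gt_1[OF t] .
  have L: "ln (t + exp 1) >= 1" using ln_add_exp_ge_1[OF t] .
  have "ln (t + exp 1) powr (s - 1) <= ln (t + exp 1) powr s" using L by (intro powr_mono) auto
  then have "abs (- (p - 1) * ln (t + exp 1) powr s + s * ln (t + exp 1) powr (s - 1)) <= (p - 1) * ln (t + exp 1) powr s + s * ln (t + exp 1) powr s"
   using p s by (intro order_trans[OF abs_triangle_ineq] add_mono) (auto simp: abs_mult mult_left_mono)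
  also have "... = ((p - 1) + s) * ln (t + exp 1) powr s" by (simp add: algebra_simps)
  also have "... <= ((p - 1) + s) * (B * (t + exp 1) powr p)" using B(2)[of "t + exp 1"] t1 p s by (intro mult_left_mono) auto
  finally have "(t + exp 1) powr (- p) * abs (- (p - 1) * ln (t + exp 1) powr s + s * ln (t + exp 1) powr (s - 1))
   <= (t + exp 1) powr (- p) * (((p - 1) + s) * (B * (t + exp 1) powr p))" by (intro mult_left_mono) auto
  also have "... = ((p - 1) + s) * B" using t1 by (simp add: powr_minus field_simps)
  finally show "abs ((t + exp 1) powr (- p) * (- (p - 1) * ln (t + exp 1) powr s + (t + exp 1) * (s * ln (t + exp 1) powr (s - 1) / (t + exp 1)))) <= ((p - 1) + s) * B"
   using t1 by (simp add: abs_mult)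
 qed (use p s B in auto)
qed

lemma Lipfun_ln_powr:
 fixes q :: real
 assumes q: "q >= 1"
 shows "Lipfun (%t. ln (t + exp 1) powr q) (%t. q * ln (t + exp 1) powr (q - 1) / (t + exp 1))"
proof -
 obtain B where B: "B >= 0" "!!x. x >= 1 ==> ln x powr (q - 1) <= B * x powr 1" using ln_powr_le[of "q - 1" 1] q by auto
 show ?thesis
 proof (rule LipfunI[of "exp 1 - 1" _ _ "q * B"])
  show "(exp 1 - 1 :: real) > 0" by simp
  show "continuous_on {- (exp 1 - 1)<..} (%t. q * ln (t + exp 1) powr (q - 1) / (t + exp 1))"
   using ln_powr_continuous by (intro continuous_intros) auto
  fix t :: real assume t: "t >= 0"
  have t1: "t + exp 1 >= 1" using add_exp_gt_1[OF t] by simp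
  have "q * ln (t + exp 1) powr (q - 1) <= q * (B * (t + exp 1))" using B(2)[OF t1] t1 q by (intro mult_left_mono) auto
  then show "abs (q * ln (t + exp 1) powr (q - 1) / (t + exp 1)) <= q * B" using t1 q by (simp add: abs_mult field_simps)
 qed (use ln_powr_deriv q B in auto)
qed

text \<open>The weight \<open>H = ln powr (j * p)\<close> in the logarithmic estimate bounds the
  gradient of the next power of the logarithm, and the Poincare inequality anchored on
  \<open>u <= 2\<close> bounds that power itself. Each stage needs the previous one on a larger
  ball, so the radius \<open>rh\<close> depends on \<open>R\<close> and \<open>j\<close>.\<close>

lemma power_log_bound:
 fixes p c al :: real and j :: nat
 assumes p: "p > 1" and c: "c >= 0"
 shows "ALL R>=1. EX C rh. ALL W u g. bddpot c (W :: 'a::euclidean_space => real) --> Wp p u g --> super p W rh u g --> normalised al u -->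
  integ (%x. ib R x * ln (u x + exp 1) powr (real j * p)) &
  (LBINT x. ib R x * ln (u x + exp 1) powr (real j * p)) <= C"
proof (induction j)
 case 0
 show ?case
 proof (intro allI impI)
  fix R :: real
  have "ln (u x + exp 1) powr 0 = 1" if "Wp p u g" for u g and x :: 'a
   using ln_add_exp_ge_1[OF WpD(3)[OF that p, of x]] by simp
  then show "EX C rh. ALL W u g. bddpot c (W :: 'a => real) --> Wp p u g --> super p W rh u g --> normalised al u -->
   integ (%x. ib R x * ln (u x + exp 1) powr (real 0 * p)) &
   (LBINT x. ib R x * ln (u x + exp 1) powr (real 0 * p)) <= C"
   by - (rule exI[of _ "measure lborel (cball 0 R :: 'a set)"], rule exI[of _ 0], simp add: integrable_ind_cball)
 qed
next
 case (Suc j)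
 define s where "s = real j * p"
 \<comment> \<open>\<open>q\<close> equals \<open>j + 1\<close>. The p-th power of the gradient of
   \<open>ln powr q\<close> is then \<open>q powr p\<close> times the p-th power of the logarithmic
   gradient times \<open>ln powr s\<close>.\<close>
 define q where "q = 1 + s / p"
 have s: "s >= 0" using p by (simp add: s_def)
 have q: "q >= 1" "(q - 1) * p = s" "q * p = real (Suc j) * p" using p s by (auto simp: q_def s_def field_simps)
 \<comment> \<open>Where the logarithm exceeds \<open>4 * s / (p - 1)\<close>, the term with
   \<open>H'\<close> is absorbed by a quarter of the good term; \<open>K\<close> bounds it where the
   logarithm is smaller.\<close>
 define K where "K = s * (4 * s / (p - 1) + 1) powr s"
 have K: "K >= 0" using s by (simp add: K_def)
 have HK: "(t + exp 1) * (s * ln (t + exp 1) powr (s - 1) / (t + exp 1)) <= (p - 1) / 4 * ln (t + exp 1) powr s + K" if t: "t >= 0" for t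
 proof -
  have L: "ln (t + exp 1) >= 1" using ln_add_exp_ge_1[OF t] .
  have "t + exp 1 ~= 0" using add_nonneg_pos[OF t exp_gt_zero[of 1]] by simp
  then have "(t + exp 1) * (s * ln (t + exp 1) powr (s - 1) / (t + exp 1)) = s * ln (t + exp 1) powr (s - 1)" by simp
  also have "... <= (p - 1) / 4 * ln (t + exp 1) powr s + K"
  proof (cases "ln (t + exp 1) >= 4 * s / (p - 1)")
   case True
   have "s * ln (t + exp 1) powr (s - 1) = (s / ln (t + exp 1)) * ln (t + exp 1) powr s" using L by (simp add: powr_diff)
   also have "... <= (p - 1) / 4 * ln (t + exp 1) powr s"
   using True L p by (intro mult_right_mono) (auto simp: field_simps)
   finally show ?thesis using K by simp
  next
   case False
   have "ln (t + exp 1) powr (s - 1) <= ln (t + exp 1) powr s" using L by (intro powr_mono) auto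
   also have "... <= (4 * s / (p - 1) + 1) powr s" using False L s by (intro powr_mono2) auto
   finally have "s * ln (t + exp 1) powr (s - 1) <= K" unfolding K_def using s by (intro mult_left_mono) auto
   moreover have "0 <= (p - 1) / 4 * ln (t + exp 1) powr s" using p by simp
   ultimately show ?thesis by linarith
  qed
  finally show ?thesis .
 qed
 show ?case
 proof (intro allI impI)
  fix R :: real assume R: "R >= 1"
  have r: "3 * R >= 0" "3 * R + 1 >= 0" "3 * R + 1 >= 1" using R by auto
  have p0: "p > 0" using p by simp
  obtain B where B: "B >= 0" "!!x. x >= 1 ==> ln x powr s <= B * x powr p" using ln_powr_le[OF s p0] by blast
  have HB: "(t + exp 1) powr (- p) * ln (t + exp 1) powr s <= B" if t: "t >= 0" for t
  proof -
   have t1: "t + exp 1 >= 1" using add_exp_gt_1[OF t] by simp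
   have "(t + exp 1) powr (- p) * ln (t + exp 1) powr s <= (t + exp 1) powr (- p) * (B * (t + exp 1) powr p)"
   using B(2)[OF t1] by (intro mult_left_mono) auto
   also have "... = B" using t1 by (simp add: powr_minus field_simps)
   finally show ?thesis .
  qed
  obtain Cw where Cw: "Cw >= 0" "!!W u g. bddpot c (W :: 'a => real) ==> Wp p u g ==> super p W (3 * R + 1) u g ==>
   integ (%x. ib (3*R) x * ((norm (g x) / (u x + exp 1)) powr p * ln (u x + exp 1) powr s)) &
   (LBINT x. ib (3*R) x * ((norm (g x) / (u x + exp 1)) powr p * ln (u x + exp 1) powr s))
   <= Cw * ((LBINT x. ib (3 * R + 1) x * ln (u x + exp 1) powr s) + K * (LBINT x. ib (3*R + 1) x * (norm (g x) / (u x + exp 1)) powr p))"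
  proof (rule log_estimate_weighted[OF p c r(1), where 'a='a], goal_cases)
   case (1 C)
   note est = 1(3)
   show ?case
   proof (rule 1(1)[OF 1(2)], goal_cases)
   case (1 W u g)
   note [measurable] = WpD(1)[OF 1(2) p]
   show ?case
   by (rule est[OF 1 exp_gt_zero Lipfun_ln_powr_test[OF p s] _ HB K HK]) (auto)
   qed
  qed
  obtain Cl where Cl: "Cl >= 0" "!!W u g. bddpot c (W :: 'a => real) ==> Wp p u g ==> super p W (3 * R + 1 + 1) u g ==>
   (LBINT x. ib (3 * R + 1) x * (norm (g x) / (u x + exp 1)) powr p) <= Cl"
  proof (rule log_estimate[OF p c r(2), where 'a='a], goal_cases)
   case (1 C)
   show ?case by (rule 1(1)[OF 1(2)]) (use 1(3) in auto)
  qed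
  obtain C0 rh0 where C0': "ALL W u g. bddpot c (W :: 'a => real) --> Wp p u g --> super p W rh0 u g --> normalised al u -->
   integ (%x. ib (3*R+1) x * ln (u x + exp 1) powr (real j * p)) &
   (LBINT x. ib (3*R+1) x * ln (u x + exp 1) powr (real j * p)) <= C0"
   using Suc.IH[rule_format, OF r(3)] by (elim exE) (rule that)
  have C0: "!!W u g. bddpot c (W :: 'a => real) ==> Wp p u g ==> super p W rh0 u g ==> normalised al u ==>
   (LBINT x. ib (3*R+1) x * ln (u x + exp 1) powr s) <= C0"
   using C0' unfolding s_def by blast
  define I where "I = abs (Cw * (C0 + K * Cl))"
  define K' where "K' = (2 * R) powr p * (q powr p * I)"
  have K': "K' >= 0" by (simp add: K'_def I_def)
  define b where "b = ln (2 + exp 1 :: real) powr q"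
  define rh where "rh = max rh0 (3 * R + 1 + 1)"
  show "EX C rh. ALL W u g. bddpot c (W :: 'a => real) --> Wp p u g --> super p W rh u g --> normalised al u -->
  integ (%x. ib R x * ln (u x + exp 1) powr (real (Suc j) * p)) &
  (LBINT x. ib R x * ln (u x + exp 1) powr (real (Suc j) * p)) <= C"
  proof (rule exI[of _ "2 powr p * (measure lborel (cball 0 (2 * R) :: 'a set) * K' / al + b powr p * measure lborel (cball 0 R :: 'a set))"], rule exI[of _ rh], intro allI impI)
   fix W :: "'a => real" and u g
   assume W: "bddpot c W" and U: "Wp p u g" and S: "super p W rh u g" and N: "normalised al u"
   note [measurable] = WpD(1,2)[OF U p]
   have u0: "u x >= 0" for x using WpD(3)[OF U p] .
   have S1: "super p W rh0 u g" "super p W (3*R+1) u g" "super p W (3*R+1+1) u g"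
   using super_mono[OF S] by (auto simp: rh_def)
   define y where "y x = norm (g x) / (u x + exp 1)" for x
   have yint: "integ (%x. ib (3*R) x * (y x powr p * ln (u x + exp 1) powr s))"
   and yI: "(LBINT x. ib (3*R) x * (y x powr p * ln (u x + exp 1) powr s)) <= I"
   proof -
   note E = Cw(2)[OF W U S1(2)]
   show "integ (%x. ib (3*R) x * (y x powr p * ln (u x + exp 1) powr s))" using E by (simp add: y_def)
   have "(LBINT x. ib (3*R) x * (y x powr p * ln (u x + exp 1) powr s))
   <= Cw * ((LBINT x. ib (3 * R + 1) x * ln (u x + exp 1) powr s) + K * (LBINT x. ib (3*R + 1) x * (norm (g x) / (u x + exp 1)) powr p))"
   using E by (simp add: y_def)
   also have "... <= Cw * (C0 + K * Cl)"
   using C0[OF W U S1(1) N] Cl(2)[OF W U S1(3)] Cw(1) K by (intro mult_left_mono add_mono) auto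
   finally show "(LBINT x. ib (3*R) x * (y x powr p * ln (u x + exp 1) powr s)) <= I" by (simp add: I_def)
   qed
   obtain ph G D where A: "approx p ph G D u g" using U by (auto simp: Wp_def)
   have ng: "norm (pgrad (%x. 1) (%x. 0) (%t. ln (t + exp 1) powr q) (%t. q * ln (t + exp 1) powr (q - 1) / (t + exp 1)) u g x) powr p
   = q powr p * (y x powr p * ln (u x + exp 1) powr s)" for x
   proof -
   have u1: "u x + exp 1 > 0" using add_nonneg_pos[OF u0 exp_gt_zero] .
   have "norm (pgrad (%x. 1) (%x. 0) (%t. ln (t + exp 1) powr q) (%t. q * ln (t + exp 1) powr (q - 1) / (t + exp 1)) u g x)
   = q * (ln (u x + exp 1) powr (q - 1) * y x)" using u1 q by (simp add: y_def abs_mult)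
   also have "... powr p = q powr p * (ln (u x + exp 1) powr ((q - 1) * p) * y x powr p)" by (simp add: powr_mult powr_powr)
   finally show ?thesis unfolding q(2) by (simp add: mult.commute)
   qed
   have tr: "(\<integral>\<^sup>+x. ib R x * ennreal (abs (ln (u (x + z) + exp 1) powr q - ln (u x + exp 1) powr q) powr p) \<partial>lborel) <= ennreal K'"
   if z: "norm z <= 2 * R" for z
   proof -
   have "(LBINT x. ib (R + norm z) x * (q powr p * (y x powr p * ln (u x + exp 1) powr s)))
   <= (LBINT x. q powr p * (ib (3*R) x * (y x powr p * ln (u x + exp 1) powr s)))"
   proof (rule integral_mono')
   show "integ (%x. q powr p * (ib (3*R) x * (y x powr p * ln (u x + exp 1) powr s)))" using yint by simp
   qed (use z in \<open>auto simp: indicator_def\<close>)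
   also have "... <= q powr p * I" using yI by (simp add: mult_left_mono)
   finally have le: "(LBINT x. ib (R + norm z) x * (q powr p * (y x powr p * ln (u x + exp 1) powr s))) <= q powr p * I" .
   have "(\<integral>\<^sup>+x. ib R x * ennreal (abs (ln (u (x + z) + exp 1) powr q - ln (u x + exp 1) powr q) powr p) \<partial>lborel)
   <= ennreal (norm z powr p * (LBINT x. ib (R + norm z) x * (q powr p * (y x powr p * ln (u x + exp 1) powr s))))"
   using approx_translation[OF A p Lipfun_ln_powr[OF q(1)] C1_const[of 1], of R z] unfolding ng by simp
   also have "... <= ennreal K'" unfolding K'_def
   using le z p by (intro ennreal_leI mult_mono powr_mono2 integral_nonneg_AE) auto
   finally show ?thesis .
   qed
   define A2 where "A2 = {x : cball 0 1. u x <= 2}"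
   have A2: "A2 : sets borel" unfolding A2_def by measurable
   have AR: "A2 \<subseteq> cball 0 R" using R by (auto simp: A2_def)
   have N2: "al > 0" "al <= measure lborel A2" using N by (auto simp: normalised_def A2_def)
   have bb: "abs (ln (u x + exp 1) powr q) <= b" if "x : A2" for x
   proof -
   have "ln (u x + exp 1) <= ln (2 + exp 1)" using that u0[of x] by (subst ln_le_cancel_iff) (auto simp: A2_def add_nonneg_pos)
   then show ?thesis unfolding b_def using ln_add_exp_ge_1[OF u0[of x]] q by (auto intro!: powr_mono2)
   qed
   have b0: "b >= 0" by (simp add: b_def)
   have R0: "R >= 0" using R by simp
   have m: "(%x. ln (u x + exp 1) powr q) : bmeas" by measurable
   have e: "abs (ln (u x + exp 1) powr q) powr p = ln (u x + exp 1) powr (real (Suc j) * p)" for x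
   by (simp add: powr_powr q(3) del: of_nat_Suc)
   from poincare_translation[OF p0 m K' R0 tr A2 AR N2 bb b0]
   show "integ (%x. ib R x * ln (u x + exp 1) powr (real (Suc j) * p)) &
   (LBINT x. ib R x * ln (u x + exp 1) powr (real (Suc j) * p))
   <= 2 powr p * (measure lborel (cball 0 (2 * R) :: 'a set) * K' / al + b powr p * measure lborel (cball 0 R :: 'a set))"
   unfolding e by simp
  qed
 qed
qed

section \<open>Local bounds for normalised solutions\<close>

text \<open>A Faber--Krahn inequality from averaging over translations: on a set that is small compared to a ball of
 radius \<open>rh\<close>, the \<open>L\<^sup>p\<close> mass is controlled by the translation modulus at scale \<open>rh\<close>.\<close>

lemma small_set_estimate:
 fixes f :: "'a::euclidean_space => real"
 assumes p: "p > 0" and f [measurable]: "f : bmeas" and f0: "!!x. f x >= 0"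
  and fi: "integ (%x. f x powr p)" and out: "!!x. norm x > R ==> f x = 0"
  and S [measurable]: "S : sets borel" and SB: "S \<subseteq> cball 0 R" and k: "k >= 0" "!!x. x : cball 0 R - S ==> f x <= k"
  and rh: "rh > 0" "2 powr p * measure lborel S <= measure lborel (cball 0 rh :: 'a set) / 2"
  and K: "K >= 0" and tr: "!!h. norm h <= rh ==> (\<integral>\<^sup>+x. ib R x * ennreal (abs (f (x + h) - f x) powr p) \<partial>lborel) <= ennreal K"
 shows "(LBINT x. f x powr p) <= 2 * (k powr p * measure lborel (cball 0 R :: 'a set)) + 2 * (2 powr p * K)"
proof -
 let ?B = "cball 0 R :: 'a set" and ?b = "measure lborel (cball 0 rh :: 'a set)"
 define X where "X = (LBINT x. f x powr p)"
 define Y where "Y = (LBINT x. indicator S x * f x powr p)"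
 have X0: "X >= 0" unfolding X_def by (intro integral_nonneg_AE) auto
 have b: "?b > 0" using content_cball_pos[OF rh(1)] by simp
 have fin: "emeasure lborel S < \<infinity>"
 proof -
  have "emeasure lborel S <= emeasure lborel ?B" by (rule emeasure_mono[OF SB]) simp
  also have "... < \<infinity>" using emeasure_lborel_cball_finite[of "0::'a" R] by (simp add: less_top)
  finally show ?thesis .
 qed
 have emS: "emeasure lborel S = ennreal (measure lborel S)" using fin by (intro emeasure_eq_ennreal_measure) auto
 have emb: "emeasure lborel (cball 0 rh :: 'a set) = ennreal ?b"
  using emeasure_lborel_cball_finite[of "0::'a" rh] by (intro emeasure_eq_ennreal_measure) auto
 have Yi: "integ (%x. indicator S x * f x powr p)"
  using integrable_real_mult_indicator[OF _ fi, of S] by (simp add: mult.commute)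
 have Xn: "(\<integral>\<^sup>+x. ennreal (f x powr p) \<partial>lborel) = ennreal X" unfolding X_def by (rule nn_integral_eq_integral[OF fi]) auto
 have Yn: "(\<integral>\<^sup>+x. ennreal (indicator S x * f x powr p) \<partial>lborel) = ennreal Y" unfolding Y_def by (rule nn_integral_eq_integral[OF Yi]) auto
 have Y0: "Y >= 0" unfolding Y_def by (intro integral_nonneg_AE) auto
 let ?r = "ib rh :: 'a => ennreal"
 let ?d = "%h x. indicator ?B x * ennreal (abs (f (x + h) - f x) powr p)"
 let ?e = "%h x. indicator S x * ennreal (f (x + h) powr p)"
 have em: "(%w. ?r (fst w) * ?e (fst w) (snd w)) : borel_measurable (lborel \<Otimes>\<^sub>M lborel)" by measurable
 have em2: "(%h. \<integral>\<^sup>+x. ?e h x \<partial>lborel) : borel_measurable lborel"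
  using lborel.borel_measurable_nn_integral[of "%h x. ?e h x" lborel] by measurable
 have dm2: "(%h. \<integral>\<^sup>+x. ?d h x \<partial>lborel) : borel_measurable lborel"
  using lborel.borel_measurable_nn_integral[of "%h x. ?d h x" lborel] by measurable
 \<comment> \<open>For each shift \<open>h\<close> in the ball of radius \<open>rh\<close>, compare
   \<open>f x\<close> with \<open>f (x + h)\<close> on \<open>S\<close>. After averaging, the mass
   of \<open>f (x + h)\<close> contributes at most \<open>measure lborel S * X\<close>, and
   \<open>rh(2)\<close> makes this half of \<open>?b * X\<close>.\<close>
 have "ennreal ?b * ennreal Y = (\<integral>\<^sup>+h. ?r h * ennreal Y \<partial>lborel)" by (simp add: nn_integral_multc emb)
 also have "... <= (\<integral>\<^sup>+h. ennreal (2 powr p) * (?r h * (\<integral>\<^sup>+x. ?d h x \<partial>lborel)) + ennreal (2 powr p) * (?r h * (\<integral>\<^sup>+x. ?e h x \<partial>lborel)) \<partial>lborel)"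
 proof (rule nn_integral_mono)
  fix h :: 'a
  have "ennreal Y <= (\<integral>\<^sup>+x. ennreal (2 powr p) * ?d h x + ennreal (2 powr p) * ?e h x \<partial>lborel)" unfolding Yn[symmetric]
  proof (rule nn_integral_mono)
   fix x
   show "ennreal (indicator S x * f x powr p) <= ennreal (2 powr p) * ?d h x + ennreal (2 powr p) * ?e h x"
   proof (cases "x : S")
   case True
   have "f x powr p <= 2 powr p * (abs (f (x + h)) powr p + abs (f (x + h) - f x) powr p)"
   using norm_diff_powr_le[OF p, of "f (x + h)" "f (x + h) - f x"] f0[of x] by simp
   also have "... = 2 powr p * abs (f (x + h) - f x) powr p + 2 powr p * f (x + h) powr p" using f0[of "x + h"] by (simp add: algebra_simps)
   finally have "ennreal (f x powr p) <= ennreal (2 powr p * abs (f (x + h) - f x) powr p + 2 powr p * f (x + h) powr p)" by (rule ennreal_leI)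
   then show ?thesis using True SB by (auto simp: ennreal_plus ennreal_mult)
   qed simp
  qed
  also have "... = ennreal (2 powr p) * (\<integral>\<^sup>+x. ?d h x \<partial>lborel) + ennreal (2 powr p) * (\<integral>\<^sup>+x. ?e h x \<partial>lborel)"
   by (simp add: nn_integral_add nn_integral_cmult)
  finally have "?r h * ennreal Y <= ?r h * (ennreal (2 powr p) * (\<integral>\<^sup>+x. ?d h x \<partial>lborel) + ennreal (2 powr p) * (\<integral>\<^sup>+x. ?e h x \<partial>lborel))"
   by (intro mult_left_mono) auto
  then show "?r h * ennreal Y <= ennreal (2 powr p) * (?r h * (\<integral>\<^sup>+x. ?d h x \<partial>lborel)) + ennreal (2 powr p) * (?r h * (\<integral>\<^sup>+x. ?e h x \<partial>lborel))"
   by (simp add: distrib_left mult.left_commute)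
 qed
 also have "... = ennreal (2 powr p) * (\<integral>\<^sup>+h. ?r h * (\<integral>\<^sup>+x. ?d h x \<partial>lborel) \<partial>lborel) + ennreal (2 powr p) * (\<integral>\<^sup>+h. ?r h * (\<integral>\<^sup>+x. ?e h x \<partial>lborel) \<partial>lborel)"
  by (subst nn_integral_add) (use em2 dm2 in \<open>auto simp: nn_integral_cmult\<close>)
 also have "... <= ennreal (2 powr p) * ennreal (?b * K) + ennreal (2 powr p) * ennreal (measure lborel S * X)"
 proof (intro add_mono mult_left_mono)
  have "(\<integral>\<^sup>+h. ?r h * (\<integral>\<^sup>+x. ?d h x \<partial>lborel) \<partial>lborel) <= (\<integral>\<^sup>+h. ?r h * ennreal K \<partial>lborel)"
   using tr by (intro nn_integral_mono) (auto simp: indicator_def)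
  then show "(\<integral>\<^sup>+h. ?r h * (\<integral>\<^sup>+x. ?d h x \<partial>lborel) \<partial>lborel) <= ennreal (?b * K)"
   using K by (simp add: nn_integral_multc emb ennreal_mult)
  have "(\<integral>\<^sup>+h. ?r h * (\<integral>\<^sup>+x. ?e h x \<partial>lborel) \<partial>lborel) <= (\<integral>\<^sup>+h. (\<integral>\<^sup>+x. ?e h x \<partial>lborel) \<partial>lborel)"
   by (intro nn_integral_mono) (auto simp: indicator_def)
  also have "... = (\<integral>\<^sup>+x. (\<integral>\<^sup>+h. ?e h x \<partial>lborel) \<partial>lborel)" by (rule lborel_pair.Fubini'[symmetric, of "%x h. ?e h x", symmetric]) measurable
  also have "... = (\<integral>\<^sup>+x. indicator S x * ennreal X \<partial>lborel)"
  proof (rule nn_integral_cong)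
   fix x :: 'a
   have "(\<integral>\<^sup>+h. ?e h x \<partial>lborel) = indicator S x * (\<integral>\<^sup>+h. ennreal (f (h + x) powr p) \<partial>lborel)"
   by (subst nn_integral_cmult) (auto simp: add.commute)
   also have "(\<integral>\<^sup>+h. ennreal (f (h + x) powr p) \<partial>lborel) = ennreal X"
   unfolding Xn[symmetric] by (rule nn_integral_lborel_shift[of "%y. ennreal (f y powr p)"]) measurable
   finally show "(\<integral>\<^sup>+h. ?e h x \<partial>lborel) = indicator S x * ennreal X" .
  qed
  also have "... = ennreal (measure lborel S * X)" using X0 by (simp add: nn_integral_multc emS ennreal_mult)
  finally show "(\<integral>\<^sup>+h. ?r h * (\<integral>\<^sup>+x. ?e h x \<partial>lborel) \<partial>lborel) <= ennreal (measure lborel S * X)" .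
 qed auto
 also have "... = ennreal (2 powr p * (?b * K) + 2 powr p * (measure lborel S * X))"
  using K X0 by (simp add: ennreal_mult ennreal_plus)
 finally have "ennreal (?b * Y) <= ennreal (2 powr p * (?b * K) + 2 powr p * (measure lborel S * X))" using Y0 by (simp add: ennreal_mult)
 then have "?b * Y <= 2 powr p * (?b * K) + 2 powr p * (measure lborel S * X)" using K X0 by (subst (asm) ennreal_le_iff) auto
 also have "2 powr p * (measure lborel S * X) <= ?b / 2 * X" using mult_right_mono[OF rh(2) X0] by (simp add: mult.assoc)
 finally have "?b * Y <= ?b * (2 powr p * K + X / 2)" by (simp add: algebra_simps)
 then have Y: "Y <= 2 powr p * K + X / 2" using b by simp
 have "X <= (LBINT x. k powr p * indicator ?B x + indicator S x * f x powr p)" unfolding X_def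
 proof (rule integral_mono[OF fi])
  show "integ (%x. k powr p * indicator ?B x + indicator S x * f x powr p)"
   by (intro Bochner_Integration.integrable_add integrable_mult_right integrable_ind_cball Yi)
  fix x
  show "f x powr p <= k powr p * indicator ?B x + indicator S x * f x powr p"
  proof (cases "x : S")
   case False
   show ?thesis
   proof (cases "norm x <= R")
   case True
   then have "f x powr p <= k powr p" using k False f0[of x] p by (intro powr_mono2) auto
   then show ?thesis using True False by simp
   qed (use out[of x] in simp)
  qed simp
 qed
 also have "... = k powr p * measure lborel ?B + Y" unfolding Y_def
  using Yi integrable_ind_cball[of "0::'a" R] by simp
 finally show ?thesis using Y unfolding X_def[symmetric] by simp
qed

text \<open>Test with \<open>sg * u\<close>; the cross term is absorbed into half of the gradient
  term because \<open>dsg\<close> carries \<open>ct powr (p - 1)\<close>. The power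
  \<open>d powr (- p)\<close> is kept explicit since the widths shrink in the iteration, and
  \<open>d <= 1\<close> lets it dominate the potential term.\<close>

lemma caccioppoli:
 assumes p: "p > 1" and c: "c >= 0"
 obtains C where "C >= 0"
 "!!W u g r d ct sg dsg. bddpot c (W :: 'a::euclidean_space => real) ==> Wp p u g ==> 0 < d ==> d <= 1 ==> sol p W (r + d) u g ==>
  C1 sg dsg ==> (!!x. sg x = ct x powr p) ==> (!!x. 0 <= ct x) ==> (!!x. ct x <= 1) ==> (!!x. norm x > r + d ==> ct x = 0) ==>
  (!!x. norm (dsg x) <= (4 * p / d) * ct x powr (p - 1)) ==>
  (LBINT x. sg x * norm (g x) powr p) <= C * d powr (- p) * (LBINT x. ib (r + d) x * u x powr p)"
proof -
 obtain K0 where K0: "K0 >= 0" "!!a b. a >= 0 ==> b >= 0 ==> a powr (p - 1) * b <= 1/2 * a powr p + K0 * b powr p"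
  using Young_powr_eps[OF p, of "1/2"] by auto
 define C where "C = 2 * (K0 * (4 * p) powr p + c)"
 have C: "C >= 0" using K0 c by (simp add: C_def)
 show ?thesis
 proof (rule that[OF C], goal_cases)
  case (1 W u g r d ct sg dsg)
  note W = 1(1) and U = 1(2) and d = 1(3,4) and S = 1(5) and sg = 1(6-)
  note [measurable] = WpD(1,2)[OF U p] bddpotD(1)[OF W] C1_meas[OF sg(1)]
  have u0: "u x >= 0" for x using WpD(3)[OF U p] .
  let ?i = "%x. indicat_real (cball 0 (r + d)) x"
  have sgs: "supp_in sg (r + d)" using sg(5) by (simp add: supp_in_def sg(2))
  have sg0: "sg x >= 0" "sg x <= ?i x" "sg x <= 1" for x
   using sg(3,4,5)[of x] p by (auto simp: sg(2) indicator_def powr_le1)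
  note T = sol_test[OF p W U S U Lipfun_id sg(1) sgs]
  let ?f = "%x. pflux p (g x) \<bullet> pgrad sg dsg (%t. t) (%t. 1) u g x + W x * u x powr (p - 1) * pval sg (%t. t) u x"
  define c' where "c' = (K0 * (4 * p) powr p + c) * d powr (- p)"
  have pt: "1/2 * (sg x * norm (g x) powr p) - c' * (?i x * u x powr p) <= ?f x" for x
  proof -
   have dp: "1 <= d powr (-p)"
   using d p by (simp add: powr_minus one_le_inverse_iff powr_le1)
   have a: "abs (pflux p (g x) \<bullet> (u x *\<^sub>R dsg x)) <= 1/2 * (sg x * norm (g x) powr p) + K0 * (4 * p) powr p * d powr (- p) * (?i x * u x powr p)"
   proof (cases "norm x <= r + d")
   case True
   have "abs (pflux p (g x) \<bullet> (u x *\<^sub>R dsg x)) <= u x * (norm (g x) powr (p - 1) * norm (dsg x))"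
   using pflux_inner_le[of p "g x" "dsg x"] u0[of x] by (simp add: abs_mult mult_left_mono)
   also have "... <= u x * (norm (g x) powr (p - 1) * ((4 * p / d) * ct x powr (p - 1)))"
   using sg(6)[of x] u0[of x] by (intro mult_left_mono) auto
   also have "... = (ct x * norm (g x)) powr (p - 1) * (4 * p / d * u x)" by (simp add: powr_mult mult_ac)
   also have "... <= 1/2 * (ct x * norm (g x)) powr p + K0 * (4 * p / d * u x) powr p"
   using K0(2)[of "ct x * norm (g x)" "4 * p / d * u x"] sg(3)[of x] u0[of x] p d by simp
   also have "... = 1/2 * (sg x * norm (g x) powr p) + K0 * (4 * p) powr p * d powr (- p) * u x powr p"
   using d by (simp add: powr_mult powr_divide powr_minus_divide sg(2))
   finally show ?thesis using True by simp
   next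
   case False
   then have "dsg x = 0" using supp_in_grad[OF sg(1) sgs, of x] by simp
   then show ?thesis using sg0 K0 by simp
   qed
   have b: "abs (W x * u x powr (p - 1) * (sg x * u x)) <= c * d powr (- p) * (?i x * u x powr p)"
   proof -
   have "abs (W x * u x powr (p - 1) * (sg x * u x)) = abs (W x) * (sg x * u x powr p)"
   using u0[of x] sg0(1)[of x] powr_minus_one_mult[of "u x" p] by (simp add: abs_mult mult_ac)
   also have "... <= (c * d powr (-p)) * (?i x * u x powr p)"
   proof (rule mult_mono)
   have "abs (W x) * 1 <= c * d powr (-p)" using bddpotD(2)[OF W, of x] dp c by (intro mult_mono) auto
   then show "abs (W x) <= c * d powr (-p)" by simp
   qed (use sg0[of x] c in \<open>auto intro!: mult_right_mono\<close>)
   finally show ?thesis .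
   qed
   have "?f x = pflux p (g x) \<bullet> (u x *\<^sub>R dsg x) + sg x * norm (g x) powr p + W x * u x powr (p - 1) * (sg x * u x)"
   by (simp add: inner_add_right pflux_inner_self)
   moreover have "c' * (?i x * u x powr p) = K0 * (4 * p) powr p * d powr (- p) * (?i x * u x powr p) + c * d powr (- p) * (?i x * u x powr p)"
   by (simp add: c'_def algebra_simps)
   ultimately show ?thesis using a b by linarith
  qed
  have i1: "integ (%x. sg x * norm (g x) powr p)"
  proof (rule integrable_le[OF WpD(5)[OF U p]])
   show "AEL x. norm (sg x * norm (g x) powr p) <= norm (norm (g x) powr p)"
   using sg0 by (intro AE_I2) (simp add: abs_mult mult_left_le_one_le)
  qed measurable
  have i2: "integ (%x. ?i x * u x powr p)" by (intro integrable_ind_mult WpD(4)[OF U p])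
  have "(LBINT x. 1/2 * (sg x * norm (g x) powr p) - c' * (?i x * u x powr p)) <= (LBINT x. ?f x)"
   by (rule integral_mono[OF _ T(2) pt]) (use i1 i2 in auto)
  also have "... = 0" using T(1) unfolding weakf_def .
  finally have "(LBINT x. sg x * norm (g x) powr p) <= 2 * c' * (LBINT x. ?i x * u x powr p)" using i1 i2 by simp
  then show ?case unfolding c'_def C_def by (simp only: mult.assoc)
 qed
qed

text \<open>Apply the small-set estimate to \<open>sg * u\<close>, whose translation modulus is
  bounded by the Caccioppoli inequality. The factor \<open>(rh / d) powr p\<close> is a contraction
  once \<open>rh\<close> is a small multiple of \<open>d\<close>, provided the superlevel set is
  small against a ball of radius \<open>rh\<close>.\<close>

lemma local_gain:
 assumes p: "p > 1" and c: "c >= 0"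
 obtains C where "C > 0"
 "!!W u g r d rh k. bddpot c (W :: 'a::euclidean_space => real) ==> Wp p u g ==> 0 <= r ==> 0 < d ==> d <= 1 ==> sol p W (r + d) u g ==>
  k >= 0 ==> rh > 0 ==> 2 powr p * measure lborel {x : cball 0 (r + d). u x > k} <= measure lborel (cball 0 rh :: 'a set) / 2 ==>
  (LBINT x. ib r x * u x powr p) <= 2 * (k powr p * measure lborel (cball 0 (r + d) :: 'a set))
   + C * (rh / d) powr p * (LBINT x. ib (r + d) x * u x powr p)"
 "!!W u g r d. bddpot c (W :: 'a::euclidean_space => real) ==> Wp p u g ==> 0 <= r ==> 0 < d ==> d <= 1 ==> sol p W (r + d) u g ==>
  (LBINT x. ib r x * norm (g x) powr p) <= C * d powr (- p) * (LBINT x. ib (r + d) x * u x powr p)"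
proof -
 obtain Ca where Ca: "Ca >= 0" "!!W u g r d ct sg dsg. bddpot c (W :: 'a => real) ==> Wp p u g ==> 0 < d ==> d <= 1 ==> sol p W (r + d) u g ==>
  C1 sg dsg ==> (!!x. sg x = ct x powr p) ==> (!!x. 0 <= ct x) ==> (!!x. ct x <= 1) ==> (!!x. norm x > r + d ==> ct x = 0) ==>
  (!!x. norm (dsg x) <= (4 * p / d) * ct x powr (p - 1)) ==>
  (LBINT x. sg x * norm (g x) powr p) <= Ca * d powr (- p) * (LBINT x. ib (r + d) x * u x powr p)"
 proof (rule caccioppoli[OF p c, where 'a='a], goal_cases)
  case (1 C)
  show ?case by (rule 1(1)[OF 1(2,3)])
 qed
 define C2 where "C2 = 2 powr p * ((4 * p) powr p + Ca)"
 have C2: "C2 >= 0" using Ca by (simp add: C2_def)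
 define C where "C = 2 * 2 powr p * C2 + Ca + 1"
 have C: "C > 0" "Ca <= C" "2 * 2 powr p * C2 <= C" using Ca(1) C2 by (auto simp: C_def add_nonneg_pos)
 show ?thesis
 proof (rule that[OF C(1)], goal_cases)
  case (1 W u g r d rh k)
  note W = 1(1) and U = 1(2) and r = 1(3) and d = 1(4,5) and S = 1(6) and k = 1(7) and rh = 1(8,9)
  obtain ct :: "'a => real" and sg dsg where sg: "C1 sg dsg" "!!x. sg x = ct x powr p" "!!x. 0 <= ct x" "!!x. ct x <= 1"
   "!!x. norm x <= r ==> ct x = 1" "!!x. norm x > r + d ==> ct x = 0"
   "!!x. norm (dsg x) <= (4 * p / d) * ct x powr (p - 1)"
   by (rule cutoff_exists[OF p r d(1), where 'a='a]) (rule that)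
  note [measurable] = WpD(1,2)[OF U p] C1_meas[OF sg(1)]
  have u0: "u x >= 0" for x using WpD(3)[OF U p] .
  let ?i = "%x. indicat_real (cball 0 (r + d)) x"
  let ?M = "LBINT x. ?i x * u x powr p"
  have sgs: "supp_in sg (r + d)" using sg(6) by (simp add: supp_in_def sg(2))
  have sg0: "sg x >= 0" "sg x <= ?i x" "sg x <= 1" for x
   using sg(3,4,6)[of x] p by (auto simp: sg(2) indicator_def powr_le1)
  have cac: "(LBINT x. sg x * norm (g x) powr p) <= Ca * d powr (- p) * ?M"
   by (rule Ca(2)[OF W U d S sg(1-4,6,7)])
  have i1: "integ (%x. sg x * norm (g x) powr p)"
  proof (rule integrable_le[OF WpD(5)[OF U p]])
   show "AEL x. norm (sg x * norm (g x) powr p) <= norm (norm (g x) powr p)"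
   using sg0 by (intro AE_I2) (simp add: abs_mult mult_left_le_one_le)
  qed measurable
  have i2: "integ (%x. ?i x * u x powr p)" by (intro integrable_ind_mult WpD(4)[OF U p])
  obtain ph G D where A: "approx p ph G D u g" using U by (auto simp: Wp_def)
  let ?f = "pval sg (%t. t) u" and ?df = "pgrad sg dsg (%t. t) (%t. 1) u g"
  have dfle: "norm (?df x) powr p <= 2 powr p * (((4 * p) powr p * d powr (- p)) * (?i x * u x powr p) + sg x * norm (g x) powr p)" for x
  proof -
   have "norm (?df x) powr p <= 2 powr p * (norm (u x *\<^sub>R dsg x) powr p + norm ((sg x * 1) *\<^sub>R g x) powr p)"
   using p by (intro norm_add_powr_le) auto
   also have "... <= 2 powr p * (((4 * p) powr p * d powr (- p)) * (?i x * u x powr p) + sg x * norm (g x) powr p)"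
   proof (intro mult_left_mono add_mono)
   show "norm (u x *\<^sub>R dsg x) powr p <= ((4 * p) powr p * d powr (- p)) * (?i x * u x powr p)"
   proof (cases "norm x <= r + d")
   case True
   have "norm (dsg x) <= 4 * p / d * 1"
   using sg(7)[of x] sg(3,4)[of x] p d by (intro order_trans[OF sg(7)] mult_left_mono powr_le1) auto
   then have "norm (dsg x) powr p <= (4 * p / d) powr p" using p by (intro powr_mono2) auto
   also have "... = (4 * p) powr p * d powr (- p)" using d by (simp add: powr_divide powr_minus_divide)
   finally show ?thesis using True u0[of x] by (simp add: powr_mult mult.commute mult_left_mono)
   next
   case False
   then have "dsg x = 0" using supp_in_grad[OF sg(1) sgs, of x] by simp
   then show ?thesis using p by simp
   qed
   have "sg x powr p <= sg x powr 1" using sg0[of x] p by (intro powr_mono') auto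
   then show "norm ((sg x * 1) *\<^sub>R g x) powr p <= sg x * norm (g x) powr p"
   using sg0(1)[of x] by (simp add: powr_mult mult_right_mono)
   qed auto
   finally show ?thesis .
  qed
  let ?rhs = "%x. 2 powr p * (((4 * p) powr p * d powr (- p)) * (?i x * u x powr p) + sg x * norm (g x) powr p)"
  have rhsi: "integ ?rhs" using i1 i2 by auto
  have rhs: "(LBINT x. ?rhs x) <= C2 * d powr (- p) * ?M"
  proof -
   have "(LBINT x. ?rhs x) = 2 powr p * (((4 * p) powr p * d powr (- p)) * ?M + (LBINT x. sg x * norm (g x) powr p))" using i1 i2 by simp
   also have "... <= 2 powr p * (((4 * p) powr p * d powr (- p)) * ?M + Ca * d powr (- p) * ?M)" using cac by (intro mult_left_mono add_left_mono) auto
   also have "... = C2 * d powr (- p) * ?M" by (simp add: C2_def algebra_simps)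
   finally show ?thesis .
  qed
  have M0: "?M >= 0" by (intro integral_nonneg_AE) auto
  define K where "K = rh powr p * (C2 * d powr (- p) * ?M)"
  have K: "K >= 0" using C2 M0 by (simp add: K_def)
  have tr: "(\<integral>\<^sup>+x. ib (r + d) x * ennreal (abs (?f (x + h) - ?f x) powr p) \<partial>lborel) <= ennreal K" if h: "norm h <= rh" for h
  proof -
   have "(LBINT x. ib (r + d + norm h) x * norm (?df x) powr p) <= (LBINT x. ?rhs x)"
   proof (rule integral_mono'[OF rhsi])
   fix x show "ib (r + d + norm h) x * norm (?df x) powr p <= ?rhs x"
   using dfle[of x] order_trans[OF powr_ge_zero dfle[of x]] by (auto simp: indicator_def)
   show "0 <= ?rhs x" using order_trans[OF powr_ge_zero dfle[of x]] .
   qed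
   then have le: "(LBINT x. ib (r + d + norm h) x * norm (?df x) powr p) <= C2 * d powr (- p) * ?M" using rhs by linarith
   have "(\<integral>\<^sup>+x. ib (r + d) x * ennreal (abs (?f (x + h) - ?f x) powr p) \<partial>lborel)
   <= ennreal (norm h powr p * (LBINT x. ib (r + d + norm h) x * norm (?df x) powr p))"
   by (rule approx_translation[OF A p Lipfun_id sg(1)])
   also have "... <= ennreal K" unfolding K_def
   using le h p by (intro ennreal_leI mult_mono powr_mono2 integral_nonneg_AE) auto
   finally show ?thesis .
  qed
  define S where "S = {x : cball 0 (r + d). u x > k}"
  have Sm: "S : sets borel" unfolding S_def by measurable
  have fk: "?f x <= k" if "x : cball 0 (r + d) - S" for x
  proof -
   have "sg x * u x <= 1 * u x" using sg0[of x] u0[of x] by (intro mult_right_mono) auto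
   then show ?thesis using that by (auto simp: S_def)
  qed
  have fi: "integ (%x. ?f x powr p)"
  proof (rule integrable_le[OF WpD(4)[OF U p]])
   show "AEL x. norm (?f x powr p) <= norm (u x powr p)"
   using sg0 u0 p by (intro AE_I2) (auto intro!: powr_mono2 mult_left_le_one_le)
  qed measurable
  have p0: "p > 0" using p by simp
  have "(LBINT x. ?f x powr p) <= 2 * (k powr p * measure lborel (cball 0 (r + d) :: 'a set)) + 2 * (2 powr p * K)"
   by (rule small_set_estimate[OF p0 _ _ fi _ Sm _ k fk rh(1) _ K tr])
   (use sg0 u0 sgs rh(2) in \<open>auto simp: S_def supp_in_def\<close>)
  moreover have "(LBINT x. ib r x * u x powr p) <= (LBINT x. ?f x powr p)"
   using sg(5) by (intro integral_mono[OF integrable_ind_mult[OF WpD(4)[OF U p]] fi]) (auto simp: indicator_def sg(2))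
  moreover have "2 * (2 powr p * K) <= C * (rh / d) powr p * ?M"
  proof -
   have "2 * (2 powr p * K) = (2 * 2 powr p * C2) * ((rh / d) powr p * ?M)"
   using d by (simp add: K_def powr_divide powr_minus_divide mult_ac)
   also have "... <= C * ((rh / d) powr p * ?M)" using C(3) M0 by (intro mult_right_mono) auto
   finally show ?thesis by (simp add: mult.assoc)
  qed
  ultimately show ?case by linarith
 next
  case (2 W u g r d)
  note W = 2(1) and U = 2(2) and r = 2(3) and d = 2(4,5) and S = 2(6)
  obtain ct :: "'a => real" and sg dsg where sg: "C1 sg dsg" "!!x. sg x = ct x powr p" "!!x. 0 <= ct x" "!!x. ct x <= 1"
   "!!x. norm x <= r ==> ct x = 1" "!!x. norm x > r + d ==> ct x = 0"
   "!!x. norm (dsg x) <= (4 * p / d) * ct x powr (p - 1)"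
   by (rule cutoff_exists[OF p r d(1), where 'a='a]) (rule that)
  note [measurable] = WpD(1,2)[OF U p] C1_meas[OF sg(1)]
  have i1: "integ (%x. sg x * norm (g x) powr p)"
  proof (rule integrable_le[OF WpD(5)[OF U p]])
   show "AEL x. norm (sg x * norm (g x) powr p) <= norm (norm (g x) powr p)"
   using sg(2,3,4) p by (intro AE_I2) (simp add: abs_mult mult_left_le_one_le powr_le1)
  qed measurable
  let ?M = "LBINT x. ib (r + d) x * u x powr p"
  have M0: "?M >= 0" by (intro integral_nonneg_AE) auto
  have "(LBINT x. ib r x * norm (g x) powr p) <= (LBINT x. sg x * norm (g x) powr p)"
   using sg(5) by (intro integral_mono[OF integrable_ind_mult[OF WpD(5)[OF U p]] i1]) (auto simp: indicator_def sg(2))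
  also have "... <= Ca * d powr (- p) * ?M"
   by (rule Ca(2)[OF W U d S sg(1-4,6,7)])
  also have "... <= C * d powr (- p) * ?M" using C(2) M0 by (intro mult_right_mono) auto
  finally show ?case .
 qed
qed

text \<open>The product \<open>T * sqrt (i + 2)\<close> is split by completing a square with weight
  \<open>ln (3/2)\<close>. The growth rate 3/2 is chosen below 2, so that it is beaten by the
  contraction factor 1/2 of the iteration.\<close>

lemma exp_sqrt_le:
 fixes T :: real and i :: nat
 assumes "T >= 0"
 shows "exp (T * sqrt (real i + 2)) <= exp (T\<^sup>2 / (4 * ln (3/2))) * (9/4) * (3/2) ^ i"
proof -
 define a where "a = ln (3/2 :: real)"
 have a: "a > 0" by (simp add: a_def)
 define b where "b = sqrt (real i + 2)"
 have b: "b\<^sup>2 = real i + 2" by (simp add: b_def)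
 have "T * b <= T\<^sup>2 / (4 * a) + a * b\<^sup>2"
 proof -
  have "0 <= (T - 2 * a * b)\<^sup>2" by simp
  then have "4 * a * (T * b) <= T\<^sup>2 + 4 * a * (a * b\<^sup>2)" by (simp add: power2_eq_square algebra_simps)
  then have "T * b <= (T\<^sup>2 + 4 * a * (a * b\<^sup>2)) / (4 * a)" using a by (simp add: field_simps)
  also have "... = T\<^sup>2 / (4 * a) + a * b\<^sup>2" using a by (simp add: field_simps)
  finally show ?thesis .
 qed
 then have "exp (T * b) <= exp (T\<^sup>2 / (4 * a) + a * b\<^sup>2)" by simp
 also have "... = exp (T\<^sup>2 / (4 * a)) * exp (real (i + 2) * a)" by (simp add: exp_add b mult.commute algebra_simps)
 also have "exp (real (i + 2) * a) = (3/2) ^ (i + 2)" unfolding exp_of_nat_mult a_def by simp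
 finally show ?thesis by (simp add: a_def b_def power_add power2_eq_square mult.assoc)
qed

text \<open>Iterate the gain over balls growing from \<open>R\<close> to \<open>R + 1\<close>. With
  the level \<open>k = exp (T * d powr (-1/4))\<close>, Chebyshev's inequality for a high power of
  the logarithm makes the superlevel set small against a ball of radius proportional to
  \<open>d\<close>. The price \<open>k powr p\<close> grows subgeometrically relative to the
  contraction, so the sum converges.\<close>

lemma local_bound:
 fixes p c R al :: real
 assumes p: "p > 1" and c: "c >= 0" and R: "R >= 1"
 obtains C rh where
 "!!W u g. bddpot c (W :: 'a::euclidean_space => real) ==> Wp p u g ==> sol p W rh u g ==> normalised al u ==>
  (LBINT x. ib R x * u x powr p) <= C"
proof -
 define N where "N = DIM('a)"
 \<comment> \<open>Makes \<open>j * p / 4\<close> at least the dimension, so that the exponent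
   \<open>-1/4\<close> of \<open>d\<close> in the logarithm of the level yields a superlevel set of
   measure at most of order \<open>d ^ N\<close>.\<close>
 define j where "j = 4 * N"
 have jp: "real j * p >= 1" "real j * p / 4 >= real N"
 proof -
  have N1: "real N >= 1" using DIM_positive[where 'a='a] by (simp add: N_def)
  have Np: "real N * 1 <= real N * p" using p N1 by (intro mult_left_mono) auto
  have j: "real j * p = 4 * (real N * p)" by (simp add: j_def)
  show "real j * p >= 1" "real j * p / 4 >= real N" unfolding j using N1 Np by linarith+
 qed
 obtain Cg where Cg: "Cg > 0" "!!W u g r d rh k. bddpot c (W :: 'a => real) ==> Wp p u g ==> 0 <= r ==> 0 < d ==> d <= 1 ==> sol p W (r + d) u g ==>
  k >= 0 ==> rh > 0 ==> 2 powr p * measure lborel {x : cball 0 (r + d). u x > k} <= measure lborel (cball 0 rh :: 'a set) / 2 ==>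
  (LBINT x. ib r x * u x powr p) <= 2 * (k powr p * measure lborel (cball 0 (r + d) :: 'a set))
   + Cg * (rh / d) powr p * (LBINT x. ib (r + d) x * u x powr p)"
 proof (rule local_gain[OF p c, where 'a='a], goal_cases)
  case (1 C)
  show ?case by (rule 1(1)[OF 1(2,3)])
 qed
 have R1: "R + 1 >= 1" using R by simp
 obtain Cj0 rhj where Cj0: "ALL W u g. bddpot c (W :: 'a => real) --> Wp p u g --> super p W rhj u g --> normalised al u -->
   integ (%x. ib (R + 1) x * ln (u x + exp 1) powr (real j * p)) &
   (LBINT x. ib (R + 1) x * ln (u x + exp 1) powr (real j * p)) <= Cj0"
  using power_log_bound[OF p c, where j=j and 'a='a and al=al, rule_format, OF R1] by (elim exE) (rule that)
 define Cj where "Cj = max 0 Cj0"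
 \<comment> \<open>With \<open>rh = kp * d\<close> the gain factor
   \<open>Cg * (rh / d) powr p\<close> is exactly 1/2.\<close>
 define kp where "kp = (1 / (2 * Cg)) powr (1 / p)"
 have kp: "kp > 0" "Cg * kp powr p = 1/2" using Cg p by (auto simp: kp_def powr_powr)
 define \<omega> where "\<omega> = unit_ball_vol (real N)"
 have \<omega>: "\<omega> > 0" by (simp add: \<omega>_def)
 \<comment> \<open>Large enough for the Chebyshev bound \<open>Cj * d ^ N / T\<close> to fall below
   the volume of the ball of radius \<open>kp * d\<close>, up to the factor
   \<open>2 * 2 powr p\<close>.\<close>
 define T where "T = max 1 (2 * 2 powr p * Cj / (\<omega> * kp ^ N))"
 have T: "T >= 1" "2 * 2 powr p * Cj <= T * (\<omega> * kp ^ N)"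
 proof -
  have "2 * 2 powr p * Cj / (\<omega> * kp ^ N) <= T" by (simp add: T_def)
  then show "2 * 2 powr p * Cj <= T * (\<omega> * kp ^ N)" using \<omega> kp by (simp add: pos_divide_le_eq)
 qed (simp add: T_def)
 define V where "V = measure lborel (cball 0 (R + 1) :: 'a set)"
 define B0 where "B0 = 2 * V * (exp ((p * T)\<^sup>2 / (4 * ln (3/2))) * (9/4))"
 have B0: "B0 >= 0" by (simp add: B0_def V_def)
 define rh where "rh = max rhj (R + 1)"
 show ?thesis
 proof (rule that[of rh "4 * B0"], goal_cases)
  case (1 W u g)
  note W = 1(1) and U = 1(2) and S = 1(3) and nrm = 1(4)
  note [measurable] = WpD(1,2)[OF U p]
  have u0: "u x >= 0" for x using WpD(3)[OF U p] .
  have Sj: "super p W rhj u g" using sol_super[OF sol_mono[OF S, of rhj]] by (simp add: rh_def)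
  define M where "M r = (LBINT x. ib r x * u x powr p)" for r
  have M0: "M r >= 0" for r unfolding M_def by (intro integral_nonneg_AE) auto
  have Li: "integ (%x. ib (R + 1) x * ln (u x + exp 1) powr (real j * p))"
   and Lb: "(LBINT x. ib (R + 1) x * ln (u x + exp 1) powr (real j * p)) <= Cj"
   using Cj0[rule_format, OF W U Sj nrm] by (auto simp: Cj_def le_max_iff_disj)
  have gain: "M r <= 1/2 * M (r + d) + 2 * V * exp (p * T * d powr (- 1/4))" if rd: "0 <= r" "0 < d" "d <= 1" "r + d <= R + 1" for r d
  proof -
   \<comment> \<open>A level exponential in a negative power of the width \<open>d\<close>: its
     logarithm is large enough for Chebyshev, while along the shells it grows only like an
     exponential of a square root.\<close>
   define k where "k = exp (T * d powr (- 1/4))"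
   have lnk: "ln k = T * d powr (-1/4)" "ln k > 0" using T rd by (auto simp: k_def)
   define Sk where "Sk = {x : cball 0 (r + d). u x > k}"
   have Sk [measurable]: "Sk : sets borel" unfolding Sk_def by measurable
   have Skfin: "emeasure lborel Sk < \<infinity>"
   proof -
   have "emeasure lborel Sk <= emeasure lborel (cball 0 (r + d) :: 'a set)" by (rule emeasure_mono) (auto simp: Sk_def)
   also have "... < \<infinity>" using emeasure_lborel_cball_finite[of "0::'a" "r + d"] by (simp add: less_top)
   finally show ?thesis .
   qed
   have "measure lborel Sk * ln k powr (real j * p) = (LBINT x. indicator Sk x * ln k powr (real j * p))" by simp
   also have "... <= (LBINT x. ib (R + 1) x * ln (u x + exp 1) powr (real j * p))"
   proof (rule integral_mono[OF _ Li])
   show "integ (%x. indicator Sk x * ln k powr (real j * p))" using Skfin by (intro integrable_mult_left integrable_real_indicator) auto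
   fix x
   have "ln k powr (real j * p) <= ln (u x + exp 1) powr (real j * p)" if "u x > k"
   proof (rule powr_mono2)
   have k0: "k > 0" by (simp add: k_def)
   have "k <= u x + exp 1" using that exp_gt_zero[of "1::real"] by linarith
   then show "ln k <= ln (u x + exp 1)" using k0 by (subst ln_le_cancel_iff) linarith+
   qed (use jp lnk in auto)
   then show "indicator Sk x * ln k powr (real j * p) <= ib (R + 1) x * ln (u x + exp 1) powr (real j * p)"
   using rd(4) by (auto simp: Sk_def indicator_def)
   qed
   also have "... <= Cj" by (rule Lb)
   finally have m1: "measure lborel Sk * ln k powr (real j * p) <= Cj" .
   have m2: "T * d powr (- real N) <= ln k powr (real j * p)"
   proof -
   have "T powr 1 <= T powr (real j * p)" using T jp by (intro powr_mono) auto
   moreover have "d powr (- real N) <= d powr (- (real j * p / 4))" using rd jp by (intro powr_mono') auto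
   ultimately have "T * d powr (- real N) <= T powr (real j * p) * d powr (- (real j * p / 4))" using T by (intro mult_mono) auto
   also have "... = ln k powr (real j * p)" unfolding lnk(1) using T rd by (simp add: powr_mult powr_powr)
   finally show ?thesis .
   qed
   have "measure lborel Sk * (T * d powr (- real N)) <= Cj"
   using mult_left_mono[OF m2, of "measure lborel Sk"] m1 by simp
   then have "measure lborel Sk * T <= Cj * d ^ N"
   using rd by (simp add: powr_minus powr_realpow field_simps)
   then have "2 * 2 powr p * (measure lborel Sk * T) <= 2 * 2 powr p * (Cj * d ^ N)" by (intro mult_left_mono) auto
   also have "... = (2 * 2 powr p * Cj) * d ^ N" by simp
   also have "... <= (T * (\<omega> * kp ^ N)) * d ^ N" using T rd by (intro mult_right_mono) auto
   finally have "T * (2 * 2 powr p * measure lborel Sk) <= T * (\<omega> * (kp * d) ^ N)" by (simp add: power_mult_distrib algebra_simps)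
   then have "2 * 2 powr p * measure lborel Sk <= \<omega> * (kp * d) ^ N" using T by simp
   moreover have "measure lborel (cball 0 (kp * d) :: 'a set) = \<omega> * (kp * d) ^ N"
   using content_cball[of "kp * d" "0::'a"] kp rd by (simp add: \<omega>_def N_def)
   ultimately have sm: "2 powr p * measure lborel Sk <= measure lborel (cball 0 (kp * d) :: 'a set) / 2" by simp
   have "M r <= 2 * (k powr p * measure lborel (cball 0 (r + d) :: 'a set)) + Cg * (kp * d / d) powr p * M (r + d)"
   unfolding M_def
   by (rule Cg(2)[OF W U rd(1-3) _ _ _ sm[unfolded Sk_def]])
   (use sol_mono[OF S, of "r + d"] rd kp in \<open>auto simp: rh_def k_def\<close>)
   also have "Cg * (kp * d / d) powr p = 1/2" using kp rd by simp
   finally have Mr: "M r <= 2 * (k powr p * measure lborel (cball 0 (r + d) :: 'a set)) + 1/2 * M (r + d)" .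
   have "measure lborel (cball 0 (r + d) :: 'a set) <= V" unfolding V_def
   using rd emeasure_lborel_cball_finite[of "0::'a" "R + 1"] by (intro measure_mono_fmeasurable) (auto simp: fmeasurable_def less_top)
   then have le: "k powr p * measure lborel (cball 0 (r + d) :: 'a set) <= k powr p * V" by (intro mult_left_mono) auto
   have "k powr p * V = V * exp (p * T * d powr (- 1/4))" by (simp add: k_def powr_def mult_ac)
   then show ?thesis using Mr le by linarith
  qed
  \<comment> \<open>The widths are \<open>1 / ((i + 1) * (i + 2))\<close>, so
    \<open>d powr (- 1/4)\<close> is at most \<open>sqrt (i + 2)\<close>.\<close>
  define r where "r i = R + 1 - 1 / (real i + 1)" for i :: nat
  have step: "M (r i) <= 1/2 * M (r (Suc i)) + B0 * (3/2) ^ i" for i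
  proof -
   define d where "d = 1 / ((real i + 1) * (real i + 2))"
   have dpos: "d > 0" by (simp add: d_def)
   have d1: "d <= 1"
   proof -
   have "1 * 1 <= (real i + 1) * (real i + 2)" by (intro mult_mono) auto
   then show ?thesis by (simp add: d_def)
   qed
   have rs: "r i + d = r (Suc i)"
   proof -
   have "1 / (real i + 1) - 1 / (real i + 2) = d" unfolding d_def by (simp add: field_simps)
   then show ?thesis by (simp add: r_def algebra_simps)
   qed
   have "r i >= 0" using R by (simp add: r_def field_simps)
   moreover have "r i + d <= R + 1" unfolding rs by (simp add: r_def)
   ultimately have g: "M (r i) <= 1/2 * M (r (Suc i)) + 2 * V * exp (p * T * d powr (- 1/4))"
   using gain[of "r i" d] dpos d1 rs by simp
   have "d powr (- 1/4) = ((real i + 1) * (real i + 2)) powr (1/4)"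
   by (simp add: d_def powr_divide powr_minus_divide)
   also have "... <= ((real i + 2) * (real i + 2)) powr (1/4)" by (intro powr_mono2 mult_right_mono) auto
   also have "... = sqrt (real i + 2)"
   by (simp add: powr_half_sqrt[symmetric] powr_mult powr_add[symmetric])
   finally have "p * T * d powr (- 1/4) <= p * T * sqrt (real i + 2)" using p T by (intro mult_left_mono) auto
   then have "exp (p * T * d powr (- 1/4)) <= exp (p * T * sqrt (real i + 2))" by simp
   also have "... <= exp ((p * T)\<^sup>2 / (4 * ln (3/2))) * (9/4) * (3/2) ^ i" using p T by (intro exp_sqrt_le) auto
   finally have "2 * V * exp (p * T * d powr (- 1/4)) <= 2 * V * (exp ((p * T)\<^sup>2 / (4 * ln (3/2))) * (9/4) * (3/2) ^ i)"
   by (intro mult_left_mono) (auto simp: V_def)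
   also have "... = B0 * (3/2) ^ i" by (simp add: B0_def)
   finally show ?thesis using g by linarith
  qed
  have it: "M (r 0) <= (1/2) ^ m * M (r m) + B0 * (\<Sum>i<m. (3/4) ^ i)" for m
  proof (induction m)
   case (Suc m)
   have "(1/2) ^ m * M (r m) <= (1/2) ^ m * (1/2 * M (r (Suc m)) + B0 * (3/2) ^ m)" using step[of m] by (intro mult_left_mono) auto
   also have "... = (1/2) ^ Suc m * M (r (Suc m)) + B0 * (3/4) ^ m"
   proof -
   have "(1/2) ^ m * (3/2) ^ m = (3/4 :: real) ^ m" by (simp flip: power_mult_distrib)
   then show ?thesis by (simp add: distrib_left mult.left_commute)
   qed
   finally show ?case using Suc by (simp add: distrib_left)
  qed simp
  have "M R <= (1/2) ^ m * M (R + 1) + 4 * B0" for m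
  proof -
   have "r m <= R + 1" by (simp add: r_def)
   then have "M (r m) <= M (R + 1)" unfolding M_def
   by (intro integral_mono integrable_ind_mult WpD(4)[OF U p]) (auto simp: indicator_def)
   then have "(1/2) ^ m * M (r m) <= (1/2) ^ m * M (R + 1)" by (intro mult_left_mono) auto
   moreover have "(\<Sum>i<m. (3/4 :: real) ^ i) <= 4" by (simp add: sum_gp_strict)
   then have "B0 * (\<Sum>i<m. (3/4) ^ i) <= B0 * 4" using B0 by (intro mult_left_mono) auto
   moreover have "M (r 0) = M R" by (simp add: r_def)
   ultimately show ?thesis using it[of m] by linarith
  qed
  \<comment> \<open>\<open>M (R + 1)\<close> is finite for each solution but has no uniform bound at
    this stage; its coefficient removes it in the limit.\<close>
  moreover have "(%m. (1/2) ^ m * M (R + 1) + 4 * B0) ----> 0 * M (R + 1) + 4 * B0"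
   by (intro tendsto_intros LIMSEQ_realpow_zero) auto
  ultimately have "M R <= 0 * M (R + 1) + 4 * B0" by (intro LIMSEQ_le_const) auto
  then show ?case by (simp add: M_def)
 qed
qed

lemma local_bound_grad:
 fixes p c R al :: real
 assumes p: "p > 1" and c: "c >= 0" and R: "R >= 1"
 obtains C rh where
 "!!W u g. bddpot c (W :: 'a::euclidean_space => real) ==> Wp p u g ==> sol p W rh u g ==> normalised al u ==>
  (LBINT x. ib R x * u x powr p) <= C & (LBINT x. ib R x * norm (g x) powr p) <= C"
proof -
 have R1: "R + 1 >= 1" using R by simp
 obtain Cg where Cg: "Cg > 0" "!!W u g r d. bddpot c (W :: 'a::euclidean_space => real) ==> Wp p u g ==> 0 <= r ==> 0 < d ==> d <= 1 ==> sol p W (r + d) u g ==>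
  (LBINT x. ib r x * norm (g x) powr p) <= Cg * d powr (- p) * (LBINT x. ib (r + d) x * u x powr p)"
 proof (rule local_gain[OF p c, where 'a='a], goal_cases)
  case (1 C)
  show ?case by (rule 1(1)[OF 1(2,4)])
 qed
 obtain C rh where C: "!!W u g. bddpot c (W :: 'a => real) ==> Wp p u g ==> sol p W rh u g ==> normalised al u ==>
  (LBINT x. ib (R + 1) x * u x powr p) <= C"
 proof (rule local_bound[OF p c R1, where 'a='a and al=al], goal_cases)
  case (1 rh C)
  show ?case by (rule 1(1)[OF 1(2)])
 qed
 show ?thesis
 proof (rule that[of "max rh (R + 1)" "max C (Cg * C)"], goal_cases)
  case (1 W u g)
  have S: "sol p W rh u g" "sol p W (R + 1) u g" using sol_mono[OF 1(3)] by auto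
  have b: "(LBINT x. ib (R + 1) x * u x powr p) <= C" using C[OF 1(1,2) S(1) 1(4)] .
  have "(LBINT x. ib R x * u x powr p) <= (LBINT x. ib (R + 1) x * u x powr p)"
   by (intro integral_mono integrable_ind_mult WpD(4)[OF 1(2) p]) (auto simp: indicator_def)
  moreover have "(LBINT x. ib R x * norm (g x) powr p) <= Cg * 1 powr (- p) * (LBINT x. ib (R + 1) x * u x powr p)"
   by (rule Cg(2)[OF 1(1,2) _ _ _ S(2)]) (use R in auto)
  moreover have "Cg * 1 powr (- p) * (LBINT x. ib (R + 1) x * u x powr p) <= Cg * C" using b Cg(1) by simp
  ultimately show ?case using b by (auto simp: le_max_iff_disj)
 qed
qed

section \<open>The energy with a source, its first variation and its minimiser\<close>

text \<open>The energy of \<open>- Delta_p u + W u^(p-1) = f\<close>; the factor \<open>p\<close> at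
  the source cancels the one from differentiating p-th powers.\<close>

definition en :: "real => ('a::euclidean_space => real) => ('a => real) => ('a => real) => ('a => 'a) => real" where
 "en p W f ph G = (LBINT x. norm (G x) powr p + W x * ph x powr p - p * f x * ph x)"

lemma le_one_plus_powr: "p >= 1 ==> t >= 0 ==> t <= 1 + (t::real) powr p"
proof (cases "t <= 1")
 case False
 assume "p >= 1" "t >= 0"
 then have "t powr 1 <= t powr p" using False by (intro powr_mono) auto
 then show ?thesis using False by simp
qed (simp add: add_increasing2)

lemma en_bound:
 assumes p: "p > 1" and W: "bddpot c W" and f: "f = indicat_real (cball z r)" and ph: "ph >= 0"
  "ph powr p <= e" "norm (v::'a::euclidean_space) powr p <= e" "0 <= e"
 shows "abs (norm v powr p + W x * ph powr p - p * f x * ph) <= e + c * e + p * (indicat_real (cball z r) x + e)"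
proof -
 have "abs (W x * ph powr p) <= c * e" unfolding abs_mult using bddpotD(2,3)[OF W] ph by (intro mult_mono) auto
 moreover have "f x * ph <= indicat_real (cball z r) x + e"
  using le_one_plus_powr[of p ph] p ph by (auto simp: f indicator_def)
 then have "p * (f x * ph) <= p * (indicat_real (cball z r) x + e)" using p by (intro mult_left_mono) auto
 moreover have "0 <= p * (f x * ph)" using p ph by (simp add: f)
 ultimately show ?thesis using ph(3) powr_ge_zero[of "norm v" p] unfolding mult.assoc by linarith
qed

lemma en_integrable:
 assumes p: "p > 1" and W: "bddpot c W" and f: "f = indicat_real (cball z r)"
  and [measurable]: "u : bmeas" "g : bmeas" and u0: "AEL x. u x >= 0"
  and i: "integ (%x. u x powr p)" "integ (%x. norm (g x :: 'a::euclidean_space) powr p)"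
 shows "integ (%x. norm (g x) powr p + W x * u x powr p - p * f x * u x)"
proof (rule integrable_le)
 note [measurable] = bddpotD(1)[OF W]
 let ?e = "%x. u x powr p + norm (g x) powr p"
 show "integ (%x. ?e x + c * ?e x + p * (indicat_real (cball z r) x + ?e x))"
  using i integrable_ind_cball[of z r] by auto
 show "AEL x. norm (norm (g x) powr p + W x * u x powr p - p * f x * u x) <= norm (?e x + c * ?e x + p * (indicat_real (cball z r) x + ?e x))"
  using u0
 proof eventually_elim
  case (elim x)
  show ?case using en_bound[OF p W f elim, of "?e x" "g x" x] by (simp only: real_norm_def) (smt (verit) powr_ge_zero)
 qed
 show "(%x. norm (g x) powr p + W x * u x powr p - p * f x * u x) : borel_measurable lborel" unfolding f by measurable
qed

lemma en_tendsto:
 assumes p: "p > 1" and W: "bddpot c W" and f: "f = indicat_real (cball z r)"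
  and [measurable]: "u : bmeas" "g : bmeas"
   "!!k. ph k : bmeas" "!!k. G k : bmeas"
  and pos: "!!k x. ph k x >= 0"
  and conv: "AEL x. (%k. ph k x) ----> u x & (%k. G k x) ----> (g x :: 'a::euclidean_space)"
  and E: "integrable lborel E" "!!k. AEL x. ph k x powr p <= E x & norm (G k x) powr p <= E x"
 shows "(%k. en p W f (ph k) (G k)) ----> en p W f u g"
proof -
 note [measurable] = bddpotD(1)[OF W]
 have [measurable]: "f : bmeas" unfolding f by measurable
 show ?thesis unfolding en_def
 proof (rule integral_dominated_convergence)
  show "integ (%x. E x + c * E x + p * (indicat_real (cball z r) x + E x))"
   using E(1) integrable_ind_cball[of z r] by auto
  show "AEL x. norm (norm (G k x) powr p + W x * ph k x powr p - p * f x * ph k x) <= E x + c * E x + p * (indicat_real (cball z r) x + E x)" for k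
   using E(2)[of k]
  proof eventually_elim
   case (elim x)
   then have "E x >= 0" using powr_ge_zero order_trans by blast
   then show ?case using en_bound[OF p W f pos, of k x "E x" "G k x" x] elim by simp
  qed
  show "AEL x. (%k. norm (G k x) powr p + W x * ph k x powr p - p * f x * ph k x) ----> norm (g x) powr p + W x * u x powr p - p * f x * u x"
   using conv by eventually_elim (use p pos in \<open>auto intro!: tendsto_intros tendsto_norm_powr tendsto_nonneg_powr\<close>)
 qed measurable
qed

lemma first_variation:
 fixes g det :: "'a::euclidean_space => 'a"
 assumes p: "p > 1" and W: "bddpot c W" and f: "f = indicat_real (cball z r)" and U: "Wp p u g"
  and [measurable]: "et : bmeas" "det : bmeas"
  and i: "integ (%x. abs (et x) powr p)" "integ (%x. norm (det x) powr p)"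
  and t0: "0 < t0" "t0 <= 1" and pos: "!!t x. 0 < t ==> t <= t0 ==> u x + t * et x >= 0"
  and min: "!!t. 0 < t ==> t <= t0 ==> en p W f u g <= en p W f (%x. u x + t * et x) (%x. g x + t *\<^sub>R det x)"
 shows "(LBINT x. f x * et x) <= weakf p W u g et det"
proof -
 note [measurable] = WpD(1,2)[OF U p] bddpotD(1)[OF W]
 have [measurable]: "f : bmeas" unfolding f by measurable
 have u0: "u x >= 0" for x using WpD(3)[OF U p] .
 define t where "t n = t0 / (real n + 1)" for n :: nat
 have t: "0 < t n" "t n <= t0" "t n <= 1" for n
 proof -
  show "t n <= t0" using t0 by (simp add: t_def field_simps mult_le_cancel_left1)
  then show "t n <= 1" using t0 by simp
 qed (use t0 in \<open>simp add: t_def\<close>)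
 have tlim: "t ----> 0"
 proof -
  have "(%n. t0 * inverse (real (Suc n))) ----> t0 * 0" by (intro tendsto_intros LIMSEQ_inverse_real_of_nat)
  then show ?thesis by (simp add: t_def[abs_def] divide_inverse add.commute)
 qed
 have tat: "filterlim t (at 0) sequentially"
 proof -
  have "t n ~= 0" for n using t(1)[of n] by linarith
  then show ?thesis using tlim by (auto simp: filterlim_at)
 qed
 have iet: "integ (%x. f x * et x)"
 proof (rule integrable_le)
  show "integ (%x. indicat_real (cball z r) x + abs (et x) powr p)" using i integrable_ind_cball[of z r] by auto
  show "AEL x. norm (f x * et x) <= norm (indicat_real (cball z r) x + abs (et x) powr p)"
   using le_one_plus_powr[of p "abs (et _)"] p by (intro AE_I2) (auto simp: f indicator_def)
 qed measurable
 \<comment> \<open>An upper bound for the integrand of the difference quotient divided by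
   \<open>p\<close>: the gradient part is estimated by the tangent at the perturbed gradient, the
   potential part is the exact quotient.\<close>
 define q where "q n x = pflux p (g x + t n *\<^sub>R det x) \<bullet> det x + W x * (((u x + t n * et x) powr p - u x powr p) / (p * t n)) - f x * et x" for n x
 have [measurable]: "q n : bmeas" for n unfolding q_def by measurable
 define w where "w x = 2 powr p * (norm (g x) powr p + norm (det x) powr p) + c * (2 powr p * (u x powr p + abs (et x) powr p)) + abs (f x * et x)" for x
 have wi: "integrable lborel w" unfolding w_def
  using i iet WpD(4,5)[OF U p] by auto
 have powA: "a powr (p - 1) * b <= (a + b) powr p" "(a + b) powr (p - 1) * b <= (a + b) powr p" if "a >= 0" "b >= 0" for a b :: real
 proof -
  show 2: "(a + b) powr (p - 1) * b <= (a + b) powr p"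
   using powr_minus_one_mult[of "a + b" p] that mult_left_mono[of b "a + b" "(a + b) powr (p - 1)"] by simp
  have "a powr (p - 1) * b <= (a + b) powr (p - 1) * b" using that p by (intro mult_right_mono powr_mono2) auto
  then show "a powr (p - 1) * b <= (a + b) powr p" using 2 by linarith
 qed
 have qw: "norm (q n x) <= w x" for n x
 proof -
  have a: "abs (pflux p (g x + t n *\<^sub>R det x) \<bullet> det x) <= 2 powr p * (norm (g x) powr p + norm (det x) powr p)"
  proof -
   have "norm (g x + t n *\<^sub>R det x) <= norm (g x) + t n * norm (det x)"
   using t(1)[of n] norm_triangle_ineq[of "g x" "t n *\<^sub>R det x"] by simp
   also have "... <= norm (g x) + norm (det x)" using t(1,3)[of n] by (simp add: mult_left_le_one_le)
   finally have n1: "norm (g x + t n *\<^sub>R det x) <= norm (g x) + norm (det x)" .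
   have "abs (pflux p (g x + t n *\<^sub>R det x) \<bullet> det x) <= norm (g x + t n *\<^sub>R det x) powr (p - 1) * norm (det x)" by (rule pflux_inner_le)
   also have "... <= (norm (g x) + norm (det x)) powr (p - 1) * norm (det x)" using n1 p by (intro mult_right_mono powr_mono2) auto
   also have "... <= (norm (g x) + norm (det x)) powr p" by (rule powA) auto
   also have "... <= 2 powr p * (norm (g x) powr p + norm (det x) powr p)" using p by (intro powr_sum_le) auto
   finally show ?thesis .
  qed
  have b: "abs (W x * (((u x + t n * et x) powr p - u x powr p) / (p * t n))) <= c * (2 powr p * (u x powr p + abs (et x) powr p))"
  proof -
   have v0: "u x + t n * et x >= 0" using pos t by simp
   have "t n * et x <= abs (et x)" using t(1,3)[of n] by (metis abs_ge_self abs_ge_zero abs_mult abs_of_pos mult_left_le_one_le order_less_imp_le order_trans)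
   then have mx: "max (u x + t n * et x) (u x) <= u x + abs (et x)" by simp
   have "abs ((u x + t n * et x) powr p - u x powr p) <= p * (max (u x + t n * et x) (u x)) powr (p - 1) * abs ((u x + t n * et x) - u x)"
   by (rule powr_diff_bound[OF p v0 u0])
   also have "... <= p * (u x + abs (et x)) powr (p - 1) * (t n * abs (et x))"
   using mx p u0[of x] t(1)[of n] by (intro mult_mono powr_mono2) (auto simp: abs_mult le_max_iff_disj)
   also have "... = (p * t n) * ((u x + abs (et x)) powr (p - 1) * abs (et x))" by simp
   also have "... <= (p * t n) * (u x + abs (et x)) powr p" using p t(1)[of n] u0[of x] by (intro mult_left_mono powA) auto
   finally have "abs (((u x + t n * et x) powr p - u x powr p) / (p * t n)) <= (u x + abs (et x)) powr p"
   using p t(1)[of n] by (simp add: abs_mult divide_le_eq mult.commute)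
   also have "... <= 2 powr p * (u x powr p + abs (et x) powr p)" using p u0[of x] by (intro powr_sum_le) auto
   finally show ?thesis unfolding abs_mult using bddpotD(2,3)[OF W] by (intro mult_mono) auto
  qed
  show ?thesis unfolding q_def w_def real_norm_def using a b by linarith
 qed
 have qi: "integ (q n)" for n
 proof (rule integrable_le[OF wi])
  show "AEL x. norm (q n x) <= norm (w x)"
   using qw[of n] by (intro AE_I2) (metis abs_ge_self order_trans real_norm_def)
 qed measurable
 have qlim: "(%n. q n x) ----> pflux p (g x) \<bullet> det x + W x * u x powr (p - 1) * et x - f x * et x" for x
 proof -
  have "(%n. g x + t n *\<^sub>R det x) ----> g x + 0 *\<^sub>R det x" by (intro tendsto_intros tlim)
  then have "(%n. pflux p (g x + t n *\<^sub>R det x)) ----> pflux p (g x)"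
   using continuous_on_tendsto_compose[OF continuous_on_pflux[OF p], of "%n. g x + t n *\<^sub>R det x" "g x"] by simp
  moreover have "(%n. ((u x + t n * et x) powr p - u x powr p) / (p * t n)) ----> u x powr (p - 1) * et x"
  proof -
   \<comment> \<open>Truncation gives a two-sided derivative even where \<open>u x = 0\<close>;
     along the sequence \<open>t n\<close> the truncation is inactive by \<open>pos\<close>.\<close>
   have "((%h. (max 0 (u x + h * et x)) powr p) has_real_derivative (p * (max 0 (u x + 0 * et x)) powr (p - 1)) * et x) (at 0)"
   by (rule DERIV_chain2[where f = "%y. (max 0 y) powr p", OF has_real_derivative_pos_powr[OF p]]) (auto intro!: derivative_eq_intros)
   then have "((%h. ((max 0 (u x + h * et x)) powr p - u x powr p) / h) \<longlongrightarrow> p * u x powr (p - 1) * et x) (at 0)"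
   using u0[of x] unfolding DERIV_def by simp
   then have "(%n. ((max 0 (u x + t n * et x)) powr p - u x powr p) / t n) ----> p * u x powr (p - 1) * et x"
   by (rule filterlim_compose[OF _ tat])
   then have "(%n. ((max 0 (u x + t n * et x)) powr p - u x powr p) / t n / p) ----> p * u x powr (p - 1) * et x / p"
   using p by (intro tendsto_divide tendsto_const) auto
   moreover have "max 0 (u x + t n * et x) = u x + t n * et x" for n using pos[of "t n" x] t[of n] by simp
   ultimately show ?thesis using p by (simp add: mult.commute)
  qed
  ultimately show ?thesis unfolding q_def mult.assoc by (intro tendsto_intros)
 qed
 have lim: "(%n. LBINT x. q n x) ----> (LBINT x. pflux p (g x) \<bullet> det x + W x * u x powr (p - 1) * et x - f x * et x)"
  by (rule integral_dominated_convergence[OF _ _ wi]) (use qw qlim in auto)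
 have "(LBINT x. q n x) >= 0" for n
 proof -
  let ?v = "%x. u x + t n * et x" and ?gv = "%x. g x + t n *\<^sub>R det x"
  have v0: "?v x >= 0" for x using pos t by simp
  have vi: "integ (%x. ?v x powr p)"
  proof (rule integrable_le)
   show "integ (%x. 2 powr p * (u x powr p + abs (et x) powr p))" using i WpD(4)[OF U p] by auto
   have "?v x powr p <= 2 powr p * (u x powr p + abs (et x) powr p)" for x
   proof -
   have "t n * et x <= abs (et x)" using t(1,3)[of n] by (metis abs_ge_self abs_ge_zero abs_mult abs_of_pos mult_left_le_one_le order_less_imp_le order_trans)
   then have "?v x powr p <= (u x + abs (et x)) powr p" using v0[of x] p by (intro powr_mono2) auto
   also have "... <= 2 powr p * (u x powr p + abs (et x) powr p)" using p u0[of x] by (intro powr_sum_le) auto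
   finally show ?thesis .
   qed
   then show "AEL x. norm (?v x powr p) <= norm (2 powr p * (u x powr p + abs (et x) powr p))" by simp
  qed measurable
  have gvi: "integ (%x. norm (?gv x) powr p)"
  proof (rule integrable_le)
   show "integ (%x. 2 powr p * (norm (g x) powr p + norm (det x) powr p))" using i WpD(5)[OF U p] by auto
   have "norm (?gv x) powr p <= 2 powr p * (norm (g x) powr p + norm (det x) powr p)" for x
   proof -
   have "norm (?gv x) powr p <= 2 powr p * (norm (g x) powr p + norm (t n *\<^sub>R det x) powr p)" using p by (intro norm_add_powr_le) auto
   also have "... <= 2 powr p * (norm (g x) powr p + norm (det x) powr p)"
   using t(1,3)[of n] p by (intro mult_left_mono add_left_mono powr_mono2) (auto simp: mult_left_le_one_le)
   finally show ?thesis .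
   qed
   then show "AEL x. norm (norm (?gv x) powr p) <= norm (2 powr p * (norm (g x) powr p + norm (det x) powr p))" by simp
  qed measurable
  have e1: "integ (%x. norm (?gv x) powr p + W x * ?v x powr p - p * f x * ?v x)"
   by (rule en_integrable[OF p W f _ _ _ vi gvi]) (use v0 in auto)
  have e2: "integ (%x. norm (g x) powr p + W x * u x powr p - p * f x * u x)"
   by (rule en_integrable[OF p W f _ _ _ WpD(4,5)[OF U p]]) (use u0 in auto)
  have "0 <= (en p W f ?v ?gv - en p W f u g) / (p * t n)"
   using min[OF t(1)[of n] t(2)[of n]] t(1)[of n] p by simp
  also have "... = (LBINT x. ((norm (?gv x) powr p + W x * ?v x powr p - p * f x * ?v x) - (norm (g x) powr p + W x * u x powr p - p * f x * u x)) / (p * t n))"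
   unfolding en_def using e1 e2 by simp
  also have "... <= (LBINT x. q n x)"
  proof (rule integral_mono[OF _ qi])
   show "integ (%x. ((norm (?gv x) powr p + W x * ?v x powr p - p * f x * ?v x) - (norm (g x) powr p + W x * u x powr p - p * f x * u x)) / (p * t n))"
   using e1 e2 by auto
   fix x
   have pt: "p * t n > 0" using p t(1)[of n] by simp
   have "norm (?gv x) powr p - norm (g x) powr p <= (p * t n) * (pflux p (?gv x) \<bullet> det x)"
   using norm_powr_tangent[OF p, of "?gv x" "g x"] by (simp add: inner_diff_right inner_add_right algebra_simps)
   then have "(norm (?gv x) powr p - norm (g x) powr p) / (p * t n) <= pflux p (?gv x) \<bullet> det x" using pt by (simp add: pos_divide_le_eq mult.commute)
   moreover have "((norm (?gv x) powr p + W x * ?v x powr p - p * f x * ?v x) - (norm (g x) powr p + W x * u x powr p - p * f x * u x)) / (p * t n)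
   = (norm (?gv x) powr p - norm (g x) powr p) / (p * t n) + W x * ((?v x powr p - u x powr p) / (p * t n)) - f x * et x"
   using pt t(1)[of n] p by (simp add: field_simps)
   ultimately show "((norm (?gv x) powr p + W x * ?v x powr p - p * f x * ?v x) - (norm (g x) powr p + W x * u x powr p - p * f x * u x)) / (p * t n) <= q n x"
   unfolding q_def by simp
  qed
  finally show ?thesis .
 qed
 then have "0 <= (LBINT x. pflux p (g x) \<bullet> det x + W x * u x powr (p - 1) * et x - f x * et x)"
  using lim by (intro LIMSEQ_le_const[OF lim]) auto
 also have "... = weakf p W u g et det - (LBINT x. f x * et x)"
  unfolding weakf_def by (rule Bochner_Integration.integral_diff[OF weakf_integrable[OF p W U _ _ i] iet]) auto
 finally show ?thesis by simp
qed

lemma C1_supp_integrable: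
 assumes "C1 ph (G :: 'a::euclidean_space => 'a)" "supp_in ph r" "p > 0"
 shows "integ (%x. abs (ph x) powr p)" "integ (%x. norm (G x) powr p)"
proof -
 obtain B where B: "B > 0" "!!x. abs (ph x) <= B" "!!x. norm (G x) <= B"
  by (rule C1_supp_bounded[OF assms(1,2)]) (rule that)
 note [measurable] = C1_meas[OF assms(1)]
 have i: "integ (%x::'a. B powr p * indicat_real (cball 0 r) x)" using integrable_ind_cball[of "0::'a" r] by auto
 have "abs (ph x) powr p <= B powr p * indicat_real (cball 0 r) x" for x
  using B(2)[of x] assms(2,3) by (cases "norm x <= r") (auto simp: supp_in_def intro: powr_mono2)
 then show "integ (%x. abs (ph x) powr p)" by (intro integrable_le[OF i]) auto
 have "norm (G x) powr p <= B powr p * indicat_real (cball 0 r) x" for x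
  using B(3)[of x] supp_in_grad[OF assms(1,2), of x] assms(3) by (cases "norm x <= r") (auto intro: powr_mono2)
 then show "integ (%x. norm (G x) powr p)" by (intro integrable_le[OF i]) auto
qed

text \<open>Lets the coercive part of the energy absorb the linear source term up to a
  constant.\<close>

lemma powr_absorb_linear:
 fixes p e :: real
 assumes "p > 1" "e > 0"
 obtains K where "K >= 0" "!!t. t >= 0 ==> t <= e * t powr p + K"
proof -
 define K where "K = (1 / e) powr (1 / (p - 1))"
 have "t <= e * t powr p + K" if "t >= 0" for t
 proof (cases "t <= K")
  case True
  have "0 <= e * t powr p" using assms by simp
  then show ?thesis using True by linarith
 next
  case False
  have "1 / e = K powr (p - 1)" using assms by (simp add: K_def powr_powr)
  also have "... <= t powr (p - 1)" using False assms by (intro powr_mono2) (auto simp: K_def)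
  finally have "1 <= e * t powr (p - 1)" using assms by (simp add: field_simps)
  then have "1 * t <= e * t powr (p - 1) * t" using that by (intro mult_right_mono) auto
  then show ?thesis using powr_minus_one_mult[OF that, of p] by (simp add: K_def mult.assoc add_increasing2)
 qed
 then show ?thesis using that[of K] by (simp add: K_def)
qed

lemma cancel_fractions:
 fixes a b e :: real
 assumes "a > 0" "b > 0"
 shows "e / (4 * a) * (2 * a) = e / 2" "a * (e / (2 * a)) = e / 2"
  "a * (e / (16 * a * b) * (4 * b)) = e / 4" "a * (b * (e / (4 * a * b))) = e / 4"
 using assms by (auto simp: field_simps)

text \<open>Rellich's theorem makes a minimising sequence Cauchy in \<open>L^p\<close>. The midpoint
  of two members is again admissible, so its energy is at least the infimum; this forces the
  convexity gap of the gradients to 0 and makes the gradients Cauchy as well. The minimiser thus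
  comes with C1 approximants supported in the same ball.\<close>

lemma energy_minimiser:
 fixes W :: "'a::euclidean_space => real"
 assumes p: "p > 1" and W: "bddpot c W" and gm: "gm > 0" and f: "f = indicat_real (cball z a)"
  and coer: "!!ph G. C1 ph G ==> (!!x. ph x >= 0) ==> supp_in ph rh ==>
   gm * (LBINT x. ph x powr p) <= (LBINT x. norm (G x) powr p + W x * ph x powr p)"
 obtains ph G D u g where "approx p ph G D u g" "!!k. supp_in (ph k) rh"
  "!!py H. C1 py H ==> (!!x. py x >= 0) ==> supp_in py rh ==> en p W f u g <= en p W f py H"
proof -
 have p0: "p > 0" using p by simp
 have c0: "c >= 0" using bddpotD(3)[OF W] .
 note [measurable] = bddpotD(1)[OF W]
 define Ad where "Ad ph G \<longleftrightarrow> C1 ph G & (ALL x. ph x >= 0) & supp_in ph rh" for ph :: "'a => real" and G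
 have AdD: "C1 ph G" "ph x >= 0" "supp_in ph rh" "ph : bmeas" "G : bmeas"
  "integ (%x. ph x powr p)" "integ (%x. norm (G x) powr p)" if "Ad ph G" for ph G x
  using that C1_meas[of ph G] C1_supp_integrable[of ph G rh p] p unfolding Ad_def by auto
 define V where "V = measure lborel (cball z a)"
 have e2: "gm / (2 * p) > 0" using gm p by simp
 obtain K where K: "K >= 0" "!!t. t >= 0 ==> t <= gm / (2 * p) * t powr p + K"
  by (rule powr_absorb_linear[OF p e2]) (rule that)
 define E0 where "E0 ph G = (LBINT x. norm (G x) powr p + W x * ph x powr p)" for ph :: "'a => real" and G :: "'a => 'a"
 have Wi: "integ (%x. W x * ph x powr p)" if "Ad ph G" for ph G
 proof (rule integrable_le[OF integrable_mult_right[OF AdD(6)[OF that], of c]])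
  note [measurable] = AdD(4,5)[OF that]
  show "AEL x. norm (W x * ph x powr p) <= norm (c * ph x powr p)"
   using bddpotD(2)[OF W] c0 by (intro AE_I2) (auto simp: abs_mult intro!: mult_right_mono)
  show "(%x. W x * ph x powr p) : borel_measurable lborel" by measurable
 qed
 have E0i: "integ (%x. norm (G x) powr p + W x * ph x powr p)" if "Ad ph G" for ph G
  using Wi[OF that] AdD(7)[OF that] by auto
 have fi: "integ (%x. p * f x * ph x)" if "Ad ph G" for ph G
 proof (rule integrable_le)
  note [measurable] = AdD(4,5)[OF that]
  show "integ (%x. p * (indicat_real (cball z a) x + ph x powr p))" using AdD(6)[OF that] integrable_ind_cball[of z a] by auto
  show "AEL x. norm (p * f x * ph x) <= norm (p * (indicat_real (cball z a) x + ph x powr p))"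
   using le_one_plus_powr[of p] p AdD(2)[OF that] by (intro AE_I2) (auto simp: f indicator_def abs_mult)
  show "(%x. p * f x * ph x) : borel_measurable lborel" unfolding f by measurable
 qed
 have enE: "en p W f ph G = E0 ph G - (LBINT x. p * f x * ph x)" if "Ad ph G" for ph G
  unfolding en_def E0_def by (rule Bochner_Integration.integral_diff[OF E0i[OF that] fi[OF that]])
 \<comment> \<open>Half of the coercive energy pays for the source, so bounded energy bounds
   \<open>E0\<close> and then both norms.\<close>
 have low: "E0 ph G / 2 - p * K * V <= en p W f ph G" if A: "Ad ph G" for ph G
 proof -
  have "(LBINT x. p * f x * ph x) <= (LBINT x. gm / 2 * ph x powr p + p * K * indicat_real (cball z a) x)"
  proof (rule integral_mono[OF fi[OF A]])
   show "integ (%x. gm / 2 * ph x powr p + p * K * indicat_real (cball z a) x)"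
   using AdD(6)[OF A] integrable_ind_cball[of z a] by auto
   fix x
   have "p * ph x <= p * (gm / (2 * p) * ph x powr p + K)" using K(2)[OF AdD(2)[OF A], of x] p by (intro mult_left_mono) auto
   also have "... = gm / 2 * ph x powr p + p * K" using p by (simp add: field_simps)
   finally show "p * f x * ph x <= gm / 2 * ph x powr p + p * K * indicat_real (cball z a) x"
   using gm K(1) p by (auto simp: f indicator_def)
  qed
  also have "... = gm / 2 * (LBINT x. ph x powr p) + p * K * V" using AdD(6)[OF A] integrable_ind_cball[of z a] by (simp add: V_def)
  also have "gm / 2 * (LBINT x. ph x powr p) <= E0 ph G / 2" using coer[of ph G] AdD(1,2,3)[OF A] unfolding E0_def by simp
  finally show ?thesis using enE[OF A] by linarith
 qed
 have E0pos: "gm * (LBINT x. ph x powr p) <= E0 ph G" "0 <= E0 ph G" if A: "Ad ph G" for ph G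
 proof -
  show 1: "gm * (LBINT x. ph x powr p) <= E0 ph G" using coer[of ph G] AdD(1,2,3)[OF A] unfolding E0_def by simp
  have "0 <= gm * (LBINT x. ph x powr p)" using gm by (intro mult_nonneg_nonneg integral_nonneg_AE) auto
  then show "0 <= E0 ph G" using 1 by linarith
 qed
 define X where "X = {en p W f ph G | ph G. Ad ph G}"
 have Ad0: "Ad (%x. 0) (%x. 0)" using C1_const[of 0] by (simp add: Ad_def supp_in_def)
 have Xne: "X ~= {}" using Ad0 by (auto simp: X_def)
 have Xbd: "bdd_below X" unfolding X_def
 proof (rule bdd_belowI[of _ "- (p * K * V)"], clarify)
  fix ph G assume "Ad ph G"
  then show "- (p * K * V) <= en p W f ph G" using low[of ph G] E0pos(2)[of ph G] by simp
 qed
 define m where "m = Inf X"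
 have mle: "m <= en p W f ph G" if "Ad ph G" for ph G unfolding m_def using Xbd that by (intro cInf_lower) (auto simp: X_def)
 have "EX ph G. Ad ph G & en p W f ph G < m + 1 / real (Suc k)" for k
  using cInf_lessD[OF Xne, of "m + 1 / real (Suc k)"] unfolding m_def X_def by auto
 then obtain ph G where Ad: "!!k. Ad (ph k) (G k)" and enk: "!!k. en p W f (ph k) (G k) < m + 1 / real (Suc k)" by metis
 note AdD' = AdD[OF Ad]
 note [measurable] = AdD'(4,5)
 define E1 where "E1 = 2 * (m + 1 + p * K * V)"
 have E1: "E0 (ph k) (G k) <= E1" for k
 proof -
  have "en p W f (ph k) (G k) < m + 1" using enk[of k] by (rule less_le_trans) (simp add: field_simps)
  then show ?thesis using low[OF Ad[of k]] by (simp add: E1_def)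
 qed
 define P where "P = E1 / gm"
 have Pk: "(LBINT x. ph k x powr p) <= P" for k
  using E0pos(1)[OF Ad[of k]] E1[of k] gm by (simp add: P_def field_simps)
 have P0: "P >= 0" using Pk[of 0] by (rule order_trans[rotated]) (intro integral_nonneg_AE, auto)
 define Q where "Q = E1 + c * P"
 have Qk: "(LBINT x. norm (G k x) powr p) <= Q" for k
 proof -
  have "E0 (ph k) (G k) = (LBINT x. norm (G k x) powr p) + (LBINT x. W x * ph k x powr p)"
   unfolding E0_def by (rule Bochner_Integration.integral_add[OF AdD'(7) Wi[OF Ad]])
  moreover have "- (c * (LBINT x. ph k x powr p)) <= (LBINT x. W x * ph k x powr p)"
  proof -
   have "(LBINT x. - c * ph k x powr p) <= (LBINT x. W x * ph k x powr p)"
   proof (rule integral_mono[OF _ Wi[OF Ad]])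
   show "integ (%x. - c * ph k x powr p)" using AdD'(6) by auto
   show "- c * ph k x powr p <= W x * ph k x powr p" for x using bddpotD(2)[OF W, of x] by (intro mult_right_mono) auto
   qed
   then show ?thesis by simp
  qed
  moreover have "c * (LBINT x. ph k x powr p) <= c * P" using Pk c0 by (intro mult_left_mono) auto
  ultimately show ?thesis using E1[of k] by (simp add: Q_def)
 qed
 have Q0: "Q >= 0" using Qk[of 0] by (rule order_trans[rotated]) (intro integral_nonneg_AE, auto)
 obtain r where r: "strict_mono (r :: nat => nat)"
  "!!R e. e > 0 ==> EX N. ALL m>=N. ALL n>=N. (LBINT x. ib R x * abs (ph (r m) x - ph (r n) x) powr p) <= e"
 proof (rule Rellich[OF p, of ph])
  show "integ (%x. abs (ph n x) powr p)" for n using AdD'(2,6) by simp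
  show "EX C>=0. ALL n. (LBINT x. ib R x * abs (ph n x) powr p) <= C &
   (ALL z. norm z <= 1 --> (\<integral>\<^sup>+x. ib R x * ennreal (abs (ph n (x + z) - ph n x) powr p) \<partial>lborel) <= ennreal (C * norm z powr p))" for R
  proof (intro exI[of _ "P + Q"] conjI allI impI)
   fix n
   have "(LBINT x. ib R x * abs (ph n x) powr p) <= (LBINT x. ph n x powr p)"
   using AdD'(2,6) by (intro integral_mono integrable_ind_mult) (auto simp: indicator_def)
   then show "(LBINT x. ib R x * abs (ph n x) powr p) <= P + Q" using Pk[of n] Q0 by linarith
   fix z :: 'a
   have "(\<integral>\<^sup>+x. ib R x * ennreal (abs (ph n (x + z) - ph n x) powr p) \<partial>lborel)
   <= ennreal (norm z powr p) * (\<integral>\<^sup>+x. ib (R + norm z) x * ennreal (norm (G n x) powr p) \<partial>lborel)"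
   by (rule C1_translation[OF p AdD'(1)])
   also have "... <= ennreal (norm z powr p) * (\<integral>\<^sup>+x. ennreal (norm (G n x) powr p) \<partial>lborel)"
   by (intro mult_left_mono nn_integral_mono) (auto simp: indicator_def)
   also have "(\<integral>\<^sup>+x. ennreal (norm (G n x) powr p) \<partial>lborel) = ennreal (LBINT x. norm (G n x) powr p)"
   by (rule nn_integral_eq_integral[OF AdD'(7)]) auto
   also have "ennreal (norm z powr p) * ... = ennreal (norm z powr p * (LBINT x. norm (G n x) powr p))" by (simp add: ennreal_mult'')
   also have "... <= ennreal ((P + Q) * norm z powr p)"
   using Qk[of n] P0 by (subst mult.commute, intro ennreal_leI mult_right_mono) auto
   finally show "(\<integral>\<^sup>+x. ib R x * ennreal (abs (ph n (x + z) - ph n x) powr p) \<partial>lborel) <= ennreal ((P + Q) * norm z powr p)" .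
  qed (use P0 Q0 in auto)
 qed (use that in auto)
 have di: "integ (%x. abs (ph m x - ph n x) powr p)" for m n
 proof (rule integrable_le)
  show "integ (%x. 2 powr p * (ph m x powr p + ph n x powr p))" using AdD'(6) by auto
  show "AEL x. norm (abs (ph m x - ph n x) powr p) <= norm (2 powr p * (ph m x powr p + ph n x powr p))"
  proof (intro AE_I2)
   fix x show "norm (abs (ph m x - ph n x) powr p) <= norm (2 powr p * (ph m x powr p + ph n x powr p))"
   using norm_diff_powr_le[OF p0, of "ph m x" "ph n x"] AdD'(2)[of m x] AdD'(2)[of n x] by simp
  qed
 qed measurable
 have Cphi: "EX N. ALL m>=N. ALL n>=N. (LBINT x. abs (ph (r m) x - ph (r n) x) powr p) <= e" if "e > 0" for e
 proof -
  have "ib rh x * abs (ph m x - ph n x) powr p = abs (ph m x - ph n x) powr p" for m n x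
   using AdD'(3)[of m] AdD'(3)[of n] by (cases "norm x <= rh") (auto simp: supp_in_def)
  then show ?thesis using r(2)[OF that, of rh] by (simp only:)
 qed
 \<comment> \<open>Four tolerances: \<open>e1\<close> weighs the gradient norms, \<open>e2\<close>
   the total gap, while \<open>e3\<close> and \<open>e4\<close> split the potential discrepancy into
   a small multiple of the mass and an \<open>L^p\<close> distance.\<close>
 have CG: "EX N. ALL m>=N. ALL n>=N. (LBINT x. norm (G (r m) x - G (r n) x) powr p) <= e" if e: "e > 0" for e
 proof -
  define e1 where "e1 = e / (4 * (Q + 1))"
  have e1: "e1 > 0" "e1 * (2 * Q) <= e / 2"
  proof -
   show "e1 > 0" using e Q0 by (simp add: e1_def)
   have "e1 * (2 * Q) <= e1 * (2 * (Q + 1))" using \<open>e1 > 0\<close> by (intro mult_left_mono) auto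
   also have "... = e / 2" unfolding e1_def by (rule cancel_fractions[of _ 1]) (use Q0 in auto)
   finally show "e1 * (2 * Q) <= e / 2" .
  qed
  obtain C where C: "C >= 0" "!!a b::'a. norm (a - b) powr p <= e1 * (norm a powr p + norm b powr p) + C * convgap p a b"
   by (rule norm_diff_convgap[OF p e1(1), where 'a='a]) (rule that)
  define e2 where "e2 = e / (2 * (C + 1))"
  have e2: "e2 > 0" "C * e2 <= e / 2"
  proof -
   show "e2 > 0" using e C by (simp add: e2_def)
   have "C * e2 <= (C + 1) * e2" using \<open>e2 > 0\<close> by (intro mult_right_mono) auto
   also have "... = e / 2" unfolding e2_def by (rule cancel_fractions[of _ 1]) (use C in auto)
   finally show "C * e2 <= e / 2" .
  qed
  define e3 where "e3 = e2 / (16 * (c + 1) * (P + 1))"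
  have e3: "e3 > 0" "c * (e3 * (4 * P)) <= e2 / 4"
  proof -
   show "e3 > 0" using e2 c0 P0 by (simp add: e3_def)
   have "c * (e3 * (4 * P)) <= (c + 1) * (e3 * (4 * (P + 1)))" using \<open>e3 > 0\<close> c0 P0 by (intro mult_mono mult_left_mono) auto
   also have "... = e2 / 4"
   unfolding e3_def by (rule cancel_fractions) (use c0 P0 in auto)
   finally show "c * (e3 * (4 * P)) <= e2 / 4" .
  qed
  obtain C' where C': "C' >= 0" "!!a b. a >= 0 ==> b >= 0 ==> (abs (a powr p - b powr p)) <= e3 * (a powr p + b powr p) + C' * abs (a - b) powr p"
   by (rule powr_diff_eps[OF p e3(1)]) (rule that)
  define e4 where "e4 = e2 / (4 * (c + 1) * (C' + 1))"
  have e4: "e4 > 0" "c * (C' * e4) <= e2 / 4"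
  proof -
   show "e4 > 0" using e2 c0 C' by (simp add: e4_def)
   have "c * (C' * e4) <= (c + 1) * ((C' + 1) * e4)" using \<open>e4 > 0\<close> c0 C' by (intro mult_mono mult_right_mono) auto
   also have "... = e2 / 4"
   unfolding e4_def by (rule cancel_fractions) (use c0 C'(1) in auto)
   finally show "c * (C' * e4) <= e2 / 4" .
  qed
  obtain N1 where N1: "!!m n. m >= N1 ==> n >= N1 ==> (LBINT x. abs (ph (r m) x - ph (r n) x) powr p) <= e4" using Cphi[OF e4(1)] by blast
  obtain N2 where N2: "1 / real (Suc N2) < e2 / 2" using reals_Archimedean[of "e2 / 2"] e2 by (auto simp: inverse_eq_divide)
  show ?thesis
  proof (intro exI[of _ "max N1 N2"] allI impI)
   fix m' n' assume mn: "max N1 N2 <= m'" "max N1 N2 <= n'"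
   define i where "i = r m'"
   define j where "j = r n'"
   have ij: "i >= N2" "j >= N2" using mn seq_suble[OF r(1)] by (auto simp: i_def j_def intro: order_trans)
   have small: "1 / real (Suc k) < e2 / 2" if "k >= N2" for k
   proof -
   have "1 / real (Suc k) <= 1 / real (Suc N2)" using that by (intro divide_left_mono) auto
   then show ?thesis using N2 by linarith
   qed
   let ?\<mu> = "%x. 1/2 * (ph i x + ph j x)" and ?M = "%x. (1/2) *\<^sub>R (G i x + G j x)"
   have Adm: "Ad ?\<mu> ?M" unfolding Ad_def
   using C1_cmult[OF C1_add[OF AdD'(1)[of i] AdD'(1)[of j]], of "1/2"] AdD'(2,3) by (auto simp: supp_in_def)
   note Admd = AdD[OF Adm]
   have cgi: "integ (%x. convgap p (G i x) (G j x))" unfolding convgap_def using AdD'(7) Admd(7) by auto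
   let ?h = "%x. W x * ?\<mu> x powr p - (W x * ph i x powr p + W x * ph j x powr p) / 2"
   have hi: "integ ?h" using Wi[OF Ad] Wi[OF Adm] by auto
   have fmid: "(LBINT x. p * f x * ?\<mu> x) = ((LBINT x. p * f x * ph i x) + (LBINT x. p * f x * ph j x)) / 2"
   proof -
   have "(%x. p * f x * ?\<mu> x) = (%x. (p * f x * ph i x + p * f x * ph j x) / 2)" by (auto simp: fun_eq_iff algebra_simps)
   then show ?thesis using fi[OF Ad[of i]] fi[OF Ad[of j]] by simp
   qed
   \<comment> \<open>The source is linear and cancels, so the gap equals the mean of the two
     energies minus that of the midpoint, plus the failure of the potential term to be
     affine.\<close>
   have cg: "(LBINT x. convgap p (G i x) (G j x)) = (en p W f (ph i) (G i) + en p W f (ph j) (G j)) / 2 - en p W f ?\<mu> ?M + (LBINT x. ?h x)"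
   proof -
   have a1: "(LBINT x. convgap p (G i x) (G j x)) = ((LBINT x. norm (G i x) powr p) + (LBINT x. norm (G j x) powr p)) / 2 - (LBINT x. norm (?M x) powr p)"
   unfolding convgap_def using AdD'(7) Admd(7) by simp
   have a2: "(LBINT x. ?h x) = (LBINT x. W x * ?\<mu> x powr p) - ((LBINT x. W x * ph i x powr p) + (LBINT x. W x * ph j x powr p)) / 2"
   using Wi[OF Ad] Wi[OF Adm] by simp
   have a3: "en p W f py H = (LBINT x. norm (H x) powr p) + (LBINT x. W x * py x powr p) - (LBINT x. p * f x * py x)" if "Ad py H" for py H
   unfolding enE[OF that] E0_def using AdD(7)[OF that] Wi[OF that] by simp
   have field: "(A + B) / 2 - M = ((A + a - k) + (B + b - l)) / 2 - (M + w - (k + l) / 2) + (w - (a + b) / 2)" for A B M a b k l w :: real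
   by argo
   show ?thesis unfolding a1 a2 a3[OF Ad[of i]] a3[OF Ad[of j]] a3[OF Adm] fmid by (rule field)
   qed
   have hle: "(LBINT x. ?h x) <= e2 / 2"
   proof -
   have hb: "?h x <= c * (e3 * (2 * (ph i x powr p + ph j x powr p)) + C' * abs (ph i x - ph j x) powr p)" for x
   proof -
   let ?a = "ph i x" and ?b = "ph j x" and ?u = "?\<mu> x"
   have ab: "?a >= 0" "?b >= 0" "?u >= 0" using AdD'(2) by auto
   have um: "?u powr p <= ?a powr p + ?b powr p"
   proof -
   have "?u powr p <= (max ?a ?b) powr p" using ab p by (intro powr_mono2) auto
   also have "... <= ?a powr p + ?b powr p" by (auto simp: max_def)
   finally show ?thesis .
   qed
   have half: "abs (?u powr p - s powr p) <= e3 * (2 * (?a powr p + ?b powr p)) + C' * abs (?a - ?b) powr p" if s: "s = ?a \<or> s = ?b" for s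
   proof -
   have s0: "s >= 0" using s ab by auto
   have "abs (?u powr p - s powr p) <= e3 * (?u powr p + s powr p) + C' * abs (?u - s) powr p" by (rule C'(2)[OF ab(3) s0])
   also have "... <= e3 * (2 * (?a powr p + ?b powr p)) + C' * abs (?a - ?b) powr p"
   proof (intro add_mono mult_left_mono powr_mono2)
   have "s powr p <= ?a powr p + ?b powr p" using s by auto
   from add_mono[OF um this] show "?u powr p + s powr p <= 2 * (?a powr p + ?b powr p)" by (simp only: mult_2)
   show "abs (?u - s) <= abs (?a - ?b)" using s by (auto simp: abs_if field_simps)
   qed (use e3 C' p in auto)
   finally show ?thesis .
   qed
   have "?h x = W x * (((?u powr p - ?a powr p) + (?u powr p - ?b powr p)) / 2)" by (simp add: algebra_simps)
   also have "... <= abs (W x) * abs (((?u powr p - ?a powr p) + (?u powr p - ?b powr p)) / 2)" by (metis abs_ge_self abs_mult)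
   also have "... <= c * (e3 * (2 * (?a powr p + ?b powr p)) + C' * abs (?a - ?b) powr p)"
   using half[of ?a] half[of ?b] bddpotD(2)[OF W, of x] c0 by (intro mult_mono) auto
   finally show ?thesis .
   qed
   have "(LBINT x. ?h x) <= (LBINT x. c * (e3 * (2 * (ph i x powr p + ph j x powr p)) + C' * abs (ph i x - ph j x) powr p))"
   by (rule integral_mono[OF hi _ hb]) (use AdD'(6) di in auto)
   also have "... = c * (e3 * (2 * ((LBINT x. ph i x powr p) + (LBINT x. ph j x powr p))) + C' * (LBINT x. abs (ph i x - ph j x) powr p))"
   using AdD'(6) di by simp
   also have "... <= c * (e3 * (4 * P) + C' * e4)"
   proof (intro mult_left_mono add_mono)
   show "2 * ((LBINT x. ph i x powr p) + (LBINT x. ph j x powr p)) <= 4 * P" using Pk[of i] Pk[of j] by simp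
   show "(LBINT x. abs (ph i x - ph j x) powr p) <= e4" unfolding i_def j_def using N1[of m' n'] mn by simp
   qed (use c0 e3 C' in auto)
   also have "... <= e2 / 2" using e3(2) e4(2) by (simp add: distrib_left)
   finally show ?thesis .
   qed
   have cgle: "(LBINT x. convgap p (G i x) (G j x)) <= e2"
   proof -
   have "(A + B) / 2 - M + H <= e" if "A < m + a" "B < m + b" "a < e / 2" "b < e / 2" "m <= M" "H <= e / 2" for A B M H a b e :: real
   using that by argo
   from this[OF enk[of i] enk[of j] small[OF ij(1)] small[OF ij(2)] mle[OF Adm] hle] show ?thesis unfolding cg .
   qed
   have gi: "integ (%x. e1 * (norm (G i x) powr p + norm (G j x) powr p) + C * convgap p (G i x) (G j x))" using AdD'(7) cgi by auto
   have "(LBINT x. norm (G i x - G j x) powr p) <= (LBINT x. e1 * (norm (G i x) powr p + norm (G j x) powr p) + C * convgap p (G i x) (G j x))"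
   by (rule integral_mono'[OF gi C(2)]) (auto intro: order_trans[OF powr_ge_zero C(2)])
   also have "... = e1 * ((LBINT x. norm (G i x) powr p) + (LBINT x. norm (G j x) powr p)) + C * (LBINT x. convgap p (G i x) (G j x))"
   using AdD'(7) cgi by simp
   also have "... <= e1 * (2 * Q) + C * e2" using Qk[of i] Qk[of j] cgle e1 C by (intro add_mono mult_left_mono) auto
   also have "... <= e" using e1 e2 by simp
   finally show "(LBINT x. norm (G (r m') x - G (r n') x) powr p) <= e" by (simp add: i_def j_def)
  qed
 qed
 obtain r1 h where r1: "strict_mono r1" "h : bmeas"
  "!!k::nat. EX D. integrable lborel D & (ALL n>=k. AEL x. x : UNIV --> norm (ph (r (r1 n)) x) powr p <= D x)"
  "AEL x. x : (\<Union>k::nat. UNIV) --> (%n. ph (r (r1 n)) x) ----> h x"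
  by (rule Lp_Cauchy_subseq[OF p0, of "%k. ph (r k)" "%k. UNIV"])
   (use AdD'(2,6) Cphi that in \<open>auto simp: incseq_def\<close>)
 obtain D1 where D1: "integrable lborel D1" "!!n. AEL x. norm (ph (r (r1 n)) x) powr p <= D1 x" using r1(3)[of 0] by auto
 have r1m: "n <= r1 n" for n using seq_suble[OF r1(1)] .
 obtain r2 g where r2: "strict_mono r2" "g : bmeas"
  "!!k::nat. EX D. integrable lborel D & (ALL n>=k. AEL x. x : UNIV --> norm (G (r (r1 (r2 n))) x) powr p <= D x)"
  "AEL x. x : (\<Union>k::nat. UNIV) --> (%n. G (r (r1 (r2 n))) x) ----> g x"
 proof (rule Lp_Cauchy_subseq[OF p0, of "%k. G (r (r1 k))" "%k. UNIV"])
  fix k :: nat and e :: real assume "e > 0"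
  then obtain N where N: "!!m n. m >= N ==> n >= N ==> (LBINT x. norm (G (r m) x - G (r n) x) powr p) <= e" using CG by blast
  then show "EX N. ALL m>=N. ALL n>=N. (LBINT x. indicator UNIV x * norm (G (r (r1 m)) x - G (r (r1 n)) x) powr p) <= e"
   using r1m order_trans by (intro exI[of _ N]) (simp, blast intro: order_trans)
 qed (use AdD'(7) that in \<open>auto simp: incseq_def\<close>)
 obtain D2 where D2: "integrable lborel D2" "!!n. AEL x. norm (G (r (r1 (r2 n))) x) powr p <= D2 x" using r2(3)[of 0] by auto
 define s where "s n = r (r1 (r2 n))" for n
 \<comment> \<open>The limit is nonnegative only almost everywhere; taking the positive part makes
   it so at every point, as \<open>approx\<close> demands.\<close>
 define u where "u x = max 0 (h x)" for x
 have [measurable]: "u : bmeas" unfolding u_def using r1(2) by measurable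
 have lim: "AEL x. (%n. ph (s n) x) ----> u x & (%n. G (s n) x) ----> g x"
  using r1(4) r2(4)
 proof eventually_elim
  case (elim x)
  have h: "(%n. ph (r (r1 n)) x) ----> h x" using elim by simp
  then have "h x >= 0" using AdD'(2) by (intro LIMSEQ_le_const) auto
  moreover have "(%n. ph (s n) x) ----> h x" using LIMSEQ_subseq_LIMSEQ[OF h r2(1)] by (simp add: s_def o_def)
  ultimately show ?case using elim by (simp add: u_def s_def)
 qed
 have Ddom: "AEL x. ph (s k) x powr p + norm (G (s k) x) powr p <= D1 x + D2 x" for k
  using D1(2)[of "r2 k"] D2(2)[of k] by eventually_elim (use AdD'(2) in \<open>simp add: s_def add_mono\<close>)
 have A: "approx p (%k. ph (s k)) (%k. G (s k)) (%x. D1 x + D2 x) u g"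
  unfolding approx_def using AdD'(1,2) D1(1) D2(1) Ddom r2(2) lim by (auto simp: u_def)
 have "(%k. en p W f (ph (s k)) (G (s k))) ----> en p W f u g"
 proof (rule en_tendsto[OF p W f])
  show "integ (%x. D1 x + D2 x)" using D1(1) D2(1) by auto
  show "AEL x. ph (s k) x powr p <= D1 x + D2 x & norm (G (s k) x) powr p <= D1 x + D2 x" for k
   using Ddom[of k] by eventually_elim (smt (verit) powr_ge_zero)
 qed (use lim AdD'(2) r2(2) in auto)
 moreover have "en p W f (ph (s k)) (G (s k)) <= m + 1 / real (Suc k)" for k
 proof -
  have "k <= s k" unfolding s_def using seq_suble[OF r(1)] seq_suble[OF r1(1)] seq_suble[OF r2(1)] by (meson order_trans)
  then have "1 / real (Suc (s k)) <= 1 / real (Suc k)" by (intro divide_left_mono) auto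
  then show ?thesis using enk[of "s k"] by linarith
 qed
 moreover have "(%k. m + 1 / real (Suc k)) ----> m + 0"
  using LIMSEQ_inverse_real_of_nat by (intro tendsto_add tendsto_const) (simp add: inverse_eq_divide)
 ultimately have "en p W f u g <= m" by (metis (no_types, lifting) LIMSEQ_le add.right_neutral)
 then show ?thesis using that[OF A] AdD'(3) mle unfolding Ad_def by (meson order_trans)
qed

section \<open>Positive solutions on balls\<close>

text \<open>An approximation of the indicator of \<open>t > 0\<close> that vanishes to first order
  at 0. Adding a small multiple of it to \<open>u\<close>, with either sign, keeps the sum
  nonnegative, which makes two-sided variations possible.\<close>

lemma Lipfun_frac:
 fixes dl :: real
 assumes "dl > 0"
 shows "Lipfun (%t. t / (t + dl)) (%t. dl / (t + dl)\<^sup>2)"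
proof (rule LipfunI[of dl _ _ "1 / dl"])
 fix t assume "t > - dl"
 then have "t + dl ~= 0" by simp
 then show "((%t. t / (t + dl)) has_real_derivative dl / (t + dl)\<^sup>2) (at t)"
  by (auto intro!: derivative_eq_intros simp: power2_eq_square)
next
 show "continuous_on {- dl<..} (%t. dl / (t + dl)\<^sup>2)" by (intro continuous_intros) auto
next
 fix t :: real assume "t >= 0"
 then have "dl / (t + dl)\<^sup>2 <= dl / dl\<^sup>2" using assms by (intro divide_left_mono power_mono mult_pos_pos) auto
 then show "abs (dl / (t + dl)\<^sup>2) <= 1 / dl" using assms by (simp add: power2_eq_square)
qed (use assms in auto)

text \<open>The derivative of \<open>t / (t + dl)\<close> is split into a positive power of
  \<open>dl\<close> times the weight of the logarithmic estimate, so its contribution to the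
  equation vanishes with \<open>dl\<close>. The exponent is 1 for \<open>p >= 2\<close> and
  \<open>p - 1\<close> otherwise.\<close>

lemma frac_deriv_bound:
 fixes p dl s :: real
 assumes "p > 1" "0 < dl" "dl <= 1" "dl <= s"
 shows "dl / s\<^sup>2 <= dl powr (min 1 (p - 1)) * (s powr (- p) + 1)"
proof -
 define k where "k = min 1 (p - 1)"
 have s: "s > 0" using assms by simp
 have d: "dl <= dl powr k" using powr_mono'[of k 1 dl] assms by (simp add: k_def)
 show ?thesis
 proof (cases "s >= 1")
  case True
  have "dl / s\<^sup>2 <= dl / 1\<^sup>2" using True assms by (intro divide_left_mono power_mono) auto
  also have "... <= dl powr k * 1" using d by simp
  also have "... <= dl powr k * (s powr (- p) + 1)" by (intro mult_left_mono) auto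
  finally show ?thesis by (simp add: k_def)
 next
  case False
  have e: "1 / s\<^sup>2 = s powr (p - 2) * s powr (- p)"
   using s by (simp flip: powr_add) (simp add: powr_minus_divide)
  have "dl * s powr (p - 2) <= dl powr k"
  proof (cases "p >= 2")
   case True
   have "s powr (p - 2) <= 1" using True False s by (intro powr_le1) auto
   then have "dl * s powr (p - 2) <= dl * 1" using assms by (intro mult_left_mono) auto
   then show ?thesis using d by simp
  next
   case 2: False
   have "s powr (p - 2) <= dl powr (p - 2)" using 2 assms by (intro powr_mono2') auto
   then have "dl * s powr (p - 2) <= dl powr 1 * dl powr (p - 2)" using assms by (simp add: mult_left_mono)
   also have "... = dl powr k" using 2 powr_add[of dl 1 "p - 2"] by (simp add: k_def)
   finally show ?thesis .
  qed
  then have "dl * s powr (p - 2) * s powr (- p) <= dl powr k * s powr (- p)" by (intro mult_right_mono) auto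
  also have "... <= dl powr k * (s powr (- p) + 1)" by (intro mult_left_mono) auto
  finally show ?thesis using e by (simp add: k_def divide_inverse mult.assoc)
 qed
qed

text \<open>Minimise the energy with a source whose support lies away from the ball of radius
  \<open>R\<close>. Nonnegative variations make the minimiser a supersolution; negative minimal
  energy and the dichotomy make it positive almost everywhere; then variations of both signs of the
  form \<open>sg * u / (u + dl)\<close> give the equation as \<open>dl\<close> tends to 0.\<close>

lemma exists_solution_ball:
 fixes W :: "'a::euclidean_space => real"
 assumes p: "p > 1" and W: "bddpot c W" and gm: "gm > 0" and R: "R >= 1"
  and coer: "!!ph G r. C1 ph G ==> (!!x. ph x >= 0) ==> supp_in ph r ==>
   gm * (LBINT x. ph x powr p) <= (LBINT x. norm (G x) powr p + W x * ph x powr p)"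
 obtains u g where "Wp p u g" "sol p W R u g" "AEL x. x : cball 0 R --> u x > 0"
proof -
 have p0: "p > 0" using p by simp
 note [measurable] = bddpotD(1)[OF W]
 obtain b :: 'a where b: "b : Basis" using nonempty_Basis by blast
 \<comment> \<open>The ball of radius \<open>R\<close> about \<open>z\<close> lies between the
   spheres of radii \<open>2 * R\<close> and \<open>4 * R\<close>: off the ball of interest, but
   inside the ball to which the dichotomy is applied.\<close>
 define z where "z = (3 * R) *\<^sub>R b"
 have nz: "norm z = 3 * R" using b R by (simp add: z_def)
 define f where "f = indicat_real (cball z R)"
 have f0: "f x >= 0" for x by (simp add: f_def)
 have fx: "2 * R <= norm x & norm x <= 4 * R" if "x : cball z R" for x
  using that nz norm_triangle_ineq2[of z x] norm_triangle_ineq2[of x z] by (auto simp: dist_norm norm_minus_commute)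
 have [measurable]: "f : bmeas" unfolding f_def by measurable
 \<comment> \<open>The dichotomy on the ball of radius \<open>4 * R\<close> needs a supersolution on
   radius \<open>12 * R + 1\<close>, which is at most \<open>13 * R\<close>.\<close>
 define rh where "rh = 13 * R"
 obtain ph G D u g where A: "approx p ph G D u g" and supp: "!!k. supp_in (ph k) rh"
  and min: "!!py H. C1 py H ==> (!!x. py x >= 0) ==> supp_in py rh ==> en p W f u g <= en p W f py H"
 proof (rule energy_minimiser[OF p W gm f_def, where rh = rh], goal_cases)
  case (1 ph G)
  then show ?case by (intro coer)
 next
  case (2 ph G D u g)
  show ?case by (rule 2(1)[OF 2(2-4)])
 qed
 have U: "Wp p u g" using A by (auto simp: Wp_def)
 note [measurable] = approxD(5,6,9,10)[OF A]
 have u0: "u x >= 0" for x using approxD(7)[OF A] .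
 \<comment> \<open>Minimality is known against C1 competitors only. Perturbing the approximants by
   their own compositions and passing to the limit gives it for the perturbed \<open>u\<close>, and
   the first variation follows.\<close>
 have EL: "(LBINT x. f x * pval sg F u x) <= weakf p W u g (pval sg F u) (pgrad sg dsg F F' u g)"
  if sg: "C1 sg dsg" "supp_in sg rh" and F: "Lipfun F F'" and t0: "0 < t0" "t0 <= 1"
   and adm: "!!t s x. 0 < t ==> t <= t0 ==> s >= 0 ==> s + t * (sg x * F s) >= 0" for sg dsg F F' t0
 proof -
  note P = approx_prod[OF A p F sg(1)]
  note [measurable] = P(2,3) C1_meas[OF P(1)]
  obtain E where E: "integrable lborel E" "!!k. AEL x. norm x <= rh --> (abs (pval sg F (ph k) x)) powr p <= E x & norm (pgrad sg dsg F F' (ph k) (G k) x) powr p <= E x"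
   "AEL x. norm x <= rh --> (abs (pval sg F u x)) powr p <= E x & norm (pgrad sg dsg F F' u g x) powr p <= E x"
   using P(5)[of rh] by blast
  have out: "sg x = 0" "dsg x = 0" if "\<not> norm x <= rh" for x
   using that sg(2) supp_in_grad[OF sg, of x] by (auto simp: supp_in_def)
  have E2: "AEL x. abs (pval sg F (ph k) x) powr p <= abs (E x) & norm (pgrad sg dsg F F' (ph k) (G k) x) powr p <= abs (E x)" for k
   using E(2)[of k]
  proof eventually_elim
   case (elim x) then show ?case using out[of x] by (cases "norm x <= rh") auto
  qed
  have E3: "AEL x. abs (pval sg F u x) powr p <= abs (E x) & norm (pgrad sg dsg F F' u g x) powr p <= abs (E x)"
   using E(3)
  proof eventually_elim
   case (elim x) then show ?case using out[of x] by (cases "norm x <= rh") auto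
  qed
  show ?thesis
  proof (rule first_variation[OF p W f_def U P(2,3) _ _ t0])
   show "integ (%x. abs (pval sg F u x) powr p)" "integ (%x. norm (pgrad sg dsg F F' u g x) powr p)"
   by (rule integrable_le[OF integrable_abs[OF E(1)]]; use E3 in auto)+
   show "u x + t * pval sg F u x >= 0" if "0 < t" "t <= t0" for t x using adm[OF that u0] .
   fix t assume t: "0 < t" "t <= t0"
   let ?v = "%k x. ph k x + t * pval sg F (ph k) x" and ?H = "%k x. G k x + t *\<^sub>R pgrad sg dsg F F' (ph k) (G k) x"
   have v0: "?v k x >= 0" for k x using adm[OF t approxD(2)[OF A]] .
   have "en p W f u g <= en p W f (?v k) (?H k)" for k
   proof (rule min)
   show "C1 (?v k) (?H k)" by (intro C1_add C1_cmult approxD(1)[OF A] P(1))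
   show "supp_in (?v k) rh" using supp[of k] sg(2) by (auto simp: supp_in_def)
   qed (rule v0)
   moreover have "(%k. en p W f (?v k) (?H k)) ----> en p W f (%x. u x + t * pval sg F u x) (%x. g x + t *\<^sub>R pgrad sg dsg F F' u g x)"
   proof (rule en_tendsto[OF p W f_def])
   show "AEL x. (%k. ?v k x) ----> u x + t * pval sg F u x & (%k. ?H k x) ----> g x + t *\<^sub>R pgrad sg dsg F F' u g x"
   using approxD(8)[OF A] P(4) by eventually_elim (auto intro!: tendsto_intros)
   show "integ (%x. 2 powr p * (D x + abs (E x)))" using approxD(3)[OF A] E(1) by auto
   fix k
   show "AEL x. ?v k x powr p <= 2 powr p * (D x + abs (E x)) & norm (?H k x) powr p <= 2 powr p * (D x + abs (E x))"
   using approxD(4)[OF A, of k] E2[of k]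
   proof eventually_elim
   case (elim x)
   have t1: "abs t <= 1" using t t0 by simp
   have d1: "ph k x powr p <= D x" using elim(1) powr_ge_zero[of "norm (G k x)" p] by linarith
   have d2: "norm (G k x) powr p <= D x" using elim(1) powr_ge_zero[of "ph k x" p] by linarith
   have "?v k x powr p = norm (ph k x + t * pval sg F (ph k) x) powr p" using v0[of k x] by simp
   also have "... <= 2 powr p * (norm (ph k x) powr p + norm (t * pval sg F (ph k) x) powr p)" using p by (intro norm_add_powr_le) auto
   also have "... <= 2 powr p * (D x + abs (E x))"
   proof (intro mult_left_mono add_mono)
   show "norm (ph k x) powr p <= D x" using d1 approxD(2)[OF A, of k x] by simp
   have "norm (t * pval sg F (ph k) x) <= abs (pval sg F (ph k) x)"
   unfolding real_norm_def abs_mult[of t] by (rule mult_left_le_one_le) (use t1 in auto)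
   then have "norm (t * pval sg F (ph k) x) powr p <= abs (pval sg F (ph k) x) powr p" using p by (intro powr_mono2) auto
   then show "norm (t * pval sg F (ph k) x) powr p <= abs (E x)" using elim(2) by linarith
   qed auto
   finally have a: "?v k x powr p <= 2 powr p * (D x + abs (E x))" .
   have "norm (?H k x) powr p <= 2 powr p * (norm (G k x) powr p + norm (t *\<^sub>R pgrad sg dsg F F' (ph k) (G k) x) powr p)"
   using p by (intro norm_add_powr_le) auto
   also have "... <= 2 powr p * (D x + abs (E x))"
   proof (intro mult_left_mono add_mono d2)
   have "norm (t *\<^sub>R pgrad sg dsg F F' (ph k) (G k) x) <= norm (pgrad sg dsg F F' (ph k) (G k) x)"
   unfolding norm_scaleR by (rule mult_left_le_one_le) (use t1 in auto)
   then have "norm (t *\<^sub>R pgrad sg dsg F F' (ph k) (G k) x) powr p <= norm (pgrad sg dsg F F' (ph k) (G k) x) powr p"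
   using p by (intro powr_mono2) auto
   then show "norm (t *\<^sub>R pgrad sg dsg F F' (ph k) (G k) x) powr p <= abs (E x)" using elim(2) by linarith
   qed auto
   finally show ?case using a by blast
   qed
   qed (use v0 in auto)
   ultimately show "en p W f u g <= en p W f (%x. u x + t * pval sg F u x) (%x. g x + t *\<^sub>R pgrad sg dsg F F' u g x)"
   by (intro LIMSEQ_le_const) auto
  qed
 qed
 have S: "super p W rh u g" unfolding super_def
 proof (intro allI impI)
  fix zt :: "'a => real" and dzt assume zt: "C1 zt dzt" "supp_in zt rh" "ALL x. 0 <= zt x"
  have "(LBINT x. f x * pval zt (%t. 1) u x) <= weakf p W u g (pval zt (%t. 1) u) (pgrad zt dzt (%t. 1) (%t. 0) u g)"
   by (rule EL[OF zt(1,2) Lipfun_const, of 1]) (use zt(3) in auto)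
  moreover have "0 <= (LBINT x. f x * pval zt (%t. 1) u x)" using zt(3) f0 by (intro integral_nonneg_AE) auto
  ultimately show "0 <= weakf p W u g zt dzt" by simp
 qed
 have fint: "integ (%x. f x * v x)" if [measurable]: "v : bmeas" and "integ (%x. abs (v x) powr p)" for v :: "'a => real"
 proof (rule integrable_le)
  show "integ (%x. indicat_real (cball z R) x + abs (v x) powr p)" using that integrable_ind_cball[of z R] by auto
  show "AEL x. norm (f x * v x) <= norm (indicat_real (cball z R) x + abs (v x) powr p)"
   using le_one_plus_powr[of p "abs (v _)"] p by (intro AE_I2) (auto simp: f_def indicator_def)
 qed measurable
 have neg: "en p W f u g < 0"
 proof -
  have R4: "4 * R >= 0" using R by simp
  obtain ct :: "'a => real" and sg dsg where sg: "C1 sg dsg" "!!x. sg x = ct x powr p" "!!x. 0 <= ct x" "!!x. ct x <= 1"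
   "!!x. norm x <= 4 * R ==> ct x = 1" "!!x. norm x > 4 * R + 1 ==> ct x = 0"
   "!!x. norm (dsg x) <= (4 * p / 1) * ct x powr (p - 1)"
   by (rule cutoff_exists[OF p R4 zero_less_one, where 'a='a]) (rule that)
  have ssg: "supp_in sg rh" using sg(6) R by (auto simp: supp_in_def sg(2) rh_def)
  have sg0: "sg x >= 0" for x by (simp add: sg(2))
  note [measurable] = C1_meas[OF sg(1)]
  note i = C1_supp_integrable[OF sg(1) ssg p0]
  have i1: "integ (%x. sg x powr p)" using i(1) sg0 by simp
  have Wi: "integ (%x. W x * sg x powr p)"
  proof (rule integrable_le[OF integrable_mult_right[OF i1, of c]])
   show "AEL x. norm (W x * sg x powr p) <= norm (c * sg x powr p)"
   using bddpotD(2,3)[OF W] by (intro AE_I2) (auto simp: abs_mult intro!: mult_right_mono)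
  qed measurable
  define E0 where "E0 = (LBINT x. norm (dsg x) powr p + W x * sg x powr p)"
  have "0 <= gm * (LBINT x. sg x powr p)" using gm by (intro mult_nonneg_nonneg integral_nonneg_AE) auto
  also have "... <= E0" unfolding E0_def by (rule coer[OF sg(1) sg0 ssg])
  finally have E0: "E0 >= 0" .
  define V where "V = measure lborel (cball z R)"
  have V: "V > 0" using content_cball_pos[of R z] R by (simp add: V_def)
  have fV: "(LBINT x. f x * sg x) = V"
  proof -
   have "(%x. f x * sg x) = indicat_real (cball z R)" using fx sg(5) by (auto simp: fun_eq_iff f_def indicator_def sg(2))
   then show ?thesis by (simp add: V_def)
  qed
  \<comment> \<open>For this multiple of the cutoff the linear source term outweighs
    \<open>s powr p * E0\<close>, so the energy is negative.\<close>
  define s where "s = (p * V / (E0 + 1)) powr (1 / (p - 1))"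
  have s: "s > 0" "s powr (p - 1) = p * V / (E0 + 1)" using p V E0 by (auto simp: s_def powr_powr)
  have "en p W f u g <= en p W f (%x. s * sg x) (%x. s *\<^sub>R dsg x)"
   by (rule min[OF C1_cmult[OF sg(1)]]) (use ssg s sg0 in \<open>auto simp: supp_in_def\<close>)
  also have "... = (LBINT x. s powr p * (norm (dsg x) powr p + W x * sg x powr p) - p * s * (f x * sg x))"
   unfolding en_def using s by (intro Bochner_Integration.integral_cong) (auto simp: powr_mult algebra_simps)
  also have "... = s powr p * E0 - p * s * V"
  proof -
   have j1: "integ (%x. s powr p * (norm (dsg x) powr p + W x * sg x powr p))" using i(2) Wi by auto
   have j2: "integ (%x. p * s * (f x * sg x))" using fint[OF _ i(1)] by auto
   show ?thesis unfolding Bochner_Integration.integral_diff[OF j1 j2] by (simp add: E0_def fV)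
  qed
  also have "s powr p = s powr (p - 1) * s" using powr_minus_one_mult[of s p] s by simp
  also have "s powr (p - 1) * s * E0 - p * s * V = p * s * V * (E0 / (E0 + 1) - 1)" unfolding s(2) by (simp add: algebra_simps)
  also have "... < 0" using p s V E0 by (intro mult_pos_neg) (auto simp: field_simps)
  finally show ?thesis .
 qed
 have pos4: "AEL x. x : cball 0 (4 * R) --> u x > 0"
 proof -
  define Z where "Z = {x : cball 0 (4 * R). u x = 0}"
  have Z [measurable]: "Z : sets borel" unfolding Z_def by measurable
  have Zfin: "emeasure lborel Z < \<infinity>"
  proof -
   have "emeasure lborel Z <= emeasure lborel (cball 0 (4 * R) :: 'a set)" by (rule emeasure_mono) (auto simp: Z_def)
   also have "... < \<infinity>" using emeasure_lborel_cball_finite[of "0::'a" "4 * R"] by (simp add: less_top)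
   finally show ?thesis .
  qed
  have "measure lborel Z = 0"
  proof (rule ccontr)
   assume "measure lborel Z ~= 0"
   then have Zp: "measure lborel {x : cball 0 (4 * R). u x = 0} > 0" using measure_nonneg[of lborel Z] unfolding Z_def by linarith
   have S4: "super p W (3 * (4 * R) + 1) u g" by (rule super_mono[OF S]) (use R in \<open>simp add: rh_def\<close>)
   \<comment> \<open>If \<open>u\<close> vanished there, the source integral would be 0 and
     coercivity along the approximants would make the limit energy nonnegative, against
     \<open>neg\<close>.\<close>
   have "AEL x. x : cball 0 (4 * R) --> u x = 0"
   by (rule super_dichotomy[OF p W U _ S4 Zp]) (use R in simp)
   then have fu0: "AEL x. f x * u x = 0"
   by eventually_elim (use fx in \<open>auto simp: f_def indicator_def\<close>)
   have fulim: "(%k. LBINT x. f x * ph k x) ----> (LBINT x. f x * u x)"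
   proof (rule integral_dominated_convergence[where w = "%x. indicat_real (cball z R) x + D x"])
   show "integ (%x. indicat_real (cball z R) x + D x)" using approxD(3)[OF A] integrable_ind_cball[of z R] by auto
   show "AEL x. (%k. f x * ph k x) ----> f x * u x" using approxD(8)[OF A] by eventually_elim (auto intro!: tendsto_intros)
   show "AEL x. norm (f x * ph k x) <= indicat_real (cball z R) x + D x" for k
   using approxD(4)[OF A, of k]
   proof eventually_elim
   case (elim x)
   have "ph k x powr p <= D x" "0 <= D x" using elim powr_ge_zero[of "norm (G k x)" p] powr_ge_zero[of "ph k x" p] by linarith+
   then show ?case using le_one_plus_powr[of p "ph k x"] p approxD(2)[OF A, of k x] by (auto simp: f_def indicator_def)
   qed
   qed auto
   have ulim: "(%k. en p W f (ph k) (G k)) ----> en p W f u g"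
   proof (rule en_tendsto[OF p W f_def _ _ _ _ approxD(2)[OF A] approxD(8)[OF A] approxD(3)[OF A]])
   show "AEL x. ph k x powr p <= D x & norm (G k x) powr p <= D x" for k
   using approxD(4)[OF A, of k] by eventually_elim (smt (verit) powr_ge_zero)
   qed auto
   have "- (p * (LBINT x. f x * ph k x)) <= en p W f (ph k) (G k)" for k
   proof -
   note i = approx_integrable(3,4)[OF A p0, of k]
   have Wi: "integ (%x. W x * ph k x powr p)"
   proof (rule integrable_le[OF integrable_mult_right[OF i(1), of c]])
   show "AEL x. norm (W x * ph k x powr p) <= norm (c * ph k x powr p)"
   using bddpotD(2,3)[OF W] by (intro AE_I2) (auto simp: abs_mult intro!: mult_right_mono)
   qed measurable
   have j1: "integ (%x. norm (G k x) powr p + W x * ph k x powr p)" using i(2) Wi by auto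
   have j2: "integ (%x. p * f x * ph k x)"
   using integrable_mult_right[OF fint[of "ph k"], of p] i(1) approxD(2)[OF A] by (simp add: mult.assoc)
   have "0 <= gm * (LBINT x. ph k x powr p)" using gm by (intro mult_nonneg_nonneg integral_nonneg_AE) auto
   also have "... <= (LBINT x. norm (G k x) powr p + W x * ph k x powr p)" by (rule coer[OF approxD(1,2)[OF A] supp])
   finally show ?thesis unfolding en_def Bochner_Integration.integral_diff[OF j1 j2] by (simp add: mult.assoc)
   qed
   then have "- (p * (LBINT x. f x * u x)) <= en p W f u g"
   by (intro LIMSEQ_le[OF tendsto_minus[OF tendsto_mult[OF tendsto_const fulim]] ulim]) auto
   moreover have "(LBINT x. f x * u x) = 0" using integral_cong_AE[OF _ _ fu0] by simp
   ultimately show False using neg by simp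
  qed
  then have "emeasure lborel Z = 0" using Zfin by (simp add: emeasure_eq_ennreal_measure)
  then have "AEL x. x \<notin> Z" by (intro AE_not_in) (auto simp: null_sets_def)
  then show ?thesis by eventually_elim (use u0 in \<open>auto simp: Z_def less_le\<close>)
 qed
 have posR: "AEL x. x : cball 0 R --> u x > 0"
  using pos4 by eventually_elim (use R in auto)
 have "sol p W R u g" unfolding sol_def
 proof (intro allI impI)
  fix sg :: "'a => real" and dsg assume sg: "C1 sg dsg" "supp_in sg R"
  note [measurable] = C1_meas[OF sg(1)]
  obtain B where B: "B > 0" "!!x. abs (sg x) <= B" "!!x. norm (dsg x) <= B" by (rule C1_supp_bounded[OF sg]) (rule that)
  have out: "sg x = 0" "dsg x = 0" if "\<not> norm x <= R" for x
   using that sg(2) supp_in_grad[OF sg, of x] by (auto simp: supp_in_def)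
  \<comment> \<open>The cutoff may have either sign here: for \<open>t <= dl / B\<close> the
    perturbed value is \<open>v / (v + dl) * (v + dl + t * s x)\<close>, which is nonnegative. The
    source disappears because it does not meet the support of \<open>s\<close>.\<close>
  have one: "0 <= weakf p W u g (pval s (%t. t / (t + dl)) u) (pgrad s ds (%t. t / (t + dl)) (%t. dl / (t + dl)\<^sup>2) u g)"
   if s: "C1 s ds" "supp_in s R" "!!x. abs (s x) <= B" and dl: "dl > 0" for s ds dl
  proof -
   have "(LBINT x. f x * pval s (%t. t / (t + dl)) u x) <= weakf p W u g (pval s (%t. t / (t + dl)) u) (pgrad s ds (%t. t / (t + dl)) (%t. dl / (t + dl)\<^sup>2) u g)"
   proof (rule EL[OF s(1) _ Lipfun_frac[OF dl], of "min 1 (dl / B)"])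
   show "supp_in s rh" using s(2) R by (auto simp: supp_in_def rh_def)
   fix t v x assume t: "0 < t" "t <= min 1 (dl / B)" and v: "(0::real) <= v"
   have "t * abs (s x) <= dl / B * B" using t s(3)[of x] B dl by (intro mult_mono) auto
   also have "... <= v + dl" using B v by simp
   finally have "abs (t * s x) <= v + dl" using t by (simp add: abs_mult)
   then have "0 <= (v + dl) + t * s x" by linarith
   then have "0 <= v / (v + dl) * ((v + dl) + t * s x)" using v dl by (intro mult_nonneg_nonneg) auto
   also have "... = v + t * (s x * (v / (v + dl)))" using v dl by (simp add: field_simps)
   finally show "0 <= v + t * (s x * (v / (v + dl)))" .
   qed (use dl B in auto)
   moreover have "(%x. f x * pval s (%t. t / (t + dl)) u x) = (%x. 0)"
   proof
   fix x show "f x * pval s (%t. t / (t + dl)) u x = 0"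
   using fx[of x] s(2) R by (cases "x : cball z R") (auto simp: f_def supp_in_def)
   qed
   ultimately show ?thesis by simp
  qed
  define dl where "dl n = 1 / real (Suc n)" for n
  have dl: "dl n > 0" "dl n <= 1" for n by (auto simp: dl_def)
  have dllim: "dl ----> 0" using LIMSEQ_inverse_real_of_nat by (simp add: dl_def[abs_def] inverse_eq_divide)
  let ?F = "%n t. t / (t + dl n)" and ?F' = "%n t. dl n / (t + dl n)\<^sup>2"
  have zero: "weakf p W u g (pval sg (?F n) u) (pgrad sg dsg (?F n) (?F' n) u g) = 0" for n
  proof (rule antisym)
   have m: "C1 (%x. - 1 * sg x) (%x. - 1 *\<^sub>R dsg x)" by (rule C1_cmult[OF sg(1)])
   have "0 <= weakf p W u g (pval (%x. - 1 * sg x) (?F n) u) (pgrad (%x. - 1 * sg x) (%x. - 1 *\<^sub>R dsg x) (?F n) (?F' n) u g)"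
   by (rule one[OF m _ _ dl(1)]) (use sg(2) B in \<open>auto simp: supp_in_def\<close>)
   also have "... = (LBINT x. - (pflux p (g x) \<bullet> pgrad sg dsg (?F n) (?F' n) u g x + W x * u x powr (p - 1) * pval sg (?F n) u x))"
   unfolding weakf_def by (intro Bochner_Integration.integral_cong) (auto simp: inner_add_right inner_diff_right algebra_simps)
   also have "... = - weakf p W u g (pval sg (?F n) u) (pgrad sg dsg (?F n) (?F' n) u g)" unfolding weakf_def by (rule integral_minus)
   finally show "weakf p W u g (pval sg (?F n) u) (pgrad sg dsg (?F n) (?F' n) u g) <= 0" by simp
   show "0 <= weakf p W u g (pval sg (?F n) u) (pgrad sg dsg (?F n) (?F' n) u g)" by (rule one[OF sg B(2) dl(1)])
  qed
  note iS = C1_supp_integrable[OF sg p0]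
  have wi: "integ (%x. pflux p (g x) \<bullet> dsg x + W x * u x powr (p - 1) * sg x)"
   by (rule weakf_integrable[OF p W U _ _ iS]) auto
  define q where "q x = pflux p (g x) \<bullet> dsg x + W x * u x powr (p - 1) * sg x" for x
  have [measurable]: "q : bmeas" unfolding q_def by measurable
  have F01: "0 <= ?F n (u x)" "?F n (u x) <= 1" for n x using u0[of x] dl(1)[of n] by auto
  have qF: "norm (q x * ?F n (u x)) <= norm (q x)" for n x
  proof -
   have "norm (q x * ?F n (u x)) = norm (q x) * ?F n (u x)" using norm_mult[of "q x" "?F n (u x)"] abs_of_nonneg[OF F01(1)[where x=x and n=n]] by (simp only: real_norm_def)
   also have "... <= norm (q x)" using F01 by (intro mult_right_le_one_le) auto
   finally show ?thesis .
  qed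
  have Ilim: "(%n. LBINT x. q x * ?F n (u x)) ----> weakf p W u g sg dsg" unfolding weakf_def
  proof (rule integral_dominated_convergence[where w = "%x. norm (q x)"])
   show "integ (%x. norm (q x))" using wi unfolding q_def by auto
   show "AEL x. norm (q x * ?F n (u x)) <= norm (q x)" for n
   using qF by (intro AE_I2)
   show "AEL x. (%n. q x * ?F n (u x)) ----> pflux p (g x) \<bullet> dsg x + W x * u x powr (p - 1) * sg x"
   using posR
   proof eventually_elim
   case (elim x)
   show ?case
   proof (cases "norm x <= R")
   case True
   then have ux: "u x > 0" using elim by simp
   have "(%n. q x * ?F n (u x)) ----> q x * (u x / (u x + 0))" using ux by (intro tendsto_intros dllim) auto
   then show ?thesis using ux by (simp add: q_def)
   next
   case False then show ?thesis using out[of x] by (simp add: q_def)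
   qed
   qed
   show "(%x. pflux p (g x) \<bullet> dsg x + W x * u x powr (p - 1) * sg x) : borel_measurable lborel" by measurable
  qed measurable
  have iI: "integ (%x. q x * ?F n (u x))" for n
  proof (rule integrable_le)
   show "integrable lborel q" using wi unfolding q_def .
   show "AEL x. norm (q x * ?F n (u x)) <= norm (q x)"
   using qF by (intro AE_I2)
  qed measurable
  have R0: "R >= 0" using R by simp
  obtain CL where CL: "CL >= 0" "!!d. d > 0 ==> integ (%x. ib R x * (norm (g x) / (u x + d)) powr p) &
   (LBINT x. ib R x * (norm (g x) / (u x + d)) powr p) <= CL"
  proof (rule log_estimate[OF p bddpotD(3)[OF W] R0, where 'a='a], goal_cases)
   case (1 C)
   have "super p W (R + 1) u g" by (rule super_mono[OF S]) (use R in \<open>simp add: rh_def\<close>)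
   then show ?case by (intro 1(1)[OF 1(2)] 1(3)[OF W U])
  qed
  define k where "k = min 1 (p - 1)"
  have k: "k > 0" using p by (simp add: k_def)
  define Q where "Q = (LBINT x. norm (g x) powr p)"
  let ?j = "%n x. sg x * (?F' n (u x) * norm (g x) powr p)"
  let ?m = "%n x. B * dl n powr k * (ib R x * (norm (g x) / (u x + dl n)) powr p + norm (g x) powr p)"
  have mi: "integ (?m n)" for n using CL(2)[OF dl(1)[of n]] WpD(5)[OF U p] by auto
  have jb: "abs (?j n x) <= ?m n x" for n x
  proof (cases "norm x <= R")
   case True
   have s: "dl n <= u x + dl n" "u x + dl n > 0" using u0[of x] dl(1)[of n] by auto
   have F'0: "?F' n (u x) >= 0" using dl(1)[of n] by simp
   have "abs (?j n x) = abs (sg x) * (?F' n (u x) * norm (g x) powr p)" using dl(1)[of n] by (simp add: abs_mult)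
   also have "... <= B * ((dl n powr k * ((u x + dl n) powr (- p) + 1)) * norm (g x) powr p)"
   unfolding k_def using B F'0 dl(1)[of n] frac_deriv_bound[OF p dl(1,2) s(1)] by (intro mult_mono mult_right_mono) auto
   also have "... = ?m n x" using True s by (simp add: powr_divide powr_minus_divide algebra_simps)
   finally show ?thesis .
  next
   case False then show ?thesis using out[of x] B(1) by simp
  qed
  have ji: "integ (?j n)" for n
  proof (rule integrable_le[OF mi[of n]])
   show "AEL x. norm (?j n x) <= norm (?m n x)"
   by (intro AE_I2, unfold real_norm_def, rule order_trans[OF jb abs_ge_self])
  qed measurable
  \<comment> \<open>The tested equation splits into the equation for \<open>sg\<close> weighted by
    \<open>u / (u + dl)\<close> and an error containing the derivative of that weight; only the
    error depends on the logarithmic estimate.\<close>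
  have IK: "(LBINT x. q x * ?F n (u x)) = - (LBINT x. ?j n x)" for n
  proof -
   have "0 = (LBINT x. q x * ?F n (u x) + ?j n x)"
   unfolding zero[of n, symmetric] weakf_def
   by (intro Bochner_Integration.integral_cong refl) (simp add: q_def inner_add_right pflux_inner_self algebra_simps)
   also have "... = (LBINT x. q x * ?F n (u x)) + (LBINT x. ?j n x)" by (rule Bochner_Integration.integral_add[OF iI ji])
   finally show ?thesis by simp
  qed
  have Kb: "norm (LBINT x. q x * ?F n (u x)) <= B * dl n powr k * (CL + Q)" for n
  proof -
   have "norm (LBINT x. q x * ?F n (u x)) <= (LBINT x. abs (?j n x))" unfolding IK using integral_abs_bound[of lborel "?j n"] by simp
   also have "... <= (LBINT x. ?m n x)" by (intro integral_mono mi jb integrable_abs ji)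
   also have "... = B * dl n powr k * ((LBINT x. ib R x * (norm (g x) / (u x + dl n)) powr p) + Q)"
   using CL(2)[OF dl(1)[of n]] WpD(5)[OF U p] by (simp add: Q_def)
   also have "... <= B * dl n powr k * (CL + Q)" using CL(2)[OF dl(1)[of n]] B(1) by (intro mult_left_mono) auto
   finally show ?thesis .
  qed
  have "(%n. B * dl n powr k * (CL + Q)) ----> B * 0 powr k * (CL + Q)"
   using k dl(1) by (intro tendsto_mult tendsto_const tendsto_nonneg_powr dllim) (auto simp: less_imp_le)
  then have "(%n. B * dl n powr k * (CL + Q)) ----> 0" by simp
  then have "(%n. LBINT x. q x * ?F n (u x)) ----> 0"
   by (rule Lim_null_comparison[rotated]) (use Kb in auto)
  then show "weakf p W u g sg dsg = 0" using Ilim LIMSEQ_unique by blast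
 qed
 then show ?thesis using that U posR by blast
qed

section \<open>Integration by parts and stability of weak gradients\<close>

text \<open>The difference quotients have integral 0 by translation invariance and converge
  boundedly on a fixed ball.\<close>

lemma integral_gradient_zero:
 fixes py :: "'a::euclidean_space => real"
 assumes py: "C1 py G" "supp_in py R"
 shows "(LBINT x. G x \<bullet> v) = 0"
proof -
 note [measurable] = C1_meas[OF py(1)]
 obtain B where B: "B > 0" "!!x. abs (py x) <= B" "!!x. norm (G x) <= B" by (rule C1_supp_bounded[OF py]) (rule that)
 define t where "t n = 1 / real (Suc n)" for n
 have t: "t n > 0" "t n <= 1" for n by (auto simp: t_def)
 have tlim: "t ----> 0" using LIMSEQ_inverse_real_of_nat by (simp add: t_def[abs_def] inverse_eq_divide)
 have tat: "filterlim t (at 0) sequentially"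
 proof -
  have "t n ~= 0" for n using t(1)[of n] by linarith
  then show ?thesis using tlim by (auto simp: filterlim_at)
 qed
 have pyi: "integrable lborel py"
 proof (rule integrable_le[OF integrable_mult_right[OF integrable_ind_cball, of B 0 R]])
  show "AEL x. norm (py x) <= norm (B * indicat_real (cball 0 R) x)"
   using B py(2) by (intro AE_I2) (auto simp: indicator_def supp_in_def not_le)
 qed simp
 have zero: "(LBINT x. (py (x + t n *\<^sub>R v) - py x) / t n) = 0" for n
  using integral_lborel_shift[of py "t n *\<^sub>R v"] integrable_lborel_shift[OF pyi, of "t n *\<^sub>R v"] pyi by simp
 have lip: "abs (py y - py x) <= B * norm (y - x)" for x y
 proof -
  have "norm (py y - py x) <= B * norm (y - x)"
  proof (rule differentiable_bound[where S = UNIV and f' = "%x h. G x \<bullet> h"])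
   fix x :: 'a
   show "onorm (%h. G x \<bullet> h) <= B"
   proof (rule onorm_le)
   fix h show "norm (G x \<bullet> h) <= B * norm h"
   using Cauchy_Schwarz_ineq2[of "G x" h] mult_right_mono[OF B(3)[of x], of "norm h"] by simp
   qed
  qed (use C1_D[OF py(1)] in auto)
  then show ?thesis by simp
 qed
 have "(%n. LBINT x. (py (x + t n *\<^sub>R v) - py x) / t n) ----> (LBINT x. G x \<bullet> v)"
 proof (rule integral_dominated_convergence[where w = "%x. (B * norm v) * indicat_real (cball 0 (R + norm v)) x"])
  show "integ (%x::'a. (B * norm v) * indicat_real (cball 0 (R + norm v)) x)"
   by (intro integrable_mult_right integrable_ind_cball)
  show "AEL x. norm ((py (x + t n *\<^sub>R v) - py x) / t n) <= (B * norm v) * indicat_real (cball 0 (R + norm v)) x" for n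
  proof (intro AE_I2)
   fix x
   show "norm ((py (x + t n *\<^sub>R v) - py x) / t n) <= (B * norm v) * indicat_real (cball 0 (R + norm v)) x"
   proof (cases "norm x <= R + norm v")
   case True
   have "abs (py (x + t n *\<^sub>R v) - py x) <= B * (t n * norm v)" using lip[of "x + t n *\<^sub>R v" x] t(1)[of n] by simp
   then show ?thesis using True t(1)[of n] by (simp add: divide_le_eq mult_ac)
   next
   case False
   have "norm x - norm (t n *\<^sub>R v) <= norm (x + t n *\<^sub>R v)" using norm_triangle_ineq4[of "x + t n *\<^sub>R v" "t n *\<^sub>R v"] by simp
   moreover have "norm (t n *\<^sub>R v) <= norm v" using t[of n] by (simp add: mult_left_le_one_le)
   ultimately have "norm (x + t n *\<^sub>R v) > R" "norm x > R" using False norm_ge_zero[of v] by linarith+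
   then show ?thesis using py(2) False by (simp add: supp_in_def)
   qed
  qed
  show "AEL x. (%n. (py (x + t n *\<^sub>R v) - py x) / t n) ----> G x \<bullet> v"
  proof (intro AE_I2)
   fix x
   have "((%h. x + h *\<^sub>R v) has_derivative (%s. s *\<^sub>R v)) (at 0)" by (auto intro!: derivative_eq_intros)
   then have "((%h. py (x + h *\<^sub>R v)) has_derivative (%s. G (x + 0 *\<^sub>R v) \<bullet> (s *\<^sub>R v))) (at 0)"
   by (rule has_derivative_compose[OF _ C1_D[OF py(1)]])
   then have "((%h. py (x + h *\<^sub>R v)) has_real_derivative (G x \<bullet> v)) (at 0)"
   unfolding has_field_derivative_def by (rule has_derivative_eq_rhs) (auto simp: mult.commute)
   then have "((%h. (py (x + h *\<^sub>R v) - py x) / h) \<longlongrightarrow> G x \<bullet> v) (at 0)" unfolding DERIV_def by simp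
   then show "(%n. (py (x + t n *\<^sub>R v) - py x) / t n) ----> G x \<bullet> v" by (rule filterlim_compose[OF _ tat])
  qed
 qed measurable
 then show ?thesis unfolding zero by (simp add: LIMSEQ_const_iff)
qed

text \<open>Only a majorant on the ball carrying the test function is required, which fits sequences
  that are bounded merely locally.\<close>

lemma weak_gradient_limit:
 fixes g :: "'a::euclidean_space => 'a"
 assumes p: "p > 1" and zt: "C1 zt dzt" "supp_in zt R"
  and [measurable]: "!!k. w k : bmeas" "!!k. G k : bmeas" "u : bmeas" "g : bmeas"
  and parts: "!!k. (LBINT x. w k x * (dzt x \<bullet> v)) = - (LBINT x. (G k x \<bullet> v) * zt x)"
  and conv: "AEL x. (%k. w k x) ----> u x & (%k. G k x) ----> g x"
  and D: "integrable lborel D" "!!k. AEL x. x : cball 0 R --> (abs (w k x)) powr p <= D x & norm (G k x) powr p <= D x"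
 shows "(LBINT x. u x * (dzt x \<bullet> v)) = - (LBINT x. (g x \<bullet> v) * zt x)"
proof -
 note [measurable] = C1_meas[OF zt(1)]
 obtain B where B: "B > 0" "!!x. abs (zt x) <= B" "!!x. norm (dzt x) <= B" by (rule C1_supp_bounded[OF zt]) (rule that)
 have out: "zt x = 0" "dzt x = 0" if "\<not> norm x <= R" for x
  using that zt(2) supp_in_grad[OF zt, of x] by (auto simp: supp_in_def)
 let ?w = "%x. B * norm v * (indicat_real (cball 0 R) x * (1 + abs (D x)))"
 have wi: "integ ?w"
 proof -
  have "?w = (%x. B * norm v * (indicat_real (cball 0 R) x + indicat_real (cball 0 R) x * abs (D x)))" by (auto simp: fun_eq_iff algebra_simps)
  then show ?thesis using D(1) integrable_ind_cball[of "0::'a" R] by (auto intro!: integrable_ind_mult)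
 qed
 have le: "a <= 1 + abs d" if "a powr p <= d" "a >= 0" for a d :: real
  using le_one_plus_powr[of p a] p that by linarith
 have 1: "(%k. LBINT x. w k x * (dzt x \<bullet> v)) ----> (LBINT x. u x * (dzt x \<bullet> v))"
 proof (rule integral_dominated_convergence[OF _ _ wi])
  show "AEL x. (%k. w k x * (dzt x \<bullet> v)) ----> u x * (dzt x \<bullet> v)"
   using conv by eventually_elim (auto intro!: tendsto_intros)
  show "AEL x. norm (w k x * (dzt x \<bullet> v)) <= ?w x" for k
   using D(2)[of k]
  proof eventually_elim
   case (elim x)
   show ?case
   proof (cases "norm x <= R")
   case True
   have "abs (dzt x \<bullet> v) <= B * norm v" using Cauchy_Schwarz_ineq2[of "dzt x" v] mult_right_mono[OF B(3)[of x], of "norm v"] by simp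
   then have "abs (dzt x \<bullet> v) * abs (w k x) <= (B * norm v) * (1 + abs (D x))" using le[of "abs (w k x)" "D x"] elim True B(1) by (intro mult_mono) auto
   then show ?thesis using True by (simp add: abs_mult mult_ac)
   qed (simp add: out)
  qed
 qed measurable
 have 2: "(%k. - (LBINT x. (G k x \<bullet> v) * zt x)) ----> - (LBINT x. (g x \<bullet> v) * zt x)"
 proof (intro tendsto_minus integral_dominated_convergence[OF _ _ wi])
  show "AEL x. (%k. (G k x \<bullet> v) * zt x) ----> (g x \<bullet> v) * zt x"
   using conv by eventually_elim (auto intro!: tendsto_intros)
  show "AEL x. norm ((G k x \<bullet> v) * zt x) <= ?w x" for k
   using D(2)[of k]
  proof eventually_elim
   case (elim x)
   show ?case
   proof (cases "norm x <= R")
   case True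
   have "abs (G k x \<bullet> v) <= norm (G k x) * norm v" by (rule Cauchy_Schwarz_ineq2)
   also have "... <= (1 + abs (D x)) * norm v" using le[of "norm (G k x)" "D x"] elim True by (intro mult_right_mono) auto
   finally have "abs (G k x \<bullet> v) * abs (zt x) <= ((1 + abs (D x)) * norm v) * B" using B by (intro mult_mono) auto
   then show ?thesis using True by (simp add: abs_mult mult_ac)
   qed (simp add: out)
  qed
 qed measurable
 show ?thesis using LIMSEQ_unique[OF 1[unfolded parts] 2] .
qed

lemma Wp_parts:
 assumes p: "p > 1" and U: "Wp p u g" and zt: "C1 zt dzt" "supp_in zt R"
 shows "(LBINT x. u x * (dzt x \<bullet> v)) = - (LBINT x. (g x \<bullet> v) * zt x)"
proof -
 obtain ph G D where A: "approx p ph G D u g" using U by (auto simp: Wp_def)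
 note [measurable] = approxD(5,6,9,10)[OF A] C1_meas[OF zt(1)]
 have out: "zt x = 0" "dzt x = 0" if "\<not> norm x <= R" for x
  using that zt(2) supp_in_grad[OF zt, of x] by (auto simp: supp_in_def)
 have cint: "integrable lborel h" if h: "continuous_on UNIV h" "!!x. \<not> norm x <= R ==> h x = 0" for h :: "'a => real"
 proof -
  have [measurable]: "h : bmeas" using h(1) by (rule borel_measurable_continuous_onI)
  obtain B where B: "B >= 0" "!!x. norm x <= R ==> norm (h x) <= B" by (rule continuous_bounded_cball[OF h(1), of R]) (rule that)
  show ?thesis
  proof (rule integrable_le[OF integrable_mult_right[OF integrable_ind_cball, of B 0 R]])
   show "AEL x. norm (h x) <= norm (B * indicat_real (cball 0 R) x)"
   using B h(2) by (intro AE_I2) (auto simp: indicator_def)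
  qed simp
 qed
 show ?thesis
 proof (rule weak_gradient_limit[OF p zt _ _ _ _ _ approxD(8)[OF A] approxD(3)[OF A]])
  fix k
  have "C1 (%x. ph k x * zt x) (%x. zt x *\<^sub>R G k x + ph k x *\<^sub>R dzt x)" by (rule C1_mult[OF approxD(1)[OF A] zt(1)])
  moreover have "supp_in (%x. ph k x * zt x) R" using zt(2) by (auto simp: supp_in_def)
  ultimately have "(LBINT x. (zt x *\<^sub>R G k x + ph k x *\<^sub>R dzt x) \<bullet> v) = 0" by (rule integral_gradient_zero)
  moreover have "(LBINT x. (zt x *\<^sub>R G k x + ph k x *\<^sub>R dzt x) \<bullet> v) = (LBINT x. (G k x \<bullet> v) * zt x + ph k x * (dzt x \<bullet> v))"
   by (intro Bochner_Integration.integral_cong) (auto simp: inner_add_left mult.commute)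
  moreover have "... = (LBINT x. (G k x \<bullet> v) * zt x) + (LBINT x. ph k x * (dzt x \<bullet> v))"
   using C1_cont[OF approxD(1)[OF A]] C1_cont_grad[OF approxD(1)[OF A]] C1_cont[OF zt(1)] C1_cont_grad[OF zt(1)]
   by (intro Bochner_Integration.integral_add cint continuous_intros) (auto simp: out)
  ultimately show "(LBINT x. ph k x * (dzt x \<bullet> v)) = - (LBINT x. (G k x \<bullet> v) * zt x)" by linarith
  show "AEL x. x : cball 0 R --> (abs (ph k x)) powr p <= D x & norm (G k x) powr p <= D x"
   using approxD(4)[OF A, of k]
  proof eventually_elim
   case (elim x)
   then show ?case using approxD(2)[OF A, of k x] powr_ge_zero[of "norm (G k x)" p] powr_ge_zero[of "ph k x" p] by (auto simp del: powr_ge_zero)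
  qed
 qed measurable
qed

section \<open>Scaling and normalisation of solutions\<close>

lemma Wp_scale:
 assumes p: "p > 1" and U: "Wp p u g" and t: "t > 0"
 shows "Wp p (%x. t * u x) (%x. t *\<^sub>R g x)"
proof -
 obtain ph G D where A: "approx p ph G D u g" using U by (auto simp: Wp_def)
 note [measurable] = approxD(5,6)[OF A]
 have "approx p (%k x. t * ph k x) (%k x. t *\<^sub>R G k x) (%x. t powr p * D x) (%x. t * u x) (%x. t *\<^sub>R g x)"
  unfolding approx_def
 proof (intro conjI allI)
  fix k x
  show "C1 (%x. t * ph k x) (%x. t *\<^sub>R G k x)" by (rule C1_cmult[OF approxD(1)[OF A]])
  show "0 <= t * ph k x" using t approxD(2)[OF A] by simp
  show "0 <= t * u x" using t approxD(7)[OF A] by simp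
  show "AEL x. (t * ph k x) powr p + norm (t *\<^sub>R G k x) powr p <= t powr p * D x"
   using approxD(4)[OF A, of k]
  proof eventually_elim
   case (elim x)
   have "(t * ph k x) powr p + norm (t *\<^sub>R G k x) powr p = t powr p * (ph k x powr p + norm (G k x) powr p)"
   using t by (simp add: powr_mult algebra_simps)
   then show ?case using elim by (simp add: mult_left_mono)
  qed
  show "integ (%x. t powr p * D x)" using approxD(3)[OF A] by simp
  show "AEL x. (%k. t * ph k x) ----> t * u x & (%k. t *\<^sub>R G k x) ----> t *\<^sub>R g x"
   using approxD(8)[OF A] by eventually_elim (auto intro!: tendsto_intros)
 qed measurable
 then show ?thesis by (auto simp: Wp_def)
qed

lemma sol_scale:
 fixes u :: "'a::euclidean_space => real"
 assumes p: "p > 1" and t: "t > 0" and U: "Wp p u g" and S: "sol p W R u g"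
 shows "sol p W R (%x. t * u x) (%x. t *\<^sub>R g x)"
 unfolding sol_def
proof (intro allI impI)
 fix zt :: "'a => real" and dzt assume zt: "C1 zt dzt" "supp_in zt R"
 have "weakf p W (%x. t * u x) (%x. t *\<^sub>R g x) zt dzt = (LBINT x. t powr (p - 1) * (pflux p (g x) \<bullet> dzt x + W x * u x powr (p - 1) * zt x))"
  unfolding weakf_def using t by (intro Bochner_Integration.integral_cong) (auto simp: pflux_scaleR powr_mult algebra_simps)
 also have "... = t powr (p - 1) * weakf p W u g zt dzt" unfolding weakf_def by simp
 also have "weakf p W u g zt dzt = 0" using S zt by (simp add: sol_def)
 finally show "weakf p W (%x. t * u x) (%x. t *\<^sub>R g x) zt dzt = 0" by simp
qed

text \<open>Search doubling thresholds for the step at which the sublevel set starts to fill more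
  than half of the unit ball. Scaling the last threshold before that to 1 sends the next one to 2,
  and each of the two sets required fills at least half.\<close>

lemma normalise:
 fixes u :: "'a::euclidean_space => real"
 assumes [measurable]: "u : bmeas" and pos: "AEL x. x : cball 0 1 --> u x > 0"
 obtains t where "t > 0" "normalised (measure lborel (cball 0 1 :: 'a set) / 2) (%x. t * u x)"
proof -
 let ?B = "cball 0 1 :: 'a set"
 define \<mu> where "\<mu> = measure lborel ?B"
 have \<mu>: "\<mu> > 0" using content_cball_pos[of 1 "0::'a"] by (simp add: \<mu>_def)
 define A where "A s = {x : ?B. u x < s}" for s
 have A [measurable]: "A s : sets borel" for s unfolding A_def by measurable
 have Bf: "?B : fmeasurable lborel" using emeasure_lborel_cball_finite[of "0::'a" 1] by (auto simp: fmeasurable_def less_top)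
 have Af: "A s : fmeasurable lborel" for s by (rule fmeasurableI2[OF Bf]) (auto simp: A_def)
 have fin: "emeasure lborel (A s) ~= \<infinity>" for s using Af[of s] by (auto simp: fmeasurable_def)
 obtain m where m: "measure lborel (A (1 / real (Suc m))) <= \<mu> / 2"
 proof -
  have "(%n. measure lborel (A (1 / real (Suc n)))) ----> measure lborel (\<Inter>n. A (1 / real (Suc n)))"
  proof (rule Lim_measure_decseq)
   show "decseq (%n. A (1 / real (Suc n)))"
   proof (intro decseq_SucI)
   fix n
   have "1 / real (Suc (Suc n)) <= 1 / real (Suc n)" by (intro divide_left_mono) auto
   then show "A (1 / real (Suc (Suc n))) \<subseteq> A (1 / real (Suc n))" by (auto simp: A_def simp del: of_nat_Suc)
   qed
  qed (use fin A in auto)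
  also have "measure lborel (\<Inter>n. A (1 / real (Suc n))) = 0"
  proof -
   have "AEL x. x \<notin> (\<Inter>n. A (1 / real (Suc n)))"
   using pos
   proof eventually_elim
   case (elim x)
   show ?case
   proof
   assume x: "x : (\<Inter>n. A (1 / real (Suc n)))"
   then have "u x > 0" using elim by (auto simp: A_def)
   then obtain n where "inverse (real (Suc n)) < u x" using reals_Archimedean by blast
   moreover have "u x < 1 / real (Suc n)" using x unfolding A_def by blast
   ultimately show False by (simp add: inverse_eq_divide)
   qed
   qed
   moreover have "(\<Inter>n. A (1 / real (Suc n))) : sets lborel" by (intro sets.countable_INT) auto
   ultimately have "(\<Inter>n. A (1 / real (Suc n))) : null_sets lborel" using AE_iff_null_sets by blast
   then show ?thesis by (simp add: measure_def null_sets_def)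
  qed
  finally have "\<forall>\<^sub>F n in sequentially. measure lborel (A (1 / real (Suc n))) < \<mu> / 2"
   by (rule order_tendstoD(2)) (use \<mu> in simp)
  then show ?thesis using that by (auto simp: eventually_sequentially intro: less_imp_le)
 qed
 \<comment> \<open>The smallest threshold \<open>1 / (m + 1)\<close> has a sublevel set of at most
   half the measure, which positivity of \<open>u\<close> guarantees for some
   \<open>m\<close>.\<close>
 define tu where "tu i = 2 ^ i / real (Suc m)" for i
 have tu: "tu i > 0" "tu (Suc i) = 2 * tu i" for i by (auto simp: tu_def)
 obtain n where n: "measure lborel (A (tu n)) > \<mu> / 2"
 proof -
  have un: "(\<Union>i. A (tu i)) = ?B"
  proof
   show "?B \<subseteq> (\<Union>i. A (tu i))"
   proof
   fix x :: 'a assume x: "x : ?B"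
   obtain i where "u x * real (Suc m) < 2 ^ i" using real_arch_pow[of 2 "u x * real (Suc m)"] by auto
   then have "u x < tu i" by (simp add: tu_def pos_less_divide_eq)
   then show "x : (\<Union>i. A (tu i))" using x by (auto simp: A_def)
   qed
  qed (auto simp: A_def)
  have "(%i. measure lborel (A (tu i))) ----> measure lborel (\<Union>i. A (tu i))"
  proof (rule Lim_measure_incseq)
   show "incseq (%i. A (tu i))" using tu by (intro incseq_SucI) (auto simp: A_def intro: less_trans)
   show "emeasure lborel (\<Union>i. A (tu i)) ~= \<infinity>" unfolding un using Bf by (auto simp: fmeasurable_def)
  qed (use A in auto)
  then have "\<forall>\<^sub>F i in sequentially. measure lborel (A (tu i)) > \<mu> / 2"
   unfolding un by (rule order_tendstoD(1)) (use \<mu> in \<open>simp add: \<mu>_def\<close>)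
  then show ?thesis using that by (auto simp: eventually_sequentially)
 qed
 \<comment> \<open>By \<open>m\<close> this index is not 0, so there is a predecessor
   \<open>i\<close>, and minimality bounds the sublevel set at \<open>tu i\<close>.\<close>
 define l where "l = (LEAST n. measure lborel (A (tu n)) > \<mu> / 2)"
 have l1: "measure lborel (A (tu l)) > \<mu> / 2" unfolding l_def by (rule LeastI[of _ n]) (rule n)
 have l0: "l ~= 0"
 proof
  assume "l = 0"
  then show False using l1 m by (simp add: tu_def)
 qed
 then obtain i where i: "l = Suc i" by (cases l) auto
 have l2: "measure lborel (A (tu i)) <= \<mu> / 2" using not_less_Least[of i "%n. measure lborel (A (tu n)) > \<mu> / 2"] i unfolding l_def by auto
 define t where "t = 1 / tu i"
 have t: "t > 0" using tu by (simp add: t_def)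
 have c1: "\<mu> / 2 <= measure lborel {x : ?B. t * u x <= 2}"
 proof -
  have "A (tu l) \<subseteq> {x : ?B. t * u x <= 2}" using tu[of i] by (auto simp: A_def i t_def divide_le_eq)
  moreover have "{x : ?B. t * u x <= 2} : fmeasurable lborel"
   by (rule fmeasurableI2[OF Bf]) auto
  ultimately have "measure lborel (A (tu l)) <= measure lborel {x : ?B. t * u x <= 2}" by (intro measure_mono_fmeasurable) auto
  then show ?thesis using l1 by linarith
 qed
 have c2: "\<mu> / 2 <= measure lborel {x : ?B. t * u x >= 1}"
 proof -
  have "{x : ?B. t * u x >= 1} = ?B - A (tu i)" using tu(1)[of i] by (auto simp: A_def t_def le_divide_eq not_less)
  moreover have "measure lborel (?B - A (tu i)) = measure lborel ?B - measure lborel (A (tu i))"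
   by (rule measure_Diff) (use Bf in \<open>auto simp: A_def fmeasurable_def\<close>)
  ultimately show ?thesis using l2 by (simp add: \<mu>_def)
 qed
 show ?thesis using that[OF t] c1 c2 \<mu> by (simp add: normalised_def \<mu>_def)
qed

section \<open>Local strong convergence of gradients and the entire solution\<close>

lemma integrable_ind_diff_powr:
 fixes f h :: "'a::euclidean_space => 'b::euclidean_space"
 assumes "p > 0" and [measurable]: "f : bmeas" "h : bmeas"
  and "integ (%x. norm (f x) powr p)" "integ (%x. norm (h x) powr p)"
 shows "integ (%x. ib R x * norm (f x - h x) powr p)"
proof (rule integrable_ind_mult, rule integrable_le)
 show "integ (%x. 2 powr p * (norm (f x) powr p + norm (h x) powr p))" using assms by auto
 show "AEL x. norm (norm (f x - h x) powr p) <= norm (2 powr p * (norm (f x) powr p + norm (h x) powr p))"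
  using norm_diff_powr_le[OF assms(1)] by (intro AE_I2) simp
qed measurable

text \<open>Test the difference of the two equations with \<open>sg * (ui - uj)\<close>: the flux
  part dominates the convexity gap, and every other term carries a factor \<open>ui - uj\<close>,
  small in \<open>L^p\<close>. The potentials need not be close to each other, as each is only
  paired with this small factor.\<close>

lemma gradient_difference_estimate:
 fixes Wi Wj :: "'a::euclidean_space => real"
 assumes p: "p > 1" and c: "c >= 0" and R: "R >= 0" and e: "e > 0" and P: "P >= 0"
 obtains \<epsilon> where "\<epsilon> > 0" "!!Wi Wj ui uj gi gj. bddpot c (Wi :: 'a => real) ==> bddpot c Wj ==> Wp p ui gi ==> Wp p uj gj ==>
  sol p Wi (R + 1) ui gi ==> sol p Wj (R + 1) uj gj ==>
  (LBINT x. ib (R + 1) x * ui x powr p) <= P ==> (LBINT x. ib (R + 1) x * norm (gi x) powr p) <= P ==>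
  (LBINT x. ib (R + 1) x * uj x powr p) <= P ==> (LBINT x. ib (R + 1) x * norm (gj x) powr p) <= P ==>
  (LBINT x. ib (R + 1) x * abs (ui x - uj x) powr p) <= \<epsilon> ==>
  (LBINT x. ib R x * norm (gi x - gj x) powr p) <= e"
proof -
 have p0: "p > 0" using p by simp
 obtain ct :: "'a => real" and sg dsg where sg: "C1 sg dsg" "!!x. sg x = ct x powr p" "!!x. 0 <= ct x" "!!x. ct x <= 1"
  "!!x. norm x <= R ==> ct x = 1" "!!x. norm x > R + 1 ==> ct x = 0"
  "!!x. norm (dsg x) <= (4 * p / 1) * ct x powr (p - 1)"
  by (rule cutoff_exists[OF p R zero_less_one, where 'a='a]) (rule that)
 have sgs: "supp_in sg (R + 1)" using sg(6) by (simp add: supp_in_def sg(2))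
 let ?i = "%x. indicat_real (cball 0 (R + 1)) x"
 have sg0: "sg x >= 0" "sg x <= ?i x" for x
  using sg(3,4,6)[of x] p by (auto simp: sg(2) indicator_def powr_le1)
 have dsg: "norm (dsg x) <= 4 * p * ?i x" for x
 proof (cases "norm x <= R + 1")
  case True
  have "norm (dsg x) <= 4 * p / 1 * ct x powr (p - 1)" by (rule sg(7))
  also have "... <= 4 * p / 1 * 1" using sg(3,4)[of x] p by (intro mult_left_mono powr_le1) auto
  finally show ?thesis using True by simp
 qed (use supp_in_grad[OF sg(1) sgs, of x] in simp)
 define B where "B = 4 * p + c"
 have B: "B > 0" using p c by (simp add: B_def add_pos_nonneg)
 define e1 where "e1 = e / (4 * (P + 1))"
 have e1: "e1 > 0" "e1 * (2 * P) <= e / 2"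
 proof -
  show "e1 > 0" using e P by (simp add: e1_def)
  have "e1 * (2 * P) <= e1 * (2 * (P + 1))" using \<open>e1 > 0\<close> by (intro mult_left_mono) auto
  also have "... = e / 2" unfolding e1_def by (rule cancel_fractions[of _ 1]) (use P in auto)
  finally show "e1 * (2 * P) <= e / 2" .
 qed
 obtain C where C: "C >= 0" "!!a b::'a. norm (a - b) powr p <= e1 * (norm a powr p + norm b powr p) + C * convgap p a b"
  by (rule norm_diff_convgap[OF p e1(1), where 'a='a]) (rule that)
 define e2 where "e2 = e / (2 * (C * p / 4 + 1))"
 have Cp: "C * p / 4 >= 0" using C p by simp
 have e2: "e2 > 0" "(C * p / 4) * e2 <= e / 2"
 proof -
  show "e2 > 0" using e Cp by (simp add: e2_def)
  have "(C * p / 4) * e2 <= (C * p / 4 + 1) * e2" using \<open>e2 > 0\<close> by (intro mult_right_mono) auto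
  also have "... = e / 2" unfolding e2_def by (rule cancel_fractions[of _ 1]) (use Cp in auto)
  finally show "(C * p / 4) * e2 <= e / 2" .
 qed
 define e3 where "e3 = e2 / (16 * B * (P + 1))"
 have e3: "e3 > 0" "B * (e3 * (4 * P)) <= e2 / 4"
 proof -
  show "e3 > 0" using e2 B P by (simp add: e3_def)
  have "B * (e3 * (4 * P)) <= B * (e3 * (4 * (P + 1)))" using \<open>e3 > 0\<close> B by (intro mult_left_mono) auto
  also have "... = e2 / 4" unfolding e3_def by (rule cancel_fractions) (use B P in auto)
  finally show "B * (e3 * (4 * P)) <= e2 / 4" .
 qed
 obtain K where K: "K >= 0" "!!a b. a >= 0 ==> b >= 0 ==> a powr (p - 1) * b <= e3 * a powr p + K * b powr p"
  using Young_powr_eps[OF p e3(1)] by blast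
 define \<epsilon> where "\<epsilon> = e2 / (4 * B * (4 * K + 1))"
 have \<epsilon>: "\<epsilon> > 0" "B * (4 * K * \<epsilon>) <= e2 / 4"
 proof -
  show "\<epsilon> > 0" using e2 B K by (simp add: \<epsilon>_def)
  have "B * (4 * K * \<epsilon>) <= B * ((4 * K + 1) * \<epsilon>)" using \<open>\<epsilon> > 0\<close> B by (intro mult_left_mono mult_right_mono) auto
  also have "... = e2 / 4" unfolding \<epsilon>_def by (rule cancel_fractions) (use B K in auto)
  finally show "B * (4 * K * \<epsilon>) <= e2 / 4" .
 qed
 show ?thesis
 proof (rule that[OF \<epsilon>(1)], goal_cases)
  case (1 Wi Wj ui uj gi gj)
  note W = 1(1,2) and Ui = 1(3) and Uj = 1(4) and Si = 1(5) and Sj = 1(6) and bd = 1(7-10) and small = 1(11)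
  note [measurable] = WpD(1,2)[OF Ui p] WpD(1,2)[OF Uj p] bddpotD(1)[OF W(1)] bddpotD(1)[OF W(2)] C1_meas[OF sg(1)]
  have u0: "ui x >= 0" "uj x >= 0" for x using WpD(3)[OF Ui p] WpD(3)[OF Uj p] by auto
  let ?w = "%W u g v h x. pflux p (g x) \<bullet> (v x *\<^sub>R dsg x + (sg x * 1) *\<^sub>R h x) + W x * u x powr (p - 1) * (sg x * v x)"
  have T: "integ (?w W u g v h) & (LBINT x. ?w W u g v h x) = 0"
   if "bddpot c W" "Wp p u g" "sol p W (R + 1) u g" "Wp p v h" for W u g v h
   using sol_test[OF p that Lipfun_id sg(1) sgs] unfolding weakf_def by simp
  let ?q = "%x. (?w Wi ui gi ui gi x - ?w Wi ui gi uj gj x) - (?w Wj uj gj ui gi x - ?w Wj uj gj uj gj x)"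
  note T4 = T[OF W(1) Ui Si Ui] T[OF W(1) Ui Si Uj] T[OF W(2) Uj Sj Ui] T[OF W(2) Uj Sj Uj]
  have q0: "(LBINT x. ?q x) = 0" and qi: "integ ?q" using T4 by auto
  have iN: "integ (%x. norm (gi x) powr p)" "integ (%x. norm (gj x) powr p)"
   "integ (%x. ui x powr p)" "integ (%x. uj x powr p)"
   using WpD(4,5)[OF Ui p] WpD(4,5)[OF Uj p] by auto
  note jN = iN[THEN integrable_ind_mult[where R = "R + 1"]] and kN = iN[THEN integrable_ind_mult[where R = R]]
  have di: "integ (%x. ?i x * abs (ui x - uj x) powr p)"
   using integrable_ind_diff_powr[OF p0, of ui uj "R + 1"] iN u0 by simp
  have cgi: "integ (%x. convgap p (gi x) (gj x))"
  proof (rule integrable_le)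
   show "integ (%x. (norm (gi x) powr p + norm (gj x) powr p) / 2)" using iN by auto
   show "AEL x. norm (convgap p (gi x) (gj x)) <= norm ((norm (gi x) powr p + norm (gj x) powr p) / 2)"
   proof (intro AE_I2)
   fix x
   have "convgap p (gi x) (gj x) <= (norm (gi x) powr p + norm (gj x) powr p) / 2"
   unfolding convgap_def by (subst diff_le_eq) (rule add_increasing2[OF powr_ge_zero order_refl])
   then show "norm (convgap p (gi x) (gj x)) <= norm ((norm (gi x) powr p + norm (gj x) powr p) / 2)"
   using convgap_nonneg[OF p, of "gi x" "gj x"] by simp
   qed
   show "(%x. convgap p (gi x) (gj x)) : borel_measurable lborel" unfolding convgap_def by measurable
  qed
  let ?z = "%x. ?i x * (ui x powr p + uj x powr p + norm (gi x) powr p + norm (gj x) powr p)"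
  have pt: "4 / p * (sg x * convgap p (gi x) (gj x)) <= ?q x + B * (e3 * ?z x + 4 * K * (?i x * abs (ui x - uj x) powr p))" for x
  proof -
   let ?d = "abs (ui x - uj x)"
   let ?a = "pflux p (gi x) - pflux p (gj x)" and ?b = "Wi x * ui x powr (p - 1) - Wj x * uj x powr (p - 1)"
   have qeq: "?q x = sg x * (?a \<bullet> (gi x - gj x)) + (ui x - uj x) * (?a \<bullet> dsg x) + ?b * (sg x * (ui x - uj x))"
   by (simp add: inner_add_right inner_diff_left inner_diff_right algebra_simps)
   have m: "4 / p * convgap p (gi x) (gj x) <= ?a \<bullet> (gi x - gj x)"
   using pflux_monotone_convgap[OF p, of "gi x" "gj x"] p by (simp add: field_simps)
   have 1: "4 / p * (sg x * convgap p (gi x) (gj x)) <= sg x * (?a \<bullet> (gi x - gj x))"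
   using mult_left_mono[OF m sg0(1)[of x]] by (simp add: mult_ac)
   let ?s = "norm (gi x) powr (p - 1) * ?d + norm (gj x) powr (p - 1) * ?d"
   let ?t = "ui x powr (p - 1) * ?d + uj x powr (p - 1) * ?d"
   have 2: "abs ((ui x - uj x) * (?a \<bullet> dsg x)) <= 4 * p * (?i x * ?s)"
   proof -
   have "abs (?a \<bullet> dsg x) <= norm ?a * norm (dsg x)" by (rule Cauchy_Schwarz_ineq2)
   also have "... <= (norm (gi x) powr (p - 1) + norm (gj x) powr (p - 1)) * (4 * p * ?i x)"
   using norm_triangle_ineq4[of "pflux p (gi x)" "pflux p (gj x)"] dsg[of x] by (intro mult_mono) (auto simp: norm_pflux)
   finally have "?d * abs (?a \<bullet> dsg x) <= ?d * ((norm (gi x) powr (p - 1) + norm (gj x) powr (p - 1)) * (4 * p * ?i x))" by (intro mult_left_mono) auto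
   also have "... = 4 * p * (?i x * ?s)" by (simp add: algebra_simps)
   finally show ?thesis unfolding abs_mult .
   qed
   have 3: "abs (?b * (sg x * (ui x - uj x))) <= c * (?i x * ?t)"
   proof -
   have "abs ?b <= abs (Wi x) * ui x powr (p - 1) + abs (Wj x) * uj x powr (p - 1)"
   using abs_triangle_ineq4[of "Wi x * ui x powr (p - 1)" "Wj x * uj x powr (p - 1)"] by (simp add: abs_mult)
   also have "... <= c * ui x powr (p - 1) + c * uj x powr (p - 1)"
   using bddpotD(2)[OF W(1), of x] bddpotD(2)[OF W(2), of x] by (intro add_mono mult_right_mono) auto
   finally have b: "abs ?b <= c * (ui x powr (p - 1) + uj x powr (p - 1))" by (simp add: distrib_left)
   have "abs (?b * (sg x * (ui x - uj x))) = abs ?b * (sg x * ?d)" using sg0(1)[of x] by (simp add: abs_mult)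
   also have "... <= (c * (ui x powr (p - 1) + uj x powr (p - 1))) * (?i x * ?d)"
   using b sg0[of x] c by (intro mult_mono mult_right_mono) auto
   also have "... = c * (?i x * ?t)" by (simp add: algebra_simps)
   finally show ?thesis .
   qed
   have y: "a powr (p - 1) * ?d <= e3 * a powr p + K * ?d powr p" if "a >= 0" for a using K(2)[OF that, of ?d] by simp
   have s0: "?s >= 0" "?t >= 0" by auto
   have "4 * p * (?i x * ?s) + c * (?i x * ?t) <= B * (?i x * (?s + ?t))"
   proof -
   have "4 * p * (?i x * ?s) <= B * (?i x * ?s)" "c * (?i x * ?t) <= B * (?i x * ?t)"
   using c p by (intro mult_right_mono; simp add: B_def)+
   then show ?thesis by (simp only: distrib_left)
   qed
   also have "... <= B * (?i x * (e3 * (ui x powr p + uj x powr p + norm (gi x) powr p + norm (gj x) powr p) + 4 * K * ?d powr p))"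
   proof (intro mult_left_mono)
   show "?s + ?t <= e3 * (ui x powr p + uj x powr p + norm (gi x) powr p + norm (gj x) powr p) + 4 * K * ?d powr p"
   using y[of "ui x"] y[of "uj x"] y[of "norm (gi x)"] y[of "norm (gj x)"] u0[of x] by (simp add: distrib_left)
   qed (use B in auto)
   also have "... = B * (e3 * ?z x + 4 * K * (?i x * ?d powr p))" by (simp add: algebra_simps)
   finally have 4: "4 * p * (?i x * ?s) + c * (?i x * ?t) <= B * (e3 * ?z x + 4 * K * (?i x * ?d powr p))" .
   have "a <= s + t + v + M" if "a <= s" "abs t <= X" "abs v <= Y" "X + Y <= M" for a s t v X Y M :: real
   using that by linarith
   from this[OF 1 2 3 4] show ?thesis unfolding qeq .
  qed
  have zi: "integ ?z" using iN by (intro integrable_ind_mult) auto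
  have sgcg: "integ (%x. sg x * convgap p (gi x) (gj x))"
  proof (rule integrable_le[OF cgi])
   show "AEL x. norm (sg x * convgap p (gi x) (gj x)) <= norm (convgap p (gi x) (gj x))"
   proof (intro AE_I2)
   fix x
   have "abs (sg x) <= 1" using sg0(1)[of x] order_trans[OF sg0(2)[of x] indicator_le_1] by simp
   then show "norm (sg x * convgap p (gi x) (gj x)) <= norm (convgap p (gi x) (gj x))" by (simp add: abs_mult mult_left_le_one_le)
   qed
   show "(%x. sg x * convgap p (gi x) (gj x)) : borel_measurable lborel" unfolding convgap_def by measurable
  qed
  have "4 / p * (LBINT x. sg x * convgap p (gi x) (gj x)) = (LBINT x. 4 / p * (sg x * convgap p (gi x) (gj x)))" by simp
  also have "... <= (LBINT x. ?q x + B * (e3 * ?z x + 4 * K * (?i x * abs (ui x - uj x) powr p)))"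
   by (rule integral_mono[OF integrable_mult_right[OF sgcg] _ pt])
   (intro Bochner_Integration.integrable_add qi integrable_mult_right zi di)
  also have "... = (LBINT x. ?q x) + (LBINT x. B * (e3 * ?z x + 4 * K * (?i x * abs (ui x - uj x) powr p)))"
   by (rule Bochner_Integration.integral_add[OF qi]) (intro Bochner_Integration.integrable_add integrable_mult_right zi di)
  also have "... = B * (e3 * (LBINT x. ?z x) + 4 * K * (LBINT x. ?i x * abs (ui x - uj x) powr p))"
   unfolding q0 using zi di by simp
  also have "... <= B * (e3 * (4 * P) + 4 * K * \<epsilon>)"
  proof (intro mult_left_mono add_mono small)
   have "(LBINT x. ?z x) = (LBINT x. ?i x * ui x powr p) + (LBINT x. ?i x * uj x powr p) + (LBINT x. ?i x * norm (gi x) powr p) + (LBINT x. ?i x * norm (gj x) powr p)"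
   using jN by (simp add: distrib_left)
   then show "(LBINT x. ?z x) <= 4 * P" using bd by linarith
  qed (use B e3 K in auto)
  also have "... <= e2" using e3(2) \<epsilon>(2) e2(1) by (simp add: distrib_left)
  finally have s1: "(LBINT x. sg x * convgap p (gi x) (gj x)) <= p / 4 * e2" using p by (simp add: field_simps)
  have icg: "integ (%x. ib R x * convgap p (gi x) (gj x))" by (intro integrable_ind_mult cgi)
  have s2: "(LBINT x. ib R x * convgap p (gi x) (gj x)) <= p / 4 * e2"
  proof -
   have "(LBINT x. ib R x * convgap p (gi x) (gj x)) <= (LBINT x. sg x * convgap p (gi x) (gj x))"
   using convgap_nonneg[OF p] sg(5) sg0 by (intro integral_mono[OF icg sgcg] mult_right_mono) (auto simp: indicator_def sg(2))
   then show ?thesis using s1 by linarith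
  qed
  have gR: "(LBINT x. ib R x * norm (g x) powr p) <= (LBINT x. ?i x * norm (g x) powr p)" if "integ (%x. norm (g x) powr p)" for g :: "'a => 'a"
   using that by (intro integral_mono integrable_ind_mult) (auto simp: indicator_def)
  let ?r = "%x. e1 * (ib R x * norm (gi x) powr p + ib R x * norm (gj x) powr p) + C * (ib R x * convgap p (gi x) (gj x))"
  have ri: "integ ?r" using kN icg by auto
  have "(LBINT x. ib R x * norm (gi x - gj x) powr p) <= (LBINT x. ?r x)"
  proof (rule integral_mono[OF integrable_ind_diff_powr[OF p0] ri])
   fix x show "ib R x * norm (gi x - gj x) powr p <= ?r x" using C(2)[of "gi x" "gj x"] by (auto simp: indicator_def)
  qed (use iN in auto)
  also have "... = e1 * ((LBINT x. ib R x * norm (gi x) powr p) + (LBINT x. ib R x * norm (gj x) powr p)) + C * (LBINT x. ib R x * convgap p (gi x) (gj x))"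
   using kN icg by simp
  also have "... <= e1 * (2 * P) + C * (p / 4 * e2)"
   using gR[OF iN(1)] gR[OF iN(2)] bd s2 e1 C by (intro add_mono mult_left_mono) auto
  also have "C * (p / 4 * e2) = C * p / 4 * e2" by simp
  also have "e1 * (2 * P) + C * p / 4 * e2 <= e" using e1(2) e2(2) by linarith
  finally show ?case .
 qed
qed

lemma eventually_bounded_imp_bounded:
 fixes a :: "nat => real"
 assumes "!!n. n >= N ==> a n <= C" "C >= 0"
 shows "a n <= C + (\<Sum>i<N. abs (a i))"
proof (cases "n < N")
 case True
 have "a n <= abs (a n)" by simp
 also have "... <= (\<Sum>i<N. abs (a i))" using True by (intro member_le_sum) auto
 finally show ?thesis using assms(2) by simp
next
 case False
 then have "a n <= C" using assms(1) by simp
 moreover have "0 <= (\<Sum>i<N. abs (a i))" by (intro sum_nonneg) auto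
 ultimately show ?thesis by linarith
qed

text \<open>Below \<open>lam\<close> by \<open>1 / (n + 1)\<close> the energy is strictly coercive
  and yields a solution on the ball of radius \<open>n + 1\<close>; the levels reach
  \<open>lam\<close> in the limit. The majorants and bounds hold on each ball for large
  \<open>n\<close>, which determines the bookkeeping.\<close>

lemma entire_solution:
 fixes V :: "'a::euclidean_space => real" and lam c0 :: real
 assumes p: "p > 1" and V: "bddpot c0 V"
  and coer: "!!n::nat. EX gm>0. ALL ph G r. C1 ph G --> (ALL x. ph x >= 0) --> supp_in ph r -->
   gm * (LBINT x. ph x powr p) <= (LBINT x. norm (G x) powr p + (V x - (lam - 1 / real (Suc n))) * ph x powr p)"
 obtains u g where "u : bmeas" "g : bmeas" "!!x. u x > 0"
  "!!R. integ (%x. ib R x * u x powr p)"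
  "!!R. integ (%x. ib R x * norm (g x) powr p)"
  "!!zt dzt R v. C1 zt dzt ==> supp_in zt R ==> (LBINT x. u x * (dzt x \<bullet> v)) = - (LBINT x. (g x \<bullet> v) * zt x)"
  "!!zt dzt R. C1 zt dzt ==> supp_in zt R ==>
   integ (%x. pflux p (g x) \<bullet> dzt x) & integ (%x. V x * u x powr (p - 1) * zt x) & integ (%x. u x powr (p - 1) * zt x) &
   (LBINT x. pflux p (g x) \<bullet> dzt x) + (LBINT x. V x * u x powr (p - 1) * zt x) - lam * (LBINT x. u x powr (p - 1) * zt x) = 0"
proof -
 have p0: "p > 0" using p by simp
 note [measurable] = bddpotD(1)[OF V]
 define W where "W n x = V x - (lam - 1 / real (Suc n))" for n x
 \<comment> \<open>One bound for all the potentials \<open>W n\<close>, so that constants of the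
   local estimates do not depend on \<open>n\<close>.\<close>
 define c where "c = c0 + abs lam + 1"
 have c: "c >= 0" using bddpotD(3)[OF V] by (simp add: c_def)
 have Wb: "bddpot c (W n)" for n unfolding bddpot_def
 proof (intro conjI allI)
  show "W n : bmeas" unfolding W_def by measurable
  fix x
  have "0 <= 1 / real (Suc n)" "1 / real (Suc n) <= 1" by auto
  then show "abs (W n x) <= c" using bddpotD(2)[OF V, of x] unfolding W_def c_def by linarith
 qed
 define al where "al = measure lborel (cball 0 1 :: 'a set) / 2"
 have "EX u g. Wp p u g & sol p (W n) (real n + 1) u g & normalised al u" for n
 proof -
  obtain gm where gm: "gm > 0" "ALL ph G r. C1 ph G --> (ALL x. ph x >= 0) --> supp_in ph r -->
   gm * (LBINT x. ph x powr p) <= (LBINT x. norm (G x) powr p + W n x * ph x powr p)"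
   using coer[of n] unfolding W_def by blast
  have R1: "real n + 1 >= 1" by simp
  obtain u g where u: "Wp p u g" "sol p (W n) (real n + 1) u g" "AEL x. x : cball 0 (real n + 1) --> u x > 0"
  proof (rule exists_solution_ball[OF p Wb[of n] gm(1) R1], goal_cases)
   case (1 ph G r) then show ?case using gm(2) by blast
  next
   case (2 u g) show ?case by (rule 2(1)[OF 2(2-4)])
  qed
  have "AEL x. x : cball 0 1 --> u x > 0" using u(3) by eventually_elim auto
  then obtain t where t: "t > 0" "normalised (measure lborel (cball 0 1 :: 'a set) / 2) (%x. t * u x)"
   by (rule normalise[OF WpD(1)[OF u(1) p]]) (rule that)
  note t = t(1) t(2)[folded al_def]
  show ?thesis using Wp_scale[OF p u(1) t(1)] sol_scale[OF p t(1) u(1,2)] t(2) by blast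
 qed
 then obtain u g where U: "!!n. Wp p (u n) (g n)" and S: "!!n. sol p (W n) (real n + 1) (u n) (g n)" and N: "!!n. normalised al (u n)" by metis
 have Sm: "sol p (W n) R (u n) (g n)" if "R <= real n" for n R using sol_mono[OF S] that by simp
 note [measurable] = WpD(1,2)[OF U p]
 have u0: "u n x >= 0" for n x using WpD(3)[OF U p] .
 \<comment> \<open>The local estimate needs a solution on the ball of radius \<open>rh\<close>,
   hence large \<open>n\<close>; for the finitely many other \<open>n\<close> the finite integrals
   themselves are added to the bound.\<close>
 have bd: "EX C>=0. ALL n. (LBINT x. ib R x * u n x powr p) <= C & (LBINT x. ib R x * norm (g n x) powr p) <= C" for R :: real
 proof -
  have R1: "max R 1 >= 1" by simp
  obtain C rh where C: "!!W u g. bddpot c (W :: 'a => real) ==> Wp p u g ==> sol p W rh u g ==> normalised al u ==>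
  (LBINT x. ib (max R 1) x * u x powr p) <= C & (LBINT x. ib (max R 1) x * norm (g x) powr p) <= C"
  proof (rule local_bound_grad[OF p c R1, where 'a='a and al=al], goal_cases)
   case (1 rh C) show ?case by (rule 1(1)[OF 1(2)])
  qed
  define M where "M = nat \<lceil>rh\<rceil>"
  have M: "rh <= real n" if "n >= M" for n using that unfolding M_def by linarith
  define C' where "C' = max C 0"
  define a where "a n = (LBINT x. ib R x * u n x powr p)" for n
  define b where "b n = (LBINT x. ib R x * norm (g n x) powr p)" for n
  have ab: "a n <= C'" "b n <= C'" if "n >= M" for n
  proof -
   note CC = C[OF Wb U Sm[OF M[OF that]] N]
   have "a n <= (LBINT x. ib (max R 1) x * u n x powr p)" unfolding a_def
   by (intro integral_mono integrable_ind_mult WpD(4)[OF U p]) (auto simp: indicator_def)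
   then show "a n <= C'" using CC unfolding C'_def by linarith
   have "b n <= (LBINT x. ib (max R 1) x * norm (g n x) powr p)" unfolding b_def
   by (intro integral_mono integrable_ind_mult WpD(5)[OF U p]) (auto simp: indicator_def)
   then show "b n <= C'" using CC unfolding C'_def by linarith
  qed
  have C'0: "C' >= 0" by (simp add: C'_def)
  have s0: "0 <= (\<Sum>i<M. abs (a i))" "0 <= (\<Sum>i<M. abs (b i))" by (auto intro!: sum_nonneg)
  have "a n <= C' + (\<Sum>i<M. abs (a i)) + (\<Sum>i<M. abs (b i)) & b n <= C' + (\<Sum>i<M. abs (a i)) + (\<Sum>i<M. abs (b i))" for n
   using eventually_bounded_imp_bounded[of M a C' n, OF ab(1) C'0] eventually_bounded_imp_bounded[of M b C' n, OF ab(2) C'0] s0 by linarith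
  then show ?thesis unfolding a_def[symmetric] b_def[symmetric] using C'0 s0
   by (intro exI[of _ "C' + (\<Sum>i<M. abs (a i)) + (\<Sum>i<M. abs (b i))"]) auto
 qed
 obtain r where r: "strict_mono (r :: nat => nat)"
  "!!R e. e > 0 ==> EX N. ALL m>=N. ALL n>=N. (LBINT x. ib R x * abs (u (r m) x - u (r n) x) powr p) <= e"
 proof (rule Rellich[OF p, of u])
  show "integ (%x. abs (u n x) powr p)" for n using u0 WpD(4)[OF U p] by simp
  fix R :: real
  obtain C where C: "C >= 0" "!!n. (LBINT x. ib R x * u n x powr p) <= C" using bd[of R] by blast
  obtain C' where C': "C' >= 0" "!!n. (LBINT x. ib (R + 1) x * norm (g n x) powr p) <= C'" using bd[of "R + 1"] by blast
  show "EX C>=0. ALL n. (LBINT x. ib R x * abs (u n x) powr p) <= C &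
   (ALL z. norm z <= 1 --> (\<integral>\<^sup>+x. ib R x * ennreal (abs (u n (x + z) - u n x) powr p) \<partial>lborel) <= ennreal (C * norm z powr p))"
  proof (intro exI[of _ "C + C'"] conjI allI impI)
   show "0 <= C + C'" using C C' by simp
   fix n
   show "(LBINT x. ib R x * abs (u n x) powr p) <= C + C'" using C(2)[of n] C'(1) u0[of n] by simp
   fix z :: 'a assume z: "norm z <= 1"
   obtain ph G D where A: "approx p ph G D (u n) (g n)" using U[of n] by (auto simp: Wp_def)
   have "(\<integral>\<^sup>+x. ib R x * ennreal (abs (u n (x + z) - u n x) powr p) \<partial>lborel)
   <= ennreal (norm z powr p * (LBINT x. ib (R + norm z) x * norm (g n x) powr p))"
   using approx_translation[OF A p Lipfun_id C1_const[of 1], of R z] by simp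
   also have "... <= ennreal ((C + C') * norm z powr p)"
   proof (rule ennreal_leI)
   have "(LBINT x. ib (R + norm z) x * norm (g n x) powr p) <= (LBINT x. ib (R + 1) x * norm (g n x) powr p)"
   using z by (intro integral_mono integrable_ind_mult WpD(5)[OF U p]) (auto simp: indicator_def)
   also have "... <= C + C'" using C'(2)[of n] C(1) by linarith
   finally show "norm z powr p * (LBINT x. ib (R + norm z) x * norm (g n x) powr p) <= (C + C') * norm z powr p"
   by (subst mult.commute) (intro mult_right_mono, auto)
   qed
   finally show "(\<integral>\<^sup>+x. ib R x * ennreal (abs (u n (x + z) - u n x) powr p) \<partial>lborel) <= ennreal ((C + C') * norm z powr p)" .
  qed
 qed (use that in auto)
 have CG: "EX N. ALL m>=N. ALL n>=N. (LBINT x. ib (real k) x * norm (g (r m) x - g (r n) x) powr p) <= e" if e: "e > 0" for e and k :: nat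
 proof -
  obtain P where P: "P >= 0" "!!n. (LBINT x. ib (real k + 1) x * u n x powr p) <= P"
   "!!n. (LBINT x. ib (real k + 1) x * norm (g n x) powr p) <= P" using bd[of "real k + 1"] by blast
  have k0: "real k >= 0" by simp
  obtain \<epsilon> where \<epsilon>: "\<epsilon> > 0" "!!Wi Wj ui uj gi gj. bddpot c (Wi :: 'a => real) ==> bddpot c Wj ==> Wp p ui gi ==> Wp p uj gj ==>
  sol p Wi (real k + 1) ui gi ==> sol p Wj (real k + 1) uj gj ==>
  (LBINT x. ib (real k + 1) x * ui x powr p) <= P ==> (LBINT x. ib (real k + 1) x * norm (gi x) powr p) <= P ==>
  (LBINT x. ib (real k + 1) x * uj x powr p) <= P ==> (LBINT x. ib (real k + 1) x * norm (gj x) powr p) <= P ==>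
  (LBINT x. ib (real k + 1) x * abs (ui x - uj x) powr p) <= \<epsilon> ==>
  (LBINT x. ib (real k) x * norm (gi x - gj x) powr p) <= e"
  proof (rule gradient_difference_estimate[OF p c k0 e P(1), where 'a='a], goal_cases)
   case (1 \<epsilon>) show ?case by (rule 1(1)[OF 1(2,3)])
  qed
  obtain M where M: "!!m n. m >= M ==> n >= M ==> (LBINT x. ib (real k + 1) x * abs (u (r m) x - u (r n) x) powr p) <= \<epsilon>"
   using r(2)[OF \<epsilon>(1), of "real k + 1"] by blast
  show ?thesis
  proof (intro exI[of _ "max M (k + 1)"] allI impI)
   \<comment> \<open>From index \<open>k + 1\<close> on both functions solve their equations on the
     ball of radius \<open>k + 1\<close>, which carries the cutoff.\<close>
   fix m n assume mn: "max M (k + 1) <= m" "max M (k + 1) <= n"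
   have "k + 1 <= r m" "k + 1 <= r n" using mn seq_suble[OF r(1), of m] seq_suble[OF r(1), of n] by linarith+
   then have S1: "sol p (W (r m)) (real k + 1) (u (r m)) (g (r m))" and S2: "sol p (W (r n)) (real k + 1) (u (r n)) (g (r n))"
   by (auto intro!: Sm)
   have Mmn: "(LBINT x. ib (real k + 1) x * abs (u (r m) x - u (r n) x) powr p) <= \<epsilon>" using M[of m n] mn by simp
   show "(LBINT x. ib (real k) x * norm (g (r m) x - g (r n) x) powr p) <= e"
   by (rule \<epsilon>(2)[OF Wb Wb U U S1 S2 P(2,3) P(2,3) Mmn])
  qed
 qed
 let ?S = "%k::nat. cball (0::'a) (real k)"
 have incS: "incseq ?S" by (auto simp: incseq_def)
 have unS: "x : (\<Union>k. ?S k)" for x using real_arch_simple[of "norm x"] by auto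
 obtain r1 h where r1: "strict_mono r1" "h : bmeas"
  "!!k. EX D. integrable lborel D & (ALL n>=k. AEL x. x : ?S k --> norm (u (r (r1 n)) x) powr p <= D x)"
  "AEL x. x : (\<Union>k. ?S k) --> (%n. u (r (r1 n)) x) ----> h x"
  by (rule Lp_Cauchy_subseq[OF p0, of "%k. u (r k)" ?S]) (use u0 WpD(4)[OF U p] r(2) incS that in auto)
 have r1m: "n <= r1 n" for n using seq_suble[OF r1(1)] .
 obtain r2 gl where r2: "strict_mono r2" "gl : bmeas"
  "!!k. EX D. integrable lborel D & (ALL n>=k. AEL x. x : ?S k --> norm (g (r (r1 (r2 n))) x) powr p <= D x)"
  "AEL x. x : (\<Union>k. ?S k) --> (%n. g (r (r1 (r2 n))) x) ----> gl x"
 proof (rule Lp_Cauchy_subseq[OF p0, of "%k. g (r (r1 k))" ?S])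
  fix k and e :: real assume "e > 0"
  then obtain M where M: "!!m n. m >= M ==> n >= M ==> (LBINT x. indicator (?S k) x * norm (g (r m) x - g (r n) x) powr p) <= e" using CG by blast
  show "EX N. ALL m>=N. ALL n>=N. (LBINT x. indicator (?S k) x * norm (g (r (r1 m)) x - g (r (r1 n)) x) powr p) <= e"
   by (intro exI[of _ M] allI impI M) (meson r1m order_trans)+
 qed (use WpD(5)[OF U p] incS that in auto)
 define s where "s n = r (r1 (r2 n))" for n
 have sn: "n <= s n" for n unfolding s_def using seq_suble[OF r(1)] seq_suble[OF r1(1)] seq_suble[OF r2(1)] by (meson order_trans)
 have lim: "AEL x. (%n. u (s n) x) ----> h x & (%n. g (s n) x) ----> gl x"
  using r1(4) r2(4)
 proof eventually_elim
  case (elim x)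
  have "(%n. u (r (r1 n)) x) ----> h x" using elim unS by blast
  then have "(%n. u (s n) x) ----> h x" using LIMSEQ_subseq_LIMSEQ[OF _ r2(1)] by (simp add: s_def o_def)
  then show ?case using elim unS by (auto simp: s_def)
 qed
 have dom: "EX D. integrable lborel D & (ALL n>=k. AEL x. x : ?S k --> u (s n) x powr p <= D x & norm (g (s n) x) powr p <= D x)" for k
 proof -
  obtain D1 where D1: "integrable lborel D1" "!!n. n >= k ==> AEL x. x : ?S k --> norm (u (r (r1 n)) x) powr p <= D1 x" using r1(3)[of k] by blast
  obtain D2 where D2: "integrable lborel D2" "!!n. n >= k ==> AEL x. x : ?S k --> norm (g (r (r1 (r2 n))) x) powr p <= D2 x" using r2(3)[of k] by blast
  show ?thesis
  proof (intro exI[of _ "%x. abs (D1 x) + abs (D2 x)"] conjI allI impI)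
   show "integ (%x. abs (D1 x) + abs (D2 x))" using D1 D2 by auto
   fix n assume n: "n >= k"
   then have "r2 n >= k" using seq_suble[OF r2(1), of n] by simp
   from D1(2)[OF this] D2(2)[OF n]
   show "AEL x. x : ?S k --> u (s n) x powr p <= abs (D1 x) + abs (D2 x) & norm (g (s n) x) powr p <= abs (D1 x) + abs (D2 x)"
   by eventually_elim (use u0 in \<open>auto simp: s_def\<close>)
  qed
 qed
 note [measurable] = r1(2) r2(2)
 \<comment> \<open>The bound on the negative part of the logarithm is uniform in the index and in
   \<open>dl\<close>. It passes to the limit for fixed \<open>dl\<close>, and a zero set of positive
   measure would make it blow up as \<open>dl\<close> tends to 0.\<close>
 have hpos: "AEL x. h x > 0"
 proof -
  have "AEL x. x : ?S k --> h x > 0" if k: "k >= 1" for k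
  proof -
   have R1: "real k >= 1" using k by simp
   obtain C where C: "!!W u g dl. bddpot c (W :: 'a => real) ==> Wp p u g ==> super p W (3 * real k + 1) u g ==> normalised al u ==> dl > 0 ==>
   integ (%x. indicator (?S k) x * abs (max 0 (- ln (u x + dl))) powr p) &
   (LBINT x. indicator (?S k) x * abs (max 0 (- ln (u x + dl))) powr p) <= C"
   proof (rule neg_log_bound[OF p c R1, where 'a='a and al=al], goal_cases)
   case (1 C) show ?case by (rule 1(1)[OF 1(2)])
   qed
   have h0: "AEL x. h x >= 0" using lim by eventually_elim (use u0 in \<open>auto intro: LIMSEQ_le_const\<close>)
   define Z where "Z = {x : ?S k. h x = 0}"
   have Zm [measurable]: "Z : sets borel" unfolding Z_def by measurable
   have Zf: "Z : fmeasurable lborel"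
   proof (rule fmeasurableI2)
   show "?S k : fmeasurable lborel" using emeasure_lborel_cball_finite[of "0::'a" "real k"] by (auto simp: fmeasurable_def less_top)
   qed (auto simp: Z_def)
   have ineq: "measure lborel Z * y powr p <= C" if y: "y > 0" for y
   proof -
   \<comment> \<open>With this choice the negative part of \<open>ln (t + dl)\<close> is at most
     \<open>y\<close>, and equals \<open>y\<close> at \<open>t = 0\<close>.\<close>
   define dl where "dl = exp (- y)"
   have dl: "dl > 0" "dl < 1" using y by (auto simp: dl_def)
   let ?f = "%n x. indicator (?S k) x * abs (max 0 (- ln (u (s n) x + dl))) powr p"
   let ?l = "%x. indicator (?S k) x * abs (max 0 (- ln (h x + dl))) powr p"
   have fb: "abs (max 0 (- ln (t + dl))) <= y" if "t >= 0" for t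
   proof -
   have "ln dl <= ln (t + dl)" using that dl by (subst ln_le_cancel_iff) auto
   then show ?thesis using y by (simp add: dl_def)
   qed
   have wi: "integ (%x::'a. indicator (?S k) x * y powr p)" by (intro integrable_mult_left integrable_ind_cball)
   have l1: "(%n. LBINT x. ?f n x) ----> (LBINT x. ?l x)"
   proof (rule integral_dominated_convergence[OF _ _ wi])
   show "AEL x. norm (?f n x) <= indicator (?S k) x * y powr p" for n
   using fb[OF u0] p by (intro AE_I2) (auto simp: indicator_def intro!: powr_mono2)
   show "AEL x. (%n. ?f n x) ----> ?l x"
   using lim h0
   proof eventually_elim
   case (elim x)
   have "(%n. max 0 (- ln (u (s n) x + dl))) ----> max 0 (- ln (h x + dl))"
   using elim dl by (intro tendsto_intros) auto
   from tendsto_norm_powr[OF this p0] show ?case by (auto intro!: tendsto_intros)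
   qed
   qed measurable
   have "(LBINT x. ?f n x) <= C" if "n >= 3 * k + 1" for n
   proof -
   have "3 * real k + 1 <= real (s n)" using sn[of n] that by linarith
   then have "super p (W (s n)) (3 * real k + 1) (u (s n)) (g (s n))" by (intro sol_super Sm)
   then show ?thesis using C[OF Wb U _ N dl(1)] by blast
   qed
   then have "(LBINT x. ?l x) <= C" by (intro LIMSEQ_le_const2[OF l1] exI[of _ "3 * k + 1"]) auto
   moreover have "measure lborel Z * y powr p <= (LBINT x. ?l x)"
   proof -
   have "measure lborel Z * y powr p = (LBINT x. indicator Z x * y powr p)" by simp
   also have "... <= (LBINT x. ?l x)"
   proof (rule integral_mono_AE)
   show "integ (%x. indicator Z x * y powr p)" using Zf by (intro integrable_mult_left integrable_real_indicator) (auto simp: fmeasurable_def)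
   show "integ ?l"
   proof (rule integrable_le[OF wi])
   show "AEL x. norm (?l x) <= norm (indicator (?S k) x * y powr p)"
   using h0
   proof eventually_elim
   case (elim x)
   have "abs (max 0 (- ln (h x + dl))) powr p <= y powr p" using fb[OF elim] p0 by (intro powr_mono2) auto
   then show ?case by (simp add: indicator_def)
   qed
   qed measurable
   show "AEL x. indicator Z x * y powr p <= ?l x"
   using y by (intro AE_I2) (auto simp: Z_def indicator_def dl_def)
   qed
   finally show ?thesis .
   qed
   ultimately show ?thesis by linarith
   qed
   have "measure lborel Z = 0"
   proof (rule ccontr)
   assume "measure lborel Z ~= 0"
   then have b: "measure lborel Z > 0" using measure_nonneg[of lborel Z] by linarith
   have C0: "C > 0" using ineq[of 1] b by simp
   define y where "y = (2 * C / measure lborel Z) powr (1 / p)"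
   have "y > 0" "y powr p = 2 * C / measure lborel Z" using C0 b p by (auto simp: y_def powr_powr)
   then have "2 * C <= C" using ineq[of y] b by simp
   then show False using C0 by simp
   qed
   then have "emeasure lborel Z = 0" using Zf by (simp add: emeasure_eq_ennreal_measure fmeasurable_def less_top[symmetric])
   then have "AEL x. x \<notin> Z" by (intro AE_not_in) (auto simp: null_sets_def)
   then show ?thesis using h0
   proof eventually_elim
   case (elim x)
   show ?case
   proof
   assume "x : ?S k"
   then have "h x ~= 0" using elim(1) unfolding Z_def by blast
   then show "h x > 0" using elim(2) by linarith
   qed
   qed
  qed
  then have "AEL x. \<forall>k\<in>{1..}. x : ?S k --> h x > 0" by (subst AE_ball_countable) auto
  then show ?thesis
  proof eventually_elim
   case (elim x)
   obtain k where "norm x <= real k" using real_arch_simple by blast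
   then have "x : ?S (Suc k)" by simp
   then show ?case using bspec[OF elim, of "Suc k"] by auto
  qed
 qed
 \<comment> \<open>Redefined on a null set, since an eigenfunction has to be positive at every
   point.\<close>
 define ul where "ul x = (if h x > 0 then h x else 1)" for x
 have [measurable]: "ul : bmeas" unfolding ul_def by measurable
 have ulp: "ul x > 0" for x by (simp add: ul_def)
 have liml: "AEL x. (%n. u (s n) x) ----> ul x & (%n. g (s n) x) ----> gl x"
  using lim hpos by eventually_elim (simp add: ul_def)
 have lb: "AEL x. x : ?S k --> ul x powr p <= D x & norm (gl x) powr p <= D x"
  if D: "!!n. n >= k ==> AEL x. x : ?S k --> u (s n) x powr p <= D x & norm (g (s n) x) powr p <= D x" for k D
 proof -
  have "AEL x. \<forall>n\<in>{k..}. x : ?S k --> u (s n) x powr p <= D x & norm (g (s n) x) powr p <= D x"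
   using D by (subst AE_ball_countable) auto
  with liml show ?thesis
  proof eventually_elim
   case (elim x)
   have "(%n. u (s n) x powr p) ----> ul x powr p" "(%n. norm (g (s n) x) powr p) ----> norm (gl x) powr p"
   using elim p0 u0 by (auto intro!: tendsto_nonneg_powr tendsto_norm_powr)
   then show ?case using elim(2)
   by (intro impI conjI; elim LIMSEQ_le_const2) (metis atLeast_iff)+
  qed
 qed
 have intS: "integ (%x. indicator (?S k) x * ul x powr p) & integ (%x. indicator (?S k) x * norm (gl x) powr p)" for k
 proof -
  obtain D where D: "integrable lborel D" "!!n. n >= k ==> AEL x. x : ?S k --> u (s n) x powr p <= D x & norm (g (s n) x) powr p <= D x" using dom[of k] by blast
  have L: "AEL x. x : ?S k --> ul x powr p <= D x & norm (gl x) powr p <= D x" by (rule lb) (rule D(2))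
  have "AEL x. norm (indicator (?S k) x * ul x powr p) <= norm (D x)" "AEL x. norm (indicator (?S k) x * norm (gl x) powr p) <= norm (D x)"
   using L by (eventually_elim, force simp: indicator_def)+
  then show ?thesis using D(1) by (auto intro: integrable_le[OF D(1)])
 qed
 have i: "integ (%x. ib R x * ul x powr p)" "integ (%x. ib R x * norm (gl x) powr p)" for R
 proof -
  obtain k where k: "R <= real k" using real_arch_simple by blast
  have "(%x. ib R x * ul x powr p) = (%x. indicat_real (cball 0 R) x * (indicator (?S k) x * ul x powr p))"
   "(%x. ib R x * norm (gl x) powr p) = (%x. indicat_real (cball 0 R) x * (indicator (?S k) x * norm (gl x) powr p))"
   using k by (auto simp: fun_eq_iff indicator_def)
  then show "integ (%x. ib R x * ul x powr p)" "integ (%x. ib R x * norm (gl x) powr p)"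
   using intS[of k] by (metis integrable_ind_mult)+
 qed
 have parts: "(LBINT x. ul x * (dzt x \<bullet> v)) = - (LBINT x. (gl x \<bullet> v) * zt x)" if zt: "C1 zt dzt" "supp_in zt R" for zt dzt R v
 proof -
  obtain k where k: "R <= real k" using real_arch_simple by blast
  have ztk: "supp_in zt (real k)" using zt(2) k by (auto simp: supp_in_def)
  obtain D where D: "integrable lborel D" "!!n. n >= k ==> AEL x. x : ?S k --> u (s n) x powr p <= D x & norm (g (s n) x) powr p <= D x" using dom[of k] by blast
  \<comment> \<open>The sequence is shifted by \<open>k\<close> because its majorant on the ball of
    radius \<open>k\<close> is valid from index \<open>k\<close> on.\<close>
  show ?thesis
  proof (rule weak_gradient_limit[OF p zt(1) ztk, where w = "%n. u (s (n + k))" and G = "%n. g (s (n + k))" and D = D])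
   show "AEL x. (%n. u (s (n + k)) x) ----> ul x & (%n. g (s (n + k)) x) ----> gl x"
   using liml by eventually_elim (auto intro: LIMSEQ_ignore_initial_segment)
   show "AEL x. x : cball 0 (real k) --> (abs (u (s (n + k)) x)) powr p <= D x & norm (g (s (n + k)) x) powr p <= D x" for n
   using D(2)[of "n + k"] u0 by simp
   show "(LBINT x. u (s (n + k)) x * (dzt x \<bullet> v)) = - (LBINT x. (g (s (n + k)) x \<bullet> v) * zt x)" for n
   by (rule Wp_parts[OF p U zt])
  qed (use D(1) in auto)
 qed
 have eqn: "integ (%x. pflux p (gl x) \<bullet> dzt x) & integ (%x. V x * ul x powr (p - 1) * zt x) & integ (%x. ul x powr (p - 1) * zt x) &
   (LBINT x. pflux p (gl x) \<bullet> dzt x) + (LBINT x. V x * ul x powr (p - 1) * zt x) - lam * (LBINT x. ul x powr (p - 1) * zt x) = 0"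
  if zt: "C1 zt dzt" "supp_in zt R" for zt dzt R
 proof -
  note [measurable] = C1_meas[OF zt(1)]
  obtain k where k: "R <= real k" using real_arch_simple by blast
  have ztk: "supp_in zt (real k)" using zt(2) k by (auto simp: supp_in_def)
  have out: "zt x = 0" "dzt x = 0" if "\<not> norm x <= real k" for x
   using that ztk supp_in_grad[OF zt(1) ztk, of x] by (auto simp: supp_in_def)
  obtain D where D: "integrable lborel D" "!!n. n >= k ==> AEL x. x : ?S k --> u (s n) x powr p <= D x & norm (g (s n) x) powr p <= D x" using dom[of k] by blast
  note iz = C1_supp_integrable[OF zt(1) ztk p0]
  let ?E = "%x. abs (D x) + norm (dzt x) powr p + abs (zt x) powr p"
  have Ei: "integ ?E" using D(1) iz by auto
  have fl: "abs (pflux p a \<bullet> dzt x) <= ?E x" if "norm a powr p <= D x" for a x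
   using pflux_inner_le[of p a "dzt x"] Young_powr_crude[OF p, of "norm a" "norm (dzt x)"] that powr_ge_zero[of "abs (zt x)" p] by (simp del: powr_ge_zero)
  have ze: "abs (t powr (p - 1) * zt x) <= ?E x" if "t >= 0" "t powr p <= D x" for t x
  proof -
   have "abs (t powr (p - 1) * zt x) = t powr (p - 1) * abs (zt x)" by (simp add: abs_mult)
   then show ?thesis using Young_powr_crude[OF p that(1), of "abs (zt x)"] that powr_ge_zero[of "norm (dzt x)" p] by linarith
  qed
  have lbD: "AEL x. x : ?S k --> ul x powr p <= D x & norm (gl x) powr p <= D x" by (rule lb) (rule D(2))
  have E0: "?E x >= 0" for x by simp
  have I1: "integ (%x. pflux p (gl x) \<bullet> dzt x)"
  proof (rule integrable_le[OF Ei])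
   show "AEL x. norm (pflux p (gl x) \<bullet> dzt x) <= norm (?E x)"
   using lbD
   proof eventually_elim
   case (elim x)
   then show ?case using fl[of "gl x" x] out[of x] by (cases "norm x <= real k") auto
   qed
  qed measurable
  have I3: "integ (%x. ul x powr (p - 1) * zt x)"
  proof (rule integrable_le[OF Ei])
   show "AEL x. norm (ul x powr (p - 1) * zt x) <= norm (?E x)"
   using lbD
   proof eventually_elim
   case (elim x)
   then show ?case using ze[of "ul x" x] ulp[of x] out[of x] by (cases "norm x <= real k") (auto simp: less_imp_le)
   qed
  qed measurable
  have I2: "integ (%x. V x * ul x powr (p - 1) * zt x)"
  proof (rule integrable_le[OF integrable_mult_right[OF I3, of c0]])
   show "AEL x. norm (V x * ul x powr (p - 1) * zt x) <= norm (c0 * (ul x powr (p - 1) * zt x))"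
   using bddpotD(2,3)[OF V] by (intro AE_I2) (auto simp: abs_mult mult.assoc intro!: mult_right_mono)
  qed measurable
  have L: "(%n. weakf p (W (s (n + k))) (u (s (n + k))) (g (s (n + k))) zt dzt) ----> (LBINT x. pflux p (gl x) \<bullet> dzt x + (V x - lam) * ul x powr (p - 1) * zt x)"
   unfolding weakf_def
  proof (rule integral_dominated_convergence[where w = "%x. ?E x + c * ?E x"])
   show "integ (%x. ?E x + c * ?E x)" using Ei by auto
   have [measurable]: "W n : bmeas" for n using bddpotD(1)[OF Wb] .
   show "(%x. pflux p (g (s (n + k)) x) \<bullet> dzt x + W (s (n + k)) x * u (s (n + k)) x powr (p - 1) * zt x) : borel_measurable lborel" for n by measurable
   show "AEL x. norm (pflux p (g (s (n + k)) x) \<bullet> dzt x + W (s (n + k)) x * u (s (n + k)) x powr (p - 1) * zt x) <= ?E x + c * ?E x" for n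
   using D(2)[of "n + k", OF le_add2]
   proof eventually_elim
   case (elim x)
   show ?case
   proof (cases "norm x <= real k")
   case True
   then have d: "u (s (n + k)) x powr p <= D x" "norm (g (s (n + k)) x) powr p <= D x" using elim by auto
   have "abs (W (s (n + k)) x * (u (s (n + k)) x powr (p - 1) * zt x)) <= c * ?E x"
   unfolding abs_mult[of "W (s (n + k)) x"] using bddpotD(2)[OF Wb] ze[OF u0 d(1)] c by (intro mult_mono) auto
   then show ?thesis using fl[OF d(2)] unfolding mult.assoc real_norm_def by linarith
   next
   case False
   then show ?thesis using out[OF False] c E0[of x] by simp
   qed
   qed
   show "AEL x. (%n. pflux p (g (s (n + k)) x) \<bullet> dzt x + W (s (n + k)) x * u (s (n + k)) x powr (p - 1) * zt x)
   ----> pflux p (gl x) \<bullet> dzt x + (V x - lam) * ul x powr (p - 1) * zt x"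
   using liml
   proof eventually_elim
   case (elim x)
   have "(%n. 1 / real (Suc (s (n + k)))) ----> 0"
   proof (rule tendsto_sandwich[OF _ _ tendsto_const])
   show "(%n. 1 / real (Suc n)) ----> 0" using LIMSEQ_inverse_real_of_nat by (simp add: inverse_eq_divide)
   have "1 / real (Suc (s (n + k))) <= 1 / real (Suc n)" for n
   using sn[of "n + k"] by (intro divide_left_mono) auto
   then show "\<forall>\<^sub>F n in sequentially. 1 / real (Suc (s (n + k))) <= 1 / real (Suc n)" by simp
   qed simp
   then have "(%n. W (s (n + k)) x) ----> V x - (lam - 0)" unfolding W_def by (intro tendsto_intros)
   moreover have "(%n. u (s (n + k)) x powr (p - 1)) ----> ul x powr (p - 1)"
   using elim p u0 by (intro tendsto_nonneg_powr LIMSEQ_ignore_initial_segment[of "%n. u (s n) x"]) auto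
   moreover have "(%n. pflux p (g (s (n + k)) x)) ----> pflux p (gl x)"
   using elim by (intro continuous_on_tendsto_compose[OF continuous_on_pflux[OF p]] LIMSEQ_ignore_initial_segment[of "%n. g (s n) x"]) auto
   ultimately show ?case by (auto intro!: tendsto_intros)
   qed
   show "(%x. pflux p (gl x) \<bullet> dzt x + (V x - lam) * ul x powr (p - 1) * zt x) : borel_measurable lborel" by measurable
  qed
  have "weakf p (W (s (n + k))) (u (s (n + k))) (g (s (n + k))) zt dzt = 0" for n
  proof -
   have "real k <= real (s (n + k))" using sn[of "n + k"] by linarith
   then have "sol p (W (s (n + k))) (real k) (u (s (n + k))) (g (s (n + k)))" by (rule Sm)
   then show ?thesis using zt(1) ztk unfolding sol_def by blast
  qed
  then have "(LBINT x. pflux p (gl x) \<bullet> dzt x + (V x - lam) * ul x powr (p - 1) * zt x) = 0" using L by (simp add: LIMSEQ_const_iff)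
  moreover have "(LBINT x. pflux p (gl x) \<bullet> dzt x + (V x - lam) * ul x powr (p - 1) * zt x)
   = (LBINT x. pflux p (gl x) \<bullet> dzt x + (V x * ul x powr (p - 1) * zt x - lam * (ul x powr (p - 1) * zt x)))"
   by (intro Bochner_Integration.integral_cong) (auto simp: algebra_simps)
  moreover have "... = (LBINT x. pflux p (gl x) \<bullet> dzt x) + ((LBINT x. V x * ul x powr (p - 1) * zt x) - lam * (LBINT x. ul x powr (p - 1) * zt x))"
   using I1 I2 I3 by simp
  ultimately show ?thesis using I1 I2 I3 by auto
 qed
 show ?thesis by (rule that[of ul gl]) (use ulp i parts eqn in auto)
qed

section \<open>Smooth bump functions\<close>

text \<open>The standard flat function divided by powers of \<open>t\<close>. The division makes the
  family closed under differentiation up to linear combinations.\<close>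

definition bump :: "nat => real => real" where
 "bump k t = (if t > 0 then exp (- (1 / t)) / t ^ k else 0)"

lemma bump_nonneg: "bump k t >= 0" by (simp add: bump_def)

text \<open>The term of order \<open>k + 2\<close> in the exponential series at \<open>1 / t\<close>
  supplies enough powers of \<open>t\<close>; quadratic smallness gives derivative 0 at the
  origin.\<close>

lemma bump_le: "abs (bump k t) <= fact (k + 2) * t\<^sup>2"
proof (cases "t > 0")
 case True
 have "(1 / t) ^ (k + 2) /\<^sub>R fact (k + 2) <= exp (1 / t)"
  unfolding exp_def using sum_le_suminf[OF summable_exp_generic[of "1 / t"], of "{k + 2}"] True by simp
 then have "1 / t ^ (k + 2) <= fact (k + 2) * exp (1 / t)"
  using True by (simp add: divide_simps del: fact_Suc power_Suc) (simp add: mult_ac del: fact_Suc power_Suc)?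
 then have "1 / t ^ (k + 2) * t ^ (k + 2) <= fact (k + 2) * exp (1 / t) * t ^ (k + 2)" using True by (intro mult_right_mono) auto
 then have "1 <= fact (k + 2) * exp (1 / t) * t ^ (k + 2)" using True by (simp del: fact_Suc power_Suc)
 then have "exp (- (1 / t)) <= fact (k + 2) * t ^ (k + 2)" by (simp add: exp_minus field_simps del: fact_Suc power_Suc)
 then show ?thesis using True by (simp add: bump_def field_simps power_add power2_eq_square del: fact_Suc)
qed (simp add: bump_def del: fact_Suc)

lemma bump_DERIV: "(bump k has_real_derivative bump (k + 2) t - real k * bump (k + 1) t) (at t)"
proof -
 consider "t > 0" | "t < 0" | "t = 0" by linarith
 then show ?thesis
 proof cases
  case 1
  have "((%t. exp (- (1 / t)) / t ^ k) has_real_derivative bump (k + 2) t - real k * bump (k + 1) t) (at t)"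
  proof -
   have "real k * t ^ (k - Suc 0) * (t * t) = real k * t ^ k * t" by (cases k) auto
   then show ?thesis using 1 by (auto intro!: derivative_eq_intros simp: bump_def field_simps power2_eq_square)
  qed
  then show ?thesis
   by (rule has_field_derivative_transform_within_open[of _ _ _ "{0<..}"]) (use 1 in \<open>auto simp: bump_def\<close>)
 next
  case 2
  have "((%t. 0) has_real_derivative 0) (at t)" by simp
  then have "(bump k has_real_derivative 0) (at t)"
   by (rule has_field_derivative_transform_within_open[of _ _ _ "{..<0}"]) (use 2 in \<open>auto simp: bump_def\<close>)
  then show ?thesis using 2 by (simp add: bump_def)
 next
  case 3
  have "((%h. (bump k (0 + h) - bump k 0) / h) \<longlongrightarrow> 0) (at 0)"
  proof (rule Lim_null_comparison)
   show "eventually (%h. norm ((bump k (0 + h) - bump k 0) / h) <= fact (k + 2) * abs h) (at 0)"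
   proof (rule eventuallyI)
   fix h :: real
   show "norm ((bump k (0 + h) - bump k 0) / h) <= fact (k + 2) * abs h"
   proof (cases "h = 0")
   case False
   have "abs (bump k h) <= (fact (k + 2) * abs h) * abs h" using bump_le[of k h] by (simp add: power2_eq_square mult.assoc del: fact_Suc)
   then have "abs (bump k h) / abs h <= fact (k + 2) * abs h" using False by (simp add: divide_le_eq del: fact_Suc)
   then show ?thesis by (simp add: bump_def del: fact_Suc split: if_splits)
   qed simp
   qed
   show "((%h. fact (k + 2) * abs h) \<longlongrightarrow> (0::real)) (at 0)" by (intro tendsto_mult_right_zero tendsto_rabs_zero) simp
  qed
  then show ?thesis using 3 by (simp add: DERIV_def bump_def)
 qed
qed

text \<open>An algebra of functions closed under directional derivatives, which is exactly the
  invariant for proving the coinductive \<open>smooth_fun\<close>.\<close>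

inductive bumpalg :: "('a::euclidean_space => real) => bool" where
 gen: "bumpalg (%x. bump k (1 - c * ((x - a) \<bullet> (x - a))))"
| const: "bumpalg (%x. c)"
| inner: "bumpalg (%x. x \<bullet> v)"
| add: "bumpalg f ==> bumpalg g ==> bumpalg (%x. f x + g x)"
| mult: "bumpalg f ==> bumpalg g ==> bumpalg (%x. f x * g x)"

lemma bumpalg_C1: "bumpalg f ==> EX G. C1 f G & (ALL v. bumpalg (%x. G x \<bullet> v))"
proof (induction rule: bumpalg.induct)
 case (gen k c a)
 let ?q = "%x::'a. 1 - c * ((x - a) \<bullet> (x - a))"
 let ?d = "%t. bump (k + 2) t - real k * bump (k + 1) t"
 have q: "C1 ?q (%x. (- 2 * c) *\<^sub>R (x - a))" unfolding C1_def
  by (auto intro!: derivative_eq_intros continuous_intros simp: inner_commute algebra_simps)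
 have cb: "continuous_on UNIV (bump j)" for j
  using DERIV_isCont[OF bump_DERIV] by (simp add: continuous_at_imp_continuous_on)
 have 1: "C1 (%x. bump k (?q x)) (%x. ?d (?q x) *\<^sub>R ((- 2 * c) *\<^sub>R (x - a)))"
  by (rule C1_compose[OF q bump_DERIV]) (intro continuous_intros continuous_on_subset[OF cb]; simp)
 have "bumpalg (%x. (?d (?q x) *\<^sub>R ((- 2 * c) *\<^sub>R (x - a))) \<bullet> v)" for v
 proof -
  have "bumpalg (%x. (bump (k + 2) (?q x) + - real k * bump (k + 1) (?q x)) * (- 2 * c * (x \<bullet> v + - (a \<bullet> v))))"
   by (intro bumpalg.intros)
  moreover have "(%x. (?d (?q x) *\<^sub>R ((- 2 * c) *\<^sub>R (x - a))) \<bullet> v) =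
   (%x. (bump (k + 2) (?q x) + - real k * bump (k + 1) (?q x)) * (- 2 * c * (x \<bullet> v + - (a \<bullet> v))))"
   by (rule ext) (simp add: inner_diff_left)
  ultimately show ?thesis by metis
 qed
 with 1 show ?case by blast
next
 case (const c)
 show ?case by (intro exI[of _ "%x. 0"]) (auto simp: C1_const intro: bumpalg.const)
next
 case (inner w)
 show ?case by (rule exI[of _ "%x. w"])
  (auto simp: C1_def inner_commute intro!: derivative_eq_intros bumpalg.const)
next
 case (add f g)
 then obtain F G where "C1 f F" "!!v. bumpalg (%x. F x \<bullet> v)" "C1 g G" "!!v. bumpalg (%x. G x \<bullet> v)" by blast
 then show ?case by (intro exI[of _ "%x. F x + G x"]) (auto simp: inner_add_left intro: C1_add bumpalg.add)
next
 case (mult f g)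
 then obtain F G where "C1 f F" "!!v. bumpalg (%x. F x \<bullet> v)" "C1 g G" "!!v. bumpalg (%x. G x \<bullet> v)" by blast
 note FG = this
 have "bumpalg (%x. (g x *\<^sub>R F x + f x *\<^sub>R G x) \<bullet> v)" for v
  using bumpalg.add[OF bumpalg.mult[OF mult.hyps(2) FG(2)[of v]] bumpalg.mult[OF mult.hyps(1) FG(4)[of v]]] by (simp add: inner_add_left)
 then show ?case using C1_mult[OF FG(1,3)] by blast
qed

lemma frechet_derivative_C1: "C1 f G ==> frechet_derivative f (at x) = (%h. G x \<bullet> h)"
 using frechet_derivative_at[OF C1_D] by metis

lemma C1_differentiable: "C1 f G ==> f differentiable (at x)"
 using C1_D by (auto simp: differentiable_def)

text \<open>Coinduction with membership in the algebra as invariant: the function is differentiable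
  and its directional derivatives stay in the algebra.\<close>

lemma bumpalg_smooth: "bumpalg f ==> smooth_fun f"
proof (coinduction arbitrary: f rule: smooth_fun.coinduct)
 case smooth_fun
 then obtain G where G: "C1 f G" "!!v. bumpalg (%x. G x \<bullet> v)" using bumpalg_C1 by blast
 then show ?case using C1_differentiable[OF G(1)] by (auto simp: frechet_derivative_C1[OF G(1)])
qed

lemma compact_supp: "compact (closure {x::'a::euclidean_space. f x ~= (0::real)}) \<longleftrightarrow> (EX R. supp_in f R)"
 unfolding compact_closure bounded_iff supp_in_def by (auto simp: not_le[symmetric])

section \<open>Convolution and mollification in \<open>L^p\<close>\<close>

definition conv :: "('a::euclidean_space => real) => ('a => real) => 'a => real" where
 "conv f et x = (LBINT y. f y * et (x - y))"

lemma uniformly_continuous_compact_supp: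
 fixes f :: "'a::euclidean_space => 'b::real_normed_vector"
 assumes "continuous_on UNIV f" "!!x. norm x > R ==> f x = 0" "e > 0"
 obtains d where "d > 0" "!!x y. norm (x - y) <= d ==> norm (f x - f y) <= e"
proof -
 have "uniformly_continuous_on (cball 0 (R + 2)) f"
  by (intro compact_uniformly_continuous continuous_on_subset[OF assms(1)]) auto
 then obtain d where d: "d > 0" "!!x y. x : cball 0 (R + 2) ==> y : cball 0 (R + 2) ==> dist x y < d ==> dist (f x) (f y) < e"
  using assms(3) unfolding uniformly_continuous_on_def by metis
 show ?thesis
 proof (rule that[of "min 1 (d / 2)"])
  fix x y :: 'a assume xy: "norm (x - y) <= min 1 (d / 2)"
  have n: "norm x <= norm y + 1" "norm y <= norm x + 1"
   using xy norm_triangle_sub[of x y] norm_triangle_sub[of y x] by (auto simp: norm_minus_commute)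
  show "norm (f x - f y) <= e"
  proof (cases "norm x <= R + 1")
   case True
   then show ?thesis using d(2)[of x y] xy n d(1) by (simp add: dist_norm)
  qed (use n assms in auto)
 qed (use d in auto)
qed

lemma conv_integrable:
 fixes f et :: "'a::euclidean_space => real"
 assumes "integ f" "continuous_on UNIV et" "!!x. abs (et x) <= B"
 shows "integ (%y. f y * et (x - y))"
proof (rule integrable_le)
 have [measurable]: "et : bmeas" "f : bmeas"
  using assms by (auto intro: borel_measurable_continuous_onI)
 show "(%y. f y * et (x - y)) : borel_measurable lborel" by measurable
 show "integ (%y. B * abs (f y))" using assms(1) by auto
 show "AEL y. norm (f y * et (x - y)) <= norm (B * abs (f y))"
  using mult_left_mono[OF order_trans[OF assms(3) abs_ge_self], OF abs_ge_zero] by (intro AE_I2) (simp add: abs_mult mult.commute[of "abs B"])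
qed

lemma conv_bound:
 fixes f h :: "'a::euclidean_space => real"
 assumes f: "integ f" and i: "integ (%y. f y * h y)" and e: "!!y. abs (h y) <= e"
 shows "abs (LBINT y. f y * h y) <= e * (LBINT y. abs (f y))"
proof -
 have "abs (LBINT y. f y * h y) <= (LBINT y. abs (f y * h y))" by (rule integral_abs_bound)
 also have "... <= (LBINT y. e * abs (f y))"
  using mult_left_mono[OF e, OF abs_ge_zero]
  by (intro integral_mono integrable_abs[OF i] integrable_mult_right integrable_abs[OF f]) (simp add: abs_mult mult.commute[of e])
 finally show ?thesis by simp
qed

lemma conv_continuous:
 assumes f: "integ f" and et: "continuous_on UNIV et" "supp_in et R"
 shows "continuous_on UNIV (conv f et)"
 unfolding continuous_on_iff
proof (intro ballI allI impI)
 fix x e assume e: "(0::real) < e"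
 define I where "I = (LBINT y. abs (f y))"
 have I: "I >= 0" by (simp add: I_def)
 have e': "e / (I + 1) > 0" using e I by simp
 obtain B where B: "!!x. abs (et x) <= B"
 proof (rule continuous_bounded_cball[OF et(1), of R])
  fix B assume "0 <= B" "!!x. norm x <= R ==> norm (et x) <= B"
  then show thesis using et(2) by (intro that[of B]) (force simp: supp_in_def not_le)
 qed
 obtain d where d: "d > 0" "!!x y. norm (x - y) <= d ==> norm (et x - et y) <= e / (I + 1)"
  using uniformly_continuous_compact_supp[OF et(1) _ e', of R] et(2) unfolding supp_in_def by metis
 have "dist (conv f et x') (conv f et x) < e" if "dist x' x < d" for x'
 proof -
  have i: "integ (%y. f y * et (x' - y))" "integ (%y. f y * et (x - y))"
   by (rule conv_integrable[OF f et(1) B])+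
  have "conv f et x' - conv f et x = (LBINT y. f y * (et (x' - y) - et (x - y)))"
   unfolding conv_def by (subst Bochner_Integration.integral_diff[OF i, symmetric]) (simp add: algebra_simps)
  also have "\<bar>...\<bar> <= e / (I + 1) * I" unfolding I_def[symmetric]
   using Bochner_Integration.integrable_diff[OF i] d(2)[of "x' - y" "x - y" for y] that unfolding I_def
   by (intro conv_bound[OF f]) (auto simp: algebra_simps dist_norm)
  also have "... < e" using e I by (simp add: field_simps)
  finally show ?thesis by (simp add: dist_real_def)
 qed
 then show "EX d>0. \<forall>x'\<in>UNIV. dist x' x < d --> dist (conv f et x') (conv f et x) < e" using d(1) by blast
qed

lemma conv_grad_integrable:
 fixes f :: "'a::euclidean_space => real"
 assumes f: "integ f" and et: "C1 et G" "supp_in et R"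
 shows "integ (%y. f y * (G (x - y) \<bullet> v))"
proof -
 obtain B where B: "B > 0" "!!x. abs (et x) <= B" "!!x. norm (G x) <= B" by (rule C1_supp_bounded[OF et]) (rule that)
 have cv: "continuous_on UNIV (%z. G z \<bullet> v)" using C1_cont_grad[OF et(1)] by (intro continuous_intros)
 show ?thesis
  using B(3) by (intro conv_integrable[OF f cv, of "B * norm v"]) (meson Cauchy_Schwarz_ineq2 mult_right_mono norm_ge_zero order_trans)
qed

lemma conv_grad_inner:
 fixes f :: "'a::euclidean_space => real"
 assumes f: "integ f" and et: "C1 et G" "supp_in et R"
 shows "(\<Sum>b\<in>Basis. conv f (%z. G z \<bullet> b) x *\<^sub>R b) \<bullet> h = (LBINT y. f y * (G (x - y) \<bullet> h))"
proof -
 have "(LBINT y. f y * (G (x - y) \<bullet> h)) = (LBINT y. (\<Sum>b\<in>Basis. (f y * (G (x - y) \<bullet> b)) * (h \<bullet> b)))"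
  by (subst euclidean_inner) (simp add: sum_distrib_left mult.assoc)
 also have "... = (\<Sum>b\<in>Basis. (LBINT y. f y * (G (x - y) \<bullet> b)) * (h \<bullet> b))"
  by (subst Bochner_Integration.integral_sum) (auto intro!: integrable_mult_left conv_grad_integrable[OF assms])
 finally show ?thesis by (simp add: conv_def inner_sum_left inner_commute[of h])
qed

text \<open>The gradient of the kernel is uniformly continuous, so the first-order remainder of the
  kernel is uniformly small and integrates against the merely integrable \<open>f\<close>.\<close>

lemma conv_C1:
 fixes f :: "'a::euclidean_space => real"
 assumes f: "integ f" and et: "C1 et G" "supp_in et R"
 shows "C1 (conv f et) (%x. \<Sum>b\<in>Basis. conv f (%z. G z \<bullet> b) x *\<^sub>R b)"
proof -
 obtain B where B: "B > 0" "!!x. abs (et x) <= B" "!!x. norm (G x) <= B" by (rule C1_supp_bounded[OF et]) (rule that)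
 note c = C1_cont[OF et(1)] C1_cont_grad[OF et(1)]
 have G0: "norm x > R ==> G x = 0" for x by (rule supp_in_grad[OF et])
 have cv: "continuous_on UNIV (%z. G z \<bullet> v)" for v using c by (intro continuous_intros)
 note iv = conv_grad_integrable[OF f et]
 have ie: "integ (%y. f y * et (x - y))" for x by (rule conv_integrable[OF f c(1) B(2)])
 note lin = conv_grad_inner[OF f et]
 define I where "I = (LBINT y. abs (f y))"
 have I: "I >= 0" by (simp add: I_def)
 show ?thesis unfolding C1_def
 proof (intro conjI allI)
  show "continuous_on UNIV (%x. \<Sum>b\<in>Basis. conv f (%z. G z \<bullet> b) x *\<^sub>R b)"
   using G0 by (intro continuous_intros conv_continuous[OF f cv, where R = R]) (auto simp: supp_in_def)
  fix x
  show "(conv f et has_derivative (%h. (\<Sum>b\<in>Basis. conv f (%z. G z \<bullet> b) x *\<^sub>R b) \<bullet> h)) (at x)"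
   unfolding has_derivative_at_alt
  proof (intro conjI allI impI)
   show "bounded_linear (%h. (\<Sum>b\<in>Basis. conv f (%z. G z \<bullet> b) x *\<^sub>R b) \<bullet> h)" by (rule bounded_linear_inner_right)
   fix e :: real assume e: "0 < e"
   have e': "e / (I + 1) > 0" using e I by simp
   obtain d where d: "d > 0" "!!x y. norm (x - y) <= d ==> norm (G x - G y) <= e / (I + 1)"
   using uniformly_continuous_compact_supp[OF c(2) G0 e'] by metis
   have key: "abs (et (z + h) - et z - G z \<bullet> h) <= norm h * (e / (I + 1))" if h: "norm h <= d" for z h
   proof -
   have "norm (et (z + h) - et z - G z \<bullet> (z + h - z)) <= norm (z + h - z) * (e / (I + 1))"
   proof (rule differentiable_bound_linearization[where S = "cball z d" and f' = "%x h. G x \<bullet> h"])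
   show "z + t *\<^sub>R (z + h - z) : cball z d" if "t : {0..1}" for t
   using that h mult_mono[of t 1 "norm h" d] d(1) by (simp add: dist_norm)
   show "(et has_derivative (%h. G w \<bullet> h)) (at w within cball z d)" for w
   using C1_D[OF et(1)] by (rule has_derivative_at_withinI)
   fix w assume "w : cball z d"
   then have "norm (G w - G z) <= e / (I + 1)" by (intro d) (simp add: dist_norm norm_minus_commute)
   then have "abs ((G w - G z) \<bullet> h) <= e / (I + 1) * norm h" for h
   by (intro order_trans[OF Cauchy_Schwarz_ineq2] mult_right_mono) auto
   then show "onorm ((%h. G w \<bullet> h) - (%h. G z \<bullet> h)) <= e / (I + 1)"
   using e' by (intro onorm_bound) (auto simp: inner_diff_left)
   qed (use d in auto)
   then show ?thesis by simp
   qed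
   have "norm (conv f et y - conv f et x - (\<Sum>b\<in>Basis. conv f (%z. G z \<bullet> b) x *\<^sub>R b) \<bullet> (y - x)) <= e * norm (y - x)"
   if y: "norm (y - x) < d" for y
   proof -
   let ?h = "%w. et (y - w) - et (x - w) - G (x - w) \<bullet> (y - x)"
   note i = Bochner_Integration.integrable_diff[OF Bochner_Integration.integrable_diff[OF ie[of y] ie[of x]] iv[of x "y - x"]]
   have eq: "f w * ?h w = f w * et (y - w) - f w * et (x - w) - f w * (G (x - w) \<bullet> (y - x))" for w by (simp add: algebra_simps)
   have "conv f et y - conv f et x - (\<Sum>b\<in>Basis. conv f (%z. G z \<bullet> b) x *\<^sub>R b) \<bullet> (y - x) = (LBINT w. f w * ?h w)"
   unfolding lin unfolding conv_def eq using ie iv by (simp add: Bochner_Integration.integral_diff)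
   also have "\<bar>...\<bar> <= (norm (y - x) * (e / (I + 1))) * I" unfolding I_def
   proof (rule conv_bound[OF f])
   show "integ (%w. f w * ?h w)" unfolding eq by (rule i)
   fix w show "abs (?h w) <= norm (y - x) * (e / ((LBINT y. abs (f y)) + 1))"
   using key[of "y - x" "x - w"] y by (simp add: I_def)
   qed
   also have "... = (e * norm (y - x)) * (I / (I + 1))" by simp
   also have "... <= (e * norm (y - x)) * 1" using I e by (intro mult_left_mono) auto
   finally show ?thesis by simp
   qed
   then show "EX d>0. ALL y. norm (y - x) < d -->
   norm (conv f et y - conv f et x - (\<Sum>b\<in>Basis. conv f (%z. G z \<bullet> b) x *\<^sub>R b) \<bullet> (y - x)) <= e * norm (y - x)"
   using d(1) by blast
  qed
 qed
qed

lemma conv_supp: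
 fixes f :: "'a::euclidean_space => real"
 shows "(!!y. norm y > R ==> f y = 0) ==> supp_in et d ==> supp_in (conv f et) (R + d)"
 unfolding supp_in_def conv_def
proof (intro allI impI)
 fix x :: 'a assume f: "!!y. norm y > R ==> f y = 0" and et: "ALL x. norm x > d --> et x = 0" and x: "norm x > R + d"
 have z: "f y * et (x - y) = 0" for y
  using f[of y] et[rule_format, of "x - y"] x norm_triangle_sub[of x y] by (cases "norm y > R") auto
 show "(LBINT y. f y * et (x - y)) = 0" unfolding z by simp
qed

text \<open>Coinduction over the kernel: a directional derivative of the convolution is the
  convolution with the derivative of the kernel, which lies in the algebra with the same support
  bound.\<close>

lemma conv_smooth:
 assumes f: "integ f" and "bumpalg et" "supp_in et R"
 shows "smooth_fun (conv f et)"
 using assms(2,3)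
proof (coinduction arbitrary: et rule: smooth_fun.coinduct)
 case smooth_fun
 then obtain G where G: "C1 et G" "!!v. bumpalg (%x. G x \<bullet> v)" using bumpalg_C1 by blast
 note C = conv_C1[OF f G(1) smooth_fun(2)]
 have "frechet_derivative (conv f et) (at x) v = conv f (%z. G z \<bullet> v) x" for x v
  unfolding frechet_derivative_C1[OF C] using conv_grad_inner[OF f G(1) smooth_fun(2)] by (simp add: conv_def)
 moreover have "supp_in (%z. G z \<bullet> v) R" for v
  using supp_in_grad[OF G(1) smooth_fun(2)] by (auto simp: supp_in_def)
 ultimately have "EX et'. (%x. frechet_derivative (conv f et) (at x) v) = conv f et' & bumpalg et' & supp_in et' R" for v
  using G(2) by (intro exI[of _ "%z. G z \<bullet> v"]) auto
 then show ?case using C1_differentiable[OF C] by blast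
qed

text \<open>Membership of the reflected translates in the algebra makes
  \<open>y \<mapsto> kp (a - y)\<close> itself a test function, to which a weak gradient can be
  applied; symmetry enters when the kernel is integrated in its first variable.\<close>

definition mollifier :: "('a::euclidean_space => real) => ('a => 'a) => real => bool" where
 "mollifier kp G d \<longleftrightarrow> C1 kp G & supp_in kp d & (ALL x. kp x >= 0) & (ALL x. kp (- x) = kp x) &
  (LBINT x. kp x) = 1 & bumpalg kp & (ALL a. bumpalg (%y. kp (a - y)))"

lemma mollifier_exists:
 assumes d: "d > 0"
 obtains kp :: "'a::euclidean_space => real" and G where "mollifier kp G d"
proof -
 define k where "k x = bump 0 (1 - (1 / d\<^sup>2) * ((x - 0) \<bullet> (x - 0)))" for x :: 'a
 have k: "bumpalg k" unfolding k_def by (rule bumpalg.gen)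
 obtain G where G: "C1 k G" using bumpalg_C1[OF k] by blast
 have s: "supp_in k d"
 proof -
  have "k x = 0" if "norm x > d" for x
  proof -
   have "d\<^sup>2 < x \<bullet> x" using that d by (simp add: dot_square_norm power_strict_mono)
   then show ?thesis using d by (simp add: k_def bump_def field_simps)
  qed
  then show ?thesis by (simp add: supp_in_def)
 qed
 have k0: "k x >= 0" for x by (simp add: k_def bump_nonneg)
 have ki: "integrable lborel k" using C1_supp_integrable[OF G s, of 1] k0 by simp
 define m where "m = (LBINT x. k x)"
 have "m > 0"
 proof -
  \<comment> \<open>On the ball of half the radius the argument of \<open>bump\<close> is at least
    3/4, and \<open>exp (- (1 / t))\<close> is there at least \<open>exp (- (4/3))\<close>; this
    gives positive total mass.\<close>
  have kl: "k x >= exp (- (4 / 3))" if "norm x <= d / 2" for x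
  proof -
   have "x \<bullet> x <= (d / 2)\<^sup>2" using that by (simp add: dot_square_norm power_mono)
   then have "1 - (1 / d\<^sup>2) * (x \<bullet> x) >= 3 / 4" using d by (simp add: field_simps power2_eq_square)
   moreover have "exp (- (4 / 3)) <= bump 0 t" if "t >= 3 / 4" for t using that by (simp add: bump_def divide_simps)
   ultimately show ?thesis by (simp add: k_def)
  qed
  have "0 < exp (- (4 / 3)) * measure lborel (cball (0::'a) (d / 2))" using d by (simp add: content_cball_pos)
  also have "... = (LBINT x. exp (- (4 / 3)) * indicator (cball (0::'a) (d / 2)) x)" by simp
  also have "... <= m" unfolding m_def using kl k0
   by (intro integral_mono ki integrable_mult_right integrable_ind_cball) (auto simp: indicator_def)
  finally show ?thesis .
 qed
 show ?thesis
 proof (rule that[of "%x. (1 / m) * k x" "%x. (1 / m) *\<^sub>R G x"])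
  have "(%y. (1 / m) * k (a - y)) = (%y. (1 / m) * bump 0 (1 - (1 / d\<^sup>2) * ((y - a) \<bullet> (y - a))))" for a
   by (auto simp: k_def algebra_simps inner_commute)
  moreover have "bumpalg (%y. (1 / m) * bump 0 (1 - (1 / d\<^sup>2) * ((y - a) \<bullet> (y - a))))" for a :: 'a
   by (rule bumpalg.mult[OF bumpalg.const bumpalg.gen])
  ultimately show "mollifier (%x. (1 / m) * k x) (%x. (1 / m) *\<^sub>R G x) d"
   unfolding mollifier_def using \<open>m > 0\<close> k0 s bumpalg.mult[OF bumpalg.const[of "1 / m"] k]
   by (auto simp: supp_in_def C1_cmult[OF G, of "1/m", simplified] m_def[symmetric]) (auto simp: k_def)
 qed
qed

lemma mollifierD:
 assumes "mollifier kp G d"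
 shows "C1 kp G" "supp_in kp d" "kp x >= 0" "bumpalg kp" "bumpalg (%y. kp (a - y))"
  "integ (%y. kp (x - y))" "(LBINT y. kp (x - y)) = 1" "EX B. ALL x. abs (kp x) <= B" "kp (- x) = kp x"
proof -
 show A: "C1 kp G" "supp_in kp d" "kp x >= 0" "bumpalg kp" "bumpalg (%y. kp (a - y))" "kp (- x) = kp x" for x
  using assms by (auto simp: mollifier_def)
 have i: "integrable lborel kp" using C1_supp_integrable[OF A(1,2), of 1] A(3) by simp
 have e: "kp (x - y) = kp (y + - x)" for y using A(6)[of "x - y"] by simp
 show "integ (%y. kp (x - y))" unfolding e by (rule integrable_lborel_shift[OF i])
 show "(LBINT y. kp (x - y)) = 1"
  unfolding e using integral_lborel_shift[OF C1_meas(1)[OF A(1)], of "- x"] assms by (simp add: mollifier_def)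
 show "EX B. ALL x. abs (kp x) <= B" by (rule C1_supp_bounded[OF A(1,2)]) blast
qed

lemma mollify_uniform:
 assumes M: "mollifier kp G d" and F: "integrable lborel F" and u: "!!x y. norm (x - y) <= d ==> (abs (F x - F y)) <= e"
 shows "abs (conv F kp x - F x) <= e"
proof -
 note D = mollifierD[OF M]
 obtain B where B: "!!x. abs (kp x) <= B" using D(8) by blast
 have i: "integ (%y. F y * kp (x - y))" by (rule conv_integrable[OF F C1_cont[OF D(1)] B])
 have i2: "integ (%y. F x * kp (x - y))" using D(6) by simp
 have "conv F kp x - F x = (LBINT y. F y * kp (x - y) - F x * kp (x - y))"
  by (subst Bochner_Integration.integral_diff[OF i i2]) (simp add: conv_def D(7))
 also have "\<bar>...\<bar> <= (LBINT y. \<bar>F y * kp (x - y) - F x * kp (x - y)\<bar>)" by (rule integral_abs_bound)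
 also have "... <= (LBINT y. e * kp (x - y))"
 proof (intro integral_mono integrable_abs Bochner_Integration.integrable_diff i i2 integrable_mult_right D(6))
  fix y
  show "abs (F y * kp (x - y) - F x * kp (x - y)) <= e * kp (x - y)"
  proof (cases "norm (x - y) <= d")
   case True
   then have "abs (F x - F y) * kp (x - y) <= e * kp (x - y)" using D(3) by (intro mult_right_mono u) auto
   moreover have "abs (F y * kp (x - y) - F x * kp (x - y)) = abs (F x - F y) * kp (x - y)"
   using D(3)[of "x - y"] by (simp add: left_diff_distrib[symmetric] abs_mult abs_minus_commute)
   ultimately show ?thesis by simp
  qed (use D(2) in \<open>simp add: supp_in_def\<close>)
 qed
 finally show ?thesis by (simp add: D(7))
qed

lemma integrable_bounded_supp:
 fixes h :: "'a::euclidean_space => real"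
 assumes [measurable]: "h : bmeas" and B: "!!x. norm x <= R ==> (abs (h x)) <= B" and z: "!!x. norm x > R ==> h x = 0"
 shows "integrable lborel h"
proof (rule integrable_le)
 show "integ (%x::'a. B * ib R x)" by (intro integrable_mult_right integrable_ind_cball)
 show "AEL x. norm (h x) <= norm (B * ib R x)"
  using B z by (intro AE_I2) (force simp: indicator_def not_le)
qed measurable

lemma Lp_imp_integrable:
 fixes f :: "'a::euclidean_space => real"
 assumes p: "p > 1" and [measurable]: "f : bmeas"
  and f: "integ (%x. abs (f x) powr p)" "!!x. norm x > R ==> f x = 0"
 shows "integ f"
proof (rule integrable_le)
 show "integ (%x::'a. ib R x + abs (f x) powr p)" by (intro Bochner_Integration.integrable_add f(1) integrable_ind_cball)
 have "abs (f x) <= ib R x + abs (f x) powr p" for x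
  using le_one_plus_powr[of p "abs (f x)"] p f(2)[of x] by (auto simp: indicator_def not_le)
 then show "AEL x. norm (f x) <= norm (ib R x + abs (f x) powr p)"
  by (intro AE_I2) (metis abs_ge_self order_trans real_norm_def)
qed measurable

text \<open>Truncate the values at \<open>M\<close>, take continuous functions converging to
  \<open>f\<close> off a negligible set, truncate them likewise and multiply by a cutoff; both
  truncations supply the majorants for dominated convergence.\<close>

lemma Lp_dense:
 fixes f :: "'a::euclidean_space => real"
 assumes p: "p > 1" and [measurable]: "f : bmeas"
  and f: "integ (%x. abs (f x) powr p)" "!!x. norm x > R ==> f x = 0" and R: "R >= 0" and e: "e > 0"
 obtains h where "continuous_on UNIV h" "!!x. norm x > R + 1 ==> h x = 0"
  "integ (%x. abs (f x - h x) powr p)" "(LBINT x. abs (f x - h x) powr p) <= e"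
proof -
 define c :: "nat => real => real" where "c M x = max (- real M) (min (real M) x)" for M x
 have cc: "continuous_on UNIV (c M)" for M unfolding c_def by (intro continuous_intros)
 have [measurable]: "c M : bmeas" for M by (rule borel_measurable_continuous_onI[OF cc])
 define e1 where "e1 = e / (2 * 2 powr p)"
 have e1: "e1 > 0" using e by (simp add: e1_def)
 have cb: "abs (t - c M t) <= abs t" "abs (c M t) <= real M" for M t by (auto simp: c_def)
 have "(%M. LBINT x. abs (f x - c M (f x)) powr p) ----> (\<integral>x. 0 \<partial>(lborel :: 'a measure))"
 proof (rule integral_dominated_convergence[OF _ _ f(1)])
  show "AEL x. (%M. abs (f x - c M (f x)) powr p) ----> 0"
  proof (intro AE_I2 tendsto_eventually)
   fix x
   obtain N where N: "abs (f x) <= real N" using real_arch_simple by blast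
   show "eventually (%M. abs (f x - c M (f x)) powr p = 0) sequentially"
   unfolding eventually_sequentially
   proof (intro exI[of _ N] allI impI)
   fix n assume "N <= n"
   then have "abs (f x) <= real n" using N by linarith
   then show "abs (f x - c n (f x)) powr p = 0" by (simp add: c_def abs_le_iff)
   qed
  qed
  show "AEL x. norm (abs (f x - c M (f x)) powr p) <= abs (f x) powr p" for M
   using cb p by (intro AE_I2) (auto intro!: powr_mono2)
 qed measurable
 then have "eventually (%M. (LBINT x. abs (f x - c M (f x)) powr p) < e1) sequentially"
  using e1 by (intro order_tendstoD(2)) auto
 then obtain M where M: "(LBINT x. abs (f x - c M (f x)) powr p) < e1" by (auto simp: eventually_sequentially)
 have Mi: "integ (%x. abs (f x - c M (f x)) powr p)"
  using cb p by (intro integrable_le[OF f(1)] AE_I2) (auto intro!: powr_mono2)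
 have "f : borel_measurable lebesgue" by (simp add: measurable_completion)
 then have "f measurable_on UNIV" by (rule lebesgue_measurable_imp_measurable_on_real) simp
 then obtain N k where N: "negligible N" and k: "!!n. continuous_on UNIV (k n)" "!!x. x \<notin> N ==> (%n. k n x) ----> f x"
  unfolding measurable_on_def by auto
 have NA: "AEL x. x \<notin> N" using N unfolding negligible_iff_null_sets by (subst AE_completion_iff[symmetric]) (rule AE_not_in)
 obtain ct sg dsg where s: "C1 sg dsg" "!!x::'a. sg x = ct x powr p" "!!x. 0 <= ct x" "!!x. ct x <= 1"
  "!!x. norm x <= R ==> ct x = 1" "!!x. norm x > R + 1 ==> ct x = 0"
  by (rule cutoff_exists[OF p R zero_less_one]) (rule that)
 have s1: "0 <= sg x" "sg x <= 1" for x using s(2-4) p by (auto intro: powr_le1)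
 define h where "h n x = sg x * c M (k n x)" for n x
 have hc: "continuous_on UNIV (h n)" for n unfolding h_def
  by (intro continuous_intros C1_cont[OF s(1)] continuous_on_compose2[OF cc k(1)]) auto
 note [measurable] = borel_measurable_continuous_onI[OF hc]
 have h0: "h n x = 0" if "norm x > R + 1" for n x using that by (simp add: h_def s(2,6))
 have hM: "abs (h n x) <= real M" for n x
  using mult_mono[OF s1(2)[of x] cb(2)[of M "k n x"]] s1 by (simp add: h_def abs_mult)
 have f0: "c M (f x) = 0" if "norm x > R" for x using f(2)[OF that] by (simp add: c_def)
 have wi: "integ (%x::'a. ib (R + 1) x * (2 * real M) powr p)" by (intro integrable_mult_left integrable_ind_cball)
 have dom: "norm (abs (c M (f x) - h n x) powr p) <= ib (R + 1) x * (2 * real M) powr p" for n x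
 proof (cases "norm x <= R + 1")
  case True
  have "abs (c M (f x) - h n x) <= 2 * real M" using hM[of n x] cb(2)[of M "f x"] by linarith
  then have "abs (c M (f x) - h n x) powr p <= (2 * real M) powr p" using p by (intro powr_mono2) auto
  then show ?thesis using True by simp
 next
  case False
  then show ?thesis using h0[of x n] f0[of x] by simp
 qed
 have "(%n. LBINT x. abs (c M (f x) - h n x) powr p) ----> (\<integral>x. 0 \<partial>(lborel :: 'a measure))"
 proof (rule integral_dominated_convergence[OF _ _ wi])
  show "AEL x. (%n. abs (c M (f x) - h n x) powr p) ----> 0"
   using NA
  proof eventually_elim
   case (elim x)
   have "(%n. h n x) ----> sg x * c M (f x)" unfolding h_def c_def by (intro tendsto_intros k(2)[OF elim])
   also have "sg x * c M (f x) = c M (f x)" using s(2,5)[of x] f0[of x] by (cases "norm x <= R") auto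
   finally have "(%n. c M (f x) - h n x) ----> c M (f x) - c M (f x)" by (intro tendsto_intros)
   from tendsto_norm_powr[OF this, of p] show ?case using p by simp
  qed
 qed (use dom in auto)
 then have "eventually (%n. (LBINT x. abs (c M (f x) - h n x) powr p) < e1) sequentially"
  using e1 by (intro order_tendstoD(2)) auto
 then obtain n where n: "(LBINT x. abs (c M (f x) - h n x) powr p) < e1" by (auto simp: eventually_sequentially)
 have ni: "integ (%x. abs (c M (f x) - h n x) powr p)"
  by (rule integrable_le[OF wi]) (use dom in \<open>auto intro: order_trans[OF _ abs_ge_self]\<close>)
 have le: "abs (f x - h n x) powr p <= 2 powr p * (abs (f x - c M (f x)) powr p + abs (c M (f x) - h n x) powr p)" for x
  using norm_add_powr_le[of p "f x - c M (f x)" "c M (f x) - h n x"] p by simp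
 have hi: "integ (%x. 2 powr p * (abs (f x - c M (f x)) powr p + abs (c M (f x) - h n x) powr p))" using Mi ni by auto
 have fi: "integ (%x. abs (f x - h n x) powr p)"
  by (rule integrable_le[OF hi]) (use le in \<open>auto intro: order_trans[OF _ abs_ge_self]\<close>)
 show ?thesis
 proof (rule that[OF hc h0 fi])
  have "(LBINT x. abs (f x - h n x) powr p) <= 2 powr p * ((LBINT x. abs (f x - c M (f x)) powr p) + (LBINT x. abs (c M (f x) - h n x) powr p))"
   using integral_mono[OF fi hi le] Mi ni by simp
  also have "... <= 2 powr p * (e1 + e1)" using M n by (intro mult_left_mono add_mono) auto
  finally show "(LBINT x. abs (f x - h n x) powr p) <= e" by (simp add: e1_def)
 qed
qed

text \<open>Jensen's inequality for the kernel as a probability density, then Fubini.\<close>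

lemma conv_Lp_le:
 fixes F :: "'a::euclidean_space => real"
 assumes p: "p > 1" and M: "mollifier kp G d" and F: "integrable lborel F" "integ (%x. abs (F x) powr p)"
 shows "integ (%x. abs (conv F kp x) powr p)"
  "(LBINT x. abs (conv F kp x) powr p) <= (LBINT x. abs (F x) powr p)"
proof -
 note D = mollifierD[OF M]
 note [measurable] = C1_meas(1)[OF D(1)] borel_measurable_continuous_onI[OF conv_continuous[OF F(1) C1_cont[OF D(1)] D(2)]]
 have [measurable]: "F : bmeas" using borel_measurable_integrable[OF F(1)] by simp
 obtain B where B: "!!x. abs (kp x) <= B" using D(8) by blast
 let ?q = "%x y. ennreal (abs (F y) powr p * kp (x - y))"
 have "(\<integral>\<^sup>+x. ennreal (abs (conv F kp x) powr p) \<partial>lborel) <= (\<integral>\<^sup>+x. (\<integral>\<^sup>+y. ?q x y \<partial>lborel) \<partial>lborel)"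
  unfolding conv_def
  by (intro nn_integral_mono jensen_kernel[OF p _ _ D(3,6,7)] conv_integrable[OF F(1) C1_cont[OF D(1)] B]) measurable
 also have "... = (\<integral>\<^sup>+y. (\<integral>\<^sup>+x. ?q x y \<partial>lborel) \<partial>lborel)"
  by (rule lborel_pair.Fubini'[symmetric]) measurable
 also have "... = (\<integral>\<^sup>+y. ennreal (abs (F y) powr p) \<partial>lborel)"
 proof (rule nn_integral_cong)
  fix y :: 'a
  have e: "kp (x - y) = kp (y - x)" for x using D(9)[of "x - y"] by simp
  have "(\<integral>\<^sup>+x. ?q x y \<partial>lborel) = ennreal (LBINT x. abs (F y) powr p * kp (y - x))"
   unfolding e using D(3,6) by (intro nn_integral_eq_integral) auto
  then show "(\<integral>\<^sup>+x. ?q x y \<partial>lborel) = ennreal (abs (F y) powr p)" by (simp add: D(7))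
 qed
 also have "... = ennreal (LBINT y. abs (F y) powr p)" using F(2) by (intro nn_integral_eq_integral) auto
 finally have X: "(\<integral>\<^sup>+x. ennreal (abs (conv F kp x) powr p) \<partial>lborel) <= ennreal (LBINT y. abs (F y) powr p)" .
 show i: "integ (%x. abs (conv F kp x) powr p)"
  by (rule integrableI_nonneg) (use X in \<open>auto simp: le_less_trans\<close>)
 show "(LBINT x. abs (conv F kp x) powr p) <= (LBINT x. abs (F x) powr p)"
  using X nn_integral_eq_integral[OF i] by simp
qed

text \<open>Through a continuous \<open>h\<close> close to \<open>f\<close>: mollification does not
  increase the \<open>L^p\<close> norm of \<open>f - h\<close>, and it moves \<open>h\<close>
  uniformly little on a fixed ball.\<close>

lemma mollify_Lp:
 fixes f :: "'a::euclidean_space => real"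
 assumes p: "p > 1" and [measurable]: "f : bmeas"
  and f: "integ (%x. abs (f x) powr p)" "!!x. norm x > R ==> f x = 0" and R: "R >= 0" and e: "e > 0"
 obtains d where "d > 0" "!!kp G d'. mollifier kp G d' ==> d' <= d ==>
  integ (%x. abs (conv f kp x - f x) powr p) & (LBINT x. abs (conv f kp x - f x) powr p) <= e"
proof -
 define e1 where "e1 = e / (3 * 4 powr p)"
 have e1: "e1 > 0" using e by (simp add: e1_def)
 obtain h where h: "continuous_on UNIV h" "!!x. norm x > R + 1 ==> h x = 0"
  "integ (%x. abs (f x - h x) powr p)" "(LBINT x. abs (f x - h x) powr p) <= e1"
  by (rule Lp_dense[OF p _ f R e1]) (auto intro: that)
 note [measurable] = borel_measurable_continuous_onI[OF h(1)]
 have fi: "integ f" by (rule Lp_imp_integrable[OF p _ f]) measurable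
 have hi: "integrable lborel h"
  by (rule continuous_bounded_cball[OF h(1), of "R + 1"]) (rule integrable_bounded_supp[where R = "R + 1"]; use h(2) in auto)
 have Fi: "integ (%x. f x - h x)" using fi hi by simp
 define m where "m = measure lborel (cball (0::'a) (R + 2))"
 define e2 where "e2 = (e1 / (m + 1)) powr (1 / p)"
 have m: "m >= 0" by (simp add: m_def)
 have e2: "e2 > 0" "e2 powr p * m <= e1" using e1 m p by (auto simp: e2_def powr_powr field_simps)
 obtain d where d: "d > 0" "!!x y. norm (x - y) <= d ==> norm (h x - h y) <= e2"
  by (rule uniformly_continuous_compact_supp[OF h(1,2) e2(1)]) (auto intro: that)
 show ?thesis
 proof (rule that[of "min 1 d"])
  show "min 1 d > 0" using d by simp
  fix kp :: "'a => real" and G d' assume M: "mollifier kp G d'" and d': "d' <= min 1 d"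
  note D = mollifierD[OF M]
  obtain B where B: "!!x. abs (kp x) <= B" using D(8) by blast
  note [measurable] = borel_measurable_continuous_onI[OF conv_continuous[OF fi C1_cont[OF D(1)] D(2)]]
  have cl: "conv (%x. f x - h x) kp x = conv f kp x - conv h kp x" for x
   unfolding conv_def left_diff_distrib
   by (intro Bochner_Integration.integral_diff conv_integrable[OF _ C1_cont[OF D(1)] B] fi hi)
  have u: "abs (conv h kp x - h x) <= ib (R + 2) x * e2" for x
  proof (cases "norm x <= R + 2")
   case True
   then show ?thesis using mollify_uniform[OF M hi, of e2 x] d d' by simp
  next
   case False
   then have "conv h kp x = 0" using conv_supp[OF h(2) D(2)] d' unfolding supp_in_def by auto
   then show ?thesis using False h(2)[of x] by simp
  qed
  have le: "abs (conv f kp x - f x) powr p <= 4 powr p * (abs (conv (%x. f x - h x) kp x) powr p + e2 powr p * ib (R + 2) x + abs (f x - h x) powr p)" for x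
  proof -
   have "abs (conv f kp x - f x) <= abs (conv (%x. f x - h x) kp x) + ib (R + 2) x * e2 + abs (f x - h x)"
   unfolding cl using u[of x] by linarith
   then have "abs (conv f kp x - f x) powr p <= (abs (conv (%x. f x - h x) kp x) + ib (R + 2) x * e2 + abs (f x - h x)) powr p"
   using p by (intro powr_mono2) auto
   also have "... <= 4 powr p * (abs (conv (%x. f x - h x) kp x) powr p + (ib (R + 2) x * e2) powr p + abs (f x - h x) powr p)"
   using p e2 by (intro sum3_powr_le) auto
   also have "(ib (R + 2) x * e2) powr p = e2 powr p * ib (R + 2) x" by (auto simp: indicator_def)
   finally show ?thesis .
  qed
  note C = conv_Lp_le[OF p M Fi h(3)]
  have ii: "integ (%x::'a. e2 powr p * ib (R + 2) x)" by (intro integrable_mult_right integrable_ind_cball)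
  have ri: "integ (%x. 4 powr p * (abs (conv (%x. f x - h x) kp x) powr p + e2 powr p * ib (R + 2) x + abs (f x - h x) powr p))"
   by (intro integrable_mult_right Bochner_Integration.integrable_add C(1) h(3) ii)
  have li: "integ (%x. abs (conv f kp x - f x) powr p)"
  proof (rule integrable_le[OF ri])
   show "AEL x. norm (abs (conv f kp x - f x) powr p) <= norm (4 powr p * (abs (conv (%x. f x - h x) kp x) powr p + e2 powr p * ib (R + 2) x + abs (f x - h x) powr p))"
   unfolding real_norm_def abs_of_nonneg[OF powr_ge_zero] by (rule AE_I2, rule order_trans[OF le abs_ge_self])
  qed measurable
  have "(LBINT x. abs (conv f kp x - f x) powr p) <= (LBINT x. 4 powr p * (abs (conv (%x. f x - h x) kp x) powr p + e2 powr p * ib (R + 2) x + abs (f x - h x) powr p))"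
   by (rule integral_mono[OF li ri le])
  also have "... = 4 powr p * ((LBINT x. abs (conv (%x. f x - h x) kp x) powr p) + e2 powr p * m + (LBINT x. abs (f x - h x) powr p))"
   using C(1) h(3) ii by (simp add: m_def)
  also have "... <= 4 powr p * (e1 + e1 + e1)"
   using C(2) h(4) e2(2) by (intro mult_left_mono add_mono) auto
  also have "... = e" by (simp add: e1_def)
  finally show "integ (%x. abs (conv f kp x - f x) powr p) & (LBINT x. abs (conv f kp x - f x) powr p) <= e" using li by blast
 qed
qed

section \<open>Approximation of local Sobolev functions, and smooth versus C1 test functions\<close>

definition vconv :: "('a::euclidean_space => 'b::euclidean_space) => ('a => real) => 'a => 'b" where
 "vconv f kp x = (\<Sum>i\<in>Basis. conv (%y. f y \<bullet> i) kp x *\<^sub>R i)"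

text \<open>Kernels are chosen with error at most \<open>(1/2)^n\<close> in each component. The sum
  of the p-th powers of all errors is then integrable, which yields convergence almost everywhere
  and the majorant together.\<close>

lemma mollify_sequence:
 fixes f :: "'a::euclidean_space => 'b::euclidean_space"
 assumes p: "p > 1" and [measurable]: "f : bmeas"
  and f: "integ (%x. norm (f x) powr p)" "!!x. norm x > R ==> f x = 0" and R: "R >= 0"
 obtains kp G d D where "!!n::nat. mollifier (kp n) (G n) (d n)" "!!n. d n <= 1" "integrable lborel D"
  "!!n. AEL x. norm (vconv f (kp n) x) powr p <= D x" "AEL x. (%n. vconv f (kp n) x) ----> f x"
proof -
 have fi: "integ (%x. abs (f x \<bullet> i) powr p)" if "i : Basis" for i
  using p Basis_le_norm[OF that] by (intro integrable_le[OF f(1)] AE_I2) (auto intro!: powr_mono2)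
 define Q where "Q n kp i \<longleftrightarrow> integ (%x. abs (conv (%y. f y \<bullet> i) kp x - f x \<bullet> i) powr p) &
  (LBINT x. abs (conv (%y. f y \<bullet> i) kp x - f x \<bullet> i) powr p) <= (1/2)^n" for n kp i
 have "EX kp G d. mollifier kp G d & d <= 1 & (\<forall>i\<in>Basis. Q n kp i)" for n
 proof -
  have "\<forall>i\<in>Basis. EX d>0. ALL kp G d'. mollifier kp G d' --> d' <= d --> Q n kp i"
  proof
   fix i :: 'b assume i: "i : Basis"
   show "EX d>0. ALL kp G d'. mollifier kp G d' --> d' <= d --> Q n kp i"
   proof (rule mollify_Lp[OF p _ fi[OF i] _ R, of "(1/2)^n"], goal_cases)
   case (4 d) then show ?case unfolding Q_def by blast
   qed (use f(2) in auto)
  qed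
  from bchoice[OF this] obtain d where d: "\<forall>i\<in>Basis. d i > 0 & (ALL kp G d'. mollifier kp G d' --> d' <= d i --> Q n kp i)" ..
  define d0 where "d0 = min 1 (Min (d ` Basis))"
  have "d0 > 0" using d by (simp add: d0_def)
  obtain kp G where M: "mollifier kp (G :: 'a => 'a) d0" using mollifier_exists[OF \<open>d0 > 0\<close>] by blast
  have "d0 <= d i" if "i : Basis" for i using that by (auto simp: d0_def min_le_iff_disj)
  then have "\<forall>i\<in>Basis. Q n kp i" using d M by blast
  moreover have "d0 <= 1" by (simp add: d0_def)
  ultimately show ?thesis using M by blast
 qed
 then obtain kp G d where M: "!!n. mollifier (kp n) (G n) (d n)" "!!n::nat. d n <= 1" and Q: "!!n. \<forall>i\<in>Basis. Q n (kp n) i"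
  by metis
 note I = conjunct1[OF bspec[OF Q, unfolded Q_def]] conjunct2[OF bspec[OF Q, unfolded Q_def]]
 define s where "s n x = (\<Sum>i\<in>Basis. abs (conv (%y. f y \<bullet> i) (kp n) x - f x \<bullet> i) powr p)" for n x
 have si: "integ (s n)" for n unfolding s_def using I(1) by auto
 then have [measurable]: "s n : bmeas" for n using borel_measurable_integrable by fastforce
 have s0: "s n x >= 0" for n x unfolding s_def by (intro sum_nonneg) auto
 have sle: "(LBINT x. s n x) <= real DIM('b) * (1/2)^n" for n
 proof -
  have "(LBINT x. s n x) = (\<Sum>i\<in>Basis. LBINT x. abs (conv (%y. f y \<bullet> i) (kp n) x - f x \<bullet> i) powr p)"
   unfolding s_def by (intro Bochner_Integration.integral_sum I(1))
  also have "... <= (\<Sum>i\<in>(Basis::'b set). (1/2)^n)" by (intro sum_mono I(2))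
  finally show ?thesis by simp
 qed
 define E where "E x = (\<Sum>n. ennreal (s n x))" for x
 have [measurable]: "E : bmeas" unfolding E_def by measurable
 have Efin: "(\<integral>\<^sup>+x. E x \<partial>lborel) < \<infinity>"
 proof -
  have "(\<integral>\<^sup>+x. E x \<partial>lborel) = (\<Sum>n. \<integral>\<^sup>+x. ennreal (s n x) \<partial>lborel)" unfolding E_def by (intro nn_integral_suminf) measurable
  also have "... <= (\<Sum>n. ennreal (real DIM('b) * (1/2)^n))"
   using sle s0 by (intro suminf_le summableI) (simp add: nn_integral_eq_integral[OF si])
  also have "... = ennreal (\<Sum>n. real DIM('b) * (1/2)^n)" by (intro suminf_ennreal2 summable_mult summable_geometric) auto
  finally show ?thesis using le_less_trans by fastforce
 qed
 have EAE: "AEL x. E x ~= \<infinity>" by (rule nn_integral_PInf_AE) (use Efin in auto)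
 have Ei: "integ (%x. enn2real (E x))"
 proof (rule integrableI_nonneg)
  have "(\<integral>\<^sup>+x. ennreal (enn2real (E x)) \<partial>lborel) = (\<integral>\<^sup>+x. E x \<partial>lborel)" using EAE by (intro nn_integral_cong_AE) (auto simp: less_top)
  then show "(\<integral>\<^sup>+x. ennreal (enn2real (E x)) \<partial>lborel) < \<infinity>" using Efin by simp
 qed auto
 have ai: "abs (conv (%y. f y \<bullet> i) (kp n) x - f x \<bullet> i) <= s n x powr (1/p)" if "i : Basis" for i n x
 proof -
  have "abs (conv (%y. f y \<bullet> i) (kp n) x - f x \<bullet> i) powr p <= s n x"
   unfolding s_def using that member_le_sum[of i Basis "%i. abs (conv (%y. f y \<bullet> i) (kp n) x - f x \<bullet> i) powr p"] by auto
  then have "(abs (conv (%y. f y \<bullet> i) (kp n) x - f x \<bullet> i) powr p) powr (1/p) <= s n x powr (1/p)" using p by (intro powr_mono2) auto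
  then show ?thesis using p by (simp add: powr_powr)
 qed
 have nv: "norm (vconv f (kp n) x - f x) <= real DIM('b) * s n x powr (1/p)" for n x
 proof -
  have "norm (vconv f (kp n) x - f x) <= (\<Sum>i\<in>Basis. abs ((vconv f (kp n) x - f x) \<bullet> i))" by (rule norm_le_l1)
  also have "... = (\<Sum>i\<in>Basis. abs (conv (%y. f y \<bullet> i) (kp n) x - f x \<bullet> i))" by (simp add: vconv_def inner_diff_left)
  also have "... <= (\<Sum>i\<in>(Basis::'b set). s n x powr (1/p))" by (intro sum_mono ai)
  finally show ?thesis by simp
 qed
 show ?thesis
 proof (rule that[OF M])
  let ?D = "%x. 2 powr p * (norm (f x) powr p + real DIM('b) powr p * enn2real (E x))"
  show "integ ?D" using f(1) Ei by auto
  show "AEL x. norm (vconv f (kp n) x) powr p <= ?D x" for n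
   using EAE
  proof eventually_elim
   case (elim x)
   have "ennreal (s n x) <= E x" unfolding E_def using sum_le_suminf[of "%n. ennreal (s n x)" "{n}"] by simp
   then have sE: "s n x <= enn2real (E x)" using elim by (metis s0 enn2real_ennreal enn2real_mono infinity_ennreal_def less_top)
   have "norm (vconv f (kp n) x - f x) powr p <= (real DIM('b) * s n x powr (1/p)) powr p" using nv[of n x] p by (intro powr_mono2) auto
   also have "... = real DIM('b) powr p * s n x" using p s0[of n x] by (simp add: powr_mult powr_powr)
   also have "... <= real DIM('b) powr p * enn2real (E x)" using sE by (intro mult_left_mono) auto
   finally have 1: "norm (vconv f (kp n) x - f x) powr p <= real DIM('b) powr p * enn2real (E x)" .
   have "norm (vconv f (kp n) x) powr p <= 2 powr p * (norm (f x) powr p + norm (vconv f (kp n) x - f x) powr p)"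
   using norm_add_powr_le[of p "f x" "vconv f (kp n) x - f x"] p by simp
   also have "... <= ?D x" using 1 by (intro mult_left_mono add_left_mono) auto
   finally show ?case .
  qed
  show "AEL x. (%n. vconv f (kp n) x) ----> f x"
   using EAE
  proof eventually_elim
   case (elim x)
   have "summable (%n. s n x)" using elim s0 by (intro summable_suminf_not_top) (auto simp: E_def)
   then have "(%n. s n x) ----> 0" by (rule summable_LIMSEQ_zero)
   then have "(%n. real DIM('b) * s n x powr (1/p)) ----> real DIM('b) * 0 powr (1/p)"
   using p s0 by (intro tendsto_mult tendsto_const tendsto_nonneg_powr) auto
   moreover have "real DIM('b) * 0 powr (1/p) = 0" by simp
   ultimately have l: "(%n. real DIM('b) * s n x powr (1/p)) ----> 0" by metis
   have "(%n. vconv f (kp n) x - f x) ----> 0" by (rule Lim_null_comparison[OF always_eventually l]) (use nv in blast)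
   then show ?case by (simp add: LIM_zero_iff)
  qed
 qed
qed

lemma C1_reflect:
 assumes "C1 kp G"
 shows "C1 (%y. kp (x - y)) (%y. - G (x - y))"
 unfolding C1_def
proof (intro conjI allI)
 fix y
 have "((%y. x - y) has_derivative (%h. - h)) (at y)" by (auto intro!: derivative_eq_intros)
 from has_derivative_compose[OF this C1_D[OF assms]]
 show "((%y. kp (x - y)) has_derivative (%h. (- G (x - y)) \<bullet> h)) (at y)" by simp
 show "continuous_on UNIV (%y. - G (x - y))"
  by (intro continuous_intros continuous_on_compose2[OF C1_cont_grad[OF assms]]) auto
qed

lemma supp_reflect:
 fixes x :: "'a::real_normed_vector"
 shows "supp_in kp d ==> supp_in (%y. kp (x - y)) (norm x + d)"
 unfolding supp_in_def
proof (intro allI impI)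
 fix y :: 'a assume a: "ALL z. d < norm z --> kp z = 0" "norm x + d < norm y"
 then have "d < norm (x - y)" using norm_triangle_sub[of y x] by (simp add: norm_minus_commute)
 then show "kp (x - y) = 0" using a(1) by blast
qed

text \<open>Friedrichs mollification brings a locally p-integrable function with a weak gradient
  into \<open>Wp\<close> after a cutoff. Function and gradient are mollified as one vector-valued
  map, so a single sequence of kernels serves both.\<close>

lemma Wp_cutoff:
 fixes py :: "'a::euclidean_space => real" and g :: "'a => 'a"
 assumes p: "p > 1" and m [measurable]: "py : bmeas" "g : bmeas" and py0: "!!x. py x >= 0"
  and loc: "!!R. integ (%x. ib R x * py x powr p)" "!!R. integ (%x. ib R x * norm (g x) powr p)"
  and wg: "!!ph G R v. smooth_fun ph ==> C1 ph G ==> supp_in ph R ==> (LBINT x. py x * (G x \<bullet> v)) = - (LBINT x. (g x \<bullet> v) * ph x)"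
  and r: "r >= 0"
 obtains sg dsg where "!!x. norm x < r ==> sg x = (1::real) & dsg x = (0::'a)"
  "Wp p (%x. sg x * py x) (%x. py x *\<^sub>R dsg x + sg x *\<^sub>R g x)"
proof -
 obtain ct sg dsg where s: "C1 sg dsg" "!!x::'a. sg x = ct x powr p" "!!x. 0 <= ct x" "!!x. ct x <= 1"
  "!!x. norm x <= r ==> ct x = 1" "!!x. norm x > r + 1 ==> ct x = 0"
  by (rule cutoff_exists[OF p r zero_less_one]) (rule that)
 have s1: "0 <= sg x" "sg x <= 1" for x using s(2-4) p by (auto intro: powr_le1)
 have ss: "supp_in sg (r + 1)" using s(2,6) by (auto simp: supp_in_def)
 note [measurable] = C1_meas[OF s(1)]
 obtain B where B: "B > 0" "!!x. abs (sg x) <= B" "!!x. norm (dsg x) <= B" by (rule C1_supp_bounded[OF s(1) ss]) (rule that)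
 have one: "sg x = 1 & dsg x = 0" if x: "norm x < r" for x
 proof -
  have "(sg has_derivative (%h. 0)) (at x)"
   by (rule has_derivative_transform_within_open[of "%x. 1" _ _ _ "ball 0 r"]) (use x s(2,5) in auto)
  then have "(%h. dsg x \<bullet> h) = (%h. 0)" using has_derivative_unique C1_D[OF s(1)] by blast
  then have "dsg x \<bullet> dsg x = 0" by metis
  then show ?thesis using x s(2,5) by simp
 qed
 \<comment> \<open>The cutoff is supported in radius \<open>r + 1\<close> and kernels have width at
   most 1, so on its support mollification does not see the truncation at
   \<open>r + 2\<close>.\<close>
 define f where "f x = ib (r + 2) x *\<^sub>R (py x, g x)" for x
 have fm [measurable]: "f : bmeas" unfolding f_def by measurable
 have fz: "f x = 0" if "norm x > r + 2" for x using that by (simp add: f_def zero_prod_def)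
 have fi: "integ (%x. norm (f x) powr p)"
 proof (rule integrable_le)
  show "integ (%x. 2 powr p * (ib (r + 2) x * py x powr p + ib (r + 2) x * norm (g x) powr p))"
   using loc by auto
  have "norm (f x) powr p <= 2 powr p * (ib (r + 2) x * py x powr p + ib (r + 2) x * norm (g x) powr p)" for x
   using norm_add_powr_le[of p "(py x, 0)" "(0, g x)"] p py0[of x] by (auto simp: f_def indicator_def norm_Pair)
  then show "AEL x. norm (norm (f x) powr p) <= norm (2 powr p * (ib (r + 2) x * py x powr p + ib (r + 2) x * norm (g x) powr p))"
   unfolding real_norm_def abs_of_nonneg[OF powr_ge_zero] by (intro AE_I2) (rule order_trans[OF _ abs_ge_self])
 qed measurable
 have r2: "r + 2 >= 0" using r by simp
 obtain kp G d D where M: "!!n::nat. mollifier (kp n) (G n) (d n)" "!!n. d n <= 1" "integrable lborel D"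
  "!!n. AEL x. norm (vconv f (kp n) x) powr p <= D x" "AEL x. (%n. vconv f (kp n) x) ----> f x"
  by (rule mollify_sequence[OF p fm fi _ r2]) (erule fz, rule that)
 note K = mollifierD[OF M(1)]
 have f1: "fst (f x) = ib (r + 2) x * py x" for x by (simp add: f_def)
 have f1m: "(%x. fst (f x)) : bmeas" unfolding f1 by measurable
 have fcp: "integ (%x. abs (fst (f x)) powr p)"
 proof (rule integrable_le[OF fi])
  show "AEL x. norm (abs (fst (f x)) powr p) <= norm (norm (f x) powr p)"
  proof (rule AE_I2)
   fix x
   have "abs (fst (f x)) <= norm (f x)" using norm_fst_le[of "fst (f x)" "snd (f x)"] by simp
   then show "norm (abs (fst (f x)) powr p) <= norm (norm (f x) powr p)" using p by (simp add: powr_mono2)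
  qed
  show "(%x. abs (fst (f x)) powr p) : borel_measurable lborel" unfolding f1 by measurable
 qed
 have fst_i: "integ (%x. fst (f x))"
  by (rule Lp_imp_integrable[OF p f1m fcp, of "r + 2"]) (use fz in simp)
 define A where "A n = conv (%y. fst (f y)) (kp n)" for n
 have Av: "fst (vconv f (kp n) x) = A n x" for n x
 proof -
  have "fst (vconv f (kp n) x) = vconv f (kp n) x \<bullet> (1, 0)" by (cases "vconv f (kp n) x") simp
  also have "... = conv (%y. f y \<bullet> (1, 0)) (kp n) x" unfolding vconv_def by (rule inner_sum_left_Basis) (simp add: Basis_prod_def)
  also have "(%y. f y \<bullet> (1, 0)) = (%y. fst (f y))" by (auto simp: inner_prod_def)
  finally show ?thesis by (simp add: A_def)
 qed
 have sv: "snd (vconv f (kp n) x) \<bullet> b = conv (%y. snd (f y) \<bullet> b) (kp n) x" if "b : Basis" for n x b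
 proof -
  have "snd (vconv f (kp n) x) \<bullet> b = vconv f (kp n) x \<bullet> (0, b)" by (cases "vconv f (kp n) x") simp
  also have "... = conv (%y. f y \<bullet> (0, b)) (kp n) x" unfolding vconv_def by (rule inner_sum_left_Basis) (use that in \<open>simp add: Basis_prod_def\<close>)
  also have "(%y. f y \<bullet> (0, b)) = (%y. snd (f y) \<bullet> b)" by (auto simp: inner_prod_def)
  finally show ?thesis .
 qed
 have A0: "A n x >= 0" for n x unfolding A_def conv_def
  using K(3) py0 by (intro integral_nonneg_AE AE_I2) (auto simp: f_def indicator_def)
 have AC: "C1 (A n) (%x. \<Sum>b\<in>Basis. conv (%y. fst (f y)) (%z. G n z \<bullet> b) x *\<^sub>R b)" for n
  unfolding A_def by (rule conv_C1[OF fst_i K(1,2)])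
 \<comment> \<open>On the ball of radius \<open>r + 1\<close> the gradient of the mollified function
   is the mollified weak gradient: the weak gradient is tested with
   \<open>y \<mapsto> kp n (x - y)\<close>.\<close>
 have grad: "(\<Sum>b\<in>Basis. conv (%y. fst (f y)) (%z. G n z \<bullet> b) x *\<^sub>R b) = snd (vconv f (kp n) x)" if x: "norm x <= r + 1" for n x
 proof (rule euclidean_eqI)
  fix b :: 'a assume b: "b : Basis"
  have out: "kp n (x - y) = 0 & G n (x - y) = 0" if "norm y > r + 2" for y
  proof -
   have "norm (x - y) > d n" using norm_triangle_sub[of y x] x that M(2)[of n] by (simp add: norm_minus_commute)
   then show ?thesis using K(2)[of n] supp_in_grad[OF K(1,2)] by (auto simp: supp_in_def)
  qed
  have "conv (%y. fst (f y)) (%z. G n z \<bullet> b) x = - (LBINT y. py y * (- G n (x - y) \<bullet> b))"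
   unfolding conv_def Bochner_Integration.integral_minus[symmetric]
   by (rule Bochner_Integration.integral_cong) (use out in \<open>auto simp: f_def indicator_def not_le\<close>)
  also have "... = (LBINT y. (g y \<bullet> b) * kp n (x - y))"
   using wg[OF bumpalg_smooth[OF mollifierD(5)[OF M(1)[of n], where a = x]] C1_reflect[OF mollifierD(1)[OF M(1)[of n]]] supp_reflect[OF mollifierD(2)[OF M(1)[of n]]], where v = b] by simp
  also have "... = conv (%y. snd (f y) \<bullet> b) (kp n) x" unfolding conv_def
   by (rule Bochner_Integration.integral_cong) (use out in \<open>auto simp: f_def indicator_def not_le\<close>)
  finally show "(\<Sum>b\<in>Basis. conv (%y. fst (f y)) (%z. G n z \<bullet> b) x *\<^sub>R b) \<bullet> b = snd (vconv f (kp n) x) \<bullet> b"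
   using b by (simp add: sv)
 qed
 define H where "H n x = A n x *\<^sub>R dsg x + sg x *\<^sub>R snd (vconv f (kp n) x)" for n x
 have HC: "C1 (%x. sg x * A n x) (H n)" for n
 proof -
  have "H n = (%x. A n x *\<^sub>R dsg x + sg x *\<^sub>R (\<Sum>b\<in>Basis. conv (%y. fst (f y)) (%z. G n z \<bullet> b) x *\<^sub>R b))"
  proof
   fix x show "H n x = A n x *\<^sub>R dsg x + sg x *\<^sub>R (\<Sum>b\<in>Basis. conv (%y. fst (f y)) (%z. G n z \<bullet> b) x *\<^sub>R b)"
   using grad[of x n] s(2,6)[of x] by (cases "norm x <= r + 1") (auto simp: H_def)
  qed
  then show ?thesis using C1_mult[OF s(1) AC[of n]] by simp
 qed
 let ?E = "%x. D x + 2 powr p * (B powr p * D x + D x)"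
 have "approx p (%n x. sg x * A n x) H ?E (%x. sg x * py x) (%x. py x *\<^sub>R dsg x + sg x *\<^sub>R g x)"
  unfolding approx_def
 proof (intro conjI allI HC)
  show "0 <= sg x * A n x" "0 <= sg x * py x" for n x using A0 s1 py0 by auto
  show "integ ?E" using M(3) by auto
  show "AEL x. (sg x * A n x) powr p + norm (H n x) powr p <= ?E x" for n
   using M(4)[of n]
  proof eventually_elim
   case (elim x)
   let ?w = "vconv f (kp n) x"
   have p0: "0 <= p" using p by simp
   have "A n x <= norm ?w" using norm_fst_le[of "fst ?w" "snd ?w"] unfolding prod.collapse unfolding Av by simp
   from powr_mono2[OF p0 A0 this] have a: "A n x powr p <= D x" using elim by linarith
   have "norm (snd ?w) <= norm ?w" using norm_snd_le[of "snd ?w" "fst ?w"] unfolding prod.collapse .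
   from powr_mono2[OF p0 norm_ge_zero this] have b: "norm (snd ?w) powr p <= D x" using elim by linarith
   have "sg x * A n x <= 1 * A n x" using s1 A0 by (intro mult_right_mono) auto
   then have "(sg x * A n x) powr p <= A n x powr p" using s1[of x] A0[of n x] p0 by (intro powr_mono2) auto
   then have 1: "(sg x * A n x) powr p <= D x" using a by linarith
   have "A n x * norm (dsg x) <= A n x * B" by (rule mult_left_mono[OF B(3) A0])
   then have "norm (A n x *\<^sub>R dsg x) <= B * A n x" using A0[of n x] by (simp add: mult.commute)
   from powr_mono2[OF p0 norm_ge_zero this] have "norm (A n x *\<^sub>R dsg x) powr p <= B powr p * A n x powr p" by (simp add: powr_mult)
   also have "... <= B powr p * D x" by (rule mult_left_mono[OF a powr_ge_zero])
   finally have 2: "norm (A n x *\<^sub>R dsg x) powr p <= B powr p * D x" .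
   have "sg x * norm (snd ?w) <= 1 * norm (snd ?w)" using s1 by (intro mult_right_mono) auto
   then have "norm (sg x *\<^sub>R snd ?w) <= norm (snd ?w)" using s1[of x] by simp
   from powr_mono2[OF p0 norm_ge_zero this] have 3: "norm (sg x *\<^sub>R snd ?w) powr p <= D x" using b by linarith
   have "norm (H n x) powr p <= 2 powr p * (norm (A n x *\<^sub>R dsg x) powr p + norm (sg x *\<^sub>R snd ?w) powr p)"
   unfolding H_def by (rule norm_add_powr_le) (use p in simp)
   also have "... <= 2 powr p * (B powr p * D x + D x)" by (rule mult_left_mono[OF add_mono[OF 2 3] powr_ge_zero])
   finally have "norm (H n x) powr p <= 2 powr p * (B powr p * D x + D x)" .
   then show ?case using 1 by linarith
  qed
  show "AEL x. (%n. sg x * A n x) ----> sg x * py x & (%n. H n x) ----> py x *\<^sub>R dsg x + sg x *\<^sub>R g x"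
   using M(5)
  proof eventually_elim
   case (elim x)
   show ?case
   proof (cases "norm x <= r + 1")
   case True
   then have fx: "f x = (py x, g x)" by (simp add: f_def)
   have "(%n. A n x) ----> py x" "(%n. snd (vconv f (kp n) x)) ----> g x"
   using tendsto_fst[OF elim] tendsto_snd[OF elim] by (simp_all add: Av fx)
   then show ?thesis unfolding H_def by (intro conjI tendsto_intros)
   next
   case False
   then have "sg x = 0" "dsg x = 0" using s(2,6)[of x] supp_in_grad[OF s(1) ss, of x] by auto
   then show ?thesis by (simp add: H_def)
   qed
  qed
 qed measurable
 then show ?thesis using one by (intro that[of sg dsg]) (auto simp: Wp_def)
qed

text \<open>A C1 test function and its gradient are approximated uniformly by mollification;
  nonnegativity is preserved and the support grows by at most 1, which is the loss of
  radius.\<close>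

lemma super_from_test:
 fixes u :: "'a::euclidean_space => real"
 assumes p: "p > 1" and W: "bddpot c W" and U: "Wp p u g"
  and T: "!!ph G. smooth_fun ph ==> C1 ph G ==> supp_in ph (r + 1) ==> (!!x. ph x >= 0) ==> weakf p W u g ph G >= 0"
 shows "super p W r u g"
 unfolding super_def
proof (intro allI impI)
 fix zt :: "'a => real" and dzt assume z: "C1 zt dzt" "supp_in zt r" and z0: "ALL x. zt x >= 0"
 note [measurable] = C1_meas[OF z(1)]
 obtain B where B: "B > 0" "!!x. abs (zt x) <= B" "!!x. norm (dzt x) <= B" by (rule C1_supp_bounded[OF z]) (rule that)
 have dz0: "dzt x = 0" if "norm x > r" for x by (rule supp_in_grad[OF z that])
 have zi: "integrable lborel zt" by (rule integrable_bounded_supp[of _ r B]) (use B z(2) in \<open>auto simp: supp_in_def\<close>)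
 have dzi: "integ (%x. dzt x \<bullet> b)" if "b : Basis" for b
  by (rule integrable_bounded_supp[of _ r B]) (use B(3) dz0 Basis_le_norm[OF that] in \<open>auto intro: order_trans\<close>)
 define e where "e n = 1 / real (Suc n)" for n
 have e: "e n > 0" "e n <= 1" for n by (auto simp: e_def)
 have "EX kp G d. mollifier kp (G :: 'a => 'a) d & d <= 1 & (ALL x y. norm (x - y) <= d --> (abs (zt x - zt y)) <= e n & norm (dzt x - dzt y) <= e n)" for n
 proof -
  obtain d1 where d1: "d1 > 0" "!!x y. norm (x - y) <= d1 ==> norm (zt x - zt y) <= e n"
   by (rule uniformly_continuous_compact_supp[OF C1_cont[OF z(1)] _ e(1), of r]) (use z(2) in \<open>auto simp: supp_in_def intro: that\<close>)
  obtain d2 where d2: "d2 > 0" "!!x y. norm (x - y) <= d2 ==> norm (dzt x - dzt y) <= e n"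
   by (rule uniformly_continuous_compact_supp[OF C1_cont_grad[OF z(1)] dz0 e(1)]) (auto intro: that)
  obtain kp G where "mollifier kp (G :: 'a => 'a) (min 1 (min d1 d2))" using mollifier_exists[of "min 1 (min d1 d2)"] d1(1) d2(1) by auto
  then show ?thesis using d1(2) d2(2) by (intro exI[of _ kp] exI[of _ G] exI[of _ "min 1 (min d1 d2)"]) auto
 qed
 then obtain kp G d where M: "!!n. mollifier (kp n) (G n :: 'a => 'a) (d n)" "!!n. d n <= 1" and
  u: "!!n x y. norm (x - y) <= d n ==> (abs (zt x - zt y)) <= e n & norm (dzt x - dzt y) <= e n" by metis
 note K = mollifierD[OF M(1)]
 let ?z = "%n. conv zt (kp n)"
 let ?g = "%n x. \<Sum>b\<in>Basis. conv zt (%z. G n z \<bullet> b) x *\<^sub>R b"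
 have C: "C1 (?z n) (?g n)" for n by (rule conv_C1[OF zi K(1,2)])
 have sp: "supp_in (?z n) (r + 1)" for n
 proof -
  have "supp_in (?z n) (r + d n)" using z(2) by (intro conv_supp K(2)) (auto simp: supp_in_def)
  then show ?thesis using M(2)[of n] by (force simp: supp_in_def)
 qed
 have ge: "weakf p W u g (?z n) (?g n) >= 0" for n
  using z0 K(3) by (intro T conv_smooth[OF zi K(4,2)] C sp) (auto simp: conv_def intro!: integral_nonneg_AE AE_I2)
 have zc: "abs (?z n x - zt x) <= e n" for n x using u by (intro mollify_uniform[OF M(1) zi]) blast
 have parts: "conv zt (%z. G n z \<bullet> b) x = conv (%y. dzt y \<bullet> b) (kp n) x" if b: "b : Basis" for n x b
 proof -
  obtain B' where B': "!!x. abs (kp n x) <= B'" using K(8) by blast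
  have i1: "integ (%y. (dzt y \<bullet> b) * kp n (x - y))" by (rule conv_integrable[OF dzi[OF b] C1_cont[OF K(1)] B'])
  have i2: "integ (%y. zt y * (G n (x - y) \<bullet> b))" by (rule conv_grad_integrable[OF zi K(1,2)])
  have "supp_in (%y. zt y * kp n (x - y)) r" using z(2) by (simp add: supp_in_def)
  from integral_gradient_zero[OF C1_mult[OF z(1) C1_reflect[OF K(1)]] this, of b]
  have "(LBINT y. (dzt y \<bullet> b) * kp n (x - y) - zt y * (G n (x - y) \<bullet> b)) = 0" by (simp add: inner_diff_left mult.commute)
  then show ?thesis using i1 i2 by (simp add: conv_def)
 qed
 have gc: "norm (?g n x - dzt x) <= real DIM('a) * e n" for n x
 proof -
  have "norm (?g n x - dzt x) <= (\<Sum>b\<in>Basis. abs ((?g n x - dzt x) \<bullet> b))" by (rule norm_le_l1)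
  also have "... = (\<Sum>b\<in>Basis. abs (conv (%y. dzt y \<bullet> b) (kp n) x - dzt x \<bullet> b))" by (simp add: inner_diff_left parts)
  also have "... <= (\<Sum>b\<in>(Basis::'a set). e n)"
  proof (rule sum_mono)
   fix b :: 'a assume b: "b : Basis"
   have "abs (dzt x \<bullet> b - dzt y \<bullet> b) <= e n" if "norm (x - y) <= d n" for x y
   using u[OF that] Basis_le_norm[OF b, of "dzt x - dzt y"] by (simp add: inner_diff_left)
   then show "abs (conv (%y. dzt y \<bullet> b) (kp n) x - dzt x \<bullet> b) <= e n" by (rule mollify_uniform[OF M(1) dzi[OF b]])
  qed
  finally show ?thesis by simp
 qed
 have e0: "e ----> 0" unfolding e_def using LIMSEQ_inverse_real_of_nat by (simp add: inverse_eq_divide)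
 let ?N = "B + real DIM('a) + 1"
 have "(%n. weakf p W u g (?z n) (?g n)) ----> weakf p W u g zt dzt"
 proof (rule weakf_tendsto[OF p W U])
  show "?z n : bmeas" "?g n : bmeas" for n by (rule C1_meas[OF C])+
  show "AEL x. (%n. ?z n x) ----> zt x & (%n. ?g n x) ----> dzt x"
  proof (intro AE_I2 conjI)
   fix x
   have "(%n. ?z n x - zt x) ----> 0"
   by (rule Lim_null_comparison[OF always_eventually e0]) (unfold real_norm_def, rule allI, rule zc)
   then show "(%n. ?z n x) ----> zt x" by (rule LIM_zero_cancel)
   have l: "(%n. real DIM('a) * e n) ----> 0" by (rule tendsto_mult_right_zero[OF e0])
   have "(%n. ?g n x - dzt x) ----> 0" by (rule Lim_null_comparison[OF always_eventually l]) (rule allI, rule gc)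
   then show "(%n. ?g n x) ----> dzt x" by (rule LIM_zero_cancel)
  qed
  show "integ (%x::'a. ib (r + 1) x * ?N powr p)" by (intro integrable_mult_left integrable_ind_cball)
  show "AEL x. abs (?z n x) powr p <= ib (r + 1) x * ?N powr p & norm (?g n x) powr p <= ib (r + 1) x * ?N powr p" for n
  proof (rule AE_I2)
   fix x
   show "abs (?z n x) powr p <= ib (r + 1) x * ?N powr p & norm (?g n x) powr p <= ib (r + 1) x * ?N powr p"
   proof (cases "norm x <= r + 1")
   case True
   have "real DIM('a) * e n <= real DIM('a) * 1" by (intro mult_left_mono e) auto
   then have "norm (?g n x) <= ?N" using gc[of n x] B(3)[of x] norm_triangle_sub[of "?g n x" "dzt x"] by linarith
   moreover have "abs (?z n x) <= ?N" using zc[of n x] B(2)[of x] e(2)[of n] by linarith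
   ultimately show ?thesis using True p by (auto intro!: powr_mono2)
   next
   case False
   then have "?z n x = 0" "?g n x = 0" using sp[of n] supp_in_grad[OF C sp, of x n] unfolding supp_in_def by auto
   then show ?thesis by simp
   qed
  qed
 qed measurable
 then show "0 <= weakf p W u g zt dzt" using ge by (intro LIMSEQ_le_const) auto
qed

section \<open>Picone's inequality and nonnegativity of the energy\<close>

text \<open>The vector is the gradient of \<open>f powr p * a powr (1 - p)\<close>, where
  \<open>a\<close> has gradient \<open>g\<close>. With \<open>A\<close> denoting
  \<open>f * norm g / a\<close>, the sharp Young inequality is exactly what cancels the term
  \<open>(p - 1) * A powr p\<close>.\<close>

lemma picone_pointwise:
 fixes g G :: "'a::real_inner"
 assumes p: "p > 1" and a: "a > 0" and f: "f >= 0"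
 shows "pflux p g \<bullet> ((a powr (1 - p) * 1) *\<^sub>R ((p * f powr (p - 1)) *\<^sub>R G) + (f powr p * (a powr (- p) * (- (p - 1) * 1 + a * 0))) *\<^sub>R g) <= norm G powr p"
proof -
 define A where "A = f * norm g * inverse a"
 have A0: "A >= 0" using a f by (simp add: A_def)
 have iv: "inverse a powr q = a powr (- q)" for q using a by (simp add: powr_minus inverse_powr)
 have A1: "A powr (p - 1) = f powr (p - 1) * norm g powr (p - 1) * a powr (1 - p)" unfolding A_def powr_mult iv by simp
 have A2: "A powr p = f powr p * norm g powr p * a powr (- p)" unfolding A_def powr_mult iv by simp
 have "pflux p g \<bullet> G <= norm g powr (p - 1) * norm G" using pflux_inner_le[of p g G] by simp
 then have "(a powr (1 - p) * (p * f powr (p - 1))) * (pflux p g \<bullet> G) <= (a powr (1 - p) * (p * f powr (p - 1))) * (norm g powr (p - 1) * norm G)"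
  using p by (intro mult_left_mono) auto
 also have "... = p * A powr (p - 1) * norm G" by (simp add: A1)
 also have "... <= (p - 1) * A powr p + norm G powr p" by (rule Young_powr[OF p A0 norm_ge_zero])
 finally have "(a powr (1 - p) * (p * f powr (p - 1))) * (pflux p g \<bullet> G) <= (p - 1) * A powr p + norm G powr p" .
 then show ?thesis by (simp add: inner_add_right pflux_inner_self A2 algebra_simps)
qed

text \<open>Insert the quotient into the supersolution inequality with \<open>u + e n\<close> in the
  denominator, estimate the gradient part pointwise and let \<open>e n\<close> tend to 0.\<close>

lemma picone:
 fixes u :: "'a::euclidean_space => real"
 assumes p: "p > 1" and W: "bddpot c W" and U: "Wp p u g" and S: "super p W R u g" and pos: "!!x. norm x <= R ==> u x > 0"
  and ph: "C1 ph G" "supp_in ph R" "!!x. ph x >= 0"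
 shows "0 <= (LBINT x. norm (G x) powr p + W x * ph x powr p)"
proof -
 note [measurable] = C1_meas[OF ph(1)] WpD(1,2)[OF U p] bddpotD(1)[OF W]
 have p0: "p > 0" using p by simp
 note i = C1_supp_integrable[OF ph(1,2) p0]
 have "C1 (%x. (max 0 (ph x)) powr p) (%x. (p * (max 0 (ph x)) powr (p - 1)) *\<^sub>R G x)"
  using p by (intro C1_compose[OF ph(1) has_real_derivative_pos_powr[OF p]] continuous_intros continuous_on_pos_powr) auto
 then have sg: "C1 (%x. ph x powr p) (%x. (p * ph x powr (p - 1)) *\<^sub>R G x)" using ph(3) by (simp add: max_absorb2)
 have sgs: "supp_in (%x. ph x powr p) R" using ph(2) by (simp add: supp_in_def)
 define e where "e n = 1 / real (Suc n)" for n
 have e: "e n > 0" for n by (simp add: e_def)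
 have e0: "e ----> 0" unfolding e_def using LIMSEQ_inverse_real_of_nat by (simp add: inverse_eq_divide)
 \<comment> \<open>The factor left in the potential term by the regularised denominator: at most 1,
   and tending to 1 where \<open>u\<close> is positive.\<close>
 define t where "t n x = u x powr (p - 1) * (u x + e n) powr (1 - p)" for n x
 have u0: "u x >= 0" for x using WpD(3)[OF U p] .
 have t1: "0 <= t n x" "t n x <= 1" for n x
 proof -
  have "u x powr (p - 1) <= (u x + e n) powr (p - 1)" using u0[of x] e[of n] p by (intro powr_mono2) auto
  then have "t n x <= (u x + e n) powr (p - 1) * (u x + e n) powr (1 - p)" unfolding t_def by (intro mult_right_mono) auto
  also have "... = 1" using u0[of x] e[of n] by (simp add: powr_add[symmetric])
  finally show "t n x <= 1" .
 qed (simp add: t_def)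
 have [measurable]: "t n : bmeas" for n unfolding t_def by measurable
 let ?J = "%n x. norm (G x) powr p + W x * ph x powr p * t n x"
 have di: "integ (%x. norm (G x) powr p + c * abs (ph x) powr p)" using i by auto
 have Jb: "norm (?J n x) <= norm (G x) powr p + c * abs (ph x) powr p" for n x
 proof -
  have "abs (W x * ph x powr p * t n x) = abs (W x) * abs (ph x) powr p * t n x" using t1[of n x] ph(3)[of x] by (simp add: abs_mult)
  also have "... <= c * abs (ph x) powr p * 1" using t1[of n x] bddpotD(2,3)[OF W] by (intro mult_mono) auto
  finally show ?thesis using powr_ge_zero[of "norm (G x)" p] unfolding real_norm_def mult_1_right by linarith
 qed
 have J0: "0 <= (LBINT x. ?J n x)" for n
 proof -
  note F = Lipfun_powr_neg[OF e p]
  note T = super_test[OF p W U S U F _ sg sgs, of n]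
  have "0 <= weakf p W u g (%x. ph x powr p * ((u x + e n) powr (1 - p) * 1))
   (%x. ((u x + e n) powr (1 - p) * 1) *\<^sub>R ((p * ph x powr (p - 1)) *\<^sub>R G x) + (ph x powr p * ((u x + e n) powr (- p) * (- (p - 1) * 1 + (u x + e n) * 0))) *\<^sub>R g x)"
   by (rule T(1)) auto
  also have "... <= (LBINT x. ?J n x)" unfolding weakf_def
  proof (rule integral_mono)
   show "integ (?J n)"
   proof (rule integrable_le[OF di])
   show "AEL x. norm (?J n x) <= norm (norm (G x) powr p + c * abs (ph x) powr p)"
   by (rule AE_I2) (rule order_trans[OF Jb], simp)
   qed measurable
   fix x
   have a: "u x + e n > 0" using u0[of x] e[of n] by linarith
   have "W x * u x powr (p - 1) * (ph x powr p * ((u x + e n) powr (1 - p) * 1)) = W x * ph x powr p * t n x" by (simp add: t_def)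
   then show "pflux p (g x) \<bullet> (((u x + e n) powr (1 - p) * 1) *\<^sub>R ((p * ph x powr (p - 1)) *\<^sub>R G x) + (ph x powr p * ((u x + e n) powr (- p) * (- (p - 1) * 1 + (u x + e n) * 0))) *\<^sub>R g x)
   + W x * u x powr (p - 1) * (ph x powr p * ((u x + e n) powr (1 - p) * 1)) <= ?J n x"
   using picone_pointwise[OF p a ph(3), of "g x" x "G x"] by linarith
  qed (rule T(2), auto)
  finally show ?thesis .
 qed
 have "(%n. LBINT x. ?J n x) ----> (LBINT x. norm (G x) powr p + W x * ph x powr p * 1)"
 proof (rule integral_dominated_convergence[OF _ _ di])
  show "AEL x. (%n. ?J n x) ----> norm (G x) powr p + W x * ph x powr p * 1"
  proof (rule AE_I2)
   fix x
   show "(%n. ?J n x) ----> norm (G x) powr p + W x * ph x powr p * 1"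
   proof (cases "norm x <= R")
   case True
   have "(%n. t n x) ----> u x powr (p - 1) * (u x + 0) powr (1 - p)"
   unfolding t_def using pos[OF True] by (intro tendsto_intros e0) auto
   also have "u x powr (p - 1) * (u x + 0) powr (1 - p) = 1" using pos[OF True] by (simp add: powr_add[symmetric])
   finally show ?thesis by (intro tendsto_intros)
   qed (use ph(2) in \<open>simp add: supp_in_def\<close>)
  qed
 qed (use Jb in auto)
 then have "0 <= (LBINT x. norm (G x) powr p + W x * ph x powr p * 1)" using J0 by (intro LIMSEQ_le_const) auto
 then show ?thesis by simp
qed

section \<open>From Lebesgue measurable data to Borel representatives\<close>

lemma lebesgue_lborel:
 fixes f f' :: "'a::euclidean_space => real"
 assumes ae: "AEL x. f x = f' x" and "f : borel_measurable lebesgue" "f' : bmeas"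
 shows "(\<integral>x. f x \<partial>lebesgue) = (LBINT x. f' x)" "integrable lebesgue f \<longleftrightarrow> integ f'"
proof -
 have m: "f' : borel_measurable lebesgue" using assms(3) by (simp add: measurable_completion)
 have "(\<integral>x. f x \<partial>lebesgue) = (\<integral>x. f' x \<partial>lebesgue)" by (rule integral_cong_AE[OF assms(2) m AE_completion[OF ae]])
 then show "(\<integral>x. f x \<partial>lebesgue) = (LBINT x. f' x)" using assms(3) by (simp add: integral_completion)
 have "integrable lebesgue f \<longleftrightarrow> integrable lebesgue f'" by (rule integrable_cong_AE[OF assms(2) m AE_completion[OF ae]])
 then show "integrable lebesgue f \<longleftrightarrow> integ f'" using assms(3) by (simp add: integrable_completion)
qed

text \<open>Unfolding the coinductive smoothness twice suffices: the derivative exists, and its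
  directional components are differentiable, hence continuous.\<close>

lemma test_fun_C1:
 fixes ph :: "'a::euclidean_space => real"
 assumes "test_fun ph"
 obtains G R where "C1 ph G" "supp_in ph R"
proof -
 have s: "smooth_fun ph" and c: "compact (closure {x. ph x ~= 0})" using assms by (auto simp: test_fun_def)
 have D: "ph differentiable (at x)" "smooth_fun (%x. frechet_derivative ph (at x) v)" for x v
  using s by (auto elim: smooth_fun.cases)
 define G where "G x = (\<Sum>b\<in>Basis. frechet_derivative ph (at x) b *\<^sub>R b)" for x
 have "frechet_derivative ph (at x) h = G x \<bullet> h" for x h
 proof -
  note l = linear_frechet_derivative[OF D(1)[of x]]
  have "frechet_derivative ph (at x) h = frechet_derivative ph (at x) (\<Sum>b\<in>Basis. (h \<bullet> b) *\<^sub>R b)" by (simp add: euclidean_representation)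
  also have "... = (\<Sum>b\<in>Basis. (h \<bullet> b) * frechet_derivative ph (at x) b)" by (simp add: linear_sum[OF l] linear_cmul[OF l])
  finally show ?thesis by (simp add: G_def inner_sum_left) (simp add: inner_commute mult.commute)
 qed
 then have "frechet_derivative ph (at x) = (%h. G x \<bullet> h)" for x by blast
 moreover have "continuous_on UNIV G" unfolding G_def
 proof (intro continuous_intros)
  fix b
  have "(%x. frechet_derivative ph (at x) b) differentiable (at x)" for x using D(2)[of b] by (auto elim: smooth_fun.cases)
  then show "continuous_on UNIV (%x. frechet_derivative ph (at x) b)"
   by (auto intro!: continuous_at_imp_continuous_on differentiable_imp_continuous_within)
 qed
 ultimately have "C1 ph G" unfolding C1_def using frechet_derivative_works[THEN iffD1, OF D(1)] by metis
 moreover obtain R where "supp_in ph R" using c compact_supp by blast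
 ultimately show ?thesis by (rule that)
qed

lemma weak_form_lborel:
 assumes m [measurable]: "u : borel_measurable lebesgue" "g : borel_measurable lebesgue" "V : borel_measurable lebesgue"
  and b [measurable]: "u' : bmeas" "g' : bmeas" "V' : bmeas"
  and AE: "AEL x. u x = u' x" "AEL x. g x = g' x" "AEL x. V x = V' x" and ph: "C1 ph G"
 shows "weak_form p V lam u g ph = (LBINT x. pflux p (g' x) \<bullet> G x) + (LBINT x. V' x * u' x powr (p - 1) * ph x)
  - lam * (LBINT x. u' x powr (p - 1) * ph x)"
proof -
 note [measurable] = C1_meas[OF ph]
 have [measurable]: "ph : borel_measurable lebesgue" "G : borel_measurable lebesgue" using C1_meas[OF ph] by (auto simp: measurable_completion)
 have a: "AEL x. norm (g x) powr (p - 2) * (G x \<bullet> g x) = norm (g' x) powr (p - 2) * (G x \<bullet> g' x)"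
  "AEL x. V x * u x powr (p - 1) * ph x = V' x * u' x powr (p - 1) * ph x" "AEL x. u x powr (p - 1) * ph x = u' x powr (p - 1) * ph x"
  using AE by (eventually_elim, simp)+
 have "(\<integral>x. norm (g x) powr (p - 2) * (G x \<bullet> g x) \<partial>lebesgue) = (LBINT x. norm (g' x) powr (p - 2) * (G x \<bullet> g' x))"
  "(\<integral>x. V x * u x powr (p - 1) * ph x \<partial>lebesgue) = (LBINT x. V' x * u' x powr (p - 1) * ph x)"
  "(\<integral>x. u x powr (p - 1) * ph x \<partial>lebesgue) = (LBINT x. u' x powr (p - 1) * ph x)"
  using lebesgue_lborel(1)[OF a(1)] lebesgue_lborel(1)[OF a(2)] lebesgue_lborel(1)[OF a(3)] by measurable
 then show ?thesis unfolding weak_form_def frechet_derivative_C1[OF ph] by (simp add: pflux_def inner_commute)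
qed

lemma borel_version:
 fixes g :: "'a::euclidean_space => 'b::euclidean_space"
 assumes [measurable]: "g : borel_measurable lebesgue"
 obtains g' where "g' : bmeas" "AEL x. g x = g' x"
proof -
 have "EX h. h : bmeas & (AEL x. g x \<bullet> b = h x)" for b
  using completion_ex_borel_measurable_real[of "%x. g x \<bullet> b" lborel] by auto
 then obtain h where h: "!!b. h b : bmeas" "!!b. AEL x. g x \<bullet> b = h b x" by metis
 show ?thesis
 proof (rule that)
  show "(%x. \<Sum>b\<in>Basis. h b x *\<^sub>R b) : bmeas" using h(1) by measurable
  have "AEL x. \<forall>b\<in>Basis. g x \<bullet> b = h b x" using h(2) by (intro eventually_ball_finite) auto
  then show "AEL x. g x = (\<Sum>b\<in>Basis. h b x *\<^sub>R b)"
   by eventually_elim (auto simp: euclidean_eq_iff[where 'a='b])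
 qed
qed

text \<open>The given supersolution is local, Lebesgue measurable and tested with smooth functions
  only. A Borel version is cut off to land in \<open>Wp\<close>, the inequality is extended to C1
  test functions, and Picone's inequality applies on the ball where the cutoff is 1.\<close>

lemma coercive_of_supersolution:
 fixes V :: "'a::euclidean_space => real"
 assumes p: "p > 1" and Vm: "V : borel_measurable lebesgue" and V1: "bddpot c V1" "AEL x. V x = V1 x"
  and py: "W1p_loc p py g" "!!x. py x > 0" and T: "!!ph. test_fun ph ==> (!!x. ph x >= 0) ==> weak_form p V lam py g ph >= 0"
  and ph: "C1 ph G" "supp_in ph r" "!!x. ph x >= 0"
 shows "0 <= (LBINT x. norm (G x) powr p + (V1 x - lam) * ph x powr p)"
proof -
 have m [measurable]: "py : borel_measurable lebesgue" "g : borel_measurable lebesgue"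
  and L: "!!K. compact K ==> integrable lebesgue (%x. indicator K x * norm (py x) powr p)" "!!K. compact K ==> integrable lebesgue (%x. indicator K x * norm (g x) powr p)"
  and wg: "weak_gradient py g" using py(1) by (auto simp: W1p_loc_def Lp_loc_def)
 obtain py1 where py1 [measurable]: "py1 : bmeas" and py1e: "AEL x. py x = py1 x" by (rule borel_version[OF m(1)]) (rule that)
 obtain g1 where g1 [measurable]: "g1 : bmeas" and g1e: "AEL x. g x = g1 x" by (rule borel_version[OF m(2)]) (rule that)
 \<comment> \<open>The Borel version agrees with the positive function only almost everywhere; the
   value 1 elsewhere restores positivity at every point.\<close>
 define v where "v x = (if py1 x > 0 then py1 x else 1)" for x
 have vm [measurable]: "v : bmeas" unfolding v_def by measurable
 have v0: "v x > 0" for x by (simp add: v_def)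
 have ve: "AEL x. py x = v x" using py1e
 proof eventually_elim
  case (elim x) then show ?case using py(2)[of x] by (simp add: v_def)
 qed
 have [measurable]: "(%x::'a. x) : borel_measurable lebesgue" by (simp add: measurable_completion)
 have L1: "integ (%x. ib R x * v x powr p)" for R
 proof -
  have a: "AEL x. ib R x * norm (py x) powr p = ib R x * v x powr p"
   using ve by eventually_elim (simp add: abs_of_pos[OF v0])
  have "integrable lebesgue (%x. ib R x * norm (py x) powr p) = integ (%x. ib R x * v x powr p)"
   by (rule lebesgue_lborel(2)[OF a]) measurable
  then show ?thesis using L(1)[of "cball 0 R"] by simp
 qed
 have L2: "integ (%x. ib R x * norm (g1 x) powr p)" for R
 proof -
  have a: "AEL x. ib R x * norm (g x) powr p = ib R x * norm (g1 x) powr p"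
   using g1e by eventually_elim simp
  have "integrable lebesgue (%x. ib R x * norm (g x) powr p) = integ (%x. ib R x * norm (g1 x) powr p)"
   by (rule lebesgue_lborel(2)[OF a]) measurable
  then show ?thesis using L(2)[of "cball 0 R"] by simp
 qed
 have tf: "test_fun et" if "smooth_fun et" "supp_in et R" for et :: "'a => real" and R
  using that compact_supp by (auto simp: test_fun_def)
 have wg1: "(LBINT x. v x * (H x \<bullet> w)) = - (LBINT x. (g1 x \<bullet> w) * et x)"
  if et: "smooth_fun et" "C1 et H" "supp_in et R" for et H R w
 proof -
  note [measurable] = C1_meas[OF et(2)]
  have [measurable]: "et : borel_measurable lebesgue" "H : borel_measurable lebesgue" using C1_meas[OF et(2)] by (auto simp: measurable_completion)
  have "(\<integral>x. py x * (H x \<bullet> w) \<partial>lebesgue) = - (\<integral>x. (g x \<bullet> w) * et x \<partial>lebesgue)"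
   using wg tf[OF et(1,3)] unfolding weak_gradient_def frechet_derivative_C1[OF et(2), symmetric] by blast
  moreover have a: "AEL x. py x * (H x \<bullet> w) = v x * (H x \<bullet> w)" "AEL x. (g x \<bullet> w) * et x = (g1 x \<bullet> w) * et x"
   using ve g1e by (eventually_elim, simp)+
  moreover have "(\<integral>x. py x * (H x \<bullet> w) \<partial>lebesgue) = (LBINT x. v x * (H x \<bullet> w))"
   by (rule lebesgue_lborel(1)[OF a(1)]) measurable
  moreover have "(\<integral>x. (g x \<bullet> w) * et x \<partial>lebesgue) = (LBINT x. (g1 x \<bullet> w) * et x)"
   by (rule lebesgue_lborel(1)[OF a(2)]) measurable
  ultimately show ?thesis by simp
 qed
 \<comment> \<open>The cutoff is 1 with zero gradient inside radius \<open>R + 2\<close>, so smooth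
   test functions supported in radius \<open>R + 1\<close> do not notice it. Mollification uses up
   that extra unit.\<close>
 define R where "R = max r 0"
 have R2: "R + 2 >= 0" by (simp add: R_def)
 have v0': "v x >= 0" for x using v0[of x] by simp
 obtain sg dsg where s: "!!x. norm x < R + 2 ==> sg x = (1::real) & dsg x = (0::'a)"
  "Wp p (%x. sg x * v x) (%x. v x *\<^sub>R dsg x + sg x *\<^sub>R g1 x)"
 proof (rule Wp_cutoff[OF p vm g1 v0' L1 L2 _ R2], goal_cases)
  case (1 et H R w) show ?case by (rule wg1[OF 1(2-4)])
 next
  case (2 sg dsg) show ?case by (rule 2(1); (rule 2(3) | erule 2(2)))
 qed
 let ?u = "%x. sg x * v x" and ?g = "%x. v x *\<^sub>R dsg x + sg x *\<^sub>R g1 x"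
 note V1m [measurable] = bddpotD(1)[OF V1(1)]
 have W: "bddpot (c + abs lam) (%x. V1 x - lam)" unfolding bddpot_def
  using bddpotD(2)[OF V1(1)] by (auto intro!: order_trans[OF abs_triangle_ineq4] add_right_mono)
 have S: "super p (%x. V1 x - lam) R ?u ?g"
 proof (rule super_from_test[OF p W s(2)])
  fix et :: "'a => real" and H assume et: "smooth_fun et" "C1 et H" "supp_in et (R + 1)" "!!x. et x >= 0"
  have p0: "p > 0" using p by simp
  note i = C1_supp_integrable[OF et(2,3) p0]
  note wi = weakf_integrable[OF p _ s(2) C1_meas[OF et(2)] i]
  have A: "integ (%x. pflux p (?g x) \<bullet> H x)"
   using wi[of 0 "%x. 0"] by (simp add: bddpot_def)
  have B: "integ (%x. V1 x * ?u x powr (p - 1) * et x)"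
   using Bochner_Integration.integrable_diff[OF wi[OF V1(1)] A] by simp
  have C: "integ (%x. ?u x powr (p - 1) * et x)"
   using Bochner_Integration.integrable_diff[OF wi[of 1 "%x. 1"] A] by (simp add: bddpot_def)
  have z: "?g x = g1 x & ?u x = v x \<or> H x = 0 & et x = 0" for x
   using s(1)[of x] et(3) supp_in_grad[OF et(2,3), of x] by (cases "norm x <= R + 1") (auto simp: supp_in_def)
  have e: "pflux p (g1 x) \<bullet> H x = pflux p (?g x) \<bullet> H x" "V1 x * v x powr (p - 1) * et x = V1 x * ?u x powr (p - 1) * et x"
   "v x powr (p - 1) * et x = ?u x powr (p - 1) * et x" for x using z[of x] by auto
  have "0 <= weak_form p V lam py g et" using et(4) by (intro T tf[OF et(1,3)])
  also have "... = (LBINT x. pflux p (?g x) \<bullet> H x) + (LBINT x. V1 x * ?u x powr (p - 1) * et x) - lam * (LBINT x. ?u x powr (p - 1) * et x)"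
   unfolding weak_form_lborel[OF m Vm vm g1 V1m ve g1e V1(2) et(2)] e ..
  also have "... = (LBINT x. pflux p (?g x) \<bullet> H x + V1 x * ?u x powr (p - 1) * et x - lam * (?u x powr (p - 1) * et x))"
   using A B C by simp
  also have "... = weakf p (%x. V1 x - lam) ?u ?g et H" unfolding weakf_def by (simp add: algebra_simps)
  finally show "0 <= weakf p (%x. V1 x - lam) ?u ?g et H" .
 qed
 show ?thesis
 proof (rule picone[OF p W s(2) S _ ph(1) _ ph(3)])
  show "0 < ?u x" if "norm x <= R" for x using s(1)[of x] that v0[of x] by simp
  show "supp_in ph R" using ph(2) by (simp add: supp_in_def R_def)
 qed
qed

section \<open>The set of eigenvalues as a closed half-line\<close>

theorem theorem1p10:
  fixes p :: real and V :: "'a::euclidean_space \<Rightarrow> real"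
  assumes "p > 1" and "Linfty V"
  shows "{lam. is_eigenvalue p V lam} = {lam. ereal lam \<le> gen_principal_eigenvalue p V}"
proof (intro equalityI subsetI; clarify)
 fix lam assume "is_eigenvalue p V lam"
 then obtain u g where "W1p_loc p u g" "ALL x. u x > 0" "ALL ph. test_fun ph --> weak_form p V lam u g ph = 0"
  unfolding is_eigenvalue_def by blast
 then show "ereal lam <= gen_principal_eigenvalue p V"
  unfolding gen_principal_eigenvalue_def by (intro SUP_upper CollectI exI[of _ u] exI[of _ g]) auto
next
 note p = assms(1)
 fix lam assume lam: "ereal lam <= gen_principal_eigenvalue p V"
 have Vm: "V : borel_measurable lebesgue" using assms(2) by (simp add: Linfty_def)
 obtain C where C: "AEL x. abs (V x) <= C" using assms(2) by (auto simp: Linfty_def AE_completion_iff)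
 obtain V' where V' [measurable]: "V' : bmeas" "AEL x. V x = V' x" by (rule borel_version[OF Vm]) (rule that)
 define c where "c = max C 0"
 \<comment> \<open>A Borel representative clipped to the essential bound, so that the bound holds at
   every point.\<close>
 define V1 where "V1 x = max (- c) (min c (V' x))" for x
 have V1m [measurable]: "V1 : bmeas" unfolding V1_def by measurable
 have V1: "bddpot c V1" unfolding bddpot_def by (auto simp: V1_def c_def)
 have V1e: "AEL x. V x = V1 x" using C V'(2) by eventually_elim (auto simp: V1_def c_def)
 have coer: "EX gm>0. ALL ph G r. C1 ph G --> (ALL x. ph x >= 0) --> supp_in ph r -->
  gm * (LBINT x. ph x powr p) <= (LBINT x. norm (G x) powr p + (V1 x - (lam - 1 / real (Suc n))) * ph x powr p)" for n
 proof -
  \<comment> \<open>Going strictly below the supremum provides a supersolution at a real level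
    \<open>l\<close> above \<open>lam - 1 / (n + 1)\<close>, also when the supremum is infinite or
    equals \<open>lam\<close>.\<close>
  have "ereal (lam - 1 / real (Suc n)) < gen_principal_eigenvalue p V" using lam by (intro less_le_trans[OF _ lam]) simp
  then obtain l py g where l: "lam - 1 / real (Suc n) < l" and py: "W1p_loc p py g" "ALL x. py x > 0"
   "ALL ph. test_fun ph & (ALL x. ph x >= 0) --> weak_form p V l py g ph >= 0"
   unfolding gen_principal_eigenvalue_def less_SUP_iff by auto
  \<comment> \<open>Nonnegativity of the energy at level \<open>l\<close> becomes coercivity at the
    lower level, and the constant is the distance of the two levels.\<close>
  let ?gm = "l - (lam - 1 / real (Suc n))"
  have "?gm * (LBINT x. ph x powr p) <= (LBINT x. norm (G x) powr p + (V1 x - (lam - 1 / real (Suc n))) * ph x powr p)"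
   if ph: "C1 ph G" "ALL x. ph x >= 0" "supp_in ph r" for ph :: "'a => real" and G r
  proof -
   note [measurable] = C1_meas[OF ph(1)]
   have e: "(a + (v - k) * t) + (k - m) * t = a + (v - m) * t" for a v k m t :: real by (simp add: algebra_simps)
   have p0: "p > 0" using p by simp
   note i = C1_supp_integrable[OF ph(1,3) p0]
   have i1: "integ (%x. ph x powr p)" using i(1) ph(2) by simp
   have i2: "integ (%x. V1 x * ph x powr p)"
   proof (rule integrable_le)
   show "integ (%x. c * ph x powr p)" using i1 by simp
   show "AEL x. norm (V1 x * ph x powr p) <= norm (c * ph x powr p)"
   using bddpotD(2,3)[OF V1] by (intro AE_I2) (simp add: abs_mult mult_right_mono)
   qed measurable
   have i3: "integ (%x. norm (G x) powr p + (V1 x - l) * ph x powr p)"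
   using i(2) i1 i2 by (simp add: left_diff_distrib)
   have "0 <= (LBINT x. norm (G x) powr p + (V1 x - l) * ph x powr p)"
   by (rule coercive_of_supersolution[OF p Vm V1 V1e py(1) _ _ ph(1,3)]) (use py ph(2) in auto)
   then have "?gm * (LBINT x. ph x powr p) <= (LBINT x. norm (G x) powr p + (V1 x - l) * ph x powr p) + (LBINT x. ?gm * ph x powr p)" by simp
   also have "... = (LBINT x. (norm (G x) powr p + (V1 x - l) * ph x powr p) + ?gm * ph x powr p)"
   by (rule Bochner_Integration.integral_add[symmetric, OF i3]) (use i1 in auto)
   also have "... = (LBINT x. norm (G x) powr p + (V1 x - (lam - 1 / real (Suc n))) * ph x powr p)"
   unfolding e ..
   finally show ?thesis .
  qed
  then show ?thesis using l by (intro exI[of _ ?gm]) auto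
 qed
 obtain u g where u [measurable]: "u : bmeas" "g : bmeas" and u0: "!!x. u x > 0"
  and ui: "!!R. integ (%x. ib R x * u x powr p)" "!!R. integ (%x. ib R x * norm (g x) powr p)"
  and wg: "!!zt dzt R v. C1 zt dzt ==> supp_in zt R ==> (LBINT x. u x * (dzt x \<bullet> v)) = - (LBINT x. (g x \<bullet> v) * zt x)"
  and eq: "!!zt dzt R. C1 zt dzt ==> supp_in zt R ==> (LBINT x. pflux p (g x) \<bullet> dzt x) + (LBINT x. V1 x * u x powr (p - 1) * zt x) - lam * (LBINT x. u x powr (p - 1) * zt x) = 0"
 proof (rule entire_solution[OF p V1 coer], goal_cases)
  case A: (1 u g)
  show ?case
  proof (rule A(1)[OF A(2-6)], goal_cases)
   case (1 zt dzt R v) then show ?case by (rule A(7))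
  next
   case (2 zt dzt R) show ?case using A(8)[OF 2] by blast
  qed
 qed
 have um [measurable]: "u : borel_measurable lebesgue" "g : borel_measurable lebesgue" using u by (auto simp: measurable_completion)
 have loc: "integrable lebesgue (%x. indicator K x * h x)"
  if K: "compact K" and [measurable]: "h : bmeas" and h: "!!R. integ (%x. ib R x * h x)" for K :: "'a set" and h :: "'a => real"
 proof -
  have [measurable]: "K : sets borel" using K by (simp add: compact_imp_closed)
  obtain R where R: "\<forall>x\<in>K. norm x <= R" using compact_imp_bounded[OF K] unfolding bounded_iff by blast
  have "integ (%x. indicator K x * h x)"
   by (rule integrable_le[OF h[of R]]) (use R in \<open>auto simp: indicator_def\<close>)
  then show ?thesis by (subst integrable_completion) auto
 qed
 have "W1p_loc p u g" unfolding W1p_loc_def Lp_loc_def weak_gradient_def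
 proof (intro conjI um allI impI)
  fix K :: "'a set" assume K: "compact K"
  show "integrable lebesgue (%x. indicator K x * norm (u x) powr p)" using ui(1) u0 by (intro loc[OF K]) (auto simp: less_imp_le)
  show "integrable lebesgue (%x. indicator K x * norm (g x) powr p)" using ui(2) by (intro loc[OF K]) auto
 next
  fix ph :: "'a => real" and v assume "test_fun ph"
  then obtain G R where ph: "C1 ph G" "supp_in ph R" by (rule test_fun_C1)
  note [measurable] = C1_meas[OF ph(1)]
  show "(\<integral>x. u x * frechet_derivative ph (at x) v \<partial>lebesgue) = - (\<integral>x. (g x \<bullet> v) * ph x \<partial>lebesgue)"
   unfolding frechet_derivative_C1[OF ph(1)] using wg[OF ph, of v] by (subst (1 2) integral_completion) auto
 qed
 moreover have "weak_form p V lam u g ph = 0" if t: "test_fun ph" for ph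
 proof -
  obtain G R where ph: "C1 ph G" "supp_in ph R" by (rule test_fun_C1[OF t]) (rule that)
  show ?thesis unfolding weak_form_lborel[OF um Vm u V1m _ _ V1e ph(1), simplified] by (rule eq[OF ph])
 qed
 ultimately show "is_eigenvalue p V lam" unfolding is_eigenvalue_def using u0 by blast
qed

end
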